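(* Let $(X,J,\omega)$ be a compact connected almost Kähler manifold of real dimension $4$. Then $$\mathcal{H}^{1,1}_{d}=\mathcal{H}^{1,1}_{\partial}=\mathcal{H}^{1,1}_{\bar\partial}=\mathcal{H}^{1,1}_{BC}=\mathcal{H}^{1,1}_{A}.$$
   Context: All manifolds are smooth, connected and without boundary. An almost Hermitian manifold $(X,J,\omega)$ of real dimension $2n$ is a manifold $X$ with an almost complex structure $J$ (an endomorphism of $TX$ with $J^2=-\mathrm{id}$, not necessarily integrable) and a Riemannian metric $g$ for which $J$ is an isometry, with fundamental form $\omega(u,v)=g(Ju,v)$. It is almost Kähler if $d\omega=0$. $A^{p,q}$ is the space of smooth complex $(p,q)$-forms with respect to $J$. The exterior differential decomposes as $d=\mu+\partial+\bar\partial+\bar\mu$, where on $A^{p,q}$ the components take values in $A^{p+2,q-1}$, $A^{p+1,q}$, $A^{p,q+1}$, $A^{p-1,q+2}$ respectively. Let $*:A^{p,q}\to A^{n-q,n-p}$ be the $\mathbb{C}$-linear Hodge star, defined by $\alpha\wedge *\bar\beta=\langle\alpha,\beta\rangle\frac{\omega^n}{n!}$, where $\langle\cdot,\cdot\rangle$ is the induced Hermitian inner product on forms. Put $d^*=-*d*$, $\partial^*=-*\bar\partial*$ and $\bar\partial^*=-*\partial*$ (formal adjoints of $d$, $\partial$, $\bar\partial$). Define the Laplacians $$\Delta_d=dd^*+d^*d,\quad \Delta_\partial=\partial\partial^*+\partial^*\partial,\quad \Delta_{\bar\partial}=\bar\partial\bar\partial^*+\bar\partial^*\bar\partial,$$ $$\Delta_{BC}=\partial\bar\partial\bar\partial^*\partial^*+\bar\partial^*\partial^*\partial\bar\partial+\partial^*\bar\partial\bar\partial^*\partial+\bar\partial^*\partial\partial^*\bar\partial+\partial^*\partial+\bar\partial^*\bar\partial,$$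 $$\Delta_{A}=\partial\bar\partial\bar\partial^*\partial^*+\bar\partial^*\partial^*\partial\bar\partial+\partial\bar\partial^*\bar\partial\partial^*+\bar\partial\partial^*\partial\bar\partial^*+\partial\partial^*+\bar\partial\bar\partial^*.$$ $\mathcal{H}^{p,q}_{d}$, $\mathcal{H}^{p,q}_{\partial}$, $\mathcal{H}^{p,q}_{\bar\partial}$, $\mathcal{H}^{p,q}_{BC}$, $\mathcal{H}^{p,q}_{A}$ denote the kernels of $\Delta_d$, $\Delta_\partial$, $\Delta_{\bar\partial}$, $\Delta_{BC}$, $\Delta_A$ respectively, intersected with $A^{p,q}$. *)

theory Defs
  imports "HOL-Analysis.Analysis" "HOL-Library.Function_Algebras"
begin

section \<open>Smooth manifolds and tangent vectors\<close>

primrec differentiable_upto :: "nat \<Rightarrow> ('e::real_normed_vector \<Rightarrow> 'b::real_normed_vector) \<Rightarrow> 'e set \<Rightarrow> bool"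
  where
    "differentiable_upto 0 f S \<longleftrightarrow> continuous_on S f"
  | "differentiable_upto (Suc m) f S \<longleftrightarrow>
       (\<forall>y\<in>S. f differentiable (at y)) \<and>
       (\<forall>w. differentiable_upto m (\<lambda>y. frechet_derivative f (at y) w) S)"

text \<open>\<open>C\<^sup>\<infinity>\<close> functions; only used for open \<open>S\<close>.\<close>

definition smooth_on :: "'e set \<Rightarrow> ('e::real_normed_vector \<Rightarrow> 'b::real_normed_vector) \<Rightarrow> bool"
  where "smooth_on S f \<longleftrightarrow> (\<forall>m. differentiable_upto m f S)"

text \<open>A chart is a domain together with a coordinate map, of which only the values on the domain
  matter.\<close>

type_synonym ('a, 'e) chart = "'a set \<times> ('a \<Rightarrow> 'e)"

definition chart_inv :: "('a, 'e) chart \<Rightarrow> 'e \<Rightarrow> 'a"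
  where "chart_inv c = inv_into (fst c) (snd c)"

definition transition :: "('a, 'e) chart \<Rightarrow> ('a, 'e) chart \<Rightarrow> 'e \<Rightarrow> 'e"
  where "transition c c' = snd c' \<circ> chart_inv c"

text \<open>A tangent vector at \<open>x\<close> is the family of its coordinate vectors in the charts around
  \<open>x\<close>, related by the derivatives of the transition maps; the family is \<open>0\<close> at every other
  argument, so that equality of tangent vectors is equality of functions.\<close>

type_synonym ('a, 'e) tvec = "('a, 'e) chart \<Rightarrow> 'e"

text \<open>A (complex-valued) form on a tangent space takes the list of its arguments.
  The value is \<open>0\<close> on lists whose length is not the degree, so that sums of forms of different
  degrees are also of this type; the operators below act on such sums degree by degree.\<close>

type_synonym ('a, 'e) cform = "('a, 'e) tvec list \<Rightarrow> complex"
type_synonym ('a, 'e) form_field = "'a \<Rightarrow> ('a, 'e) cform"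

definition comb :: "real \<Rightarrow> ('a, 'e::real_vector) tvec \<Rightarrow> real \<Rightarrow> ('a, 'e) tvec \<Rightarrow> ('a, 'e) tvec"
  where "comb a u b v = (\<lambda>c. a *\<^sub>R u c + b *\<^sub>R v c)"

text \<open>Unnormalised wedge product, as a sum over shuffles:
  \<open>(\<alpha> \<and> \<beta>)(v\<^sub>1,\<dots>,v\<^sub>k\<^sub>+\<^sub>l) = 1/(k! l!) \<Sum>\<^sub>\<sigma> sgn \<sigma> \<alpha>(v\<^sub>\<sigma>\<^sub>1,\<dots>,v\<^sub>\<sigma>\<^sub>k) \<beta>(v\<^sub>\<sigma>\<^sub>(\<^sub>k\<^sub>+\<^sub>1\<^sub>),\<dots>)\<close>. The set \<open>S\<close> holds the positions of
  the arguments of \<open>\<alpha>\<close>; only those with \<open>card S = k\<close> contribute if \<open>\<alpha>\<close> has degree \<open>k\<close>.\<close>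

definition shuffle_sign :: "nat \<Rightarrow> nat set \<Rightarrow> complex"
  where "shuffle_sign m S = (-1) ^ card {(i, j). i \<in> S \<and> j \<in> {..<m} - S \<and> j < i}"

definition wedge :: "('a, 'e) cform \<Rightarrow> ('a, 'e) cform \<Rightarrow> ('a, 'e) cform"
  where "wedge \<alpha> \<beta> = (\<lambda>vs. \<Sum>S\<in>Pow {..<length vs}.
    shuffle_sign (length vs) S * \<alpha> (nths vs S) * \<beta> (nths vs (- S)))"

primrec wedge_power :: "('a, 'e) cform \<Rightarrow> nat \<Rightarrow> ('a, 'e) cform"
  where
    "wedge_power \<alpha> 0 = (\<lambda>vs. if vs = [] then 1 else 0)"
  | "wedge_power \<alpha> (Suc m) = wedge \<alpha> (wedge_power \<alpha> m)"

text \<open>Complex multilinear extension of a form to \<open>T \<otimes> \<complex>\<close>, where the pair \<open>(u, v)\<close> stands for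
  \<open>u + \<i> v\<close>.\<close>

definition complexify :: "('a, 'e) cform \<Rightarrow> (('a, 'e) tvec \<times> ('a, 'e) tvec) list \<Rightarrow> complex"
  where "complexify \<alpha> zs = (\<Sum>S\<in>Pow {..<length zs}.
    \<i> ^ card S * \<alpha> (map (\<lambda>j. if j \<in> S then snd (zs ! j) else fst (zs ! j)) [0..<length zs]))"

locale smooth_manifold =
  fixes X :: "'a topology" and A :: "('a, 'e::euclidean_space) chart set"
  assumes Hausdorff: "Hausdorff_space X"
    and second_countable: "second_countable X"
    and cover: "(\<Union>c\<in>A. fst c) = topspace X"
    and chart_open: "c \<in> A \<Longrightarrow> openin X (fst c) \<and> open (snd c ` fst c)"
    and chart_homeo: "c \<in> A \<Longrightarrow>
      homeomorphic_map (subtopology X (fst c)) (top_of_set (snd c ` fst c)) (snd c)"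
    and transition_smooth: "c \<in> A \<Longrightarrow> c' \<in> A \<Longrightarrow>
      smooth_on (snd c ` (fst c \<inter> fst c')) (transition c c')"
begin

definition tangent_space :: "'a \<Rightarrow> ('a, 'e) tvec set"
  where "tangent_space x = {v.
    (\<forall>c\<in>A. \<forall>c'\<in>A. x \<in> fst c \<and> x \<in> fst c' \<longrightarrow>
       v c' = frechet_derivative (transition c c') (at (snd c x)) (v c)) \<and>
    (\<forall>c. \<not> (c \<in> A \<and> x \<in> fst c) \<longrightarrow> v c = 0)}"

text \<open>The tangent vector at \<open>x\<close> with coordinates \<open>w\<close> in the chart \<open>c\<close>.\<close>

definition tangent :: "('a, 'e) chart \<Rightarrow> 'a \<Rightarrow> 'e \<Rightarrow> ('a, 'e) tvec"
  where "tangent c x w = (\<lambda>c'. if c' \<in> A \<and> x \<in> fst c'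
    then frechet_derivative (transition c c') (at (snd c x)) w else 0)"

definition alternating :: "'a \<Rightarrow> nat \<Rightarrow> ('a, 'e) cform set"
  where "alternating x k = {\<alpha>.
    (\<forall>vs. \<not> (length vs = k \<and> set vs \<subseteq> tangent_space x) \<longrightarrow> \<alpha> vs = 0) \<and>
    (\<forall>vs i a u b v. length vs = k \<and> set vs \<subseteq> tangent_space x \<and> i < k \<and>
        u \<in> tangent_space x \<and> v \<in> tangent_space x \<longrightarrow>
       \<alpha> (vs[i := comb a u b v]) = of_real a * \<alpha> (vs[i := u]) + of_real b * \<alpha> (vs[i := v])) \<and>
    (\<forall>vs i j. i < j \<and> j < length vs \<and> vs ! i = vs ! j \<longrightarrow> \<alpha> vs = 0)}"

text \<open>Forms are complex-valued and smooth in every chart.\<close>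

definition forms :: "nat \<Rightarrow> ('a, 'e) form_field set"
  where "forms k = {\<eta>.
    (\<forall>x. x \<notin> topspace X \<longrightarrow> \<eta> x = 0) \<and>
    (\<forall>x\<in>topspace X. \<eta> x \<in> alternating x k) \<and>
    (\<forall>c\<in>A. \<forall>ws. length ws = k \<longrightarrow>
       smooth_on (snd c ` fst c) (\<lambda>y. \<eta> (chart_inv c y) (map (tangent c (chart_inv c y)) ws)))}"

definition chart_at :: "'a \<Rightarrow> ('a, 'e) chart"
  where "chart_at x = (SOME c. c \<in> A \<and> x \<in> fst c)"

text \<open>In a chart, \<open>d\<eta>(v\<^sub>0,\<dots>,v\<^sub>k) = \<Sum>\<^sub>i (-1)\<^sup>i D\<^sub>v\<^sub>i [\<eta>(v\<^sub>0,\<dots>,v\<^sub>i\<^sub>-\<^sub>1,v\<^sub>i\<^sub>+\<^sub>1,\<dots>,v\<^sub>k)]\<close>, the \<open>v\<^sub>i\<close> being extended to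
  vector fields with constant coordinates. For smooth forms this does not depend on the chart.\<close>

definition ext_deriv :: "('a, 'e) form_field \<Rightarrow> ('a, 'e) form_field"
  where "ext_deriv \<eta> x vs =
    (if x \<in> topspace X \<and> set vs \<subseteq> tangent_space x then
       let c = chart_at x in
       \<Sum>i<length vs. (-1) ^ i *
         frechet_derivative
           (\<lambda>y. \<eta> (chart_inv c y)
                  (map (\<lambda>v. tangent c (chart_inv c y) (v c)) (take i vs @ drop (Suc i) vs)))
           (at (snd c x)) ((vs ! i) c)
     else 0)"

end


section \<open>Almost Hermitian manifolds\<close>

locale almost_hermitian = smooth_manifold X A
  for X :: "'a topology" and A :: "('a, 'e::euclidean_space) chart set" +
  fixes J :: "'a \<Rightarrow> ('a, 'e) tvec \<Rightarrow> ('a, 'e) tvec"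
    and g :: "'a \<Rightarrow> ('a, 'e) tvec \<Rightarrow> ('a, 'e) tvec \<Rightarrow> real"
  assumes J_tangent: "x \<in> topspace X \<Longrightarrow> v \<in> tangent_space x \<Longrightarrow> J x v \<in> tangent_space x"
    and J_linear: "x \<in> topspace X \<Longrightarrow> u \<in> tangent_space x \<Longrightarrow> v \<in> tangent_space x \<Longrightarrow>
      J x (comb a u b v) = comb a (J x u) b (J x v)"
    and J_squared: "x \<in> topspace X \<Longrightarrow> v \<in> tangent_space x \<Longrightarrow> J x (J x v) = - v"
    and J_smooth: "c \<in> A \<Longrightarrow>
      smooth_on (snd c ` fst c) (\<lambda>y. J (chart_inv c y) (tangent c (chart_inv c y) e) c)"
    and g_linear: "x \<in> topspace X \<Longrightarrow> u \<in> tangent_space x \<Longrightarrow> v \<in> tangent_space x \<Longrightarrow>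
      w \<in> tangent_space x \<Longrightarrow> g x (comb a u b v) w = a * g x u w + b * g x v w"
    and g_sym: "x \<in> topspace X \<Longrightarrow> u \<in> tangent_space x \<Longrightarrow> v \<in> tangent_space x \<Longrightarrow>
      g x u v = g x v u"
    and g_pos: "x \<in> topspace X \<Longrightarrow> v \<in> tangent_space x \<Longrightarrow> v \<noteq> 0 \<Longrightarrow> g x v v > 0"
    and g_smooth: "c \<in> A \<Longrightarrow>
      smooth_on (snd c ` fst c)
        (\<lambda>y. g (chart_inv c y) (tangent c (chart_inv c y) e) (tangent c (chart_inv c y) e'))"
    and J_isometry: "x \<in> topspace X \<Longrightarrow> u \<in> tangent_space x \<Longrightarrow> v \<in> tangent_space x \<Longrightarrow>
      g x (J x u) (J x v) = g x u v"
begin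

definition fundamental_form :: "('a, 'e) form_field"
  where "fundamental_form x vs =
    (if x \<in> topspace X \<and> length vs = 2 \<and> set vs \<subseteq> tangent_space x
     then of_real (g x (J x (vs ! 0)) (vs ! 1)) else 0)"

subsection \<open>Types of forms\<close>

text \<open>A complex \<open>(p + q)\<close>-form has type \<open>(p, q)\<close> if its complex multilinear extension vanishes on
  vectors of pure type, unless exactly \<open>p\<close> of them are in \<open>T\<^sup>1\<^sup>,\<^sup>0 = {v - \<i> J v}\<close> and the other \<open>q\<close>
  in \<open>T\<^sup>0\<^sup>,\<^sup>1 = {v + \<i> J v}\<close>. The set \<open>S\<close> holds the positions of the former.\<close>

definition pq_forms :: "nat \<Rightarrow> nat \<Rightarrow> ('a, 'e) form_field set"
  where "pq_forms p q = {\<eta> \<in> forms (p + q).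
    \<forall>x\<in>topspace X. \<forall>vs S. length vs = p + q \<and> set vs \<subseteq> tangent_space x \<and>
        S \<subseteq> {..<p + q} \<and> card S \<noteq> p \<longrightarrow>
      complexify (\<eta> x)
        (map (\<lambda>j. (vs ! j, if j \<in> S then - J x (vs ! j) else J x (vs ! j))) [0..<p + q]) = 0}"

text \<open>Projection onto the \<open>(p, q)\<close> component: split each argument as
  \<open>v = (v - \<i> J v)/2 + (v + \<i> J v)/2\<close> and keep the terms with \<open>p\<close> arguments in \<open>T\<^sup>1\<^sup>,\<^sup>0\<close> and \<open>q\<close>
  in \<open>T\<^sup>0\<^sup>,\<^sup>1\<close>.\<close>

definition pq_part :: "nat \<Rightarrow> nat \<Rightarrow> ('a, 'e) form_field \<Rightarrow> ('a, 'e) form_field"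
  where "pq_part p q \<eta> x vs =
    (if x \<in> topspace X \<and> length vs = p + q \<and> set vs \<subseteq> tangent_space x then
       \<Sum>S | S \<subseteq> {..<p + q} \<and> card S = p.
         complexify (\<eta> x)
           (map (\<lambda>j. (comb (1/2) (vs ! j) 0 0,
                      comb (if j \<in> S then - 1/2 else 1/2) (J x (vs ! j)) 0 0)) [0..<p + q])
     else 0)"

text \<open>On \<open>A\<^sup>p\<^sup>,\<^sup>q\<close> these are the components of \<open>d\<close> in \<open>A\<^sup>p\<^sup>+\<^sup>1\<^sup>,\<^sup>q\<close> and \<open>A\<^sup>p\<^sup>,\<^sup>q\<^sup>+\<^sup>1\<close>, extended
  additively. A value on \<open>m\<close> arguments only involves the types with \<open>p + q + 1 = m\<close>.\<close>

definition del :: "('a, 'e) form_field \<Rightarrow> ('a, 'e) form_field"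
  where "del \<eta> x vs =
    (\<Sum>(p, q) | p + q + 1 = length vs. pq_part (p + 1) q (ext_deriv (pq_part p q \<eta>)) x vs)"

definition delbar :: "('a, 'e) form_field \<Rightarrow> ('a, 'e) form_field"
  where "delbar \<eta> x vs =
    (\<Sum>(p, q) | p + q + 1 = length vs. pq_part p (q + 1) (ext_deriv (pq_part p q \<eta>)) x vs)"

subsection \<open>Hodge star and formal adjoints\<close>

definition orthonormal_frame :: "'a \<Rightarrow> ('a, 'e) tvec list"
  where "orthonormal_frame x = (SOME es. length es = DIM('e) \<and> set es \<subseteq> tangent_space x \<and>
    (\<forall>i<DIM('e). \<forall>j<DIM('e). g x (es ! i) (es ! j) = (if i = j then 1 else 0)))"

text \<open>The Hermitian inner product on \<open>k\<close>-forms for which the \<open>e\<^sup>i\<^sup>1 \<and> \<dots> \<and> e\<^sup>i\<^sup>k\<close> with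
  \<open>i\<^sub>1 < \<dots> < i\<^sub>k\<close> are orthonormal, \<open>e\<close> being any orthonormal coframe; complex linear in the first
  argument.\<close>

definition form_inner :: "'a \<Rightarrow> nat \<Rightarrow> ('a, 'e) cform \<Rightarrow> ('a, 'e) cform \<Rightarrow> complex"
  where "form_inner x k \<alpha> \<beta> = (\<Sum>I | I \<subseteq> {..<DIM('e)} \<and> card I = k.
    \<alpha> (nths (orthonormal_frame x) I) * cnj (\<beta> (nths (orthonormal_frame x) I)))"

text \<open>\<open>\<omega>\<^sup>n / n!\<close> with \<open>DIM('e) = 2 n\<close>.\<close>

definition volume_form :: "('a, 'e) form_field"
  where "volume_form x vs =
    wedge_power (fundamental_form x) (DIM('e) div 2) vs / fact (DIM('e) div 2)"

text \<open>For a \<open>k\<close>-form \<open>\<eta>\<close> at \<open>x\<close>, \<open>*\<eta>\<close> is the \<open>(2n - k)\<close>-form \<open>\<zeta>\<close> with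
  \<open>\<alpha> \<and> \<zeta> = \<langle>\<alpha>, cnj \<eta>\<rangle> \<omega>\<^sup>n / n!\<close> for all \<open>k\<close>-forms \<open>\<alpha>\<close>, that is, \<open>\<alpha> \<and> *(cnj \<beta>) = \<langle>\<alpha>, \<beta>\<rangle> \<omega>\<^sup>n / n!\<close>.\<close>

definition hodge_star :: "('a, 'e) form_field \<Rightarrow> ('a, 'e) form_field"
  where "hodge_star \<eta> x vs =
    (if x \<in> topspace X \<and> length vs \<le> DIM('e) then
       let k = DIM('e) - length vs in
       (THE \<zeta>. \<zeta> \<in> alternating x (length vs) \<and>
          (\<forall>\<alpha>\<in>alternating x k.
             wedge \<alpha> \<zeta> = (\<lambda>us. form_inner x k \<alpha> (\<lambda>ws. cnj (\<eta> x ws)) * volume_form x us))) vs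
     else 0)"

definition ext_deriv_adj :: "('a, 'e) form_field \<Rightarrow> ('a, 'e) form_field"
  where "ext_deriv_adj \<eta> = - hodge_star (ext_deriv (hodge_star \<eta>))"

definition del_adj :: "('a, 'e) form_field \<Rightarrow> ('a, 'e) form_field"
  where "del_adj \<eta> = - hodge_star (delbar (hodge_star \<eta>))"

definition delbar_adj :: "('a, 'e) form_field \<Rightarrow> ('a, 'e) form_field"
  where "delbar_adj \<eta> = - hodge_star (del (hodge_star \<eta>))"

subsection \<open>Laplacians and harmonic forms\<close>

definition laplacian_d :: "('a, 'e) form_field \<Rightarrow> ('a, 'e) form_field"
  where "laplacian_d \<eta> = ext_deriv (ext_deriv_adj \<eta>) + ext_deriv_adj (ext_deriv \<eta>)"

definition laplacian_del :: "('a, 'e) form_field \<Rightarrow> ('a, 'e) form_field"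
  where "laplacian_del \<eta> = del (del_adj \<eta>) + del_adj (del \<eta>)"

definition laplacian_delbar :: "('a, 'e) form_field \<Rightarrow> ('a, 'e) form_field"
  where "laplacian_delbar \<eta> = delbar (delbar_adj \<eta>) + delbar_adj (delbar \<eta>)"

definition laplacian_BC :: "('a, 'e) form_field \<Rightarrow> ('a, 'e) form_field"
  where "laplacian_BC \<eta> =
      del (delbar (delbar_adj (del_adj \<eta>)))
    + delbar_adj (del_adj (del (delbar \<eta>)))
    + del_adj (delbar (delbar_adj (del \<eta>)))
    + delbar_adj (del (del_adj (delbar \<eta>)))
    + del_adj (del \<eta>)
    + delbar_adj (delbar \<eta>)"

definition laplacian_A :: "('a, 'e) form_field \<Rightarrow> ('a, 'e) form_field"
  where "laplacian_A \<eta> =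
      del (delbar (delbar_adj (del_adj \<eta>)))
    + delbar_adj (del_adj (del (delbar \<eta>)))
    + del (delbar_adj (delbar (del_adj \<eta>)))
    + delbar (del_adj (del (delbar_adj \<eta>)))
    + del (del_adj \<eta>)
    + delbar (delbar_adj \<eta>)"

definition harmonic_d :: "nat \<Rightarrow> nat \<Rightarrow> ('a, 'e) form_field set"
  where "harmonic_d p q = {\<eta> \<in> pq_forms p q. laplacian_d \<eta> = 0}"

definition harmonic_del :: "nat \<Rightarrow> nat \<Rightarrow> ('a, 'e) form_field set"
  where "harmonic_del p q = {\<eta> \<in> pq_forms p q. laplacian_del \<eta> = 0}"

definition harmonic_delbar :: "nat \<Rightarrow> nat \<Rightarrow> ('a, 'e) form_field set"
  where "harmonic_delbar p q = {\<eta> \<in> pq_forms p q. laplacian_delbar \<eta> = 0}"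

definition harmonic_BC :: "nat \<Rightarrow> nat \<Rightarrow> ('a, 'e) form_field set"
  where "harmonic_BC p q = {\<eta> \<in> pq_forms p q. laplacian_BC \<eta> = 0}"

definition harmonic_A :: "nat \<Rightarrow> nat \<Rightarrow> ('a, 'e) form_field set"
  where "harmonic_A p q = {\<eta> \<in> pq_forms p q. laplacian_A \<eta> = 0}"

end

locale almost_kaehler = almost_hermitian X A J g
  for X :: "'a topology" and A :: "('a, 'e::euclidean_space) chart set"
    and J :: "'a \<Rightarrow> ('a, 'e) tvec \<Rightarrow> ('a, 'e) tvec"
    and g :: "'a \<Rightarrow> ('a, 'e) tvec \<Rightarrow> ('a, 'e) tvec \<Rightarrow> real" +
  assumes closed: "ext_deriv fundamental_form = 0"

end

theory Submission
  imports Defs "HOL-Analysis.Analysis" "HOL-Real_Asymp.Real_Asymp"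
begin

text \<open>On a \<open>(1, 1)\<close>-form \<open>\<eta>\<close> one has \<open>*\<eta> = h \<omega> - \<eta>\<close> with \<open>h = (\<eta> \<and> \<omega>) / (\<omega>\<^sup>2 / 2)\<close>. All five spaces consist of the
  \<open>\<eta>\<close> with \<open>d\<eta> = 0\<close> and \<open>d *\<eta> = 0\<close>. Pairing each Laplacian with \<open>\<eta>\<close> turns it into a sum of squared norms. If, for
  instance, \<open>del \<eta> = 0\<close> and \<open>del\<^sup>* \<eta> = 0\<close>, then \<open>d\<eta> = delbar \<eta> = delbar h \<and> \<omega>\<close>, because \<open>d\<omega> = 0\<close>. Hence \<open>d(delbar h \<and> \<omega>) = 0\<close>; integrating this
  against the conjugate of \<open>h\<close> gives \<open>delbar h = 0\<close>. As \<open>d(dh \<and> \<omega>) = 0\<close>, also \<open>d(del h \<and> \<omega>) = 0\<close> and so \<open>del h = 0\<close> by the same argument.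
  Therefore \<open>dh = 0\<close>, which yields \<open>d\<eta> = 0\<close> and \<open>d *\<eta> = 0\<close>. For the Laplacian of \<open>d\<close> nothing remains
  to be shown, and the others lead to the same equation for \<open>h\<close>.\<close>

section \<open>Smooth functions\<close>

text \<open>Since J need not be integrable, neither del nor delbar need square to zero; only energy
  identities and the equation for h are used, no Hodge decomposition. Two facts of real dimension
  four keep the remaining components of d harmless: forms of type (3,0) and (0,3) vanish, so d = del
  + delbar on (1,1)-forms, and the star maps J-invariant 2-forms to J-invariant 2-forms. The
  first-order summands of the Bott-Chern Laplacian give only d \<eta> = 0, and those of the Aeppli
  Laplacian only d star \<eta> = 0. The missing half comes from one fourth-order summand: delbar*
  del* \<eta> = 0 in the first case, del delbar \<eta> = 0 in the second. Each of them turns into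
  d(delbar h \<and> \<omega>) = 0. Integration enters through a functional on 4-forms of which three
  properties are used: linearity, vanishing on exact forms, and positivity. It is built from a
  partition of unity. The orientation is taken from \<omega> \<and> \<omega> and not from the atlas,
  so charts of either sign are allowed.\<close>

lemma has_derivative_cong_open:
  assumes "open S" "y \<in> S" "\<And>z. z \<in> S \<Longrightarrow> f z = g z"
  shows "(f has_derivative F) (at y) \<longleftrightarrow> (g has_derivative F) (at y)"
  using has_derivative_transform_within_open[OF _ assms(1,2), of f F UNIV g]
    has_derivative_transform_within_open[OF _ assms(1,2), of g F UNIV f] assms(3) by auto

text \<open>Local expressions of forms are controlled only on the open range of a chart, so
  derivatives must be compared for functions that agree merely near the point.\<close>

lemma frechet_derivative_cong_open:
  assumes "open S" "y \<in> S" "\<And>z. z \<in> S \<Longrightarrow> f z = g z"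
  shows "frechet_derivative f (at y) = frechet_derivative g (at y)"
  using has_derivative_cong_open[OF assms] by (simp add: frechet_derivative_def)

lemma frechet_derivative_eq: "(f has_derivative F) (at y) \<Longrightarrow> frechet_derivative f (at y) = F"
  using frechet_derivative_at by metis

lemma has_derivative_frechet:
  "f differentiable (at y) \<Longrightarrow> (f has_derivative frechet_derivative f (at y)) (at y)"
  using frechet_derivative_works by blast

lemma frechet_linear: "f differentiable (at y) \<Longrightarrow> linear (frechet_derivative f (at y))"
  by (simp add: linear_frechet_derivative)

lemma differentiable_upto_Suc_D: "differentiable_upto (Suc m) f S \<Longrightarrow> differentiable_upto m f S"
proof (induction m arbitrary: f)
  case 0
  then show ?case
    by (auto intro!: continuous_at_imp_continuous_on differentiable_imp_continuous_within)
next
  case (Suc m)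
  then show ?case by auto
qed

lemma differentiable_upto_cong:
  assumes "open S" "\<And>z. z \<in> S \<Longrightarrow> f z = g z"
  shows "differentiable_upto m f S \<longleftrightarrow> differentiable_upto m g S"
  using assms(2)
proof (induction m arbitrary: f g)
  case 0
  then show ?case by (auto cong: continuous_on_cong)
next
  case (Suc m)
  have "f differentiable (at y) \<longleftrightarrow> g differentiable (at y)" if "y \<in> S" for y
    unfolding differentiable_def using has_derivative_cong_open[OF assms(1) that Suc.prems] by simp
  moreover have "differentiable_upto m (\<lambda>y. frechet_derivative f (at y) w) S \<longleftrightarrow>
      differentiable_upto m (\<lambda>y. frechet_derivative g (at y) w) S" for w
    by (rule Suc.IH) (use frechet_derivative_cong_open[OF assms(1) _ Suc.prems] in simp)
  ultimately show ?case by simp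
qed

lemma smooth_on_cong:
  "open S \<Longrightarrow> (\<And>z. z \<in> S \<Longrightarrow> f z = g z) \<Longrightarrow> smooth_on S f \<longleftrightarrow> smooth_on S g"
  unfolding smooth_on_def using differentiable_upto_cong by blast

lemma smooth_on_congI:
  "open S \<Longrightarrow> smooth_on S g \<Longrightarrow> (\<And>z. z \<in> S \<Longrightarrow> f z = g z) \<Longrightarrow> smooth_on S f"
  using smooth_on_cong[of S f g] by blast

lemma smooth_on_continuous: "smooth_on S f \<Longrightarrow> continuous_on S f"
  unfolding smooth_on_def using differentiable_upto.simps(1) by blast

lemma smooth_on_differentiable: "smooth_on S f \<Longrightarrow> y \<in> S \<Longrightarrow> f differentiable (at y)"
  unfolding smooth_on_def using differentiable_upto.simps(2) by blast

lemma smooth_on_has_derivative: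
  "smooth_on S f \<Longrightarrow> y \<in> S \<Longrightarrow> (f has_derivative frechet_derivative f (at y)) (at y)"
  by (simp add: has_derivative_frechet smooth_on_differentiable)

lemma smooth_on_derivative:
  "smooth_on S f \<Longrightarrow> smooth_on S (\<lambda>y. frechet_derivative f (at y) w)"
  unfolding smooth_on_def using differentiable_upto.simps(2) by blast

lemma smooth_on_subset: "smooth_on S f \<Longrightarrow> T \<subseteq> S \<Longrightarrow> smooth_on T f"
proof -
  have "differentiable_upto m f S \<Longrightarrow> T \<subseteq> S \<Longrightarrow> differentiable_upto m f T" for m
    by (induction m arbitrary: f) (auto intro: continuous_on_subset)
  then show "smooth_on S f \<Longrightarrow> T \<subseteq> S \<Longrightarrow> ?thesis" by (auto simp: smooth_on_def)
qed

text \<open>Meant for functions glued from different formulas, such as bump functions extended by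
  zero. The induction passes to derivatives in a fixed direction, which inherit the local
  hypothesis.\<close>

lemma smooth_on_locally:
  assumes "open S" "\<And>y. y \<in> S \<Longrightarrow> \<exists>T. open T \<and> y \<in> T \<and> smooth_on T f"
  shows "smooth_on S f"
proof -
  have "differentiable_upto m f S"
    if "\<And>y. y \<in> S \<Longrightarrow> \<exists>T. open T \<and> y \<in> T \<and> differentiable_upto m f T" for m
    using that
  proof (induction m arbitrary: f)
    case 0
    have "continuous (at y) f" if y: "y \<in> S" for y
      using 0[OF y] by (auto simp: continuous_on_eq_continuous_at)
    then show ?case by (simp add: continuous_at_imp_continuous_on)
  next
    case (Suc m)
    have "differentiable_upto m (\<lambda>y. frechet_derivative f (at y) w) S" for w
    proof (rule Suc.IH)
      fix y assume "y \<in> S"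
      then show "\<exists>T. open T \<and> y \<in> T \<and> differentiable_upto m (\<lambda>y. frechet_derivative f (at y) w) T"
        using Suc.prems[of y] by auto
    qed
    moreover have "f differentiable (at y)" if "y \<in> S" for y
      using Suc.prems[OF that] by auto
    ultimately show ?case by simp
  qed
  then show ?thesis using assms(2) unfolding smooth_on_def by meson
qed

lemma differentiable_upto_const: "differentiable_upto m (\<lambda>y. c) S"
  by (induction m arbitrary: c) auto

lemma smooth_on_const [simp]: "smooth_on S (\<lambda>y. c)"
  by (simp add: smooth_on_def differentiable_upto_const)

lemma smooth_on_bounded_linear:
  assumes "bounded_linear L" "open S" "smooth_on S f"
  shows "smooth_on S (\<lambda>y. L (f y))"
proof -
  have "differentiable_upto m f S \<Longrightarrow> differentiable_upto m (\<lambda>y. L (f y)) S" for m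
  proof (induction m arbitrary: f)
    case 0
    then show ?case
      using bounded_linear.continuous_on[OF assms(1)] by simp
  next
    case (Suc m)
    have der: "((\<lambda>y. L (f y)) has_derivative (\<lambda>w. L (frechet_derivative f (at y) w))) (at y)"
      if "y \<in> S" for y
      by (intro bounded_linear.has_derivative[OF assms(1) has_derivative_frechet]) (use Suc.prems that in auto)
    have "differentiable_upto m (\<lambda>y. L (frechet_derivative f (at y) w)) S" for w
      using Suc by simp
    moreover have "differentiable_upto m (\<lambda>y. frechet_derivative (\<lambda>y. L (f y)) (at y) w) S \<longleftrightarrow>
        differentiable_upto m (\<lambda>y. L (frechet_derivative f (at y) w)) S" for w
      by (rule differentiable_upto_cong[OF assms(2)]) (simp add: frechet_derivative_eq[OF der])
    ultimately show ?case using der by (auto simp: differentiable_def)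
  qed
  then show ?thesis using assms(3) by (simp add: smooth_on_def)
qed

lemma differentiable_upto_add:
  assumes "open S"
  shows "differentiable_upto m f S \<Longrightarrow> differentiable_upto m g S \<Longrightarrow>
    differentiable_upto m (\<lambda>y. f y + g y) S"
proof (induction m arbitrary: f g)
  case 0
  then show ?case by (auto intro: continuous_on_add)
next
  case (Suc m)
  have der: "((\<lambda>y. f y + g y) has_derivative
      (\<lambda>w. frechet_derivative f (at y) w + frechet_derivative g (at y) w)) (at y)" if "y \<in> S" for y
    using Suc.prems that by (auto intro!: has_derivative_add has_derivative_frechet)
  have "differentiable_upto m (\<lambda>y. frechet_derivative (\<lambda>y. f y + g y) (at y) w) S \<longleftrightarrow>
      differentiable_upto m (\<lambda>y. frechet_derivative f (at y) w + frechet_derivative g (at y) w) S" for w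
    by (rule differentiable_upto_cong[OF assms]) (simp add: frechet_derivative_eq[OF der])
  then show ?case using der Suc by (auto simp: differentiable_def)
qed

lemma differentiable_upto_sum:
  assumes "open S" "\<And>i. i \<in> I \<Longrightarrow> differentiable_upto m (f i) S"
  shows "differentiable_upto m (\<lambda>y. \<Sum>i\<in>I. f i y) S"
  using assms(2)
  by (induction I rule: infinite_finite_induct)
    (auto intro: differentiable_upto_add[OF assms(1)] differentiable_upto_const)

lemma smooth_on_add:
  "open S \<Longrightarrow> smooth_on S f \<Longrightarrow> smooth_on S g \<Longrightarrow> smooth_on S (\<lambda>y. f y + g y)"
  by (simp add: smooth_on_def differentiable_upto_add)

text \<open>In each of the two Leibniz terms only one factor loses an order; the other is lowered by
  \<open>differentiable_upto_Suc_D\<close>, so that the induction hypothesis applies to both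
  terms.\<close>

lemma differentiable_upto_bilinear:
  assumes "bounded_bilinear h" "open S"
  shows "differentiable_upto m f S \<Longrightarrow> differentiable_upto m g S \<Longrightarrow>
    differentiable_upto m (\<lambda>y. h (f y) (g y)) S"
proof (induction m arbitrary: f g)
  case 0
  then show ?case by (auto intro: bounded_bilinear.continuous_on[OF assms(1)])
next
  case (Suc m)
  let ?D = "\<lambda>y w. h (f y) (frechet_derivative g (at y) w) + h (frechet_derivative f (at y) w) (g y)"
  have der: "((\<lambda>y. h (f y) (g y)) has_derivative ?D y) (at y)" if "y \<in> S" for y
    using Suc.prems that
    by (auto intro!: bounded_bilinear.FDERIV[OF assms(1)] has_derivative_frechet)
  have "differentiable_upto m (\<lambda>y. ?D y w) S" for w
    using Suc.prems differentiable_upto_Suc_D[OF Suc.prems(1)] differentiable_upto_Suc_D[OF Suc.prems(2)]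
    by (intro differentiable_upto_add assms Suc.IH) auto
  moreover have "differentiable_upto m (\<lambda>y. frechet_derivative (\<lambda>y. h (f y) (g y)) (at y) w) S \<longleftrightarrow>
      differentiable_upto m (\<lambda>y. ?D y w) S" for w
    by (rule differentiable_upto_cong[OF assms(2)]) (simp add: frechet_derivative_eq[OF der])
  ultimately show ?case using der by (auto simp: differentiable_def)
qed

lemma smooth_on_bilinear:
  "bounded_bilinear h \<Longrightarrow> open S \<Longrightarrow> smooth_on S f \<Longrightarrow> smooth_on S g \<Longrightarrow>
    smooth_on S (\<lambda>y. h (f y) (g y))"
  by (simp add: smooth_on_def differentiable_upto_bilinear)

lemmas smooth_on_mult = smooth_on_bilinear[OF bounded_bilinear_mult]
lemmas smooth_on_scaleR = smooth_on_bilinear[OF bounded_bilinear_scaleR]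
lemmas smooth_on_inner = smooth_on_bilinear[OF bounded_bilinear_inner]

lemma smooth_on_minus: "open S \<Longrightarrow> smooth_on S f \<Longrightarrow> smooth_on S (\<lambda>y. - f y)"
  using smooth_on_bounded_linear[OF bounded_linear_minus[OF bounded_linear_ident]] .

lemma smooth_on_diff:
  "open S \<Longrightarrow> smooth_on S f \<Longrightarrow> smooth_on S g \<Longrightarrow> smooth_on S (\<lambda>y. f y - g y)"
  using smooth_on_add[of S f "\<lambda>y. - g y"] smooth_on_minus by auto

lemma smooth_on_sum:
  "open S \<Longrightarrow> (\<And>i. i \<in> I \<Longrightarrow> smooth_on S (f i)) \<Longrightarrow> smooth_on S (\<lambda>y. \<Sum>i\<in>I. f i y)"
  by (induction I rule: infinite_finite_induct) (auto intro: smooth_on_add)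

lemma smooth_on_of_real:
  "open S \<Longrightarrow> smooth_on S f \<Longrightarrow> smooth_on S (\<lambda>y. of_real (f y) :: complex)"
  using smooth_on_bounded_linear[OF bounded_linear_of_real] .

lemma smooth_on_cnj: "open S \<Longrightarrow> smooth_on S f \<Longrightarrow> smooth_on S (\<lambda>y. cnj (f y))"
  using smooth_on_bounded_linear[OF bounded_linear_cnj] .

text \<open>The derivative of 1/f is a product of copies of 1/f and a derivative of f. Order m of
  this product needs 1/f only to order m, which is the induction hypothesis.\<close>

lemma smooth_on_inverse:
  fixes f :: "'e::real_normed_vector \<Rightarrow> 'b::real_normed_field"
  assumes "open S" "smooth_on S f" "\<And>y. y \<in> S \<Longrightarrow> f y \<noteq> 0"
  shows "smooth_on S (\<lambda>y. inverse (f y))"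
proof -
  have "differentiable_upto m (\<lambda>y. inverse (f y)) S" for m
  proof (induction m)
    case 0
    then show ?case
      using smooth_on_continuous[OF assms(2)] assms(3) by (auto intro!: continuous_on_inverse)
  next
    case (Suc m)
    let ?D = "\<lambda>y w. - (inverse (f y) * frechet_derivative f (at y) w * inverse (f y))"
    have der: "((\<lambda>y. inverse (f y)) has_derivative ?D y) (at y)" if "y \<in> S" for y
      using Deriv.has_derivative_inverse[OF assms(3)[OF that] smooth_on_has_derivative[OF assms(2) that]] .
    have d: "differentiable_upto m (\<lambda>y. frechet_derivative f (at y) w) S" for w
      using smooth_on_derivative[OF assms(2)] by (simp add: smooth_on_def)
    \<comment> \<open>The minus sign is treated as multiplication by a constant, so the bilinear
      rule covers the whole expression.\<close>
    have c: "differentiable_upto m (\<lambda>y. - 1 :: 'b) S"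
      by (rule differentiable_upto_const)
    have "differentiable_upto m (\<lambda>y. - 1 * (inverse (f y) * frechet_derivative f (at y) w * inverse (f y))) S" for w
      by (intro differentiable_upto_bilinear[OF bounded_bilinear_mult assms(1)] c d Suc)
    moreover have "differentiable_upto m (\<lambda>y. frechet_derivative (\<lambda>y. inverse (f y)) (at y) w) S \<longleftrightarrow>
        differentiable_upto m (\<lambda>y. ?D y w) S" for w
      by (rule differentiable_upto_cong[OF assms(1)]) (simp add: frechet_derivative_eq[OF der])
    ultimately show ?case using der by (auto simp: differentiable_def)
  qed
  then show ?thesis by (simp add: smooth_on_def)
qed

lemma smooth_on_divide:
  fixes f :: "'e::real_normed_vector \<Rightarrow> 'b::real_normed_field"
  assumes "open S" "smooth_on S f" "smooth_on S g" "\<And>y. y \<in> S \<Longrightarrow> g y \<noteq> 0"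
  shows "smooth_on S (\<lambda>y. f y / g y)"
  using smooth_on_mult[OF assms(1,2) smooth_on_inverse[OF assms(1,3,4)]] by (simp add: divide_inverse)

lemma smooth_on_ident: "smooth_on S (\<lambda>y. y)"
proof -
  have "differentiable_upto m (\<lambda>y. frechet_derivative (\<lambda>y. y) (at y) w) S" for m and w :: 'a
    unfolding frechet_derivative_ident by (rule differentiable_upto_const)
  then have "differentiable_upto m (\<lambda>y::'a. y) S" for m by (cases m) auto
  then show ?thesis by (simp add: smooth_on_def)
qed

lemma linear_euclidean_sum:
  fixes F :: "'e::euclidean_space \<Rightarrow> 'b::real_vector"
  assumes "linear F"
  shows "F w = (\<Sum>i\<in>Basis. (w \<bullet> i) *\<^sub>R F i)"
proof -
  have "F w = F (\<Sum>i\<in>Basis. (w \<bullet> i) *\<^sub>R i)" by (simp add: euclidean_representation)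
  then show ?thesis by (simp add: linear_sum[OF assms] linear_cmul[OF assms])
qed

text \<open>\<open>differentiable_upto\<close> differentiates in a direction fixed beforehand,
  whereas the chain rule differentiates f in the direction T'(y) w, which moves with y. Expanding
  this direction in the basis leaves derivatives of f in fixed directions, with smooth
  coefficients.\<close>

lemma smooth_on_compose:
  fixes f :: "'e::euclidean_space \<Rightarrow> 'b::real_normed_vector"
    and T :: "'d::real_normed_vector \<Rightarrow> 'e"
  assumes "open S" "open R" "smooth_on S T" "T ` S \<subseteq> R" "smooth_on R f"
  shows "smooth_on S (\<lambda>y. f (T y))"
proof -
  have *: "smooth_on R f \<Longrightarrow> differentiable_upto m (\<lambda>y. f (T y)) S" for m
  proof (induction m arbitrary: f)
    case 0
    then show ?case
      using continuous_on_compose2[OF smooth_on_continuous smooth_on_continuous] assms by auto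
  next
    case (Suc m)
    let ?D = "\<lambda>y w. frechet_derivative f (at (T y)) (frechet_derivative T (at y) w)"
    let ?E = "\<lambda>y w. \<Sum>i\<in>Basis. (frechet_derivative T (at y) w \<bullet> i) *\<^sub>R frechet_derivative f (at (T y)) i"
    have der: "((\<lambda>y. f (T y)) has_derivative ?D y) (at y)" if "y \<in> S" for y
      using diff_chain_at[OF smooth_on_has_derivative[OF assms(3) that], of f] that assms(4)
        smooth_on_has_derivative[OF Suc.prems] by (auto simp: o_def)
    have "?D y w = ?E y w" if "y \<in> S" for y w
      using linear_euclidean_sum[OF frechet_linear[OF smooth_on_differentiable[OF Suc.prems]]] that assms(4)
      by blast
    moreover have "differentiable_upto m (\<lambda>y. ?E y w) S" for w
    proof -
      have "differentiable_upto m (\<lambda>y. (frechet_derivative T (at y) w \<bullet> i) *\<^sub>R frechet_derivative f (at (T y)) i) S" for i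
        using smooth_on_inner[OF assms(1) smooth_on_derivative[OF assms(3)] smooth_on_const]
          Suc.IH[OF smooth_on_derivative[OF Suc.prems]]
        by (intro differentiable_upto_bilinear[OF bounded_bilinear_scaleR assms(1)])
          (auto simp: smooth_on_def)
      then show ?thesis by (intro differentiable_upto_sum assms)
    qed
    moreover have "differentiable_upto m (\<lambda>y. frechet_derivative (\<lambda>y. f (T y)) (at y) w) S \<longleftrightarrow>
        differentiable_upto m (\<lambda>y. ?D y w) S" for w
      by (rule differentiable_upto_cong[OF assms(1)]) (simp add: frechet_derivative_eq[OF der])
    moreover have "differentiable_upto m (\<lambda>y. ?D y w) S \<longleftrightarrow> differentiable_upto m (\<lambda>y. ?E y w) S" for w
      by (rule differentiable_upto_cong[OF assms(1)]) (rule calculation(1))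
    ultimately have "differentiable_upto m (\<lambda>y. frechet_derivative (\<lambda>y. f (T y)) (at y) w) S" for w
      by blast
    then show ?case using der unfolding differentiable_upto.simps differentiable_def by blast
  qed
  show ?thesis using *[OF assms(5)] by (simp add: smooth_on_def)
qed

section \<open>Symmetry of second derivatives\<close>

lemma second_difference_mean_value:
  fixes f :: "'e::real_normed_vector \<Rightarrow> real"
  assumes "smooth_on S f" "h > 0"
    and S: "\<And>s t. 0 \<le> s \<Longrightarrow> s \<le> h \<Longrightarrow> 0 \<le> t \<Longrightarrow> t \<le> h \<Longrightarrow> y + s *\<^sub>R u + t *\<^sub>R v \<in> S"
  shows "\<exists>s t. 0 \<le> s \<and> s \<le> h \<and> 0 \<le> t \<and> t \<le> h \<and>
    f (y + h *\<^sub>R u + h *\<^sub>R v) - f (y + h *\<^sub>R u) - f (y + h *\<^sub>R v) + f y =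
    h * (h * frechet_derivative (\<lambda>z. frechet_derivative f (at z) u) (at (y + s *\<^sub>R u + t *\<^sub>R v)) v)"
proof -
  have line: "((\<lambda>r. F (a + r *\<^sub>R w)) has_real_derivative frechet_derivative F (at (a + r *\<^sub>R w)) w) (at r)"
    if "F differentiable (at (a + r *\<^sub>R w))" for F :: "'e \<Rightarrow> real" and a w r
  proof -
    have "((\<lambda>r. F (a + r *\<^sub>R w)) has_derivative
        (\<lambda>x. frechet_derivative F (at (a + r *\<^sub>R w)) (0 + x *\<^sub>R w))) (at r)"
      by (rule has_derivative_compose[of "\<lambda>r. a + r *\<^sub>R w", OF _ has_derivative_frechet[OF that]])
        (auto intro!: derivative_eq_intros)
    then show ?thesis
      by (simp add: has_field_derivative_def linear_cmul[OF frechet_linear[OF that]] mult.commute[of _ "frechet_derivative F (at (a + r *\<^sub>R w)) w"])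
  qed
  let ?Du = "\<lambda>z. frechet_derivative f (at z) u"
  \<comment> \<open>First mean value step: the increment of f under \<open>h *\<^sub>R v\<close>,
    regarded as a function along u. The second step runs along v and produces the mixed
    derivative.\<close>
  have "\<exists>s. 0 < s \<and> s < h \<and>
    (f (y + h *\<^sub>R v + h *\<^sub>R u) - f (y + h *\<^sub>R u)) - (f (y + h *\<^sub>R v + 0 *\<^sub>R u) - f (y + 0 *\<^sub>R u)) =
    (h - 0) * (?Du (y + h *\<^sub>R v + s *\<^sub>R u) - ?Du (y + s *\<^sub>R u))"
  proof (rule MVT2[OF assms(2)])
    fix s assume s: "0 \<le> s" "s \<le> h"
    have "f differentiable (at (y + h *\<^sub>R v + s *\<^sub>R u))" "f differentiable (at (y + s *\<^sub>R u))"
      using S[OF s, of h] S[OF s, of 0] assms(2) smooth_on_differentiable[OF assms(1)]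
      by (auto simp: algebra_simps)
    then show "((\<lambda>s. f (y + h *\<^sub>R v + s *\<^sub>R u) - f (y + s *\<^sub>R u)) has_real_derivative
        (?Du (y + h *\<^sub>R v + s *\<^sub>R u) - ?Du (y + s *\<^sub>R u))) (at s)"
      by (intro DERIV_diff line)
  qed
  then obtain s where s: "0 < s" "s < h" and s_eq:
    "(f (y + h *\<^sub>R v + h *\<^sub>R u) - f (y + h *\<^sub>R u)) - (f (y + h *\<^sub>R v) - f y) =
      h * (?Du (y + h *\<^sub>R v + s *\<^sub>R u) - ?Du (y + s *\<^sub>R u))"
    by auto
  have "\<exists>t. 0 < t \<and> t < h \<and> ?Du ((y + s *\<^sub>R u) + h *\<^sub>R v) - ?Du ((y + s *\<^sub>R u) + 0 *\<^sub>R v) =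
    (h - 0) * frechet_derivative ?Du (at ((y + s *\<^sub>R u) + t *\<^sub>R v)) v"
  proof (rule MVT2[OF assms(2)])
    fix t assume "0 \<le> t" "t \<le> h"
    then show "((\<lambda>t. ?Du ((y + s *\<^sub>R u) + t *\<^sub>R v)) has_real_derivative
        frechet_derivative ?Du (at ((y + s *\<^sub>R u) + t *\<^sub>R v)) v) (at t)"
      using S[of s t] s smooth_on_differentiable[OF smooth_on_derivative[OF assms(1)]]
      by (intro line) auto
  qed
  then obtain t where t: "0 < t" "t < h"
    "?Du ((y + s *\<^sub>R u) + h *\<^sub>R v) - ?Du (y + s *\<^sub>R u) =
      h * frechet_derivative ?Du (at ((y + s *\<^sub>R u) + t *\<^sub>R v)) v"
    by auto
  show ?thesis
    using s t s_eq by (intro exI[of _ s] exI[of _ t]) (auto simp: algebra_simps)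
qed

text \<open>The second difference is symmetric in u and v and equals h squared times either mixed
  derivative at some nearby point. Continuity of both mixed derivatives then forces them to agree at
  y.\<close>

lemma second_derivative_symmetric_real:
  fixes f :: "'e::real_normed_vector \<Rightarrow> real"
  assumes "open S" "smooth_on S f" "y \<in> S"
  shows "frechet_derivative (\<lambda>z. frechet_derivative f (at z) u) (at y) v =
    frechet_derivative (\<lambda>z. frechet_derivative f (at z) v) (at y) u"
proof -
  let ?a = "\<lambda>u v z. frechet_derivative (\<lambda>z. frechet_derivative f (at z) u) (at z) v"
  have cont: "isCont (?a u v) y" for u v
    using smooth_on_continuous[OF smooth_on_derivative[OF smooth_on_derivative[OF assms(2)]]]
      assms(1,3) continuous_on_eq_continuous_at by blast
  have "\<bar>?a u v y - ?a v u y\<bar> \<le> e" if "e > 0" for e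
  proof -
    have "e / 2 > 0" using that by simp
    obtain d1 where d1: "d1 > 0" "\<And>z. dist z y < d1 \<Longrightarrow> dist (?a u v z) (?a u v y) < e / 2"
      using cont[of u v, unfolded continuous_at_eps_delta, rule_format, of "e / 2"] \<open>e / 2 > 0\<close> by blast
    obtain d2 where d2: "d2 > 0" "\<And>z. dist z y < d2 \<Longrightarrow> dist (?a v u z) (?a v u y) < e / 2"
      using cont[of v u, unfolded continuous_at_eps_delta, rule_format, of "e / 2"] \<open>e / 2 > 0\<close> by blast
    obtain d3 where d3: "d3 > 0" "\<And>z. dist z y < d3 \<Longrightarrow> z \<in> S"
      using assms(1,3) by (auto simp: open_dist)
    define d where "d = min d1 (min d2 d3)"
    \<comment> \<open>The parallelogram with sides h u and h v lies within d / 2 of y; the summand 1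
      keeps the denominator positive when u and v vanish.\<close>
    define h where "h = d / (2 * (norm u + norm v + 1))"
    have "d > 0" using d1 d2 d3 by (simp add: d_def)
    have n: "norm u + norm v + 1 > 0" by (simp add: add_nonneg_pos)
    then have "h > 0" using \<open>d > 0\<close> by (simp add: h_def)
    have near: "dist (y + s *\<^sub>R u + t *\<^sub>R v) y < d" "dist (y + s *\<^sub>R v + t *\<^sub>R u) y < d"
      if "0 \<le> s" "s \<le> h" "0 \<le> t" "t \<le> h" for s t
    proof -
      have *: "norm (a *\<^sub>R u + b *\<^sub>R v) < d" if "0 \<le> a" "a \<le> h" "0 \<le> b" "b \<le> h" for a b
      proof -
        have "norm (a *\<^sub>R u + b *\<^sub>R v) \<le> h * norm u + h * norm v"
          using that by (intro norm_triangle_le add_mono) (auto intro: mult_right_mono)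
        also have "\<dots> \<le> h * (norm u + norm v + 1)" using \<open>h > 0\<close> by (simp add: algebra_simps)
        also have "\<dots> = d / 2" unfolding h_def using n by (simp add: field_simps)
        finally show ?thesis using \<open>d > 0\<close> by simp
      qed
      show "dist (y + s *\<^sub>R u + t *\<^sub>R v) y < d" "dist (y + s *\<^sub>R v + t *\<^sub>R u) y < d"
        using *[of s t] *[of t s] that by (auto simp: dist_norm add.commute)
    qed
    have near_S: "y + s *\<^sub>R u + t *\<^sub>R v \<in> S" "y + s *\<^sub>R v + t *\<^sub>R u \<in> S"
      if "0 \<le> s" "s \<le> h" "0 \<le> t" "t \<le> h" for s t
      using near[OF that] d3(2) by (auto simp: d_def)
    obtain s t where st: "0 \<le> s" "s \<le> h" "0 \<le> t" "t \<le> h" and 1: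
      "f (y + h *\<^sub>R u + h *\<^sub>R v) - f (y + h *\<^sub>R u) - f (y + h *\<^sub>R v) + f y =
        h * (h * ?a u v (y + s *\<^sub>R u + t *\<^sub>R v))"
      using second_difference_mean_value[OF assms(2) \<open>h > 0\<close> near_S(1)] by blast
    obtain s' t' where st': "0 \<le> s'" "s' \<le> h" "0 \<le> t'" "t' \<le> h" and 2:
      "f (y + h *\<^sub>R v + h *\<^sub>R u) - f (y + h *\<^sub>R v) - f (y + h *\<^sub>R u) + f y =
        h * (h * ?a v u (y + s' *\<^sub>R v + t' *\<^sub>R u))"
      using second_difference_mean_value[OF assms(2) \<open>h > 0\<close> near_S(2)] by blast
    have "f (y + h *\<^sub>R u + h *\<^sub>R v) = f (y + h *\<^sub>R v + h *\<^sub>R u)" by (simp add: algebra_simps)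
    then have "h * (h * ?a u v (y + s *\<^sub>R u + t *\<^sub>R v)) = h * (h * ?a v u (y + s' *\<^sub>R v + t' *\<^sub>R u))"
      using 1 2 by linarith
    then have "?a u v (y + s *\<^sub>R u + t *\<^sub>R v) = ?a v u (y + s' *\<^sub>R v + t' *\<^sub>R u)"
      using \<open>h > 0\<close> by simp
    then show ?thesis
      using d1(2)[of "y + s *\<^sub>R u + t *\<^sub>R v"] d2(2)[of "y + s' *\<^sub>R v + t' *\<^sub>R u"] near(1)[OF st] near(2)[OF st']
      unfolding d_def dist_real_def min_less_iff_conj by linarith
  qed
  then have "\<bar>?a u v y - ?a v u y\<bar> \<le> 0" by (rule field_le_epsilon[of _ 0, simplified])
  then show ?thesis by simp
qed

text \<open>The mean value theorem needs real values, so the claim is reduced to the coordinates of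
  f.\<close>

lemma second_derivative_symmetric:
  fixes f :: "'e::real_normed_vector \<Rightarrow> 'b::euclidean_space"
  assumes "open S" "smooth_on S f" "y \<in> S"
  shows "frechet_derivative (\<lambda>z. frechet_derivative f (at z) u) (at y) v =
    frechet_derivative (\<lambda>z. frechet_derivative f (at z) v) (at y) u"
proof (rule euclidean_eqI)
  fix i :: 'b assume "i \<in> Basis"
  have bl: "bounded_linear (\<lambda>x::'b. x \<bullet> i)" by (rule bounded_linear_inner_left)
  have der: "frechet_derivative (\<lambda>z. F z \<bullet> i) (at z) w = frechet_derivative F (at z) w \<bullet> i"
    if "F differentiable (at z)" for F :: "'e \<Rightarrow> 'b" and z w
    using frechet_derivative_eq[OF bounded_linear.has_derivative[OF bl has_derivative_frechet[OF that]]]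
    by simp
  have "frechet_derivative (\<lambda>z. frechet_derivative (\<lambda>z. f z \<bullet> i) (at z) u) (at y) v =
      frechet_derivative (\<lambda>z. frechet_derivative f (at z) u) (at y) v \<bullet> i" for u v
  proof -
    have "frechet_derivative (\<lambda>z. frechet_derivative (\<lambda>z. f z \<bullet> i) (at z) u) (at y) =
        frechet_derivative (\<lambda>z. frechet_derivative f (at z) u \<bullet> i) (at y)"
      by (rule frechet_derivative_cong_open[OF assms(1,3)])
        (simp add: der smooth_on_differentiable[OF assms(2)])
    then show ?thesis
      by (simp add: der smooth_on_differentiable[OF smooth_on_derivative[OF assms(2)] assms(3)])
  qed
  then show "frechet_derivative (\<lambda>z. frechet_derivative f (at z) u) (at y) v \<bullet> i =
      frechet_derivative (\<lambda>z. frechet_derivative f (at z) v) (at y) u \<bullet> i"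
    using second_derivative_symmetric_real[OF assms(1) smooth_on_bounded_linear[OF bl assms(1,2)] assms(3)]
    by metis
qed

section \<open>Multilinear maps depending on a parameter\<close>

definition multilin :: "nat \<Rightarrow> ('e::real_vector list \<Rightarrow> 'b::real_vector) \<Rightarrow> bool"
  where "multilin k F \<longleftrightarrow> (\<forall>ws i a u b v. length ws = k \<and> i < k \<longrightarrow>
    F (ws[i := a *\<^sub>R u + b *\<^sub>R v]) = a *\<^sub>R F (ws[i := u]) + b *\<^sub>R F (ws[i := v]))"

lemma multilinD:
  "multilin k F \<Longrightarrow> length ws = k \<Longrightarrow> i < k \<Longrightarrow>
    F (ws[i := a *\<^sub>R u + b *\<^sub>R v]) = a *\<^sub>R F (ws[i := u]) + b *\<^sub>R F (ws[i := v])"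
  by (simp add: multilin_def)

lemma multilin_linear:
  assumes "multilin k F" "length ws = k" "i < k"
  shows "linear (\<lambda>u. F (ws[i := u]))"
  using multilinD[OF assms, of 1 _ 1] multilinD[OF assms, of _ _ 0 0]
  by (intro linearI) auto

lemma multilin_Cons: "multilin (Suc k) F \<Longrightarrow> multilin k (\<lambda>ws. F (u # ws))"
  unfolding multilin_def
proof (intro allI impI, elim conjE)
  fix ws :: "'a list" and i a v b w
  assume "\<forall>ws i a u b v. length ws = Suc k \<and> i < Suc k \<longrightarrow>
    F (ws[i := a *\<^sub>R u + b *\<^sub>R v]) = a *\<^sub>R F (ws[i := u]) + b *\<^sub>R F (ws[i := v])"
    and "length ws = k" "i < k"
  from this(1)[rule_format, of "u # ws" "Suc i"] this(2-)
  show "F (u # ws[i := a *\<^sub>R v + b *\<^sub>R w]) = a *\<^sub>R F (u # ws[i := v]) + b *\<^sub>R F (u # ws[i := w])"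
    by simp
qed

lemma multilin_linear_Cons: "multilin (Suc k) F \<Longrightarrow> length ws = k \<Longrightarrow> linear (\<lambda>u. F (u # ws))"
  using multilin_linear[of "Suc k" F "0 # ws" 0] by simp

text \<open>Induction over the argument fields: the head is expanded in the basis with smooth
  coefficients, and fixing a basis vector as head leaves a multilinear map with one argument fewer.
  This is how forms are evaluated on non-constant fields such as J w.\<close>

lemma smooth_on_multilin:
  fixes F :: "'d::real_normed_vector \<Rightarrow> 'e::euclidean_space list \<Rightarrow> 'b::real_normed_vector"
  assumes "open S"
    and "\<And>y. y \<in> S \<Longrightarrow> multilin (length us) (F y)"
    and "\<And>ws. length ws = length us \<Longrightarrow> smooth_on S (\<lambda>y. F y ws)"
    and "\<And>u. u \<in> set us \<Longrightarrow> smooth_on S u"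
  shows "smooth_on S (\<lambda>y. F y (map (\<lambda>u. u y) us))"
  using assms(2-)
proof (induction us arbitrary: F)
  case Nil
  then show ?case by simp
next
  case (Cons u us)
  have "smooth_on S (\<lambda>y. F y (i # map (\<lambda>u. u y) us))" for i
    using Cons.prems by (intro Cons.IH[of "\<lambda>y ws. F y (i # ws)"]) (auto intro: multilin_Cons)
  then have "smooth_on S (\<lambda>y. \<Sum>i\<in>Basis. (u y \<bullet> i) *\<^sub>R F y (i # map (\<lambda>u. u y) us))"
    using Cons.prems(3)
    by (intro smooth_on_sum smooth_on_scaleR smooth_on_inner assms(1) smooth_on_const) auto
  moreover have "F y (u y # map (\<lambda>u. u y) us) = (\<Sum>i\<in>Basis. (u y \<bullet> i) *\<^sub>R F y (i # map (\<lambda>u. u y) us))"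
    if "y \<in> S" for y
    using Cons.prems(1)[OF that] by (intro linear_euclidean_sum multilin_linear_Cons) auto
  ultimately show ?case
    using smooth_on_cong[OF assms(1), of "\<lambda>y. F y (map (\<lambda>u. u y) (u # us))"] by simp
qed

text \<open>Product rule with one term for the coefficients and one for each argument. It is applied
  with T a transition map and the fields \<open>us\<close> its own derivatives, so the sum over j
  collects the second derivatives of the transition map.\<close>

lemma has_derivative_multilin:
  fixes F :: "'e::euclidean_space \<Rightarrow> 'e list \<Rightarrow> 'b::real_normed_vector"
    and T :: "'d::real_normed_vector \<Rightarrow> 'e"
  assumes S: "open S" "y \<in> S" "\<And>z. z \<in> S \<Longrightarrow> T z \<in> R" "open R" and T: "(T has_derivative T') (at y)"
    and "\<And>z. z \<in> R \<Longrightarrow> multilin (length us) (F z)"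
    and "\<And>ws. length ws = length us \<Longrightarrow> (\<lambda>z. F z ws) differentiable (at (T y))"
    and "\<And>u. u \<in> set us \<Longrightarrow> u differentiable (at y)"
  shows "((\<lambda>z. F (T z) (map (\<lambda>u. u z) us)) has_derivative
    (\<lambda>h. frechet_derivative (\<lambda>z. F z (map (\<lambda>u. u y) us)) (at (T y)) (T' h) +
      (\<Sum>j<length us. F (T y) ((map (\<lambda>u. u y) us)[j := frechet_derivative (us ! j) (at y) h])))) (at y)"
  using assms(6-)
proof (induction us arbitrary: F)
  case Nil
  show ?case
    using has_derivative_compose[OF T has_derivative_frechet] Nil.prems(2)[of "[]"] by simp
next
  case (Cons u us)
  let ?r = "\<lambda>z. map (\<lambda>u. u z) us"
  let ?G' = "\<lambda>i h. frechet_derivative (\<lambda>z. F z (i # ?r y)) (at (T y)) (T' h) +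
      (\<Sum>j<length us. F (T y) (i # (?r y)[j := frechet_derivative (us ! j) (at y) h]))"
  have ml: "multilin (Suc (length us)) (F (T y))" using Cons.prems(1) S(2,3) by simp
  have G: "((\<lambda>z. F (T z) (i # ?r z)) has_derivative ?G' i) (at y)" for i
    using Cons.prems by (intro Cons.IH) (auto intro: multilin_Cons)
  have u: "(u has_derivative frechet_derivative u (at y)) (at y)"
    using Cons.prems(3) by (intro has_derivative_frechet) simp
  have expR: "F z (w # ws) = (\<Sum>i\<in>Basis. (w \<bullet> i) *\<^sub>R F z (i # ws))"
    if "z \<in> R" "length ws = length us" for z w ws
    using Cons.prems(1)[OF that(1)] that(2) by (intro linear_euclidean_sum multilin_linear_Cons) auto
  have exp: "F (T z) (w # ws) = (\<Sum>i\<in>Basis. (w \<bullet> i) *\<^sub>R F (T z) (i # ws))"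
    if "z \<in> S" "length ws = length us" for z w ws
    using expR S(3) that by blast
  have dF: "((\<lambda>z. F z (i # ?r y)) has_derivative
      frechet_derivative (\<lambda>z. F z (i # ?r y)) (at (T y))) (at (T y))" for i
    using Cons.prems(2) by (intro has_derivative_frechet) simp
  have "((\<lambda>z. \<Sum>i\<in>Basis. (u y \<bullet> i) *\<^sub>R F z (i # ?r y)) has_derivative
      (\<lambda>k. \<Sum>i\<in>Basis. (u y \<bullet> i) *\<^sub>R frechet_derivative (\<lambda>z. F z (i # ?r y)) (at (T y)) k)) (at (T y))"
    by (intro has_derivative_sum has_derivative_scaleR_right dF)
  then have "((\<lambda>z. F z (u y # ?r y)) has_derivative
      (\<lambda>k. \<Sum>i\<in>Basis. (u y \<bullet> i) *\<^sub>R frechet_derivative (\<lambda>z. F z (i # ?r y)) (at (T y)) k)) (at (T y))"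
    by (subst has_derivative_cong_open[OF S(4) S(3)[OF S(2)]]) (auto intro: expR)
  from frechet_derivative_eq[OF this] have D: "frechet_derivative (\<lambda>z. F z (u y # ?r y)) (at (T y)) k =
      (\<Sum>i\<in>Basis. (u y \<bullet> i) *\<^sub>R frechet_derivative (\<lambda>z. F z (i # ?r y)) (at (T y)) k)" for k
    by simp
  have "((\<lambda>z. \<Sum>i\<in>Basis. (u z \<bullet> i) *\<^sub>R F (T z) (i # ?r z)) has_derivative
      (\<lambda>h. \<Sum>i\<in>Basis. (u y \<bullet> i) *\<^sub>R ?G' i h + (frechet_derivative u (at y) h \<bullet> i) *\<^sub>R F (T y) (i # ?r y))) (at y)"
    by (intro has_derivative_sum has_derivative_scaleR G has_derivative_inner_left u)
  also have "(\<lambda>h. \<Sum>i\<in>Basis. (u y \<bullet> i) *\<^sub>R ?G' i h + (frechet_derivative u (at y) h \<bullet> i) *\<^sub>R F (T y) (i # ?r y)) =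
    (\<lambda>h. frechet_derivative (\<lambda>z. F z (u y # ?r y)) (at (T y)) (T' h) +
      (\<Sum>j<length (u # us). F (T y) ((u y # ?r y)[j := frechet_derivative ((u # us) ! j) (at y) h])))"
  proof
    fix h
    have 1: "(\<Sum>i\<in>Basis. (u y \<bullet> i) *\<^sub>R (\<Sum>j<length us. F (T y) (i # (?r y)[j := frechet_derivative (us ! j) (at y) h])))
        = (\<Sum>j<length us. F (T y) (u y # (?r y)[j := frechet_derivative (us ! j) (at y) h]))"
      unfolding scaleR_sum_right
      by (subst sum.swap, rule sum.cong[OF refl], rule exp[OF S(2), symmetric]) simp
    have 2: "F (T y) (frechet_derivative u (at y) h # ?r y) =
        (\<Sum>i\<in>Basis. (frechet_derivative u (at y) h \<bullet> i) *\<^sub>R F (T y) (i # ?r y))"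
      by (rule exp[OF S(2)]) simp
    show "(\<Sum>i\<in>Basis. (u y \<bullet> i) *\<^sub>R ?G' i h + (frechet_derivative u (at y) h \<bullet> i) *\<^sub>R F (T y) (i # ?r y)) =
      frechet_derivative (\<lambda>z. F z (u y # ?r y)) (at (T y)) (T' h) +
      (\<Sum>j<length (u # us). F (T y) ((u y # ?r y)[j := frechet_derivative ((u # us) ! j) (at y) h]))"
      unfolding list.size(4) add_Suc_right add_0_right sum.lessThan_Suc_shift
      unfolding sum.distrib scaleR_right_distrib 1 D list_update.simps nat.case nth_Cons_0 nth_Cons_Suc 2
      by simp
  qed
  finally have "((\<lambda>z. \<Sum>i\<in>Basis. (u z \<bullet> i) *\<^sub>R F (T z) (i # ?r z)) has_derivative
    (\<lambda>h. frechet_derivative (\<lambda>z. F z (u y # ?r y)) (at (T y)) (T' h) +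
      (\<Sum>j<length (u # us). F (T y) ((u y # ?r y)[j := frechet_derivative ((u # us) ! j) (at y) h])))) (at y)" .
  then show ?case
    by (subst has_derivative_cong_open[OF S(1,2), of _ "\<lambda>z. \<Sum>i\<in>Basis. (u z \<bullet> i) *\<^sub>R F (T z) (i # ?r z)"])
      (auto intro!: exp)
qed

section \<open>Recursive evaluation on lists of arguments\<close>

lemma Pow_lessThan_Suc_split:
  "Pow {..<Suc n} = (`) Suc ` Pow {..<n} \<union> (\<lambda>T. insert 0 (Suc ` T)) ` Pow {..<n}"
proof -
  have "{..<Suc n} = insert 0 (Suc ` {..<n})" by (simp add: lessThan_Suc_eq_insert_0)
  then show ?thesis by (simp add: Pow_insert image_image image_Pow_surj[symmetric] flip: image_Pow_surj)
qed

text \<open>Subsets are sorted by whether they contain position 0. This turns the subset sums in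
  \<open>wedge\<close>, \<open>complexify\<close> and \<open>form_inner\<close> into recursions on
  the argument list, which the simplifier can run on explicit lists.\<close>

lemma sum_Pow_lessThan_Suc:
  "(\<Sum>S\<in>Pow {..<Suc n}. f S) = (\<Sum>T\<in>Pow {..<n}. f (Suc ` T)) + (\<Sum>T\<in>Pow {..<n}. f (insert 0 (Suc ` T)))"
proof -
  have inj: "inj_on ((`) Suc) (Pow {..<n})" "inj_on (\<lambda>T. insert 0 (Suc ` T)) (Pow {..<n})"
  proof -
    show "inj_on ((`) Suc) (Pow {..<n})" by (simp add: inj_on_image inj_on_def inj_image_eq_iff)
    show "inj_on (\<lambda>T. insert 0 (Suc ` T)) (Pow {..<n})"
    proof (rule inj_onI)
      fix S T assume "insert 0 (Suc ` S) = insert 0 (Suc ` T)"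
      then have "Suc ` S = Suc ` T" by (metis image_iff insert_ident nat.distinct(1))
      then show "S = T" by (simp add: inj_image_eq_iff)
    qed
  qed
  have "(`) Suc ` Pow {..<n} \<inter> (\<lambda>T. insert 0 (Suc ` T)) ` Pow {..<n} = {}" by auto
  then show ?thesis
    unfolding Pow_lessThan_Suc_split
    by (subst sum.union_disjoint) (auto simp: sum.reindex[OF inj(1)] sum.reindex[OF inj(2)])
qed

lemma nths_Cons_Suc_image: "nths (v # vs) (Suc ` T) = nths vs T"
  "nths (v # vs) (insert 0 (Suc ` T)) = v # nths vs T"
  "nths (v # vs) (- Suc ` T) = v # nths vs (- T)"
  "nths (v # vs) (- insert 0 (Suc ` T)) = nths vs (- T)"
proof -
  have "{j. Suc j \<in> Suc ` T} = T" "{j. Suc j \<in> insert 0 (Suc ` T)} = T"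
    "{j. Suc j \<in> - Suc ` T} = - T" "{j. Suc j \<in> - insert 0 (Suc ` T)} = - T" by auto
  then show "nths (v # vs) (Suc ` T) = nths vs T"
    "nths (v # vs) (insert 0 (Suc ` T)) = v # nths vs T"
    "nths (v # vs) (- Suc ` T) = v # nths vs (- T)"
    "nths (v # vs) (- insert 0 (Suc ` T)) = nths vs (- T)" by (auto simp: nths_Cons)
qed

text \<open>If position 0 is left out, every chosen position forms a new inversion with it, hence
  the factor (-1) ^ card T; if it is chosen, nothing precedes it and no inversion is added.\<close>

lemma shuffle_sign_Suc:
  assumes "T \<subseteq> {..<n}"
  shows "shuffle_sign (Suc n) (Suc ` T) = (-1) ^ card T * shuffle_sign n T"
    and "shuffle_sign (Suc n) (insert 0 (Suc ` T)) = shuffle_sign n T"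
proof -
  let ?I = "\<lambda>n S. {(i, j). i \<in> S \<and> j \<in> {..<n} - S \<and> j < (i::nat)}"
  let ?s = "\<lambda>(i, j). (Suc i, Suc j)"
  have fT: "finite T" using assms finite_subset by blast
  have fin: "finite (?I n T)"
    by (rule finite_subset[of _ "T \<times> {..<n}"]) (use fT in auto)
  have inj: "inj_on ?s A" for A by (auto simp: inj_on_def)
  have 1: "?I (Suc n) (Suc ` T) = (\<lambda>i. (Suc i, 0)) ` T \<union> ?s ` ?I n T"
  proof (intro set_eqI iffI)
    fix z assume "z \<in> ?I (Suc n) (Suc ` T)"
    then obtain i j where z: "z = (Suc i, j)" "i \<in> T" "j < Suc n" "j \<notin> Suc ` T" "j < Suc i" by auto
    then show "z \<in> (\<lambda>i. (Suc i, 0)) ` T \<union> ?s ` ?I n T" by (cases j) (auto simp: image_iff)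
  qed auto
  have "card (?I (Suc n) (Suc ` T)) = card T + card (?I n T)"
    unfolding 1 using fT fin
    by (subst card_Un_disjoint) (auto simp: card_image inj inj_on_def)
  then show "shuffle_sign (Suc n) (Suc ` T) = (-1) ^ card T * shuffle_sign n T"
    by (simp add: shuffle_sign_def power_add)
  have 2: "?I (Suc n) (insert 0 (Suc ` T)) = ?s ` ?I n T"
  proof (intro set_eqI iffI)
    fix z assume "z \<in> ?I (Suc n) (insert 0 (Suc ` T))"
    then obtain i j where z: "z = (Suc i, j)" "i \<in> T" "j < Suc n" "j \<noteq> 0" "j \<notin> Suc ` T" "j < Suc i" by auto
    then show "z \<in> ?s ` ?I n T" by (cases j) (auto simp: image_iff)
  qed auto
  show "shuffle_sign (Suc n) (insert 0 (Suc ` T)) = shuffle_sign n T"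
    unfolding shuffle_sign_def 2 by (simp add: card_image[OF inj])
qed

lemma length_nths_subset: "T \<subseteq> {..<length vs} \<Longrightarrow> length (nths vs T) = card T"
  by (auto simp: length_nths intro!: arg_cong[of _ _ card])

lemma wedge_Nil: "wedge \<alpha> \<beta> [] = \<alpha> [] * \<beta> []"
  by (simp add: wedge_def shuffle_sign_def)

text \<open>The sign (-1) ^ card T counts the arguments handed to the left factor, so it is absorbed
  into that factor as (-1) ^ length us.\<close>

lemma wedge_Cons:
  "wedge \<alpha> \<beta> (v # vs) = wedge (\<lambda>us. \<alpha> (v # us)) \<beta> vs
    + wedge (\<lambda>us. (-1) ^ length us * \<alpha> us) (\<lambda>us. \<beta> (v # us)) vs"
  unfolding wedge_def list.size(4) add_Suc_right add_0_right sum_Pow_lessThan_Suc nths_Cons_Suc_image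
  by (subst add.commute, intro arg_cong2[of _ _ _ _ "(+)"] sum.cong refl)
    (auto simp: shuffle_sign_Suc length_nths_subset)

lemma complexify_Nil: "complexify \<alpha> [] = \<alpha> []"
  by (simp add: complexify_def)

lemma complexify_Cons:
  "complexify \<alpha> (z # zs) =
    complexify (\<lambda>us. \<alpha> (fst z # us)) zs + \<i> * complexify (\<lambda>us. \<alpha> (snd z # us)) zs"
proof -
  have card: "card (insert 0 (Suc ` T)) = Suc (card T)" if "T \<subseteq> {..<length zs}" for T
    using finite_subset[OF that] by (simp add: card_image)
  have map: "map (\<lambda>j. if j \<in> S then snd ((z # zs) ! j) else fst ((z # zs) ! j)) [0..<Suc n] =
     (if 0 \<in> S then snd z else fst z) # map (\<lambda>j. if Suc j \<in> S then snd (zs ! j) else fst (zs ! j)) [0..<n]"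
    for S n by (simp only: map_upt_Suc) simp
  show ?thesis
    unfolding complexify_def list.size(4) add_Suc_right add_0_right sum_Pow_lessThan_Suc map
    by (simp add: card card_image sum_distrib_left image_iff mult.assoc)
qed

lemma complexify_linear:
  "complexify (\<lambda>us. a * \<alpha> us + b * \<beta> us) zs = a * complexify \<alpha> zs + b * complexify \<beta> zs"
  unfolding complexify_def by (simp add: sum.distrib sum_distrib_left algebra_simps)

text \<open>The index set of \<open>form_inner\<close>, isolated so that it can be unfolded along an
  explicit frame.\<close>

definition subset_sum :: "nat \<Rightarrow> ('v list \<Rightarrow> complex) \<Rightarrow> 'v list \<Rightarrow> complex"
  where "subset_sum k f vs = (\<Sum>I | I \<subseteq> {..<length vs} \<and> card I = k. f (nths vs I))"

lemma sum_card_Pow: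
  "(\<Sum>S | S \<subseteq> {..<n} \<and> card S = k. f S) = (\<Sum>S\<in>Pow {..<n}. if card S = k then f S else 0)"
  for f :: "nat set \<Rightarrow> complex"
  by (simp add: sum.If_cases Collect_conj_eq Pow_def Int_commute)

lemma subset_sum_0: "subset_sum 0 f vs = f []"
proof -
  have "{I. I \<subseteq> {..<length vs} \<and> card I = 0} = {{}}"
    using finite_subset[OF _ finite_lessThan] by auto
  then show ?thesis by (simp add: subset_sum_def)
qed

lemma subset_sum_Nil: "subset_sum (Suc k) f [] = 0"
  by (simp add: subset_sum_def)

lemma card_Suc_image:
  assumes "T \<subseteq> {..<n}"
  shows "card (Suc ` T) = card T" "card (insert 0 (Suc ` T)) = Suc (card T)"
  using finite_subset[OF assms] by (simp_all add: card_image)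

lemma subset_sum_Cons:
  "subset_sum (Suc k) f (v # vs) = subset_sum k (\<lambda>us. f (v # us)) vs + subset_sum (Suc k) f vs"
  unfolding subset_sum_def sum_card_Pow list.size(4) add_Suc_right add_0_right sum_Pow_lessThan_Suc
    nths_Cons_Suc_image
  by (subst add.commute) (auto simp: card_Suc_image intro!: arg_cong2[of _ _ _ _ "(+)"] sum.cong)

text \<open>The sum in \<open>pq_part\<close>, with \<open>p\<close> arguments of type \<open>(1, 0)\<close> and \<open>q\<close> of type \<open>(0, 1)\<close>.\<close>

definition type_part ::
  "(('a, 'e::real_vector) tvec \<Rightarrow> ('a, 'e) tvec) \<Rightarrow> nat \<Rightarrow> ('a, 'e) cform \<Rightarrow> ('a, 'e) tvec list \<Rightarrow> complex"
  where "type_part J p \<alpha> vs = (\<Sum>S | S \<subseteq> {..<length vs} \<and> card S = p. complexify \<alpha>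
    (map (\<lambda>j. (comb (1/2) (vs ! j) 0 0, comb (if j \<in> S then - 1/2 else 1/2) (J (vs ! j)) 0 0)) [0..<length vs]))"

lemma type_part_Nil: "type_part J 0 \<alpha> [] = \<alpha> []" "type_part J (Suc p) \<alpha> [] = 0"
proof -
  have "{S. S = ({}::nat set) \<and> card S = 0} = {{}}" by auto
  then show "type_part J 0 \<alpha> [] = \<alpha> []" by (simp add: type_part_def complexify_Nil)
qed (simp add: type_part_def)

lemma type_part_Cons:
  "type_part J p \<alpha> (v # vs) =
    (if p = 0 then 0 else type_part J (p - 1)
      (\<lambda>us. \<alpha> (comb (1/2) v 0 0 # us) + \<i> * \<alpha> (comb (-1/2) (J v) 0 0 # us)) vs) +
    type_part J p (\<lambda>us. \<alpha> (comb (1/2) v 0 0 # us) + \<i> * \<alpha> (comb (1/2) (J v) 0 0 # us)) vs"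
proof -
  have map: "map (\<lambda>j. (comb (1/2) ((v # vs) ! j) 0 0, comb (if j \<in> S then - 1/2 else 1/2) (J ((v # vs) ! j)) 0 0)) [0..<Suc n]
    = (comb (1/2) v 0 0, comb (if 0 \<in> S then - 1/2 else 1/2) (J v) 0 0) #
      map (\<lambda>j. (comb (1/2) (vs ! j) 0 0, comb (if Suc j \<in> S then - 1/2 else 1/2) (J (vs ! j)) 0 0)) [0..<n]"
    for S n by (simp only: map_upt_Suc) simp
  have lin: "complexify (\<lambda>us. \<alpha> us + \<i> * \<beta> us) zs = complexify \<alpha> zs + \<i> * complexify \<beta> zs" for \<alpha> \<beta> zs
    using complexify_linear[of 1 \<alpha> \<i> \<beta>] by simp
  show ?thesis
    unfolding type_part_def sum_card_Pow list.size(4) add_Suc_right add_0_right sum_Pow_lessThan_Suc map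
      complexify_Cons
    by (subst add.commute)
      (auto simp: card_Suc_image lin image_iff intro!: arg_cong2[of _ _ _ _ "(+)"] sum.cong)
qed

section \<open>Alternating forms on a real vector space\<close>

text \<open>The conditions of \<open>alternating\<close> over an arbitrary set V, so that the
  pointwise linear algebra can be done away from any manifold.\<close>

definition alt_forms :: "('a, 'e::real_vector) tvec set \<Rightarrow> nat \<Rightarrow> ('a, 'e) cform set"
  where "alt_forms V k = {\<alpha>.
    (\<forall>vs. \<not> (length vs = k \<and> set vs \<subseteq> V) \<longrightarrow> \<alpha> vs = 0) \<and>
    (\<forall>vs i a u b v. length vs = k \<and> set vs \<subseteq> V \<and> i < k \<and> u \<in> V \<and> v \<in> V \<longrightarrow>
       \<alpha> (vs[i := comb a u b v]) = of_real a * \<alpha> (vs[i := u]) + of_real b * \<alpha> (vs[i := v])) \<and>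
    (\<forall>vs i j. i < j \<and> j < length vs \<and> vs ! i = vs ! j \<longrightarrow> \<alpha> vs = 0)}"

lemma alt_formsD:
  assumes "\<alpha> \<in> alt_forms V k"
  shows "length vs \<noteq> k \<Longrightarrow> \<alpha> vs = 0"
    and "\<not> set vs \<subseteq> V \<Longrightarrow> \<alpha> vs = 0"
    and "length vs = k \<Longrightarrow> set vs \<subseteq> V \<Longrightarrow> i < k \<Longrightarrow> u \<in> V \<Longrightarrow> v \<in> V \<Longrightarrow>
      \<alpha> (vs[i := comb a u b v]) = of_real a * \<alpha> (vs[i := u]) + of_real b * \<alpha> (vs[i := v])"
    and "i < j \<Longrightarrow> j < length vs \<Longrightarrow> vs ! i = vs ! j \<Longrightarrow> \<alpha> vs = 0"
  using assms unfolding alt_forms_def by blast+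

lemma alt_forms_linear:
  "\<alpha> \<in> alt_forms V k \<Longrightarrow> \<beta> \<in> alt_forms V k \<Longrightarrow> (\<lambda>vs. a * \<alpha> vs + b * \<beta> vs) \<in> alt_forms V k"
  unfolding alt_forms_def by (auto simp: algebra_simps)

lemma alt_forms_zero: "(\<lambda>vs. 0) \<in> alt_forms V k"
  unfolding alt_forms_def by auto

lemma alt_forms_scale: "\<alpha> \<in> alt_forms V k \<Longrightarrow> (\<lambda>vs. a * \<alpha> vs) \<in> alt_forms V k"
  using alt_forms_linear[OF _ alt_forms_zero, of \<alpha> V k a 0] by simp

lemma alt_forms_cnj: "\<alpha> \<in> alt_forms V k \<Longrightarrow> (\<lambda>vs. cnj (\<alpha> vs)) \<in> alt_forms V k"
  unfolding alt_forms_def by (auto simp: algebra_simps)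

text \<open>Closure and linearity are assumed for \<open>comb\<close> only; negation and zero are
  recovered as special combinations.\<close>

lemma comb_simps: "comb 1 u 0 v = u" "comb 0 u 1 v = v" "comb (-1) u 0 v = - u" "comb 0 u 0 v = 0"
  by (auto simp: comb_def fun_eq_iff)

lemma alt_forms_0I: "(\<lambda>vs. if vs = [] then c else 0) \<in> alt_forms V 0"
  unfolding alt_forms_def by auto

lemma alt_forms_1I:
  assumes "\<And>vs. \<not> (length vs = 1 \<and> set vs \<subseteq> V) \<Longrightarrow> \<alpha> vs = 0"
    and "\<And>a b u v. u \<in> V \<Longrightarrow> v \<in> V \<Longrightarrow> \<alpha> [comb a u b v] = of_real a * \<alpha> [u] + of_real b * \<alpha> [v]"
  shows "\<alpha> \<in> alt_forms V 1"
proof -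
  have "\<alpha> (vs[i := comb a u b v]) = of_real a * \<alpha> (vs[i := u]) + of_real b * \<alpha> (vs[i := v])"
    if "length vs = 1" "i < 1" "u \<in> V" "v \<in> V" for vs i a u b v
    using that assms(2) by (auto simp: length_Suc_conv)
  moreover have "\<alpha> vs = 0" if "i < j" "j < length vs" for vs and i j :: nat
    using that by (intro assms(1)) auto
  ultimately show ?thesis unfolding alt_forms_def using assms(1) by blast
qed

text \<open>As in the analogous rules for degrees 3 and 4, linearity in the first slot and
  antisymmetry under adjacent transpositions suffice: any slot can be moved to the front, and equal
  entries can be made adjacent, where antisymmetry yields twice the value zero.\<close>

lemma alt_forms_2I:
  assumes "\<And>vs. \<not> (length vs = 2 \<and> set vs \<subseteq> V) \<Longrightarrow> \<alpha> vs = 0"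
    and lin: "\<And>a b u v w. u \<in> V \<Longrightarrow> v \<in> V \<Longrightarrow> w \<in> V \<Longrightarrow> comb a u b v \<in> V \<Longrightarrow>
      \<alpha> [comb a u b v, w] = of_real a * \<alpha> [u, w] + of_real b * \<alpha> [v, w]"
    and sw: "\<And>u v. u \<in> V \<Longrightarrow> v \<in> V \<Longrightarrow> \<alpha> [u, v] = - \<alpha> [v, u]"
    and V: "\<And>a b u v. u \<in> V \<Longrightarrow> v \<in> V \<Longrightarrow> comb a u b v \<in> V"
  shows "\<alpha> \<in> alt_forms V 2"
proof -
  have 1: "\<alpha> (vs[i := comb a u b v]) = of_real a * \<alpha> (vs[i := u]) + of_real b * \<alpha> (vs[i := v])"
    if vs: "length vs = 2" "set vs \<subseteq> V" and "i < 2" and uv: "u \<in> V" "v \<in> V" for vs i a u b v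
  proof -
    obtain x y where xy: "vs = [x, y]" "x \<in> V" "y \<in> V"
      using vs by (auto simp: numeral_eq_Suc length_Suc_conv)
    have "\<alpha> [x, comb a u b v] = - \<alpha> [comb a u b v, x]" "\<alpha> [x, u] = - \<alpha> [u, x]" "\<alpha> [x, v] = - \<alpha> [v, x]"
      using sw xy uv V by blast+
    then show ?thesis using \<open>i < 2\<close> xy uv V lin by (auto simp: less_2_cases_iff)
  qed
  have "\<alpha> vs = 0" if "i < j" "j < length vs" "vs ! i = vs ! j" for vs i j
  proof (cases "length vs = 2 \<and> set vs \<subseteq> V")
    case True
    then obtain x y where xy: "vs = [x, y]" "x \<in> V" "y \<in> V"
      by (auto simp: numeral_eq_Suc length_Suc_conv)
    then have "x = y" using that by (auto simp: less_Suc_eq numeral_eq_Suc)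
    then show ?thesis using sw[of x x] xy by simp
  qed (use assms(1) in auto)
  then show ?thesis unfolding alt_forms_def using assms(1) 1 by blast
qed

lemma alt_forms_3I:
  assumes "\<And>vs. \<not> (length vs = 3 \<and> set vs \<subseteq> V) \<Longrightarrow> \<alpha> vs = 0"
    and lin: "\<And>a b u v w x. u \<in> V \<Longrightarrow> v \<in> V \<Longrightarrow> w \<in> V \<Longrightarrow> x \<in> V \<Longrightarrow> comb a u b v \<in> V \<Longrightarrow>
      \<alpha> [comb a u b v, w, x] = of_real a * \<alpha> [u, w, x] + of_real b * \<alpha> [v, w, x]"
    and sw1: "\<And>u v w. u \<in> V \<Longrightarrow> v \<in> V \<Longrightarrow> w \<in> V \<Longrightarrow> \<alpha> [u, v, w] = - \<alpha> [v, u, w]"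
    and sw2: "\<And>u v w. u \<in> V \<Longrightarrow> v \<in> V \<Longrightarrow> w \<in> V \<Longrightarrow> \<alpha> [u, v, w] = - \<alpha> [u, w, v]"
    and V: "\<And>a b u v. u \<in> V \<Longrightarrow> v \<in> V \<Longrightarrow> comb a u b v \<in> V"
  shows "\<alpha> \<in> alt_forms V 3"
proof -
  \<comment> \<open>Two adjacent transpositions bring the last entry to the front, so linearity in
    the first slot transfers to the others.\<close>
  have r: "\<alpha> [x, y, z] = \<alpha> [z, x, y]" if "x \<in> V" "y \<in> V" "z \<in> V" for x y z
    using that sw2[of x y z] sw1[of x z y] by simp
  have 1: "\<alpha> (vs[i := comb a u b v]) = of_real a * \<alpha> (vs[i := u]) + of_real b * \<alpha> (vs[i := v])"
    if vs: "length vs = 3" "set vs \<subseteq> V" and "i < 3" and uv: "u \<in> V" "v \<in> V" for vs i a u b v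
  proof -
    obtain x y z where xy: "vs = [x, y, z]" "x \<in> V" "y \<in> V" "z \<in> V"
      using vs by (auto simp: numeral_eq_Suc length_Suc_conv)
    have "\<alpha> [x, w, z] = \<alpha> [w, z, x]" "\<alpha> [x, y, w] = \<alpha> [w, x, y]" if "w \<in> V" for w
      using r xy that by metis+
    then show ?thesis using \<open>i < 3\<close> xy uv V lin by (auto simp: numeral_3_eq_3 less_Suc_eq)
  qed
  have "\<alpha> vs = 0" if "i < j" "j < length vs" "vs ! i = vs ! j" for vs i j
  proof (cases "length vs = 3 \<and> set vs \<subseteq> V")
    case True
    then obtain x y z where xy: "vs = [x, y, z]" "x \<in> V" "y \<in> V" "z \<in> V"
      by (auto simp: numeral_eq_Suc length_Suc_conv)
    then have "x = y \<or> x = z \<or> y = z" using that by (auto simp: less_Suc_eq numeral_eq_Suc)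
    moreover have "\<alpha> [x, y, z] = \<alpha> [z, x, y]" using r xy by blast
    ultimately show ?thesis using sw1[of x y z] sw1[of z x y] sw2[of x y z] xy by auto
  qed (use assms(1) in auto)
  then show ?thesis unfolding alt_forms_def using assms(1) 1 by blast
qed

lemma alt_forms_4I:
  assumes "\<And>vs. \<not> (length vs = 4 \<and> set vs \<subseteq> V) \<Longrightarrow> \<alpha> vs = 0"
    and lin: "\<And>a b u v w x y. u \<in> V \<Longrightarrow> v \<in> V \<Longrightarrow> w \<in> V \<Longrightarrow> x \<in> V \<Longrightarrow> y \<in> V \<Longrightarrow> comb a u b v \<in> V \<Longrightarrow>
      \<alpha> [comb a u b v, w, x, y] = of_real a * \<alpha> [u, w, x, y] + of_real b * \<alpha> [v, w, x, y]"
    and sw1: "\<And>u v w x. u \<in> V \<Longrightarrow> v \<in> V \<Longrightarrow> w \<in> V \<Longrightarrow> x \<in> V \<Longrightarrow> \<alpha> [u, v, w, x] = - \<alpha> [v, u, w, x]"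
    and sw2: "\<And>u v w x. u \<in> V \<Longrightarrow> v \<in> V \<Longrightarrow> w \<in> V \<Longrightarrow> x \<in> V \<Longrightarrow> \<alpha> [u, v, w, x] = - \<alpha> [u, w, v, x]"
    and sw3: "\<And>u v w x. u \<in> V \<Longrightarrow> v \<in> V \<Longrightarrow> w \<in> V \<Longrightarrow> x \<in> V \<Longrightarrow> \<alpha> [u, v, w, x] = - \<alpha> [u, v, x, w]"
    and V: "\<And>a b u v. u \<in> V \<Longrightarrow> v \<in> V \<Longrightarrow> comb a u b v \<in> V"
  shows "\<alpha> \<in> alt_forms V 4"
proof -
  \<comment> \<open>A cycle of length four is odd, hence the sign, in contrast to degree 3.\<close>
  have r: "\<alpha> [x, y, z, w] = - \<alpha> [w, x, y, z]" if "x \<in> V" "y \<in> V" "z \<in> V" "w \<in> V" for x y z w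
    using that sw3[of x y z w] sw2[of x y w z] sw1[of x w y z] by simp
  have 1: "\<alpha> (vs[i := comb a u b v]) = of_real a * \<alpha> (vs[i := u]) + of_real b * \<alpha> (vs[i := v])"
    if vs: "length vs = 4" "set vs \<subseteq> V" and "i < 4" and uv: "u \<in> V" "v \<in> V" for vs i a u b v
  proof -
    obtain x y z t where xy: "vs = [x, y, z, t]" "x \<in> V" "y \<in> V" "z \<in> V" "t \<in> V"
      using vs by (auto simp: numeral_eq_Suc length_Suc_conv)
    have "\<alpha> [x, w, z, t] = - \<alpha> [w, x, z, t]" "\<alpha> [x, y, w, t] = \<alpha> [w, x, y, t]" "\<alpha> [x, y, z, w] = - \<alpha> [w, x, y, z]"
      if "w \<in> V" for w
      using r[of x y z w] sw1[of x w z t] sw2[of x y w t] sw1[of x w y t] xy that by auto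
    moreover have "comb a u b v \<in> V" using V uv by blast
    ultimately show ?thesis using \<open>i < 4\<close> xy uv lin by (auto simp: numeral_eq_Suc less_Suc_eq)
  qed
  have "\<alpha> vs = 0" if "i < j" "j < length vs" "vs ! i = vs ! j" for vs i j
  proof (cases "length vs = 4 \<and> set vs \<subseteq> V")
    case True
    then obtain x y z t where xy: "vs = [x, y, z, t]" "x \<in> V" "y \<in> V" "z \<in> V" "t \<in> V"
      by (auto simp: numeral_eq_Suc length_Suc_conv)
    then have "x = y \<or> x = z \<or> x = t \<or> y = z \<or> y = t \<or> z = t"
      using that by (auto simp: less_Suc_eq numeral_eq_Suc)
    then show ?thesis
      using sw1[of x y z t] sw2[of x y z t] sw3[of x y z t] sw1[of x z y t] sw3[of x t y z] sw1[of x t y z]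
        sw2[of x y t z] sw2[of x z y t] sw3[of x z y t] xy by auto
  qed (use assms(1) in auto)
  then show ?thesis unfolding alt_forms_def using assms(1) 1 by blast
qed

section \<open>Wedge products in low degrees\<close>

lemma wedge_zero_left: "wedge (\<lambda>us. 0) \<beta> vs = 0" "wedge \<alpha> (\<lambda>us. 0) vs = 0"
  by (simp_all add: wedge_def)

lemma wedge_degree_0_left: "(\<And>us. us \<noteq> [] \<Longrightarrow> \<alpha> us = 0) \<Longrightarrow> wedge \<alpha> \<beta> vs = \<alpha> [] * \<beta> vs"
proof (induction vs arbitrary: \<beta>)
  case Nil
  then show ?case by (simp add: wedge_Nil)
next
  case (Cons v vs)
  have "(\<lambda>us. \<alpha> (v # us)) = (\<lambda>us. 0)" "(\<lambda>us. (-1) ^ length us * \<alpha> us) = \<alpha>"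
    using Cons.prems by (auto simp: fun_eq_iff) (metis length_0_conv mult_1 mult_zero_right power_0)
  then show ?case using Cons by (simp add: wedge_Cons wedge_zero_left)
qed

lemma wedge_degree_0_right: "(\<And>us. us \<noteq> [] \<Longrightarrow> \<beta> us = 0) \<Longrightarrow> wedge \<alpha> \<beta> vs = \<alpha> vs * \<beta> []"
proof (induction vs arbitrary: \<alpha>)
  case Nil
  then show ?case by (simp add: wedge_Nil)
next
  case (Cons v vs)
  have "(\<lambda>us. \<beta> (v # us)) = (\<lambda>us. 0)" using Cons.prems by auto
  then show ?case using Cons by (simp add: wedge_Cons wedge_zero_left)
qed

text \<open>Each subset S distributes the arguments over two complementary lists whose lengths add
  up and whose entries cover all arguments. If the total is wrong, one of the two lists is bad for
  its factor.\<close>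

lemma wedge_outside:
  assumes "\<alpha> \<in> alt_forms V k" "\<beta> \<in> alt_forms V l" "\<not> (length vs = k + l \<and> set vs \<subseteq> V)"
  shows "wedge \<alpha> \<beta> vs = 0"
  unfolding wedge_def
proof (intro sum.neutral ballI)
  fix S assume S: "S \<in> Pow {..<length vs}"
  have "{i. i < length vs \<and> i \<in> - S} = {..<length vs} - S" by auto
  then have "length (nths vs (- S)) = length vs - card S"
    using S by (simp add: length_nths card_Diff_subset finite_subset[of S "{..<length vs}"])
  moreover have "card S \<le> length vs" using S card_mono[of "{..<length vs}" S] by simp
  ultimately have len: "length (nths vs S) + length (nths vs (- S)) = length vs"
    using S by (simp add: length_nths_subset)
  have "set vs = set (nths vs S) \<union> set (nths vs (- S))"
    unfolding set_nths set_eq_iff in_set_conv_nth by blast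
  then have "\<not> (length (nths vs S) = k \<and> set (nths vs S) \<subseteq> V) \<or>
      \<not> (length (nths vs (- S)) = l \<and> set (nths vs (- S)) \<subseteq> V)"
    using assms(3) len by auto
  then show "shuffle_sign (length vs) S * \<alpha> (nths vs S) * \<beta> (nths vs (- S)) = 0"
    using alt_formsD(1,2)[OF assms(1)] alt_formsD(1,2)[OF assms(2)] by fastforce
qed

lemma wedge_1_2:
  assumes "\<alpha> \<in> alt_forms V 1" "\<beta> \<in> alt_forms V 2"
  shows "wedge \<alpha> \<beta> [a, b, c] = \<alpha> [a] * \<beta> [b, c] - \<alpha> [b] * \<beta> [a, c] + \<alpha> [c] * \<beta> [a, b]"
  by (simp add: wedge_Cons wedge_Nil alt_formsD(1)[OF assms(1)] alt_formsD(1)[OF assms(2)])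

lemma wedge_1_3:
  assumes "\<alpha> \<in> alt_forms V 1" "\<beta> \<in> alt_forms V 3"
  shows "wedge \<alpha> \<beta> [a, b, c, d] =
    \<alpha> [a] * \<beta> [b, c, d] - \<alpha> [b] * \<beta> [a, c, d] + \<alpha> [c] * \<beta> [a, b, d] - \<alpha> [d] * \<beta> [a, b, c]"
  by (simp add: wedge_Cons wedge_Nil alt_formsD(1)[OF assms(1)] alt_formsD(1)[OF assms(2)])

lemma wedge_3_1:
  assumes "\<alpha> \<in> alt_forms V 3" "\<beta> \<in> alt_forms V 1"
  shows "wedge \<alpha> \<beta> [a, b, c, d] =
    \<alpha> [a, b, c] * \<beta> [d] - \<alpha> [a, b, d] * \<beta> [c] + \<alpha> [a, c, d] * \<beta> [b] - \<alpha> [b, c, d] * \<beta> [a]"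
  by (simp add: wedge_Cons wedge_Nil alt_formsD(1)[OF assms(1)] alt_formsD(1)[OF assms(2)])

lemma wedge_2_2:
  assumes "\<alpha> \<in> alt_forms V 2" "\<beta> \<in> alt_forms V 2"
  shows "wedge \<alpha> \<beta> [a, b, c, d] =
    \<alpha> [a, b] * \<beta> [c, d] - \<alpha> [a, c] * \<beta> [b, d] + \<alpha> [a, d] * \<beta> [b, c]
    + \<alpha> [b, c] * \<beta> [a, d] - \<alpha> [b, d] * \<beta> [a, c] + \<alpha> [c, d] * \<beta> [a, b]"
  by (simp add: wedge_Cons wedge_Nil alt_formsD(1)[OF assms(1)] alt_formsD(1)[OF assms(2)])

lemma length_eq_lists:
  "length vs = 0 \<longleftrightarrow> vs = []"
  "length vs = 1 \<longleftrightarrow> (\<exists>a. vs = [a])"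
  "length vs = 2 \<longleftrightarrow> (\<exists>a b. vs = [a, b])"
  "length vs = 3 \<longleftrightarrow> (\<exists>a b c. vs = [a, b, c])"
  "length vs = 4 \<longleftrightarrow> (\<exists>a b c d. vs = [a, b, c, d])"
  by (auto simp: numeral_eq_Suc length_Suc_conv)

section \<open>Alternating forms on a space of tangent vectors\<close>

locale tvec_space =
  fixes V :: "('a, 'e::real_vector) tvec set"
  assumes comb_V [simp]: "u \<in> V \<Longrightarrow> v \<in> V \<Longrightarrow> comb a u b v \<in> V"
    and nonempty: "V \<noteq> {}"
begin

abbreviation "alt \<equiv> alt_forms V"

lemma neg_V [simp]: "u \<in> V \<Longrightarrow> - u \<in> V"
  using comb_V[of u u "-1" 0] by (simp add: comb_simps)

lemma zero_V [simp]: "0 \<in> V"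
  using nonempty comb_V[of _ _ 0 0] by (metis comb_simps(4) ex_in_conv)

text \<open>Polarisation: the form vanishes when both slots hold the sum of the two entries, and
  expanding that value leaves the two swapped values, which therefore add up to zero.\<close>

lemma alt_swap:
  assumes \<alpha>: "\<alpha> \<in> alt k" and vs: "length vs = k" "set vs \<subseteq> V" "i < j" "j < k"
  shows "\<alpha> (vs[i := vs ! j, j := vs ! i]) = - \<alpha> vs"
proof -
  let ?a = "vs ! i" and ?b = "vs ! j"
  define s where "s = comb 1 ?a 1 ?b"
  have V: "?a \<in> V" "?b \<in> V" using vs by (auto simp: nth_mem subset_iff)
  then have s: "s \<in> V" by (simp add: s_def)
  have set: "set (vs[l := x]) \<subseteq> V" if "x \<in> V" for l x
    using vs(2) that by (metis insert_subset order_trans set_update_subset_insert)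
  have z: "\<alpha> (vs[i := x, j := x]) = 0" for x
    using alt_formsD(4)[OF \<alpha>, of i j "vs[i := x, j := x]"] vs by simp
  have lin: "\<alpha> (vs[i := x, j := s]) = \<alpha> (vs[i := x, j := ?a]) + \<alpha> (vs[i := x, j := ?b])" if "x \<in> V" for x
    using alt_formsD(3)[OF \<alpha>, of "vs[i := x]" j ?a ?b 1 1] vs V set[OF that] by (simp add: s_def)
  have "\<alpha> (vs[i := s, j := x]) = \<alpha> (vs[i := ?a, j := x]) + \<alpha> (vs[i := ?b, j := x])" if "x \<in> V" for x
    using alt_formsD(3)[OF \<alpha>, of "vs[j := x]" i ?a ?b 1 1] vs V set[OF that]
    unfolding s_def list_update_swap[OF less_imp_neq[OF vs(3)]] by simp
  from this[OF s] have "0 = \<alpha> (vs[i := ?a, j := s]) + \<alpha> (vs[i := ?b, j := s])" using z by simp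
  then have "0 = \<alpha> (vs[i := ?a, j := ?b]) + \<alpha> (vs[i := ?b, j := ?a])"
    unfolding lin[OF V(1)] lin[OF V(2)] z by simp
  then show ?thesis by (simp add: add_eq_0_iff2)
qed

lemma alt_1:
  assumes "\<alpha> \<in> alt 1"
  shows "u \<in> V \<Longrightarrow> v \<in> V \<Longrightarrow> \<alpha> [comb a u b v] = of_real a * \<alpha> [u] + of_real b * \<alpha> [v]"
    and "u \<in> V \<Longrightarrow> \<alpha> [- u] = - \<alpha> [u]"
proof -
  show c: "\<alpha> [comb a u b v] = of_real a * \<alpha> [u] + of_real b * \<alpha> [v]" if "u \<in> V" "v \<in> V" for u v a b
    using alt_formsD(3)[OF assms, of "[u]" 0 u v a b] that by simp
  show "\<alpha> [- u] = - \<alpha> [u]" if "u \<in> V"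
    using c[of u u "-1" 0] that by (simp add: comb_simps)
qed

lemma alt_2:
  assumes "\<alpha> \<in> alt 2"
  shows "u \<in> V \<Longrightarrow> v \<in> V \<Longrightarrow> w \<in> V \<Longrightarrow> \<alpha> [comb a u b v, w] = of_real a * \<alpha> [u, w] + of_real b * \<alpha> [v, w]"
    and "u \<in> V \<Longrightarrow> v \<in> V \<Longrightarrow> w \<in> V \<Longrightarrow> \<alpha> [w, comb a u b v] = of_real a * \<alpha> [w, u] + of_real b * \<alpha> [w, v]"
    and "u \<in> V \<Longrightarrow> w \<in> V \<Longrightarrow> \<alpha> [- u, w] = - \<alpha> [u, w]"
    and "u \<in> V \<Longrightarrow> w \<in> V \<Longrightarrow> \<alpha> [w, - u] = - \<alpha> [w, u]"
    and "\<alpha> [u, u] = 0"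
proof -
  show 1: "\<alpha> [comb a u b v, w] = of_real a * \<alpha> [u, w] + of_real b * \<alpha> [v, w]"
    if "u \<in> V" "v \<in> V" "w \<in> V" for u v w a b
    using alt_formsD(3)[OF assms, of "[u, w]" 0 u v a b] that by simp
  show 2: "\<alpha> [w, comb a u b v] = of_real a * \<alpha> [w, u] + of_real b * \<alpha> [w, v]"
    if "u \<in> V" "v \<in> V" "w \<in> V" for u v w a b
    using alt_formsD(3)[OF assms, of "[w, u]" 1 u v a b] that by simp
  show "\<alpha> [- u, w] = - \<alpha> [u, w]" "\<alpha> [w, - u] = - \<alpha> [w, u]" if "u \<in> V" "w \<in> V"
    using 1[of u u w "-1" 0] 2[of u u w "-1" 0] that by (simp_all add: comb_simps)
  show "\<alpha> [u, u] = 0" using alt_formsD(4)[OF assms, of 0 1 "[u, u]"] by simp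
qed

lemma alt_2_swap: "\<alpha> \<in> alt 2 \<Longrightarrow> u \<in> V \<Longrightarrow> v \<in> V \<Longrightarrow> \<alpha> [v, u] = - \<alpha> [u, v]"
  using alt_swap[of \<alpha> 2 "[u, v]" 0 1] by simp

lemma alt_3:
  assumes "\<alpha> \<in> alt 3"
  shows "u \<in> V \<Longrightarrow> v \<in> V \<Longrightarrow> w \<in> V \<Longrightarrow> x \<in> V \<Longrightarrow>
      \<alpha> [comb a u b v, w, x] = of_real a * \<alpha> [u, w, x] + of_real b * \<alpha> [v, w, x]"
    and "u \<in> V \<Longrightarrow> v \<in> V \<Longrightarrow> w \<in> V \<Longrightarrow> x \<in> V \<Longrightarrow>
      \<alpha> [w, comb a u b v, x] = of_real a * \<alpha> [w, u, x] + of_real b * \<alpha> [w, v, x]"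
    and "u \<in> V \<Longrightarrow> v \<in> V \<Longrightarrow> w \<in> V \<Longrightarrow> x \<in> V \<Longrightarrow>
      \<alpha> [w, x, comb a u b v] = of_real a * \<alpha> [w, x, u] + of_real b * \<alpha> [w, x, v]"
    and "u \<in> V \<Longrightarrow> w \<in> V \<Longrightarrow> x \<in> V \<Longrightarrow> \<alpha> [- u, w, x] = - \<alpha> [u, w, x]"
    and "u \<in> V \<Longrightarrow> w \<in> V \<Longrightarrow> x \<in> V \<Longrightarrow> \<alpha> [w, - u, x] = - \<alpha> [w, u, x]"
    and "u \<in> V \<Longrightarrow> w \<in> V \<Longrightarrow> x \<in> V \<Longrightarrow> \<alpha> [w, x, - u] = - \<alpha> [w, x, u]"
    and "\<alpha> [u, u, w] = 0" "\<alpha> [u, w, u] = 0" "\<alpha> [w, u, u] = 0"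
proof -
  show 1: "\<alpha> [comb a u b v, w, x] = of_real a * \<alpha> [u, w, x] + of_real b * \<alpha> [v, w, x]"
    if "u \<in> V" "v \<in> V" "w \<in> V" "x \<in> V" for u v w x a b
    using alt_formsD(3)[OF assms, of "[u, w, x]" 0 u v a b] that by simp
  show 2: "\<alpha> [w, comb a u b v, x] = of_real a * \<alpha> [w, u, x] + of_real b * \<alpha> [w, v, x]"
    if "u \<in> V" "v \<in> V" "w \<in> V" "x \<in> V" for u v w x a b
    using alt_formsD(3)[OF assms, of "[w, u, x]" 1 u v a b] that by simp
  show 3: "\<alpha> [w, x, comb a u b v] = of_real a * \<alpha> [w, x, u] + of_real b * \<alpha> [w, x, v]"
    if "u \<in> V" "v \<in> V" "w \<in> V" "x \<in> V" for u v w x a b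
    using alt_formsD(3)[OF assms, of "[w, x, u]" 2 u v a b] that by (simp add: numeral_2_eq_2)
  show "\<alpha> [- u, w, x] = - \<alpha> [u, w, x]" "\<alpha> [w, - u, x] = - \<alpha> [w, u, x]" "\<alpha> [w, x, - u] = - \<alpha> [w, x, u]"
    if "u \<in> V" "w \<in> V" "x \<in> V"
    using 1[of u u w x "-1" 0] 2[of u u w x "-1" 0] 3[of u u w x "-1" 0] that by (simp_all add: comb_simps)
  show "\<alpha> [u, u, w] = 0" "\<alpha> [u, w, u] = 0" "\<alpha> [w, u, u] = 0"
    using alt_formsD(4)[OF assms, of 0 1 "[u, u, w]"] alt_formsD(4)[OF assms, of 0 2 "[u, w, u]"]
      alt_formsD(4)[OF assms, of 1 2 "[w, u, u]"] by simp_all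
qed

lemma alt_3_swap:
  assumes "\<alpha> \<in> alt 3" "u \<in> V" "v \<in> V" "w \<in> V"
  shows "\<alpha> [v, u, w] = - \<alpha> [u, v, w]" "\<alpha> [w, v, u] = - \<alpha> [w, u, v]"
  using alt_swap[of \<alpha> 3 "[u, v, w]" 0 1] alt_swap[of \<alpha> 3 "[w, u, v]" 1 2] assms
  by (simp_all add: numeral_2_eq_2)

lemma alt_4:
  assumes "\<alpha> \<in> alt 4"
  shows "u \<in> V \<Longrightarrow> v \<in> V \<Longrightarrow> w \<in> V \<Longrightarrow> x \<in> V \<Longrightarrow> y \<in> V \<Longrightarrow>
      \<alpha> [comb a u b v, w, x, y] = of_real a * \<alpha> [u, w, x, y] + of_real b * \<alpha> [v, w, x, y]"
    and "u \<in> V \<Longrightarrow> v \<in> V \<Longrightarrow> w \<in> V \<Longrightarrow> x \<in> V \<Longrightarrow> y \<in> V \<Longrightarrow>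
      \<alpha> [w, comb a u b v, x, y] = of_real a * \<alpha> [w, u, x, y] + of_real b * \<alpha> [w, v, x, y]"
    and "u \<in> V \<Longrightarrow> v \<in> V \<Longrightarrow> w \<in> V \<Longrightarrow> x \<in> V \<Longrightarrow> y \<in> V \<Longrightarrow>
      \<alpha> [w, x, comb a u b v, y] = of_real a * \<alpha> [w, x, u, y] + of_real b * \<alpha> [w, x, v, y]"
    and "u \<in> V \<Longrightarrow> v \<in> V \<Longrightarrow> w \<in> V \<Longrightarrow> x \<in> V \<Longrightarrow> y \<in> V \<Longrightarrow>
      \<alpha> [w, x, y, comb a u b v] = of_real a * \<alpha> [w, x, y, u] + of_real b * \<alpha> [w, x, y, v]"
    and "u \<in> V \<Longrightarrow> w \<in> V \<Longrightarrow> x \<in> V \<Longrightarrow> y \<in> V \<Longrightarrow> \<alpha> [- u, w, x, y] = - \<alpha> [u, w, x, y]"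
    and "u \<in> V \<Longrightarrow> w \<in> V \<Longrightarrow> x \<in> V \<Longrightarrow> y \<in> V \<Longrightarrow> \<alpha> [w, - u, x, y] = - \<alpha> [w, u, x, y]"
    and "u \<in> V \<Longrightarrow> w \<in> V \<Longrightarrow> x \<in> V \<Longrightarrow> y \<in> V \<Longrightarrow> \<alpha> [w, x, - u, y] = - \<alpha> [w, x, u, y]"
    and "u \<in> V \<Longrightarrow> w \<in> V \<Longrightarrow> x \<in> V \<Longrightarrow> y \<in> V \<Longrightarrow> \<alpha> [w, x, y, - u] = - \<alpha> [w, x, y, u]"
    and "\<alpha> [u, u, w, x] = 0" "\<alpha> [u, w, u, x] = 0" "\<alpha> [u, w, x, u] = 0"
      "\<alpha> [w, u, u, x] = 0" "\<alpha> [w, u, x, u] = 0" "\<alpha> [w, x, u, u] = 0"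
proof -
  show 1: "\<alpha> [comb a u b v, w, x, y] = of_real a * \<alpha> [u, w, x, y] + of_real b * \<alpha> [v, w, x, y]"
    if "u \<in> V" "v \<in> V" "w \<in> V" "x \<in> V" "y \<in> V" for u v w x y a b
    using alt_formsD(3)[OF assms, of "[u, w, x, y]" 0 u v a b] that by simp
  show 2: "\<alpha> [w, comb a u b v, x, y] = of_real a * \<alpha> [w, u, x, y] + of_real b * \<alpha> [w, v, x, y]"
    if "u \<in> V" "v \<in> V" "w \<in> V" "x \<in> V" "y \<in> V" for u v w x y a b
    using alt_formsD(3)[OF assms, of "[w, u, x, y]" 1 u v a b] that by simp
  show 3: "\<alpha> [w, x, comb a u b v, y] = of_real a * \<alpha> [w, x, u, y] + of_real b * \<alpha> [w, x, v, y]"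
    if "u \<in> V" "v \<in> V" "w \<in> V" "x \<in> V" "y \<in> V" for u v w x y a b
    using alt_formsD(3)[OF assms, of "[w, x, u, y]" 2 u v a b] that by (simp add: numeral_2_eq_2)
  show 4: "\<alpha> [w, x, y, comb a u b v] = of_real a * \<alpha> [w, x, y, u] + of_real b * \<alpha> [w, x, y, v]"
    if "u \<in> V" "v \<in> V" "w \<in> V" "x \<in> V" "y \<in> V" for u v w x y a b
    using alt_formsD(3)[OF assms, of "[w, x, y, u]" 3 u v a b] that by (simp add: numeral_3_eq_3)
  show "\<alpha> [- u, w, x, y] = - \<alpha> [u, w, x, y]" "\<alpha> [w, - u, x, y] = - \<alpha> [w, u, x, y]"
    "\<alpha> [w, x, - u, y] = - \<alpha> [w, x, u, y]" "\<alpha> [w, x, y, - u] = - \<alpha> [w, x, y, u]"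
    if "u \<in> V" "w \<in> V" "x \<in> V" "y \<in> V"
    using 1[of u u w x y "-1" 0] 2[of u u w x y "-1" 0] 3[of u u w x y "-1" 0] 4[of u u w x y "-1" 0] that
    by (simp_all add: comb_simps)
  show "\<alpha> [u, u, w, x] = 0" "\<alpha> [u, w, u, x] = 0" "\<alpha> [u, w, x, u] = 0"
      "\<alpha> [w, u, u, x] = 0" "\<alpha> [w, u, x, u] = 0" "\<alpha> [w, x, u, u] = 0"
    using alt_formsD(4)[OF assms, of 0 1 "[u, u, w, x]"] alt_formsD(4)[OF assms, of 0 2 "[u, w, u, x]"]
      alt_formsD(4)[OF assms, of 0 3 "[u, w, x, u]"] alt_formsD(4)[OF assms, of 1 2 "[w, u, u, x]"]
      alt_formsD(4)[OF assms, of 1 3 "[w, u, x, u]"] alt_formsD(4)[OF assms, of 2 3 "[w, x, u, u]"]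
    by simp_all
qed

lemma alt_4_swap:
  assumes "\<alpha> \<in> alt 4" "u \<in> V" "v \<in> V" "w \<in> V" "x \<in> V"
  shows "\<alpha> [v, u, w, x] = - \<alpha> [u, v, w, x]" "\<alpha> [w, v, u, x] = - \<alpha> [w, u, v, x]"
    "\<alpha> [w, x, v, u] = - \<alpha> [w, x, u, v]"
  using alt_swap[of \<alpha> 4 "[u, v, w, x]" 0 1] alt_swap[of \<alpha> 4 "[w, u, v, x]" 1 2]
    alt_swap[of \<alpha> 4 "[w, x, u, v]" 2 3] assms
  by (simp_all add: numeral_2_eq_2 numeral_3_eq_3)

lemma wedge_1_2_alt: "\<alpha> \<in> alt 1 \<Longrightarrow> \<beta> \<in> alt 2 \<Longrightarrow> wedge \<alpha> \<beta> \<in> alt 3"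
proof (rule alt_forms_3I)
  assume a: "\<alpha> \<in> alt 1" "\<beta> \<in> alt 2"
  show "wedge \<alpha> \<beta> vs = 0" if "\<not> (length vs = 3 \<and> set vs \<subseteq> V)" for vs
    using that by (intro wedge_outside[OF a]) simp
  note simps = wedge_1_2[OF a] alt_1[OF a(1)] alt_2[OF a(2)]
  show "wedge \<alpha> \<beta> [comb p u q v, w, x] = of_real p * wedge \<alpha> \<beta> [u, w, x] + of_real q * wedge \<alpha> \<beta> [v, w, x]"
    if "u \<in> V" "v \<in> V" "w \<in> V" "x \<in> V" for p u q v w x
    using that by (simp add: simps algebra_simps)
  show "wedge \<alpha> \<beta> [u, v, w] = - wedge \<alpha> \<beta> [v, u, w]" "wedge \<alpha> \<beta> [u, v, w] = - wedge \<alpha> \<beta> [u, w, v]"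
    if "u \<in> V" "v \<in> V" "w \<in> V" for u v w
    using that by (simp_all add: simps alt_2_swap[OF a(2) that(1,2)] alt_2_swap[OF a(2) that(2,3)])
qed auto

lemma wedge_1_3_alt: "\<alpha> \<in> alt 1 \<Longrightarrow> \<beta> \<in> alt 3 \<Longrightarrow> wedge \<alpha> \<beta> \<in> alt 4"
proof (rule alt_forms_4I)
  assume a: "\<alpha> \<in> alt 1" "\<beta> \<in> alt 3"
  show "wedge \<alpha> \<beta> vs = 0" if "\<not> (length vs = 4 \<and> set vs \<subseteq> V)" for vs
    using that by (intro wedge_outside[OF a]) simp
  note simps = wedge_1_3[OF a] alt_1[OF a(1)] alt_3[OF a(2)]
  show "wedge \<alpha> \<beta> [comb p u q v, w, x, y] = of_real p * wedge \<alpha> \<beta> [u, w, x, y] + of_real q * wedge \<alpha> \<beta> [v, w, x, y]"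
    if "u \<in> V" "v \<in> V" "w \<in> V" "x \<in> V" "y \<in> V" for p u q v w x y
    using that by (simp add: simps algebra_simps)
  fix u v w x assume V: "u \<in> V" "v \<in> V" "w \<in> V" "x \<in> V"
  show "wedge \<alpha> \<beta> [u, v, w, x] = - wedge \<alpha> \<beta> [v, u, w, x]"
    using V by (simp add: simps alt_3_swap(1)[OF a(2) V(1,2)])
  show "wedge \<alpha> \<beta> [u, v, w, x] = - wedge \<alpha> \<beta> [u, w, v, x]"
    using V by (simp add: simps alt_3_swap[OF a(2) V(2,3)])
  show "wedge \<alpha> \<beta> [u, v, w, x] = - wedge \<alpha> \<beta> [u, v, x, w]"
    using V by (simp add: simps alt_3_swap(2)[OF a(2) V(3,4)])
qed auto

lemma wedge_2_2_alt: "\<alpha> \<in> alt 2 \<Longrightarrow> \<beta> \<in> alt 2 \<Longrightarrow> wedge \<alpha> \<beta> \<in> alt 4"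
proof (rule alt_forms_4I)
  assume a: "\<alpha> \<in> alt 2" "\<beta> \<in> alt 2"
  show "wedge \<alpha> \<beta> vs = 0" if "\<not> (length vs = 4 \<and> set vs \<subseteq> V)" for vs
    using that by (intro wedge_outside[OF a]) simp
  note simps = wedge_2_2[OF a] alt_2[OF a(1)] alt_2[OF a(2)]
  show "wedge \<alpha> \<beta> [comb p u q v, w, x, y] = of_real p * wedge \<alpha> \<beta> [u, w, x, y] + of_real q * wedge \<alpha> \<beta> [v, w, x, y]"
    if "u \<in> V" "v \<in> V" "w \<in> V" "x \<in> V" "y \<in> V" for p u q v w x y
    using that by (simp add: simps algebra_simps)
  fix u v w x assume V: "u \<in> V" "v \<in> V" "w \<in> V" "x \<in> V"
  show "wedge \<alpha> \<beta> [u, v, w, x] = - wedge \<alpha> \<beta> [v, u, w, x]"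
    using V by (simp add: simps alt_2_swap[OF a(1) V(1,2)] alt_2_swap[OF a(2) V(1,2)])
  show "wedge \<alpha> \<beta> [u, v, w, x] = - wedge \<alpha> \<beta> [u, w, v, x]"
    using V by (simp add: simps alt_2_swap[OF a(1) V(2,3)] alt_2_swap[OF a(2) V(2,3)])
  show "wedge \<alpha> \<beta> [u, v, w, x] = - wedge \<alpha> \<beta> [u, v, x, w]"
    using V by (simp add: simps alt_2_swap[OF a(1) V(3,4)] alt_2_swap[OF a(2) V(3,4)])
qed auto

lemma wedge_commute_1_3: "\<alpha> \<in> alt 1 \<Longrightarrow> \<beta> \<in> alt 3 \<Longrightarrow> wedge \<beta> \<alpha> = (\<lambda>vs. - wedge \<alpha> \<beta> vs)"
proof
  fix vs assume a: "\<alpha> \<in> alt 1" "\<beta> \<in> alt 3"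
  show "wedge \<beta> \<alpha> vs = - wedge \<alpha> \<beta> vs"
  proof (cases "length vs = 4")
    case True
    then show ?thesis using a by (auto simp: length_eq_lists wedge_1_3 wedge_3_1)
  next
    case False
    then show ?thesis by (subst wedge_outside[OF a(2,1)] wedge_outside[OF a], simp)+ simp
  qed
qed

lemma wedge_commute_2_2: "\<alpha> \<in> alt 2 \<Longrightarrow> \<beta> \<in> alt 2 \<Longrightarrow> wedge \<beta> \<alpha> = wedge \<alpha> \<beta>"
proof
  fix vs assume a: "\<alpha> \<in> alt 2" "\<beta> \<in> alt 2"
  show "wedge \<beta> \<alpha> vs = wedge \<alpha> \<beta> vs"
  proof (cases "length vs = 4")
    case True
    then show ?thesis using a by (auto simp: length_eq_lists wedge_2_2)
  next
    case False
    then show ?thesis by (subst wedge_outside[OF a(2,1)] wedge_outside[OF a], simp)+ simp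
  qed
qed

text \<open>Two nested \<open>comb\<close> terms because \<open>comb\<close> combines two vectors.
  Independence is not demanded: the uses are comparisons of forms on the four vectors.\<close>

definition spanning :: "('a, 'e) tvec \<Rightarrow> ('a, 'e) tvec \<Rightarrow> ('a, 'e) tvec \<Rightarrow> ('a, 'e) tvec \<Rightarrow> bool"
  where "spanning e0 e1 e2 e3 \<longleftrightarrow> e0 \<in> V \<and> e1 \<in> V \<and> e2 \<in> V \<and> e3 \<in> V \<and>
    (\<forall>v\<in>V. \<exists>a b c d. v = comb 1 (comb a e0 b e1) 1 (comb c e2 d e3))"

text \<open>Arguments are replaced from the right: the list is split into a free prefix
  \<open>us\<close> and a suffix \<open>bs\<close> of basis vectors, and the last entry of the
  prefix is expanded in the basis.\<close>

lemma alt_zero_on_basis: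
  assumes \<alpha>: "\<alpha> \<in> alt k" and sp: "spanning e0 e1 e2 e3"
    and B: "\<And>bs. set bs \<subseteq> {e0, e1, e2, e3} \<Longrightarrow> length bs = k \<Longrightarrow> \<alpha> bs = 0"
  shows "\<alpha> vs = 0"
proof -
  have e: "e0 \<in> V" "e1 \<in> V" "e2 \<in> V" "e3 \<in> V" using sp by (auto simp: spanning_def)
  have "\<alpha> (us @ bs) = 0"
    if "set us \<subseteq> V" "set bs \<subseteq> {e0, e1, e2, e3}" "length us + length bs = k" for us bs
    using that
  proof (induction us arbitrary: bs rule: rev_induct)
    case Nil
    then show ?case using B by simp
  next
    case (snoc v us)
    have v: "v \<in> V" using snoc.prems by simp
    obtain a b c d where abcd: "v = comb 1 (comb a e0 b e1) 1 (comb c e2 d e3)"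
      using sp v unfolding spanning_def by blast
    have lin: "\<alpha> (us @ comb a u b w # bs) = of_real a * \<alpha> (us @ u # bs) + of_real b * \<alpha> (us @ w # bs)"
      if "u \<in> V" "w \<in> V" for a u b w
      using alt_formsD(3)[OF \<alpha>, of "us @ u # bs" "length us" u w a b] that snoc.prems e
      by (auto simp: subset_iff)
    have "\<alpha> (us @ x # bs) = 0" if "x \<in> {e0, e1, e2, e3}" for x
      using snoc.IH[of "x # bs"] snoc.prems that by simp
    then show ?case using e by (simp add: abcd lin)
  qed
  from this[of vs "[]"] show ?thesis using alt_formsD(1,2)[OF \<alpha>, of vs] by auto
qed

lemma alt_1_eqI:
  assumes "spanning e0 e1 e2 e3" "\<alpha> \<in> alt 1" "\<beta> \<in> alt 1"
    and "\<alpha> [e0] = \<beta> [e0]" "\<alpha> [e1] = \<beta> [e1]" "\<alpha> [e2] = \<beta> [e2]" "\<alpha> [e3] = \<beta> [e3]"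
  shows "\<alpha> = \<beta>"
proof
  fix vs
  have "1 * \<alpha> vs + (-1) * \<beta> vs = 0"
    by (rule alt_zero_on_basis[OF alt_forms_linear[OF assms(2,3)] assms(1)])
      (use assms in \<open>auto simp: length_eq_lists length_Suc_conv\<close>)
  then show "\<alpha> vs = \<beta> vs" by simp
qed

lemma alt_2_eqI:
  assumes "spanning e0 e1 e2 e3" "\<alpha> \<in> alt 2" "\<beta> \<in> alt 2"
    and eq: "\<alpha> [e0, e1] = \<beta> [e0, e1]" "\<alpha> [e0, e2] = \<beta> [e0, e2]" "\<alpha> [e0, e3] = \<beta> [e0, e3]"
      "\<alpha> [e1, e2] = \<beta> [e1, e2]" "\<alpha> [e1, e3] = \<beta> [e1, e3]" "\<alpha> [e2, e3] = \<beta> [e2, e3]"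
  shows "\<alpha> = \<beta>"
proof
  fix vs
  define \<delta> where "\<delta> = (\<lambda>vs. 1 * \<alpha> vs + (-1) * \<beta> vs)"
  have \<delta>: "\<delta> \<in> alt 2" unfolding \<delta>_def by (rule alt_forms_linear[OF assms(2,3)])
  have e: "e0 \<in> V" "e1 \<in> V" "e2 \<in> V" "e3 \<in> V" using assms(1) by (auto simp: spanning_def)
  have 0: "\<delta> [e0, e1] = 0" "\<delta> [e0, e2] = 0" "\<delta> [e0, e3] = 0" "\<delta> [e1, e2] = 0" "\<delta> [e1, e3] = 0" "\<delta> [e2, e3] = 0"
    using eq by (simp_all add: \<delta>_def)
  have sw: "\<delta> [x, y] = 0" if "\<delta> [y, x] = 0" "x \<in> V" "y \<in> V" for x y
    using alt_2_swap[OF \<delta>, of x y] that by simp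
  have "\<delta> vs = 0"
  proof (rule alt_zero_on_basis[OF \<delta> assms(1)])
    fix bs assume "set bs \<subseteq> {e0, e1, e2, e3}" "length bs = 2"
    then obtain x y where "bs = [x, y]" "x \<in> {e0, e1, e2, e3}" "y \<in> {e0, e1, e2, e3}"
      by (auto simp: length_eq_lists)
    then show "\<delta> bs = 0" using 0 sw[OF 0(1)] sw[OF 0(2)] sw[OF 0(3)] sw[OF 0(4)] sw[OF 0(5)] sw[OF 0(6)] e alt_2(5)[OF \<delta>]
      by blast
  qed
  then show "\<alpha> vs = \<beta> vs" by (simp add: \<delta>_def)
qed

lemma alt_3_eqI:
  assumes "spanning e0 e1 e2 e3" "\<alpha> \<in> alt 3" "\<beta> \<in> alt 3"
    and eq: "\<alpha> [e0, e1, e2] = \<beta> [e0, e1, e2]" "\<alpha> [e0, e1, e3] = \<beta> [e0, e1, e3]"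
      "\<alpha> [e0, e2, e3] = \<beta> [e0, e2, e3]" "\<alpha> [e1, e2, e3] = \<beta> [e1, e2, e3]"
  shows "\<alpha> = \<beta>"
proof
  fix vs
  define \<delta> where "\<delta> = (\<lambda>vs. 1 * \<alpha> vs + (-1) * \<beta> vs)"
  have \<delta>: "\<delta> \<in> alt 3" unfolding \<delta>_def by (rule alt_forms_linear[OF assms(2,3)])
  have e: "e0 \<in> V" "e1 \<in> V" "e2 \<in> V" "e3 \<in> V" using assms(1) by (auto simp: spanning_def)
  have sw: "\<delta> [x, z, y] = 0" "\<delta> [y, x, z] = 0" "\<delta> [y, z, x] = 0" "\<delta> [z, x, y] = 0" "\<delta> [z, y, x] = 0"
    if "\<delta> [x, y, z] = 0" "x \<in> V" "y \<in> V" "z \<in> V" for x y z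
    using alt_3_swap[OF \<delta>, of x y z] alt_3_swap[OF \<delta>, of y z x] alt_3_swap[OF \<delta>, of x z y] that by simp_all
  have 0: "\<delta> [e0, e1, e2] = 0" "\<delta> [e0, e1, e3] = 0" "\<delta> [e0, e2, e3] = 0" "\<delta> [e1, e2, e3] = 0"
    using eq by (simp_all add: \<delta>_def)
  have "\<delta> vs = 0"
  proof (rule alt_zero_on_basis[OF \<delta> assms(1)])
    fix bs assume "set bs \<subseteq> {e0, e1, e2, e3}" "length bs = 3"
    then obtain x y z where bs: "bs = [x, y, z]" and
      xyz: "x \<in> {e0, e1, e2, e3}" "y \<in> {e0, e1, e2, e3}" "z \<in> {e0, e1, e2, e3}"
      by (auto simp: length_eq_lists)
    have "\<forall>x\<in>{e0, e1, e2, e3}. \<forall>y\<in>{e0, e1, e2, e3}. \<forall>z\<in>{e0, e1, e2, e3}. \<delta> [x, y, z] = 0"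
      by (simp add: 0 sw[OF 0(1) e(1-3)] sw[OF 0(2) e(1,2,4)] sw[OF 0(3) e(1,3,4)]
          sw[OF 0(4) e(2-4)] alt_3(7-9)[OF \<delta>])
    then show "\<delta> bs = 0" using bs xyz by blast
  qed
  then show "\<alpha> vs = \<beta> vs" by (simp add: \<delta>_def)
qed

lemma alt_4_eqI:
  assumes "spanning e0 e1 e2 e3" "\<alpha> \<in> alt 4" "\<beta> \<in> alt 4"
    and eq: "\<alpha> [e0, e1, e2, e3] = \<beta> [e0, e1, e2, e3]"
  shows "\<alpha> = \<beta>"
proof
  fix vs
  define \<delta> where "\<delta> = (\<lambda>vs. 1 * \<alpha> vs + (-1) * \<beta> vs)"
  have \<delta>: "\<delta> \<in> alt 4" unfolding \<delta>_def by (rule alt_forms_linear[OF assms(2,3)])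
  have e: "e0 \<in> V" "e1 \<in> V" "e2 \<in> V" "e3 \<in> V" using assms(1) by (auto simp: spanning_def)
  have sw: "\<delta> [x, y, t, z] = 0" "\<delta> [x, z, y, t] = 0" "\<delta> [x, z, t, y] = 0" "\<delta> [x, t, y, z] = 0" "\<delta> [x, t, z, y] = 0"
    "\<delta> [y, x, z, t] = 0" "\<delta> [y, x, t, z] = 0" "\<delta> [y, z, x, t] = 0" "\<delta> [y, z, t, x] = 0" "\<delta> [y, t, x, z] = 0" "\<delta> [y, t, z, x] = 0"
    if "\<delta> [x, y, z, t] = 0" "x \<in> V" "y \<in> V" "z \<in> V" "t \<in> V" for x y z t
  proof -
    note s = alt_4_swap[OF \<delta>]
    show 1: "\<delta> [x, y, t, z] = 0" and 2: "\<delta> [x, z, y, t] = 0" and 6: "\<delta> [y, x, z, t] = 0"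
      using s(3)[of z t x y] s(2)[of y z x t] s(1)[of x y z t] that by simp_all
    show 3: "\<delta> [x, z, t, y] = 0" and 4: "\<delta> [x, t, y, z] = 0" and 7: "\<delta> [y, x, t, z] = 0" and 8: "\<delta> [y, z, x, t] = 0"
      using s(3)[of y t x z] s(2)[of y t x z] s(3)[of z t y x] s(2)[of x z y t] that 1 2 6 by simp_all
    show "\<delta> [x, t, z, y] = 0" and 9: "\<delta> [y, z, t, x] = 0" and 10: "\<delta> [y, t, x, z] = 0"
      using s(3)[of y z x t] s(3)[of x t y z] s(2)[of x t y z] that 4 8 7 by simp_all
    show "\<delta> [y, t, z, x] = 0" using s(3)[of x z y t] that 10 by simp
  qed
  have 0: "\<delta> [e0, e1, e2, e3] = 0" using eq by (simp add: \<delta>_def)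
  \<comment> \<open>\<open>sw\<close> reaches the orderings that begin with one of the first two
    entries. Two cyclic shifts give this second starting point, whose orderings begin with e2 or
    e3.\<close>
  have 1: "\<delta> [e2, e3, e0, e1] = 0"
    by (rule sw(9)[OF sw(9)[OF 0 e] e(2,3,4,1)])
  have "\<delta> vs = 0"
  proof (rule alt_zero_on_basis[OF \<delta> assms(1)])
    fix bs assume "set bs \<subseteq> {e0, e1, e2, e3}" "length bs = 4"
    then obtain x y z t where bs: "bs = [x, y, z, t]" and
      xyz: "x \<in> {e0, e1, e2, e3}" "y \<in> {e0, e1, e2, e3}" "z \<in> {e0, e1, e2, e3}" "t \<in> {e0, e1, e2, e3}"
      by (auto simp: length_eq_lists)
    have "\<forall>x\<in>{e0, e1, e2, e3}. \<forall>y\<in>{e0, e1, e2, e3}. \<forall>z\<in>{e0, e1, e2, e3}.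
        \<forall>t\<in>{e0, e1, e2, e3}. \<delta> [x, y, z, t] = 0"
      by (simp add: 0 1 sw[OF 0 e] sw[OF 1 e(3,4,1,2)] alt_4(9-14)[OF \<delta>])
    then show "\<delta> bs = 0" using bs xyz by blast
  qed
  then show "\<alpha> vs = \<beta> vs" by (simp add: \<delta>_def)
qed

end

text \<open>V is a set and not a type, so its dimension is expressed by the linear bijection
  \<kappa> from real ^ 4; on a manifold \<kappa> will be the coordinate parametrisation
  \<open>tangent c x\<close> of the tangent space.\<close>

locale hermitian4 = tvec_space V for V :: "('a, 'e::real_vector) tvec set" +
  fixes J :: "('a, 'e) tvec \<Rightarrow> ('a, 'e) tvec"
    and g :: "('a, 'e) tvec \<Rightarrow> ('a, 'e) tvec \<Rightarrow> real"
    and \<kappa> :: "real ^ 4 \<Rightarrow> ('a, 'e) tvec"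
  assumes J_V [simp]: "v \<in> V \<Longrightarrow> J v \<in> V"
    and J_comb [simp]: "u \<in> V \<Longrightarrow> v \<in> V \<Longrightarrow> J (comb a u b v) = comb a (J u) b (J v)"
    and J_J [simp]: "v \<in> V \<Longrightarrow> J (J v) = - v"
    and g_comb: "u \<in> V \<Longrightarrow> v \<in> V \<Longrightarrow> w \<in> V \<Longrightarrow> g (comb a u b v) w = a * g u w + b * g v w"
    and g_commute: "u \<in> V \<Longrightarrow> v \<in> V \<Longrightarrow> g u v = g v u"
    and g_positive: "v \<in> V \<Longrightarrow> v \<noteq> 0 \<Longrightarrow> g v v > 0"
    and g_J_J: "u \<in> V \<Longrightarrow> v \<in> V \<Longrightarrow> g (J u) (J v) = g u v"
    and \<kappa>_linear: "\<kappa> (a *\<^sub>R x + b *\<^sub>R y) = comb a (\<kappa> x) b (\<kappa> y)"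
    and \<kappa>_bij: "bij_betw \<kappa> UNIV V"
begin

lemma \<kappa>_V [simp]: "\<kappa> x \<in> V"
  using \<kappa>_bij by (auto simp: bij_betw_def)

lemma \<kappa>_eq_iff: "\<kappa> x = \<kappa> y \<longleftrightarrow> x = y"
  using \<kappa>_bij by (auto simp: bij_betw_def inj_on_def)

lemma \<kappa>_surj: "v \<in> V \<Longrightarrow> \<exists>x. v = \<kappa> x"
  using \<kappa>_bij by (auto simp: bij_betw_def)

lemma J_neg [simp]: "v \<in> V \<Longrightarrow> J (- v) = - J v"
  using J_comb[of v v "-1" 0] by (simp add: comb_simps)

lemma g_linear_right: "u \<in> V \<Longrightarrow> v \<in> V \<Longrightarrow> w \<in> V \<Longrightarrow> g w (comb a u b v) = a * g w u + b * g w v"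
  using g_comb[of u v w a b] g_commute by simp

lemma g_neg: "u \<in> V \<Longrightarrow> v \<in> V \<Longrightarrow> g (- u) v = - g u v" "u \<in> V \<Longrightarrow> v \<in> V \<Longrightarrow> g u (- v) = - g u v"
  using g_comb[of u u v "-1" 0] g_linear_right[of v v u "-1" 0] by (simp_all add: comb_simps)

lemma g_J_swap: "u \<in> V \<Longrightarrow> v \<in> V \<Longrightarrow> g (J u) v = - g u (J v)"
  using g_J_J[of "J u" v] by (simp add: g_neg)

lemma g_J_antisym: "u \<in> V \<Longrightarrow> v \<in> V \<Longrightarrow> g (J u) v = - g (J v) u"
  using g_J_swap[of u v] g_commute[of u "J v"] by simp

lemma g_J_self [simp]: "v \<in> V \<Longrightarrow> g (J v) v = 0" "v \<in> V \<Longrightarrow> g v (J v) = 0"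
  using g_J_antisym[of v v] g_commute[of v "J v"] by simp_all

section \<open>Orthonormal and J-adapted frames\<close>

definition orthonormal :: "('a, 'e) tvec \<Rightarrow> ('a, 'e) tvec \<Rightarrow> ('a, 'e) tvec \<Rightarrow> ('a, 'e) tvec \<Rightarrow> bool"
  where "orthonormal e0 e1 e2 e3 \<longleftrightarrow> e0 \<in> V \<and> e1 \<in> V \<and> e2 \<in> V \<and> e3 \<in> V \<and>
    g e0 e0 = 1 \<and> g e1 e1 = 1 \<and> g e2 e2 = 1 \<and> g e3 e3 = 1 \<and>
    g e0 e1 = 0 \<and> g e0 e2 = 0 \<and> g e0 e3 = 0 \<and> g e1 e2 = 0 \<and> g e1 e3 = 0 \<and> g e2 e3 = 0"

text \<open>The frame is pulled back by \<kappa> to real ^ 4, where four independent vectors span by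
  a dimension count; \<gamma> is the pulled-back metric.\<close>

lemma orthonormal_spanning:
  assumes "orthonormal e0 e1 e2 e3"
  shows "spanning e0 e1 e2 e3"
proof -
  have e: "e0 \<in> V" "e1 \<in> V" "e2 \<in> V" "e3 \<in> V"
    "g e0 e0 = 1" "g e1 e1 = 1" "g e2 e2 = 1" "g e3 e3 = 1"
    "g e0 e1 = 0" "g e0 e2 = 0" "g e0 e3 = 0" "g e1 e2 = 0" "g e1 e3 = 0" "g e2 e3 = 0"
    using assms by (simp_all add: orthonormal_def)
  then have sym: "g e1 e0 = 0" "g e2 e0 = 0" "g e3 e0 = 0" "g e2 e1 = 0" "g e3 e1 = 0" "g e3 e2 = 0"
    using g_commute by metis+
  obtain b0 b1 b2 b3 where b: "e0 = \<kappa> b0" "e1 = \<kappa> b1" "e2 = \<kappa> b2" "e3 = \<kappa> b3"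
    using \<kappa>_surj e by metis
  define \<gamma> where "\<gamma> x y = g (\<kappa> x) (\<kappa> y)" for x y
  have lin: "\<gamma> (x + y) z = \<gamma> x z + \<gamma> y z" "\<gamma> (r *\<^sub>R x) z = r * \<gamma> x z" "\<gamma> (x - y) z = \<gamma> x z - \<gamma> y z" for x y z r
    using \<kappa>_linear[of 1 x 1 y] \<kappa>_linear[of r x 0 x] \<kappa>_linear[of 1 x "-1" y]
    by (simp_all add: \<gamma>_def g_comb)
  have \<gamma>: "\<gamma> b0 b0 = 1" "\<gamma> b1 b1 = 1" "\<gamma> b2 b2 = 1" "\<gamma> b3 b3 = 1"
    "\<gamma> b0 b1 = 0" "\<gamma> b0 b2 = 0" "\<gamma> b0 b3 = 0" "\<gamma> b1 b2 = 0" "\<gamma> b1 b3 = 0" "\<gamma> b2 b3 = 0"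
    "\<gamma> b1 b0 = 0" "\<gamma> b2 b0 = 0" "\<gamma> b3 b0 = 0" "\<gamma> b2 b1 = 0" "\<gamma> b3 b1 = 0" "\<gamma> b3 b2 = 0"
    using e sym b by (simp_all add: \<gamma>_def)
  have \<gamma>0: "\<gamma> 0 z = 0" for z using lin(2)[of 0 0 z] by simp
  have "b0 \<noteq> b1" "b0 \<noteq> b2" "b0 \<noteq> b3" "b1 \<noteq> b2" "b1 \<noteq> b3" "b2 \<noteq> b3" using \<gamma> by auto
  \<comment> \<open>If a vector lay in the span of the later ones, pairing the relation with that
    vector under \<gamma> would give 1 = 0.\<close>
  moreover have "independent {b0, b1, b2, b3}"
  proof -
    have "b3 \<notin> span {}" using \<gamma> \<gamma>0 by auto
    moreover have "b2 \<notin> span {b3}"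
    proof
      assume "b2 \<in> span {b3}"
      then obtain k where "b2 - k *\<^sub>R b3 = 0" unfolding span_breakdown_eq by auto
      then have "\<gamma> (b2 - k *\<^sub>R b3) b2 = 0" using \<gamma>0 by simp
      then show False by (simp add: lin \<gamma>)
    qed
    moreover have "b1 \<notin> span {b2, b3}"
    proof
      assume "b1 \<in> span {b2, b3}"
      then obtain k l where "b1 - k *\<^sub>R b2 - l *\<^sub>R b3 = 0" unfolding span_breakdown_eq by auto
      then have "\<gamma> (b1 - k *\<^sub>R b2 - l *\<^sub>R b3) b1 = 0" using \<gamma>0 by simp
      then show False by (simp add: lin \<gamma>)
    qed
    moreover have "b0 \<notin> span {b1, b2, b3}"
    proof
      assume "b0 \<in> span {b1, b2, b3}"
      then obtain k l m where "b0 - k *\<^sub>R b1 - l *\<^sub>R b2 - m *\<^sub>R b3 = 0" unfolding span_breakdown_eq by auto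
      then have "\<gamma> (b0 - k *\<^sub>R b1 - l *\<^sub>R b2 - m *\<^sub>R b3) b0 = 0" using \<gamma>0 by simp
      then show False by (simp add: lin \<gamma>)
    qed
    ultimately show ?thesis
      by (intro independent_insertI independent_empty) auto
  qed
  ultimately have "UNIV \<subseteq> span {b0, b1, b2, b3}"
    by (intro card_ge_dim_independent) (auto simp: dim_UNIV)
  have "\<exists>a b c d. v = comb 1 (comb a e0 b e1) 1 (comb c e2 d e3)" if "v \<in> V" for v
  proof -
    obtain x where x: "v = \<kappa> x" using \<kappa>_surj \<open>v \<in> V\<close> by blast
    have "x \<in> span {b0, b1, b2, b3}" using \<open>UNIV \<subseteq> _\<close> by blast
    then obtain k l m n where "x - k *\<^sub>R b0 - l *\<^sub>R b1 - m *\<^sub>R b2 - n *\<^sub>R b3 = 0"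
      unfolding span_breakdown_eq by auto
    then have "x = 1 *\<^sub>R (k *\<^sub>R b0 + l *\<^sub>R b1) + 1 *\<^sub>R (m *\<^sub>R b2 + n *\<^sub>R b3)" by (simp add: algebra_simps)
    then show ?thesis unfolding x b using \<kappa>_linear by metis
  qed
  then show ?thesis using e by (auto simp: spanning_def)
qed

lemma orthonormal_expansion:
  assumes "orthonormal e0 e1 e2 e3" "v \<in> V"
  shows "v = comb 1 (comb (g v e0) e0 (g v e1) e1) 1 (comb (g v e2) e2 (g v e3) e3)"
proof -
  obtain a b c d where v: "v = comb 1 (comb a e0 b e1) 1 (comb c e2 d e3)"
    using orthonormal_spanning[OF assms(1)] assms(2) by (auto simp: spanning_def)
  have e: "e0 \<in> V" "e1 \<in> V" "e2 \<in> V" "e3 \<in> V"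
    "g e0 e0 = 1" "g e1 e1 = 1" "g e2 e2 = 1" "g e3 e3 = 1"
    "g e0 e1 = 0" "g e0 e2 = 0" "g e0 e3 = 0" "g e1 e2 = 0" "g e1 e3 = 0" "g e2 e3 = 0"
    using assms by (simp_all add: orthonormal_def)
  then have sym: "g e1 e0 = 0" "g e2 e0 = 0" "g e3 e0 = 0" "g e2 e1 = 0" "g e3 e1 = 0" "g e3 e2 = 0"
    using g_commute by metis+
  have "g v e0 = a" "g v e1 = b" "g v e2 = c" "g v e3 = d"
    unfolding v using e sym by (simp_all add: g_comb)
  then show ?thesis using v by simp
qed

text \<open>J is a skew isometry, so e0 and J e0 are orthonormal once e0 is a unit vector, and their
  orthogonal complement is stable under J. A unit vector e2 of the complement therefore completes
  the frame together with J e2.\<close>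

lemma adapted_frame: "\<exists>e0 e2. orthonormal e0 (J e0) e2 (J e2)"
proof -
  have normalize: "\<exists>r. r \<noteq> 0 \<and> g (comb r v 0 v) (comb r v 0 v) = 1" if "v \<in> V" "v \<noteq> 0" for v
  proof -
    have "g v v > 0" using g_positive that by blast
    then have "1 / sqrt (g v v) * (1 / sqrt (g v v)) * g v v = 1" by (simp add: real_sqrt_mult[symmetric])
    then show ?thesis
      using that \<open>g v v > 0\<close>
      by (intro exI[of _ "1 / sqrt (g v v)"]) (simp add: g_comb g_linear_right)
  qed
  have \<kappa>0: "\<kappa> 0 = 0" using \<kappa>_linear[of 0 0 0 0] by (simp add: comb_simps)
  have "axis 1 1 \<noteq> (0 :: real ^ 4)" by simp
  then have "\<kappa> (axis 1 1) \<noteq> 0" using \<kappa>_eq_iff \<kappa>0 by metis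
  then obtain r where "g (comb r (\<kappa> (axis 1 1)) 0 (\<kappa> (axis 1 1))) (comb r (\<kappa> (axis 1 1)) 0 (\<kappa> (axis 1 1))) = 1"
    using normalize by force
  then obtain e0 where e0: "e0 \<in> V" "g e0 e0 = 1" using comb_V by (meson \<kappa>_V)
  obtain b0 b1 where b: "e0 = \<kappa> b0" "J e0 = \<kappa> b1" using \<kappa>_surj e0(1) J_V by metis
  have "dim {b0, b1} \<le> card {b0, b1}" by (rule dim_le_card') simp
  also have "\<dots> \<le> 2" by (simp add: card_insert_if)
  finally have "dim (span {b0, b1}) \<le> 2" by (simp add: dim_span)
  have "span {b0, b1} \<noteq> UNIV"
  proof
    assume "span {b0, b1} = UNIV"
    then have "dim (UNIV :: (real ^ 4) set) \<le> 2" using \<open>dim (span {b0, b1}) \<le> 2\<close> by metis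
    then show False by simp
  qed
  then obtain x where x: "x \<notin> span {b0, b1}" by blast
  \<comment> \<open>Gram-Schmidt: the component of \<open>\<kappa> x\<close> orthogonal to e0 and J
    e0. It is nonzero because x lies outside the span of their preimages.\<close>
  define w where "w = comb 1 (\<kappa> x) 1 (comb (- g (\<kappa> x) e0) e0 (- g (\<kappa> x) (J e0)) (J e0))"
  have w: "w \<in> V" using e0 by (simp add: w_def)
  have "w \<noteq> 0"
  proof
    assume "w = 0"
    have "w = \<kappa> (1 *\<^sub>R x + 1 *\<^sub>R ((- g (\<kappa> x) e0) *\<^sub>R b0 + (- g (\<kappa> x) (J e0)) *\<^sub>R b1))"
      unfolding \<kappa>_linear w_def b[symmetric] ..
    then have "x + ((- g (\<kappa> x) e0) *\<^sub>R b0 + (- g (\<kappa> x) (J e0)) *\<^sub>R b1) = 0"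
      using \<open>w = 0\<close> \<kappa>0 \<kappa>_eq_iff by (metis scaleR_one)
    then have "x = g (\<kappa> x) e0 *\<^sub>R b0 + g (\<kappa> x) (J e0) *\<^sub>R b1" by (simp add: algebra_simps)
    then have "x \<in> span {b0, b1}" by (metis insertI1 insertI2 span_add span_base span_scale)
    then show False using x by blast
  qed
  have gJ: "g (J e0) (J e0) = 1" using e0 g_J_J by simp
  have w0: "g w e0 = 0" "g w (J e0) = 0"
    using e0 gJ by (simp_all add: w_def g_comb)
  obtain s where s: "g (comb s w 0 w) (comb s w 0 w) = 1" using normalize[OF w \<open>w \<noteq> 0\<close>] by blast
  define e2 where "e2 = comb s w 0 w"
  have e2: "e2 \<in> V" "g e2 e2 = 1" using w s by (simp_all add: e2_def)
  have 2: "g e2 e0 = 0" "g e2 (J e0) = 0" using w e0 w0 by (simp_all add: e2_def g_comb)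
  then have 3: "g e0 e2 = 0" "g (J e0) e2 = 0" using g_commute e2 e0 J_V by metis+
  have 4: "g e0 (J e2) = 0" using g_J_swap[of e0 e2] 3(2) e0 e2 by simp
  have 5: "g (J e0) (J e2) = 0" using g_J_J e0 e2 3 by simp
  have "orthonormal e0 (J e0) e2 (J e2)"
    using e0 e2 gJ g_J_J[of e2 e2] 3 4 5 by (simp add: orthonormal_def)
  then show ?thesis by blast
qed

text \<open>In an orthonormal frame J is a matrix that is both skew and orthogonal. In dimension
  four such a matrix is self-dual or anti-self-dual: its first row is a point (a, b, c) of the unit
  sphere, and a sign s determines the remaining entries.\<close>

lemma orthonormal_J_matrix:
  assumes "orthonormal e0 e1 e2 e3"
  shows "\<exists>a b c s. (s = 1 \<or> s = -1) \<and> a\<^sup>2 + b\<^sup>2 + c\<^sup>2 = 1 \<and>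
    J e0 = comb 1 (comb 0 e0 a e1) 1 (comb b e2 c e3) \<and>
    J e1 = comb 1 (comb (- a) e0 0 e1) 1 (comb (s * c) e2 (- s * b) e3) \<and>
    J e2 = comb 1 (comb (- b) e0 (- s * c) e1) 1 (comb 0 e2 (s * a) e3) \<and>
    J e3 = comb 1 (comb (- c) e0 (s * b) e1) 1 (comb (- s * a) e2 0 e3)"
proof -
  have e: "e0 \<in> V" "e1 \<in> V" "e2 \<in> V" "e3 \<in> V"
    "g e0 e0 = 1" "g e1 e1 = 1" "g e2 e2 = 1" "g e3 e3 = 1"
    "g e0 e1 = 0" "g e0 e2 = 0" "g e0 e3 = 0" "g e1 e2 = 0" "g e1 e3 = 0" "g e2 e3 = 0"
    using assms by (simp_all add: orthonormal_def)
  then have sym: "g e1 e0 = 0" "g e2 e0 = 0" "g e3 e0 = 0" "g e2 e1 = 0" "g e3 e1 = 0" "g e3 e2 = 0"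
    using g_commute by metis+
  define a b c d e f where "a = g (J e0) e1" and "b = g (J e0) e2" and "c = g (J e0) e3"
    and "d = g (J e1) e2" and "e = g (J e1) e3" and "f = g (J e2) e3"
  have as: "g (J e1) e0 = - a" "g (J e2) e0 = - b" "g (J e3) e0 = - c" "g (J e2) e1 = - d"
    "g (J e3) e1 = - e" "g (J e3) e2 = - f"
    unfolding a_def b_def c_def d_def e_def f_def using g_J_antisym e by blast+
  have J0: "J e0 = comb 1 (comb 0 e0 a e1) 1 (comb b e2 c e3)"
    and J1: "J e1 = comb 1 (comb (- a) e0 0 e1) 1 (comb d e2 e e3)"
    and J2: "J e2 = comb 1 (comb (- b) e0 (- d) e1) 1 (comb 0 e2 f e3)"
    and J3: "J e3 = comb 1 (comb (- c) e0 (- e) e1) 1 (comb (- f) e2 0 e3)"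
    using orthonormal_expansion[OF assms, of "J e0"] orthonormal_expansion[OF assms, of "J e1"]
      orthonormal_expansion[OF assms, of "J e2"] orthonormal_expansion[OF assms, of "J e3"]
    by (simp_all add: e as flip: a_def b_def c_def d_def e_def f_def)
  have "g (J e0) (J e0) = 1" "g (J e1) (J e1) = 1" "g (J e2) (J e2) = 1" "g (J e3) (J e3) = 1"
    "g (J e0) (J e1) = 0" "g (J e0) (J e2) = 0" "g (J e0) (J e3) = 0" "g (J e1) (J e2) = 0"
    "g (J e1) (J e3) = 0" "g (J e2) (J e3) = 0"
    using e by (simp_all add: g_J_J)
  then have r: "a * a + (b * b + c * c) = 1" "a * a + (d * d + e * e) = 1" "b * b + d * d + f * f = 1"
      "c * c + e * e + f * f = 1" "b * d + c * e = 0" "a * d = c * f" "a * e + b * f = 0"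
      "a * b + e * f = 0" "a * c = d * f" "b * c + d * e = 0"
    unfolding J0 J1 J2 J3 using e sym by (simp_all add: g_comb g_linear_right algebra_simps)
  \<comment> \<open>The Pfaffian of the skew matrix. Orthogonality makes multiplication by it
    exchange complementary entries up to sign, which also forces its square to be 1.\<close>
  define s where "s = a * f - b * e + c * d"
  have "d * d + e * e + f * f = 1" using r(1-4) by linarith
  have sf: "s * a = f" using r unfolding s_def by algebra
  have se: "s * b = - e" using r unfolding s_def by algebra
  have sd: "s * c = d" using r unfolding s_def by algebra
  have "s * s = 1"
  proof -
    have "s * s = f * (s * a) - e * (s * b) + d * (s * c)" unfolding s_def by (simp add: algebra_simps)
    then show ?thesis unfolding sf se sd using \<open>d * d + e * e + f * f = 1\<close> by simp
  qed
  then have "s = 1 \<or> s = -1" by algebra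
  then show ?thesis
    using J0 J1 J2 J3 r(1) sf se sd
    by (intro exI[of _ a] exI[of _ b] exI[of _ c] exI[of _ s]) (simp add: power2_eq_square)
qed

section \<open>Fundamental form, volume form and top coefficient\<close>

definition omega :: "('a, 'e) cform"
  where "omega vs = (if length vs = 2 \<and> set vs \<subseteq> V then of_real (g (J (vs ! 0)) (vs ! 1)) else 0)"

definition vol :: "('a, 'e) cform"
  where "vol vs = wedge_power omega 2 vs / fact 2"

definition form_J :: "('a, 'e) cform \<Rightarrow> ('a, 'e) cform"
  where "form_J \<alpha> vs = (if set vs \<subseteq> V then \<alpha> (map J vs) else 0)"

definition tpart :: "nat \<Rightarrow> nat \<Rightarrow> ('a, 'e) cform \<Rightarrow> ('a, 'e) cform"
  where "tpart p q \<alpha> vs = (if length vs = p + q \<and> set vs \<subseteq> V then type_part J p \<alpha> vs else 0)"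

lemma omega_eval: "u \<in> V \<Longrightarrow> v \<in> V \<Longrightarrow> omega [u, v] = of_real (g (J u) v)"
  by (simp add: omega_def)

lemma omega_alt: "omega \<in> alt 2"
proof (rule alt_forms_2I)
  show "omega [u, v] = - omega [v, u]" if "u \<in> V" "v \<in> V" for u v
    using that g_J_antisym[of u v] by (simp add: omega_eval)
qed (auto simp: omega_def g_comb)

lemma vol_eq: "vol = (\<lambda>vs. wedge omega omega vs / 2)"
proof -
  have "wedge omega (\<lambda>vs. if vs = [] then 1 else 0) = omega"
    by (simp add: fun_eq_iff wedge_degree_0_right)
  then have "wedge_power omega 2 = wedge omega omega" by (simp add: numeral_2_eq_2)
  then show ?thesis by (simp add: vol_def fun_eq_iff)
qed

lemma vol_alt: "vol \<in> alt 4"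
  using alt_forms_scale[OF wedge_2_2_alt[OF omega_alt omega_alt], of "1/2"] by (simp add: vol_eq)

text \<open>The frame is arbitrary, so it may be oriented against \<omega> \<and> \<omega>; the
  value is the sign s of \<open>orthonormal_J_matrix\<close>. This is needed because
  \<open>orthonormal_frame\<close> is an unspecified choice.\<close>

lemma vol_orthonormal:
  assumes "orthonormal e0 e1 e2 e3"
  shows "vol [e0, e1, e2, e3] = 1 \<or> vol [e0, e1, e2, e3] = - 1"
proof -
  have e: "e0 \<in> V" "e1 \<in> V" "e2 \<in> V" "e3 \<in> V"
    "g e0 e0 = 1" "g e1 e1 = 1" "g e2 e2 = 1" "g e3 e3 = 1"
    "g e0 e1 = 0" "g e0 e2 = 0" "g e0 e3 = 0" "g e1 e2 = 0" "g e1 e3 = 0" "g e2 e3 = 0"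
    using assms by (simp_all add: orthonormal_def)
  then have sym: "g e1 e0 = 0" "g e2 e0 = 0" "g e3 e0 = 0" "g e2 e1 = 0" "g e3 e1 = 0" "g e3 e2 = 0"
    using g_commute by metis+
  obtain a b c s where s: "s = 1 \<or> s = -1" and abc: "a\<^sup>2 + b\<^sup>2 + c\<^sup>2 = 1" and
    J: "J e0 = comb 1 (comb 0 e0 a e1) 1 (comb b e2 c e3)"
    "J e1 = comb 1 (comb (- a) e0 0 e1) 1 (comb (s * c) e2 (- s * b) e3)"
    "J e2 = comb 1 (comb (- b) e0 (- s * c) e1) 1 (comb 0 e2 (s * a) e3)"
    "J e3 = comb 1 (comb (- c) e0 (s * b) e1) 1 (comb (- s * a) e2 0 e3)"
    using orthonormal_J_matrix[OF assms] by blast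
  have "vol [e0, e1, e2, e3] = of_real (s * (a\<^sup>2 + b\<^sup>2 + c\<^sup>2))"
    using e sym by (simp add: vol_eq wedge_2_2[OF omega_alt omega_alt] omega_eval J g_comb
        algebra_simps power2_eq_square)
  then show ?thesis using s abc by auto
qed

lemma vol_adapted: "orthonormal e0 (J e0) e2 (J e2) \<Longrightarrow> vol [e0, J e0, e2, J e2] = 1"
  using g_commute[of e0 e2] g_commute[of e0 "J e2"] g_commute[of "J e0" e2] g_commute[of "J e0" "J e2"]
  by (simp add: orthonormal_def vol_eq wedge_2_2[OF omega_alt omega_alt] omega_eval g_neg)

text \<open>The quotient of T by \<open>vol\<close>, read off in a chosen adapted frame, where
  \<open>vol\<close> has the value 1. As an evaluation it is linear for all functions T;
  \<open>top_coeff_eq\<close> shows that for 4-forms the choice does not matter.\<close>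

definition top_coeff :: "('a, 'e) cform \<Rightarrow> complex"
  where "top_coeff T = (let (e0, e2) = (SOME (e0, e2). orthonormal e0 (J e0) e2 (J e2)) in T [e0, J e0, e2, J e2])"

lemma top_coeff_eq:
  assumes "T \<in> alt 4"
  shows "T = (\<lambda>vs. top_coeff T * vol vs)"
proof -
  define p where "p = (SOME (e0, e2). orthonormal e0 (J e0) e2 (J e2))"
  obtain e0 e2 where p: "p = (e0, e2)" by force
  have "case p of (e0, e2) \<Rightarrow> orthonormal e0 (J e0) e2 (J e2)"
    unfolding p_def by (rule someI_ex) (use adapted_frame in auto)
  then have e: "orthonormal e0 (J e0) e2 (J e2)" by (simp add: p)
  have "top_coeff T = T [e0, J e0, e2, J e2]"
    unfolding top_coeff_def p_def[symmetric] p by simp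
  then show ?thesis
    using vol_adapted[OF e] by (intro alt_4_eqI[OF orthonormal_spanning[OF e] assms alt_forms_scale[OF vol_alt]]) simp
qed

lemma top_coeff_linear: "top_coeff (\<lambda>vs. a * S vs + b * T vs) = a * top_coeff S + b * top_coeff T"
  unfolding top_coeff_def by (simp add: case_prod_beta)

lemma top_coeff_eval: "T \<in> alt 4 \<Longrightarrow> T vs = top_coeff T * vol vs"
  using top_coeff_eq by metis

lemma top_coeff_scale_vol: "top_coeff (\<lambda>vs. c * vol vs) = c"
proof -
  obtain e0 e2 where e: "orthonormal e0 (J e0) e2 (J e2)" using adapted_frame by blast
  show ?thesis
    using top_coeff_eval[OF alt_forms_scale[OF vol_alt, of c], of "[e0, J e0, e2, J e2]"] vol_adapted[OF e] by simp
qed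

lemma alt_4_eq_adapted:
  assumes "orthonormal e0 (J e0) e2 (J e2)" "S \<in> alt 4" "T \<in> alt 4"
    "S [e0, J e0, e2, J e2] = T [e0, J e0, e2, J e2]"
  shows "S = T"
  using alt_4_eqI[OF orthonormal_spanning[OF assms(1)] assms(2-4)] .

section \<open>Types of forms\<close>

lemma tpart_outside: "\<not> (length vs = p + q \<and> set vs \<subseteq> V) \<Longrightarrow> tpart p q \<alpha> vs = 0"
  by (auto simp: tpart_def)

lemma tpart_0_0: "\<alpha> \<in> alt 0 \<Longrightarrow> tpart 0 0 \<alpha> = \<alpha>"
  by (auto simp: tpart_def fun_eq_iff type_part_Nil alt_formsD(1,2))

lemmas type_part_simps = type_part_Cons type_part_Nil One_nat_def numeral_2_eq_2 numeral_3_eq_3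

lemma tpart_1:
  assumes "\<alpha> \<in> alt 1" "v \<in> V"
  shows "tpart (Suc 0) 0 \<alpha> [v] = (\<alpha> [v] - \<i> * \<alpha> [J v]) / 2" "tpart 0 (Suc 0) \<alpha> [v] = (\<alpha> [v] + \<i> * \<alpha> [J v]) / 2"
  using assms(2) by (simp_all add: tpart_def type_part_simps alt_1[OF assms(1)] field_simps)

lemma tpart_2:
  assumes "\<alpha> \<in> alt 2" "u \<in> V" "v \<in> V"
  shows "tpart 2 0 \<alpha> [u, v] = (\<alpha> [u, v] - \<alpha> [J u, J v] - \<i> * (\<alpha> [J u, v] + \<alpha> [u, J v])) / 4"
    and "tpart (Suc 0) (Suc 0) \<alpha> [u, v] = (\<alpha> [u, v] + \<alpha> [J u, J v]) / 2"
    and "tpart 0 2 \<alpha> [u, v] = (\<alpha> [u, v] - \<alpha> [J u, J v] + \<i> * (\<alpha> [J u, v] + \<alpha> [u, J v])) / 4"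
  using assms(2,3) by (simp_all add: tpart_def type_part_simps alt_2[OF assms(1)] field_simps)

text \<open>This and \<open>J_cubic_3\<close> together say that the (3,0) and (0,3) components
  vanish, as there are only two complex dimensions. The left-hand side is itself alternating, so it
  suffices to compare on an adapted frame.\<close>

lemma J_quadratic_3:
  assumes a: "\<alpha> \<in> alt 3" and V: "u \<in> V" "v \<in> V" "w \<in> V"
  shows "\<alpha> [J u, J v, w] + \<alpha> [J u, v, J w] + \<alpha> [u, J v, J w] = \<alpha> [u, v, w]"
proof -
  define Q where "Q vs = (if length vs = 3 \<and> set vs \<subseteq> V then
    \<alpha> [J (vs ! 0), J (vs ! 1), vs ! 2] + \<alpha> [J (vs ! 0), vs ! 1, J (vs ! 2)] + \<alpha> [vs ! 0, J (vs ! 1), J (vs ! 2)] else 0)" for vs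
  have Q: "Q [u, v, w] = \<alpha> [J u, J v, w] + \<alpha> [J u, v, J w] + \<alpha> [u, J v, J w]"
    if "u \<in> V" "v \<in> V" "w \<in> V" for u v w
    using that by (simp add: Q_def numeral_2_eq_2)
  note simps = Q alt_3[OF a]
  have "Q \<in> alt 3"
  proof (rule alt_forms_3I)
    show "Q vs = 0" if "\<not> (length vs = 3 \<and> set vs \<subseteq> V)" for vs using that by (auto simp: Q_def)
    show "Q [comb p u q v, w, x] = of_real p * Q [u, w, x] + of_real q * Q [v, w, x]"
      if "u \<in> V" "v \<in> V" "w \<in> V" "x \<in> V" for p u q v w x
      using that by (simp add: simps algebra_simps)
    fix u v w assume V: "u \<in> V" "v \<in> V" "w \<in> V"
    show "Q [u, v, w] = - Q [v, u, w]"
      using V alt_3_swap(1)[OF a, of "J u" "J v" w] alt_3_swap(1)[OF a, of "J u" "v" "J w"]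
        alt_3_swap(1)[OF a, of u "J v" "J w"] by (simp add: simps)
    show "Q [u, v, w] = - Q [u, w, v]"
      using V alt_3_swap(2)[OF a, of "J v" w "J u"] alt_3_swap(2)[OF a, of v "J w" "J u"]
        alt_3_swap(2)[OF a, of "J v" "J w" u] by (simp add: simps)
  qed auto
  moreover obtain e0 e2 where e: "orthonormal e0 (J e0) e2 (J e2)" using adapted_frame by blast
  moreover from e have V': "e0 \<in> V" "e2 \<in> V" by (auto simp: orthonormal_def)
  \<comment> \<open>Every triple from an adapted frame contains a pair e, J e. Only the term in
    which J acts on exactly this pair survives, and there J rotates the pair, which leaves the value
    unchanged.\<close>
  ultimately have "Q = \<alpha>"
    using a alt_3_swap[OF a, of e0 "J e0"] alt_3_swap[OF a, of e2 "J e2"] alt_3_swap[OF a, of e0 e2]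
    by (intro alt_3_eqI[OF orthonormal_spanning[OF e]]) (simp_all add: simps)
  then show ?thesis using Q[OF V] by simp
qed

lemma J_cubic_3:
  assumes a: "\<alpha> \<in> alt 3" and V: "u \<in> V" "v \<in> V" "w \<in> V"
  shows "\<alpha> [J u, J v, J w] = \<alpha> [J u, v, w] + \<alpha> [u, J v, w] + \<alpha> [u, v, J w]"
  using J_quadratic_3[OF a, of "J u" v w] V by (simp add: alt_3[OF a] algebra_simps)

lemma tpart_3:
  assumes "\<alpha> \<in> alt 3" "u \<in> V" "v \<in> V" "w \<in> V"
  shows "tpart 2 (Suc 0) \<alpha> [u, v, w] = (\<alpha> [u, v, w] - \<i> * (\<alpha> [J u, v, w] + \<alpha> [u, J v, w] + \<alpha> [u, v, J w])) / 2"
    and "tpart (Suc 0) 2 \<alpha> [u, v, w] = (\<alpha> [u, v, w] + \<i> * (\<alpha> [J u, v, w] + \<alpha> [u, J v, w] + \<alpha> [u, v, J w])) / 2"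
    and "tpart 3 0 \<alpha> [u, v, w] = 0" "tpart 0 3 \<alpha> [u, v, w] = 0"
proof -
  have *: "\<alpha> [J u, J v, w] = \<alpha> [u, v, w] - \<alpha> [J u, v, J w] - \<alpha> [u, J v, J w]"
    using J_quadratic_3[OF assms] by (simp add: algebra_simps)
  show "tpart 2 (Suc 0) \<alpha> [u, v, w] = (\<alpha> [u, v, w] - \<i> * (\<alpha> [J u, v, w] + \<alpha> [u, J v, w] + \<alpha> [u, v, J w])) / 2"
    and "tpart (Suc 0) 2 \<alpha> [u, v, w] = (\<alpha> [u, v, w] + \<i> * (\<alpha> [J u, v, w] + \<alpha> [u, J v, w] + \<alpha> [u, v, J w])) / 2"
    and "tpart 3 0 \<alpha> [u, v, w] = 0" "tpart 0 3 \<alpha> [u, v, w] = 0"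
    using assms(2-)
    by (simp_all add: tpart_def type_part_simps alt_3[OF assms(1)] J_cubic_3[OF assms] * field_simps)
qed

text \<open>J acts on top forms as a derivation, that is, by multiplication with its trace, and the
  trace of J is zero.\<close>

lemma J_linear_4:
  assumes a: "T \<in> alt 4" and V: "u \<in> V" "v \<in> V" "w \<in> V" "x \<in> V"
  shows "T [J u, v, w, x] + T [u, J v, w, x] + T [u, v, J w, x] + T [u, v, w, J x] = 0"
proof -
  define Q where "Q vs = (if length vs = 4 \<and> set vs \<subseteq> V then
    (case vs of [u, v, w, x] \<Rightarrow> T [J u, v, w, x] + T [u, J v, w, x] + T [u, v, J w, x] + T [u, v, w, J x]) else 0)" for vs
  have Q: "Q [u, v, w, x] = T [J u, v, w, x] + T [u, J v, w, x] + T [u, v, J w, x] + T [u, v, w, J x]"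
    if "u \<in> V" "v \<in> V" "w \<in> V" "x \<in> V" for u v w x
    using that by (simp add: Q_def)
  note simps = Q alt_4[OF a]
  have "Q \<in> alt 4"
  proof (rule alt_forms_4I)
    show "Q vs = 0" if "\<not> (length vs = 4 \<and> set vs \<subseteq> V)" for vs using that by (auto simp: Q_def)
    show "Q [comb p u q v, w, x, y] = of_real p * Q [u, w, x, y] + of_real q * Q [v, w, x, y]"
      if "u \<in> V" "v \<in> V" "w \<in> V" "x \<in> V" "y \<in> V" for p u q v w x y
      using that by (simp add: simps algebra_simps)
    fix u v w x assume V: "u \<in> V" "v \<in> V" "w \<in> V" "x \<in> V"
    show "Q [u, v, w, x] = - Q [v, u, w, x]"
      using V alt_4_swap(1)[OF a, of "J u" v w x] alt_4_swap(1)[OF a, of u "J v" w x]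
        alt_4_swap(1)[OF a, of u v "J w" x] alt_4_swap(1)[OF a, of u v w "J x"] by (simp add: simps)
    show "Q [u, v, w, x] = - Q [u, w, v, x]"
      using V alt_4_swap(2)[OF a, of v w "J u" x] alt_4_swap(2)[OF a, of "J v" w u x]
        alt_4_swap(2)[OF a, of v "J w" u x] alt_4_swap(2)[OF a, of v w u "J x"] by (simp add: simps)
    show "Q [u, v, w, x] = - Q [u, v, x, w]"
      using V alt_4_swap(3)[OF a, of w x "J u" v] alt_4_swap(3)[OF a, of w x u "J v"]
        alt_4_swap(3)[OF a, of "J w" x u v] alt_4_swap(3)[OF a, of w "J x" u v] by (simp add: simps)
  qed auto
  moreover obtain e0 e2 where e: "orthonormal e0 (J e0) e2 (J e2)" using adapted_frame by blast
  moreover from e have V': "e0 \<in> V" "e2 \<in> V" by (auto simp: orthonormal_def)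
  ultimately have "Q = (\<lambda>vs. 0)"
    by (intro alt_4_eqI[OF orthonormal_spanning[OF e] _ alt_forms_zero]) (simp_all add: simps)
  then show ?thesis using Q[OF V] by simp
qed

text \<open>The linear identity is used four times, each time with J already applied to one slot.
  The sum of the four instances counts each pair of slots twice.\<close>

lemma J_quadratic_4:
  assumes a: "T \<in> alt 4" and V: "u \<in> V" "v \<in> V" "w \<in> V" "x \<in> V"
  shows "T [J u, J v, w, x] + T [J u, v, J w, x] + T [J u, v, w, J x]
    + T [u, J v, J w, x] + T [u, J v, w, J x] + T [u, v, J w, J x] = 2 * T [u, v, w, x]"
proof -
  have *: "T [J u, J v, w, x] + T [J u, v, J w, x] + T [J u, v, w, J x] = T [u, v, w, x]"
    "T [J u, J v, w, x] + T [u, J v, J w, x] + T [u, J v, w, J x] = T [u, v, w, x]"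
    "T [J u, v, J w, x] + T [u, J v, J w, x] + T [u, v, J w, J x] = T [u, v, w, x]"
    "T [J u, v, w, J x] + T [u, J v, w, J x] + T [u, v, J w, J x] = T [u, v, w, x]"
    using J_linear_4[OF a, of "J u" v w x] J_linear_4[OF a, of u "J v" w x]
      J_linear_4[OF a, of u v "J w" x] J_linear_4[OF a, of u v w "J x"] V
    by (simp_all add: alt_4[OF a] algebra_simps)
  have "2 * (T [J u, J v, w, x] + T [J u, v, J w, x] + T [J u, v, w, J x]
    + T [u, J v, J w, x] + T [u, J v, w, J x] + T [u, v, J w, J x]) =
    (T [J u, J v, w, x] + T [J u, v, J w, x] + T [J u, v, w, J x])
    + (T [J u, J v, w, x] + T [u, J v, J w, x] + T [u, J v, w, J x])
    + (T [J u, v, J w, x] + T [u, J v, J w, x] + T [u, v, J w, J x])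
    + (T [J u, v, w, J x] + T [u, J v, w, J x] + T [u, v, J w, J x])" by (simp add: algebra_simps)
  also have "\<dots> = 2 * (2 * T [u, v, w, x])" unfolding * by simp
  finally show ?thesis unfolding mult_cancel_left by simp
qed

text \<open>This is det J = 1, obtained from the quadratic identity with J applied to the first two
  slots.\<close>

lemma J_quartic_4:
  assumes a: "T \<in> alt 4" and V: "u \<in> V" "v \<in> V" "w \<in> V" "x \<in> V"
  shows "T [J u, J v, J w, J x] = T [u, v, w, x]"
proof -
  have *: "T [J u, J v, w, x] + T [J u, v, J w, x] + T [J u, v, w, J x] = T [u, v, w, x]"
    "T [J u, J v, w, x] + T [u, J v, J w, x] + T [u, J v, w, J x] = T [u, v, w, x]"
    using J_linear_4[OF a, of "J u" v w x] J_linear_4[OF a, of u "J v" w x] V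
    by (simp_all add: alt_4[OF a] algebra_simps)
  have "T [J u, J v, J w, J x] - T [u, J v, w, J x] - T [u, J v, J w, x]
      - T [J u, v, w, J x] - T [J u, v, J w, x] + T [u, v, w, x] = 2 * T [J u, J v, w, x]"
    using J_quadratic_4[OF a, of "J u" "J v" w x] V by (simp add: alt_4[OF a] algebra_simps)
  then have "T [J u, J v, J w, J x] + T [u, v, w, x] =
    (T [J u, J v, w, x] + T [J u, v, J w, x] + T [J u, v, w, J x])
    + (T [J u, J v, w, x] + T [u, J v, J w, x] + T [u, J v, w, J x])" by (simp add: algebra_simps)
  then show ?thesis unfolding * by simp
qed

lemma J_cubic_4:
  assumes a: "T \<in> alt 4" and V: "u \<in> V" "v \<in> V" "w \<in> V" "x \<in> V"
  shows "T [u, J v, J w, J x] + T [J u, v, J w, J x] + T [J u, J v, w, J x] + T [J u, J v, J w, x] = 0"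
proof -
  have "- T [u, J v, J w, J x] + (- T [J u, v, J w, J x]) + (- T [J u, J v, w, J x]) + (- T [J u, J v, J w, x]) = 0"
    using J_linear_4[OF a, of "J u" "J v" "J w" "J x"] V by (simp add: alt_4[OF a] del: add_uminus_conv_diff)
  then have "- (T [u, J v, J w, J x] + T [J u, v, J w, J x] + T [J u, J v, w, J x] + T [J u, J v, J w, x]) = 0"
    by (simp only: minus_add_distrib)
  then show ?thesis by (simp only: neg_equal_0_iff_equal)
qed

text \<open>Top forms are multiples of \<omega> \<and> \<omega> and so have type (2,2). In the
  computation the identities of degrees 1 to 4 in J eliminate all values with J in some
  slot.\<close>

lemma tpart_4:
  assumes "T \<in> alt 4" "u \<in> V" "v \<in> V" "w \<in> V" "x \<in> V"
  shows "tpart 2 2 T [u, v, w, x] = T [u, v, w, x]"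
    and "tpart 3 (Suc 0) T [u, v, w, x] = 0" "tpart (Suc 0) 3 T [u, v, w, x] = 0"
    and "tpart 4 0 T [u, v, w, x] = 0" "tpart 0 4 T [u, v, w, x] = 0"
proof -
  have *: "T [J u, J v, w, x] = 2 * T [u, v, w, x] - T [J u, v, J w, x] - T [J u, v, w, J x]
    - T [u, J v, J w, x] - T [u, J v, w, J x] - T [u, v, J w, J x]"
    using J_quadratic_4[OF assms] by (simp add: algebra_simps)
  have **: "T [J u, v, w, x] = - T [u, J v, w, x] - T [u, v, J w, x] - T [u, v, w, J x]"
    using J_linear_4[OF assms] by algebra
  have ***: "T [u, J v, J w, J x] = - T [J u, v, J w, J x] - T [J u, J v, w, J x] - T [J u, J v, J w, x]"
    using J_cubic_4[OF assms] by algebra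
  show "tpart 2 2 T [u, v, w, x] = T [u, v, w, x]"
    and "tpart 3 (Suc 0) T [u, v, w, x] = 0" "tpart (Suc 0) 3 T [u, v, w, x] = 0"
    and "tpart 4 0 T [u, v, w, x] = 0" "tpart 0 4 T [u, v, w, x] = 0"
    using assms(2-)
    by (simp_all add: tpart_def type_part_simps eval_nat_numeral(2) alt_4[OF assms(1)]
      J_quartic_4[OF assms] field_simps) (simp_all add: * ** *** algebra_simps)
qed

lemma tpart_1_alt:
  assumes "\<alpha> \<in> alt 1"
  shows "tpart (Suc 0) 0 \<alpha> \<in> alt 1" "tpart 0 (Suc 0) \<alpha> \<in> alt 1"
proof -
  note simps = tpart_1[OF assms] alt_1[OF assms]
  have "tpart (Suc 0) 0 \<alpha> [comb a u b v] = of_real a * tpart (Suc 0) 0 \<alpha> [u] + of_real b * tpart (Suc 0) 0 \<alpha> [v]"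
    "tpart 0 (Suc 0) \<alpha> [comb a u b v] = of_real a * tpart 0 (Suc 0) \<alpha> [u] + of_real b * tpart 0 (Suc 0) \<alpha> [v]"
    if "u \<in> V" "v \<in> V" for a b u v
    using that by (simp_all add: simps field_simps)
  note lin = this
  show "tpart (Suc 0) 0 \<alpha> \<in> alt 1"
  proof (rule alt_forms_1I)
    show "tpart (Suc 0) 0 \<alpha> vs = 0" if "\<not> (length vs = 1 \<and> set vs \<subseteq> V)" for vs
      using that by (intro tpart_outside) simp
  qed (rule lin(1))
  show "tpart 0 (Suc 0) \<alpha> \<in> alt 1"
  proof (rule alt_forms_1I)
    show "tpart 0 (Suc 0) \<alpha> vs = 0" if "\<not> (length vs = 1 \<and> set vs \<subseteq> V)" for vs
      using that by (intro tpart_outside) simp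
  qed (rule lin(2))
qed

lemma tpart_2_alt:
  assumes a: "\<alpha> \<in> alt 2"
  shows "tpart 2 0 \<alpha> \<in> alt 2" "tpart (Suc 0) (Suc 0) \<alpha> \<in> alt 2" "tpart 0 2 \<alpha> \<in> alt 2"
proof -
  note simps = tpart_2[OF a] alt_2[OF a]
  have sw: "\<alpha> [v, u] = - \<alpha> [u, v]" "\<alpha> [J v, J u] = - \<alpha> [J u, J v]" "\<alpha> [J v, u] = - \<alpha> [u, J v]" "\<alpha> [v, J u] = - \<alpha> [J u, v]"
    if "u \<in> V" "v \<in> V" for u v
    using that by (intro alt_2_swap[OF a]; simp)+
  show "tpart 2 0 \<alpha> \<in> alt 2"
  proof (rule alt_forms_2I)
    show "tpart 2 0 \<alpha> vs = 0" if "\<not> (length vs = 2 \<and> set vs \<subseteq> V)" for vs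
      using that by (intro tpart_outside) simp
    show "tpart 2 0 \<alpha> [comb p u q v, w] = of_real p * tpart 2 0 \<alpha> [u, w] + of_real q * tpart 2 0 \<alpha> [v, w]"
      if "u \<in> V" "v \<in> V" "w \<in> V" for p u q v w
      using that by (simp add: simps field_simps)
    show "tpart 2 0 \<alpha> [u, v] = - tpart 2 0 \<alpha> [v, u]" if "u \<in> V" "v \<in> V" for u v
      using that by (simp add: simps sw[of u v] field_simps)
  qed auto
  show "tpart (Suc 0) (Suc 0) \<alpha> \<in> alt 2"
  proof (rule alt_forms_2I)
    show "tpart (Suc 0) (Suc 0) \<alpha> vs = 0" if "\<not> (length vs = 2 \<and> set vs \<subseteq> V)" for vs
      using that by (intro tpart_outside) simp
    show "tpart (Suc 0) (Suc 0) \<alpha> [u, v] = - tpart (Suc 0) (Suc 0) \<alpha> [v, u]" if "u \<in> V" "v \<in> V" for u v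
      using that by (simp add: simps sw[of u v] field_simps)
    show "tpart (Suc 0) (Suc 0) \<alpha> [comb p u q v, w] = of_real p * tpart (Suc 0) (Suc 0) \<alpha> [u, w] + of_real q * tpart (Suc 0) (Suc 0) \<alpha> [v, w]"
      if "u \<in> V" "v \<in> V" "w \<in> V" for p u q v w
      using that by (simp add: simps field_simps)
  qed auto
  show "tpart 0 2 \<alpha> \<in> alt 2"
  proof (rule alt_forms_2I)
    show "tpart 0 2 \<alpha> vs = 0" if "\<not> (length vs = 2 \<and> set vs \<subseteq> V)" for vs
      using that by (intro tpart_outside) simp
    show "tpart 0 2 \<alpha> [comb p u q v, w] = of_real p * tpart 0 2 \<alpha> [u, w] + of_real q * tpart 0 2 \<alpha> [v, w]"
      if "u \<in> V" "v \<in> V" "w \<in> V" for p u q v w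
      using that by (simp add: simps field_simps)
    show "tpart 0 2 \<alpha> [u, v] = - tpart 0 2 \<alpha> [v, u]" if "u \<in> V" "v \<in> V" for u v
      using that by (simp add: simps sw[of u v] field_simps)
  qed auto
qed

lemma tpart_3_alt:
  assumes a: "\<alpha> \<in> alt 3"
  shows "tpart 2 (Suc 0) \<alpha> \<in> alt 3" "tpart (Suc 0) 2 \<alpha> \<in> alt 3"
proof -
  note simps = tpart_3[OF a] alt_3[OF a]
  have lin: "tpart 2 (Suc 0) \<alpha> [comb p u q v, w, x] = of_real p * tpart 2 (Suc 0) \<alpha> [u, w, x] + of_real q * tpart 2 (Suc 0) \<alpha> [v, w, x]"
      "tpart (Suc 0) 2 \<alpha> [comb p u q v, w, x] = of_real p * tpart (Suc 0) 2 \<alpha> [u, w, x] + of_real q * tpart (Suc 0) 2 \<alpha> [v, w, x]"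
    if "u \<in> V" "v \<in> V" "w \<in> V" "x \<in> V" for p u q v w x
    using that by (simp_all add: simps field_simps)
  have sw1: "tpart 2 (Suc 0) \<alpha> [u, v, w] = - tpart 2 (Suc 0) \<alpha> [v, u, w]" "tpart (Suc 0) 2 \<alpha> [u, v, w] = - tpart (Suc 0) 2 \<alpha> [v, u, w]"
    if "u \<in> V" "v \<in> V" "w \<in> V" for u v w
    using that alt_3_swap(1)[OF a, of u v w] alt_3_swap(1)[OF a, of "J u" v w] alt_3_swap(1)[OF a, of u "J v" w]
      alt_3_swap(1)[OF a, of u v "J w"] by (simp_all add: simps field_simps)
  have sw2: "tpart 2 (Suc 0) \<alpha> [u, v, w] = - tpart 2 (Suc 0) \<alpha> [u, w, v]" "tpart (Suc 0) 2 \<alpha> [u, v, w] = - tpart (Suc 0) 2 \<alpha> [u, w, v]"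
    if "u \<in> V" "v \<in> V" "w \<in> V" for u v w
    using that alt_3_swap(2)[OF a, of v w u] alt_3_swap(2)[OF a, of "J v" w u] alt_3_swap(2)[OF a, of v "J w" u]
      alt_3_swap(2)[OF a, of v w "J u"] by (simp_all add: simps field_simps)
  show "tpart 2 (Suc 0) \<alpha> \<in> alt 3"
    by (rule alt_forms_3I) (auto intro!: tpart_outside lin sw1 sw2)
  show "tpart (Suc 0) 2 \<alpha> \<in> alt 3"
    by (rule alt_forms_3I) (auto intro!: tpart_outside lin sw1 sw2)
qed

lemma tpart_3_zero:
  assumes "\<alpha> \<in> alt 3"
  shows "tpart 3 0 \<alpha> = (\<lambda>vs. 0)" "tpart 0 3 \<alpha> = (\<lambda>vs. 0)"
proof -
  show "tpart 3 0 \<alpha> = (\<lambda>vs. 0)"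
  proof
    show "tpart 3 0 \<alpha> vs = 0" for vs
      by (cases "length vs = 3 \<and> set vs \<subseteq> V") (auto simp: length_eq_lists tpart_3[OF assms] tpart_outside)
  qed
  show "tpart 0 3 \<alpha> = (\<lambda>vs. 0)"
  proof
    show "tpart 0 3 \<alpha> vs = 0" for vs
      by (cases "length vs = 3 \<and> set vs \<subseteq> V") (auto simp: length_eq_lists tpart_3[OF assms] tpart_outside)
  qed
qed

lemma tpart_4_cases:
  assumes "T \<in> alt 4"
  shows "tpart 2 2 T = T" "tpart 4 0 T = (\<lambda>vs. 0)" "tpart 3 (Suc 0) T = (\<lambda>vs. 0)"
    "tpart (Suc 0) 3 T = (\<lambda>vs. 0)" "tpart 0 4 T = (\<lambda>vs. 0)"
proof -
  have "tpart 2 2 T vs = T vs \<and> tpart 4 0 T vs = 0 \<and> tpart 3 (Suc 0) T vs = 0 \<and> tpart (Suc 0) 3 T vs = 0 \<and> tpart 0 4 T vs = 0" for vs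
  proof (cases "length vs = 4 \<and> set vs \<subseteq> V")
    case True
    then show ?thesis by (auto simp: length_eq_lists tpart_4[OF assms])
  next
    case False
    then show ?thesis using alt_formsD(1,2)[OF assms, of vs] by (auto simp: tpart_outside)
  qed
  then show "tpart 2 2 T = T" "tpart 4 0 T = (\<lambda>vs. 0)" "tpart 3 (Suc 0) T = (\<lambda>vs. 0)"
    "tpart (Suc 0) 3 T = (\<lambda>vs. 0)" "tpart 0 4 T = (\<lambda>vs. 0)" by auto
qed

text \<open>J is real, so conjugation exchanges the spaces of (1,0) and (0,1) vectors. This later
  exchanges del with delbar and halves many arguments.\<close>

lemma tpart_cnj:
  shows "\<alpha> \<in> alt 1 \<Longrightarrow> tpart (Suc 0) 0 (\<lambda>vs. cnj (\<alpha> vs)) = (\<lambda>vs. cnj (tpart 0 (Suc 0) \<alpha> vs))"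
    and "\<alpha> \<in> alt 1 \<Longrightarrow> tpart 0 (Suc 0) (\<lambda>vs. cnj (\<alpha> vs)) = (\<lambda>vs. cnj (tpart (Suc 0) 0 \<alpha> vs))"
    and "\<beta> \<in> alt 2 \<Longrightarrow> tpart 2 0 (\<lambda>vs. cnj (\<beta> vs)) = (\<lambda>vs. cnj (tpart 0 2 \<beta> vs))"
    and "\<beta> \<in> alt 2 \<Longrightarrow> tpart (Suc 0) (Suc 0) (\<lambda>vs. cnj (\<beta> vs)) = (\<lambda>vs. cnj (tpart (Suc 0) (Suc 0) \<beta> vs))"
    and "\<beta> \<in> alt 2 \<Longrightarrow> tpart 0 2 (\<lambda>vs. cnj (\<beta> vs)) = (\<lambda>vs. cnj (tpart 2 0 \<beta> vs))"
    and "\<gamma> \<in> alt 3 \<Longrightarrow> tpart 2 (Suc 0) (\<lambda>vs. cnj (\<gamma> vs)) = (\<lambda>vs. cnj (tpart (Suc 0) 2 \<gamma> vs))"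
    and "\<gamma> \<in> alt 3 \<Longrightarrow> tpart (Suc 0) 2 (\<lambda>vs. cnj (\<gamma> vs)) = (\<lambda>vs. cnj (tpart 2 (Suc 0) \<gamma> vs))"
proof -
  have ext: "tpart p q (\<lambda>vs. cnj (\<alpha> vs)) = (\<lambda>vs. cnj (tpart q p \<alpha> vs))"
    if "\<And>vs. length vs = p + q \<Longrightarrow> set vs \<subseteq> V \<Longrightarrow> tpart p q (\<lambda>vs. cnj (\<alpha> vs)) vs = cnj (tpart q p \<alpha> vs)" for p q \<alpha>
  proof
    fix vs
    show "tpart p q (\<lambda>vs. cnj (\<alpha> vs)) vs = cnj (tpart q p \<alpha> vs)"
      using that[of vs] tpart_outside[of vs p q] tpart_outside[of vs q p] by (cases "length vs = p + q \<and> set vs \<subseteq> V") auto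
  qed
  show "\<alpha> \<in> alt 1 \<Longrightarrow> tpart (Suc 0) 0 (\<lambda>vs. cnj (\<alpha> vs)) = (\<lambda>vs. cnj (tpart 0 (Suc 0) \<alpha> vs))"
    and "\<alpha> \<in> alt 1 \<Longrightarrow> tpart 0 (Suc 0) (\<lambda>vs. cnj (\<alpha> vs)) = (\<lambda>vs. cnj (tpart (Suc 0) 0 \<alpha> vs))"
    using alt_forms_cnj[of \<alpha> V 1] by (intro ext; force simp: length_Suc_conv tpart_1)+
  show "\<beta> \<in> alt 2 \<Longrightarrow> tpart 2 0 (\<lambda>vs. cnj (\<beta> vs)) = (\<lambda>vs. cnj (tpart 0 2 \<beta> vs))"
    and "\<beta> \<in> alt 2 \<Longrightarrow> tpart (Suc 0) (Suc 0) (\<lambda>vs. cnj (\<beta> vs)) = (\<lambda>vs. cnj (tpart (Suc 0) (Suc 0) \<beta> vs))"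
    and "\<beta> \<in> alt 2 \<Longrightarrow> tpart 0 2 (\<lambda>vs. cnj (\<beta> vs)) = (\<lambda>vs. cnj (tpart 2 0 \<beta> vs))"
    using alt_forms_cnj[of \<beta> V 2] by (intro ext; force simp: length_Suc_conv numeral_2_eq_2 tpart_2[unfolded numeral_2_eq_2])+
  show "\<gamma> \<in> alt 3 \<Longrightarrow> tpart 2 (Suc 0) (\<lambda>vs. cnj (\<gamma> vs)) = (\<lambda>vs. cnj (tpart (Suc 0) 2 \<gamma> vs))"
    and "\<gamma> \<in> alt 3 \<Longrightarrow> tpart (Suc 0) 2 (\<lambda>vs. cnj (\<gamma> vs)) = (\<lambda>vs. cnj (tpart 2 (Suc 0) \<gamma> vs))"
    using alt_forms_cnj[of \<gamma> V 3]
    by (intro ext; force simp: length_Suc_conv numeral_2_eq_2 numeral_3_eq_3 tpart_3[unfolded numeral_2_eq_2 numeral_3_eq_3])+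
qed

text \<open>A top form has type (2,2), so a factor of type (1,0) meets only the (1,2) part of the
  other one. The projection can thus be moved across the wedge, which reduces integration by parts
  for del and delbar to that for d.\<close>

lemma wedge_tpart_1_3:
  assumes a: "\<alpha> \<in> alt 1" and c: "\<gamma> \<in> alt 3"
  shows "wedge (tpart (Suc 0) 0 \<alpha>) \<gamma> = wedge \<alpha> (tpart (Suc 0) 2 \<gamma>)"
    and "wedge (tpart 0 (Suc 0) \<alpha>) \<gamma> = wedge \<alpha> (tpart 2 (Suc 0) \<gamma>)"
proof -
  obtain e0 e2 where e: "orthonormal e0 (J e0) e2 (J e2)" using adapted_frame by blast
  then have V: "e0 \<in> V" "e2 \<in> V" by (auto simp: orthonormal_def)
  note simps = tpart_1[OF a] tpart_3[OF c] alt_1[OF a] alt_3[OF c] V alt_3_swap[OF c, of e0 "J e0"] alt_3_swap[OF c, of e2 "J e2"]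
    alt_3_swap[OF c, of e0 e2]
  show "wedge (tpart (Suc 0) 0 \<alpha>) \<gamma> = wedge \<alpha> (tpart (Suc 0) 2 \<gamma>)"
    by (rule alt_4_eq_adapted[OF e wedge_1_3_alt[OF tpart_1_alt(1)[OF a] c] wedge_1_3_alt[OF a tpart_3_alt(2)[OF c]]],
        unfold wedge_1_3[OF tpart_1_alt(1)[OF a] c] wedge_1_3[OF a tpart_3_alt(2)[OF c]]) (simp add: simps field_simps)
  show "wedge (tpart 0 (Suc 0) \<alpha>) \<gamma> = wedge \<alpha> (tpart 2 (Suc 0) \<gamma>)"
    by (rule alt_4_eq_adapted[OF e wedge_1_3_alt[OF tpart_1_alt(2)[OF a] c] wedge_1_3_alt[OF a tpart_3_alt(1)[OF c]]],
        unfold wedge_1_3[OF tpart_1_alt(2)[OF a] c] wedge_1_3[OF a tpart_3_alt(1)[OF c]]) (simp add: simps field_simps)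
qed

lemma wedge_tpart_2_2:
  assumes a: "\<alpha> \<in> alt 2" and c: "\<gamma> \<in> alt 2"
  shows "wedge (tpart 2 0 \<alpha>) \<gamma> = wedge \<alpha> (tpart 0 2 \<gamma>)"
    and "wedge (tpart (Suc 0) (Suc 0) \<alpha>) \<gamma> = wedge \<alpha> (tpart (Suc 0) (Suc 0) \<gamma>)"
    and "wedge (tpart 0 2 \<alpha>) \<gamma> = wedge \<alpha> (tpart 2 0 \<gamma>)"
proof -
  obtain e0 e2 where e: "orthonormal e0 (J e0) e2 (J e2)" using adapted_frame by blast
  then have V: "e0 \<in> V" "e2 \<in> V" by (auto simp: orthonormal_def)
  note simps = tpart_2[OF a] tpart_2[OF c] alt_2[OF a] alt_2[OF c] V alt_2_swap[OF c, of e0 "J e0"] alt_2_swap[OF c, of e2 "J e2"]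
    alt_2_swap[OF a, of e0 "J e0"] alt_2_swap[OF a, of e2 "J e2"]
  note ta = tpart_2_alt[OF a] and tc = tpart_2_alt[OF c]
  show "wedge (tpart 2 0 \<alpha>) \<gamma> = wedge \<alpha> (tpart 0 2 \<gamma>)"
    by (rule alt_4_eq_adapted[OF e wedge_2_2_alt[OF ta(1) c] wedge_2_2_alt[OF a tc(3)]],
        unfold wedge_2_2[OF ta(1) c] wedge_2_2[OF a tc(3)]) (simp add: simps field_simps)
  show "wedge (tpart (Suc 0) (Suc 0) \<alpha>) \<gamma> = wedge \<alpha> (tpart (Suc 0) (Suc 0) \<gamma>)"
    by (rule alt_4_eq_adapted[OF e wedge_2_2_alt[OF ta(2) c] wedge_2_2_alt[OF a tc(2)]],
        unfold wedge_2_2[OF ta(2) c] wedge_2_2[OF a tc(2)]) (simp add: simps field_simps)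
  show "wedge (tpart 0 2 \<alpha>) \<gamma> = wedge \<alpha> (tpart 2 0 \<gamma>)"
    by (rule alt_4_eq_adapted[OF e wedge_2_2_alt[OF ta(3) c] wedge_2_2_alt[OF a tc(1)]],
        unfold wedge_2_2[OF ta(3) c] wedge_2_2[OF a tc(1)]) (simp add: simps field_simps)
qed

text \<open>\<omega> has type (1,1), so wedging with it raises both indices by one and commutes with
  the projections.\<close>

lemma tpart_wedge_omega:
  assumes a: "\<alpha> \<in> alt 1"
  shows "tpart (Suc 0) 2 (wedge \<alpha> omega) = wedge (tpart 0 (Suc 0) \<alpha>) omega"
    and "tpart 2 (Suc 0) (wedge \<alpha> omega) = wedge (tpart (Suc 0) 0 \<alpha>) omega"
proof -
  obtain e0 e2 where e: "orthonormal e0 (J e0) e2 (J e2)" using adapted_frame by blast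
  then have V: "e0 \<in> V" "e2 \<in> V" by (auto simp: orthonormal_def)
  note w = wedge_1_2_alt[OF a omega_alt]
  have o: "omega [e0, J e0] = 1" "omega [e0, e2] = 0" "omega [e0, J e2] = 0" "omega [J e0, e2] = 0"
    "omega [J e0, J e2] = 0" "omega [e2, J e2] = 1"
    using e by (auto simp: orthonormal_def omega_eval g_neg g_J_swap[of e0 "J e2"])
  note simps = tpart_1[OF a] tpart_3[OF w] alt_1[OF a] alt_3[OF w] wedge_1_2[OF a omega_alt] alt_2[OF omega_alt] V o
    alt_2_swap[OF omega_alt, of e0 "J e0"] alt_2_swap[OF omega_alt, of e2 "J e2"]
  show "tpart (Suc 0) 2 (wedge \<alpha> omega) = wedge (tpart 0 (Suc 0) \<alpha>) omega"
    by (rule alt_3_eqI[OF orthonormal_spanning[OF e] tpart_3_alt(2)[OF w] wedge_1_2_alt[OF tpart_1_alt(2)[OF a] omega_alt]];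
        unfold wedge_1_2[OF tpart_1_alt(2)[OF a] omega_alt]; simp add: simps field_simps)
  show "tpart 2 (Suc 0) (wedge \<alpha> omega) = wedge (tpart (Suc 0) 0 \<alpha>) omega"
    by (rule alt_3_eqI[OF orthonormal_spanning[OF e] tpart_3_alt(1)[OF w] wedge_1_2_alt[OF tpart_1_alt(1)[OF a] omega_alt]];
        unfold wedge_1_2[OF tpart_1_alt(1)[OF a] omega_alt]; simp add: simps field_simps)
qed

lemma form_J_eval: "v \<in> V \<Longrightarrow> form_J \<alpha> [v] = \<alpha> [J v]" "u \<in> V \<Longrightarrow> v \<in> V \<Longrightarrow> form_J \<alpha> [u, v] = \<alpha> [J u, J v]"
  by (simp_all add: form_J_def)

lemma form_J_outside: "\<alpha> \<in> alt k \<Longrightarrow> \<not> (length vs = k \<and> set vs \<subseteq> V) \<Longrightarrow> form_J \<alpha> vs = 0"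
  using alt_formsD(1)[of \<alpha> V k "map J vs"] by (auto simp: form_J_def)

lemma form_J_1_alt:
  assumes "\<alpha> \<in> alt 1"
  shows "form_J \<alpha> \<in> alt 1"
proof (rule alt_forms_1I)
  show "form_J \<alpha> vs = 0" if "\<not> (length vs = 1 \<and> set vs \<subseteq> V)" for vs
    using form_J_outside[OF assms that] .
qed (simp add: form_J_eval alt_1[OF assms])

lemma form_J_2_alt:
  assumes "\<alpha> \<in> alt 2"
  shows "form_J \<alpha> \<in> alt 2"
proof (rule alt_forms_2I)
  show "form_J \<alpha> vs = 0" if "\<not> (length vs = 2 \<and> set vs \<subseteq> V)" for vs
    using form_J_outside[OF assms that] .
  show "form_J \<alpha> [u, v] = - form_J \<alpha> [v, u]" if "u \<in> V" "v \<in> V" for u v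
    using alt_2_swap[OF assms, of "J u" "J v"] that by (simp add: form_J_eval)
qed (simp_all add: form_J_eval alt_2[OF assms])

section \<open>The Hodge star\<close>

definition flat :: "('a, 'e) tvec \<Rightarrow> ('a, 'e) cform"
  where "flat v us = (if length us = 1 \<and> set us \<subseteq> V then of_real (g v (hd us)) else 0)"

lemma flat_eval: "u \<in> V \<Longrightarrow> flat v [u] = of_real (g v u)"
  by (simp add: flat_def)

lemma flat_alt: "v \<in> V \<Longrightarrow> flat v \<in> alt 1"
  by (rule alt_forms_1I) (auto simp: flat_def g_linear_right)

definition star_0 :: "('a, 'e) cform \<Rightarrow> ('a, 'e) cform"
  where "star_0 \<alpha> vs = \<alpha> [] * vol vs"

text \<open>A formula for the star in terms of J and \<omega>. No frame occurs in it, which makes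
  the smoothness of the star of a smooth 1-form immediate.\<close>

definition star_1 :: "('a, 'e) cform \<Rightarrow> ('a, 'e) cform"
  where "star_1 \<alpha> vs = - wedge (form_J \<alpha>) omega vs"

text \<open>\<open>form_J\<close> is the identity on type (1,1) and minus the identity on types
  (2,0) and (0,2). The formula therefore fixes (2,0), (0,2) and multiples of \<omega>, and changes
  the sign of primitive (1,1)-forms.\<close>

definition star_2 :: "('a, 'e) cform \<Rightarrow> ('a, 'e) cform"
  where "star_2 \<alpha> vs = - form_J \<alpha> vs + top_coeff (wedge \<alpha> omega) * omega vs"

text \<open>For a vector v, the 4-form flat v \<and> star star \<gamma> is (star \<gamma>)(v) times
  the volume; as star star = -1 in degree 3, this reads off star \<gamma> from flat v \<and>
  \<gamma>, with a minus sign.\<close>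

definition star_3 :: "('a, 'e) cform \<Rightarrow> ('a, 'e) cform"
  where "star_3 \<alpha> vs = (if length vs = 1 \<and> set vs \<subseteq> V then - top_coeff (wedge (flat (hd vs)) \<alpha>) else 0)"

definition star_4 :: "('a, 'e) cform \<Rightarrow> ('a, 'e) cform"
  where "star_4 \<alpha> vs = (if vs = [] then top_coeff \<alpha> else 0)"

lemma star_0_alt: "star_0 \<alpha> \<in> alt 4"
  unfolding star_0_def[abs_def] by (rule alt_forms_scale[OF vol_alt])

lemma star_1_alt: "\<alpha> \<in> alt 1 \<Longrightarrow> star_1 \<alpha> \<in> alt 3"
  using alt_forms_scale[OF wedge_1_2_alt[OF form_J_1_alt omega_alt], of \<alpha> "-1"]
  by (simp add: star_1_def[abs_def])

lemma star_2_alt: "\<alpha> \<in> alt 2 \<Longrightarrow> star_2 \<alpha> \<in> alt 2"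
  using alt_forms_linear[OF form_J_2_alt omega_alt, of \<alpha> "-1" "top_coeff (wedge \<alpha> omega)"]
  by (simp add: star_2_def[abs_def])

lemma star_3_alt:
  assumes a: "\<alpha> \<in> alt 3"
  shows "star_3 \<alpha> \<in> alt 1"
proof (rule alt_forms_1I)
  fix p q u v assume uv: "u \<in> V" "v \<in> V"
  have "wedge (flat (comb p u q v)) \<alpha> = (\<lambda>vs. of_real p * wedge (flat u) \<alpha> vs + of_real q * wedge (flat v) \<alpha> vs)"
  proof -
    have "flat (comb p u q v) = (\<lambda>us. of_real p * flat u us + of_real q * flat v us)"
    proof
      fix us
      show "flat (comb p u q v) us = of_real p * flat u us + of_real q * flat v us"
        using uv by (cases us) (auto simp: flat_def g_comb)
    qed
    then show ?thesis by (simp add: wedge_def fun_eq_iff sum_distrib_left sum.distrib[symmetric] algebra_simps)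
  qed
  then show "star_3 \<alpha> [comb p u q v] = of_real p * star_3 \<alpha> [u] + of_real q * star_3 \<alpha> [v]"
    using uv by (simp add: star_3_def top_coeff_linear)
qed (auto simp: star_3_def)

lemma star_4_alt: "star_4 \<alpha> \<in> alt 0"
  unfolding star_4_def[abs_def] by (rule alt_forms_0I)

text \<open>The usual table of the Hodge star, with \<epsilon> the orientation sign of the frame. It
  links the frame-free formulas to the definition of the star by inner products.\<close>

lemma star_components:
  assumes "orthonormal e0 e1 e2 e3"
  defines "\<epsilon> \<equiv> vol [e0, e1, e2, e3]"
  shows "\<alpha> \<in> alt 1 \<Longrightarrow> star_1 \<alpha> [e1, e2, e3] = \<epsilon> * \<alpha> [e0] \<and> star_1 \<alpha> [e0, e2, e3] = - \<epsilon> * \<alpha> [e1] \<and>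
      star_1 \<alpha> [e0, e1, e3] = \<epsilon> * \<alpha> [e2] \<and> star_1 \<alpha> [e0, e1, e2] = - \<epsilon> * \<alpha> [e3]"
    and "\<beta> \<in> alt 2 \<Longrightarrow> star_2 \<beta> [e0, e1] = \<epsilon> * \<beta> [e2, e3] \<and> star_2 \<beta> [e0, e2] = - \<epsilon> * \<beta> [e1, e3] \<and>
      star_2 \<beta> [e0, e3] = \<epsilon> * \<beta> [e1, e2] \<and> star_2 \<beta> [e1, e2] = \<epsilon> * \<beta> [e0, e3] \<and>
      star_2 \<beta> [e1, e3] = - \<epsilon> * \<beta> [e0, e2] \<and> star_2 \<beta> [e2, e3] = \<epsilon> * \<beta> [e0, e1]"
    and "\<gamma> \<in> alt 3 \<Longrightarrow> star_3 \<gamma> [e0] = - \<epsilon> * \<gamma> [e1, e2, e3] \<and> star_3 \<gamma> [e1] = \<epsilon> * \<gamma> [e0, e2, e3] \<and>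
      star_3 \<gamma> [e2] = - \<epsilon> * \<gamma> [e0, e1, e3] \<and> star_3 \<gamma> [e3] = \<epsilon> * \<gamma> [e0, e1, e2]"
    and "T \<in> alt 4 \<Longrightarrow> top_coeff T = \<epsilon> * T [e0, e1, e2, e3]"
    and "\<epsilon> * \<epsilon> = 1"
proof -
  have e: "e0 \<in> V" "e1 \<in> V" "e2 \<in> V" "e3 \<in> V"
    "g e0 e0 = 1" "g e1 e1 = 1" "g e2 e2 = 1" "g e3 e3 = 1"
    "g e0 e1 = 0" "g e0 e2 = 0" "g e0 e3 = 0" "g e1 e2 = 0" "g e1 e3 = 0" "g e2 e3 = 0"
    using assms by (simp_all add: orthonormal_def)
  then have sym: "g e1 e0 = 0" "g e2 e0 = 0" "g e3 e0 = 0" "g e2 e1 = 0" "g e3 e1 = 0" "g e3 e2 = 0"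
    using g_commute by metis+
  have "\<epsilon> = 1 \<or> \<epsilon> = - 1" using vol_orthonormal[OF assms(1)] by (simp add: \<epsilon>_def)
  then show \<epsilon>2: "\<epsilon> * \<epsilon> = 1" by auto
  have top: "top_coeff T = \<epsilon> * T [e0, e1, e2, e3]" if "T \<in> alt 4" for T
    using top_coeff_eval[OF that, of "[e0, e1, e2, e3]"] \<open>\<epsilon> = 1 \<or> \<epsilon> = - 1\<close> by (auto simp: \<epsilon>_def)
  then show "T \<in> alt 4 \<Longrightarrow> top_coeff T = \<epsilon> * T [e0, e1, e2, e3]" .
  obtain a b c s where s: "s = 1 \<or> s = -1" and abc: "a\<^sup>2 + b\<^sup>2 + c\<^sup>2 = 1" and
    J: "J e0 = comb 1 (comb 0 e0 a e1) 1 (comb b e2 c e3)"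
    "J e1 = comb 1 (comb (- a) e0 0 e1) 1 (comb (s * c) e2 (- s * b) e3)"
    "J e2 = comb 1 (comb (- b) e0 (- s * c) e1) 1 (comb 0 e2 (s * a) e3)"
    "J e3 = comb 1 (comb (- c) e0 (s * b) e1) 1 (comb (- s * a) e2 0 e3)"
    using orthonormal_J_matrix[OF assms(1)] by blast
  have "\<epsilon> = of_real (s * (a\<^sup>2 + b\<^sup>2 + c\<^sup>2))"
    using e sym by (simp add: \<epsilon>_def vol_eq wedge_2_2[OF omega_alt omega_alt] omega_eval J g_comb
        algebra_simps power2_eq_square)
  then have \<epsilon>: "\<epsilon> = of_real s" using abc by simp
  have "of_real (a * a + b * b + c * c) = (1 :: complex)" using abc by (simp add: power2_eq_square)
  \<comment> \<open>The relation a^2 + b^2 + c^2 = 1 as a rewrite rule for the square of c;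
    \<open>ccx\<close> is its version for right-nested products.\<close>
  then have cc: "of_real c * of_real c = 1 - of_real a * of_real a - (of_real b * of_real b :: complex)"
    by (simp add: algebra_simps)
  then have ccx: "of_real c * (of_real c * x) = (1 - of_real a * of_real a - of_real b * of_real b) * x" for x :: complex
    by (simp flip: mult.assoc)
  have o: "omega [e0, e1] = of_real a" "omega [e0, e2] = of_real b" "omega [e0, e3] = of_real c"
    "omega [e1, e2] = of_real (s * c)" "omega [e1, e3] = of_real (- s * b)" "omega [e2, e3] = of_real (s * a)"
    using e sym by (simp_all add: omega_eval J g_comb)
  show "star_1 \<alpha> [e1, e2, e3] = \<epsilon> * \<alpha> [e0] \<and> star_1 \<alpha> [e0, e2, e3] = - \<epsilon> * \<alpha> [e1] \<and>
      star_1 \<alpha> [e0, e1, e3] = \<epsilon> * \<alpha> [e2] \<and> star_1 \<alpha> [e0, e1, e2] = - \<epsilon> * \<alpha> [e3]" if "\<alpha> \<in> alt 1"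
  proof -
    note simps = star_1_def wedge_1_2[OF form_J_1_alt[OF that] omega_alt] o form_J_eval J alt_1[OF that] e \<epsilon>
    show ?thesis using s by (elim disjE) (simp_all add: simps algebra_simps cc ccx)
  qed
  show "star_2 \<beta> [e0, e1] = \<epsilon> * \<beta> [e2, e3] \<and> star_2 \<beta> [e0, e2] = - \<epsilon> * \<beta> [e1, e3] \<and>
      star_2 \<beta> [e0, e3] = \<epsilon> * \<beta> [e1, e2] \<and> star_2 \<beta> [e1, e2] = \<epsilon> * \<beta> [e0, e3] \<and>
      star_2 \<beta> [e1, e3] = - \<epsilon> * \<beta> [e0, e2] \<and> star_2 \<beta> [e2, e3] = \<epsilon> * \<beta> [e0, e1]" if "\<beta> \<in> alt 2"
  proof -
    note swaps = alt_2_swap[OF that e(1,2)] alt_2_swap[OF that e(1,3)] alt_2_swap[OF that e(1,4)]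
      alt_2_swap[OF that e(2,3)] alt_2_swap[OF that e(2,4)] alt_2_swap[OF that e(3,4)]
    note simps = star_2_def top[OF wedge_2_2_alt[OF that omega_alt]] wedge_2_2[OF that omega_alt] o form_J_eval J
      alt_2[OF that] swaps e \<epsilon>
    show ?thesis using s by (elim disjE) (simp_all add: simps algebra_simps cc ccx)
  qed
  show "star_3 \<gamma> [e0] = - \<epsilon> * \<gamma> [e1, e2, e3] \<and> star_3 \<gamma> [e1] = \<epsilon> * \<gamma> [e0, e2, e3] \<and>
      star_3 \<gamma> [e2] = - \<epsilon> * \<gamma> [e0, e1, e3] \<and> star_3 \<gamma> [e3] = \<epsilon> * \<gamma> [e0, e1, e2]" if "\<gamma> \<in> alt 3"
    using e sym by (simp add: star_3_def top[OF wedge_1_3_alt[OF flat_alt that]] wedge_1_3[OF flat_alt that] flat_eval)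
qed

definition inner :: "nat \<Rightarrow> ('a, 'e) tvec list \<Rightarrow> ('a, 'e) cform \<Rightarrow> ('a, 'e) cform \<Rightarrow> complex"
  where "inner k es \<alpha> \<beta> = subset_sum k (\<lambda>vs. \<alpha> vs * cnj (\<beta> vs)) es"

lemma inner_eval:
  "inner 0 es \<alpha> \<beta> = \<alpha> [] * cnj (\<beta> [])"
  "inner 1 [e0, e1, e2, e3] \<alpha> \<beta> = \<alpha> [e0] * cnj (\<beta> [e0]) + \<alpha> [e1] * cnj (\<beta> [e1])
    + \<alpha> [e2] * cnj (\<beta> [e2]) + \<alpha> [e3] * cnj (\<beta> [e3])"
  "inner 2 [e0, e1, e2, e3] \<alpha> \<beta> = \<alpha> [e0, e1] * cnj (\<beta> [e0, e1]) + \<alpha> [e0, e2] * cnj (\<beta> [e0, e2])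
    + \<alpha> [e0, e3] * cnj (\<beta> [e0, e3]) + \<alpha> [e1, e2] * cnj (\<beta> [e1, e2]) + \<alpha> [e1, e3] * cnj (\<beta> [e1, e3])
    + \<alpha> [e2, e3] * cnj (\<beta> [e2, e3])"
  "inner 3 [e0, e1, e2, e3] \<alpha> \<beta> = \<alpha> [e0, e1, e2] * cnj (\<beta> [e0, e1, e2])
    + \<alpha> [e0, e1, e3] * cnj (\<beta> [e0, e1, e3]) + \<alpha> [e0, e2, e3] * cnj (\<beta> [e0, e2, e3])
    + \<alpha> [e1, e2, e3] * cnj (\<beta> [e1, e2, e3])"
  "inner 4 [e0, e1, e2, e3] \<alpha> \<beta> = \<alpha> [e0, e1, e2, e3] * cnj (\<beta> [e0, e1, e2, e3])"
  by (simp_all add: inner_def subset_sum_0 subset_sum_Cons subset_sum_Nil numeral_eq_Suc)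

text \<open>The condition under the definite description in \<open>hodge_star\<close>, at a point
  and for a given frame.\<close>

definition is_star :: "nat \<Rightarrow> ('a, 'e) tvec list \<Rightarrow> ('a, 'e) cform \<Rightarrow> ('a, 'e) cform \<Rightarrow> bool"
  where "is_star k es \<eta> \<zeta> \<longleftrightarrow> \<zeta> \<in> alt (4 - k) \<and>
    (\<forall>\<alpha>\<in>alt k. wedge \<alpha> \<zeta> = (\<lambda>us. inner k es \<alpha> (\<lambda>ws. cnj (\<eta> ws)) * vol us))"

lemma is_star:
  assumes "orthonormal e0 e1 e2 e3"
  shows "\<eta> \<in> alt 0 \<Longrightarrow> is_star 0 [e0, e1, e2, e3] \<eta> (star_0 \<eta>)"
    and "\<eta> \<in> alt 1 \<Longrightarrow> is_star 1 [e0, e1, e2, e3] \<eta> (star_1 \<eta>)"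
    and "\<eta> \<in> alt 2 \<Longrightarrow> is_star 2 [e0, e1, e2, e3] \<eta> (star_2 \<eta>)"
    and "\<eta> \<in> alt 3 \<Longrightarrow> is_star 3 [e0, e1, e2, e3] \<eta> (star_3 \<eta>)"
    and "\<eta> \<in> alt 4 \<Longrightarrow> is_star 4 [e0, e1, e2, e3] \<eta> (star_4 \<eta>)"
proof -
  note sp = orthonormal_spanning[OF assms] and comp = star_components[OF assms]
  show "is_star 0 [e0, e1, e2, e3] \<eta> (star_0 \<eta>)" if "\<eta> \<in> alt 0"
    using star_0_alt
    by (simp add: is_star_def inner_eval star_0_def fun_eq_iff wedge_degree_0_left alt_formsD(1))
  show "is_star 1 [e0, e1, e2, e3] \<eta> (star_1 \<eta>)" if "\<eta> \<in> alt 1"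
    unfolding is_star_def
  proof (intro conjI ballI)
    show "star_1 \<eta> \<in> alt (4 - 1)" using star_1_alt[OF that] by simp
    fix \<alpha> assume \<alpha>: "\<alpha> \<in> alt 1"
    show "wedge \<alpha> (star_1 \<eta>) = (\<lambda>us. inner 1 [e0, e1, e2, e3] \<alpha> (\<lambda>ws. cnj (\<eta> ws)) * vol us)"
      by (rule alt_4_eqI[OF sp wedge_1_3_alt[OF \<alpha> star_1_alt[OF that]] alt_forms_scale[OF vol_alt]])
        (simp add: wedge_1_3[OF \<alpha> star_1_alt[OF that]] inner_eval[unfolded One_nat_def] comp(1)[OF that] algebra_simps)
  qed
  show "is_star 2 [e0, e1, e2, e3] \<eta> (star_2 \<eta>)" if "\<eta> \<in> alt 2"
    unfolding is_star_def
  proof (intro conjI ballI)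
    show "star_2 \<eta> \<in> alt (4 - 2)" using star_2_alt[OF that] by simp
    fix \<alpha> assume \<alpha>: "\<alpha> \<in> alt 2"
    show "wedge \<alpha> (star_2 \<eta>) = (\<lambda>us. inner 2 [e0, e1, e2, e3] \<alpha> (\<lambda>ws. cnj (\<eta> ws)) * vol us)"
      by (rule alt_4_eqI[OF sp wedge_2_2_alt[OF \<alpha> star_2_alt[OF that]] alt_forms_scale[OF vol_alt]])
        (simp add: wedge_2_2[OF \<alpha> star_2_alt[OF that]] inner_eval comp(2)[OF that] algebra_simps)
  qed
  show "is_star 3 [e0, e1, e2, e3] \<eta> (star_3 \<eta>)" if "\<eta> \<in> alt 3"
    unfolding is_star_def
  proof (intro conjI ballI)
    show "star_3 \<eta> \<in> alt (4 - 3)" using star_3_alt[OF that] by simp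
    fix \<alpha> assume \<alpha>: "\<alpha> \<in> alt 3"
    have al: "wedge \<alpha> (star_3 \<eta>) \<in> alt 4"
      using alt_forms_scale[OF wedge_1_3_alt[OF star_3_alt[OF that] \<alpha>], of "-1"]
      by (simp add: wedge_commute_1_3[OF star_3_alt[OF that] \<alpha>])
    show "wedge \<alpha> (star_3 \<eta>) = (\<lambda>us. inner 3 [e0, e1, e2, e3] \<alpha> (\<lambda>ws. cnj (\<eta> ws)) * vol us)"
      by (rule alt_4_eqI[OF sp al alt_forms_scale[OF vol_alt]])
        (simp add: wedge_3_1[OF \<alpha> star_3_alt[OF that]] inner_eval comp(3)[OF that] algebra_simps)
  qed
  show "is_star 4 [e0, e1, e2, e3] \<eta> (star_4 \<eta>)" if "\<eta> \<in> alt 4"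
    unfolding is_star_def
  proof (intro conjI ballI)
    show "star_4 \<eta> \<in> alt (4 - 4)" using star_4_alt by simp
    fix \<alpha> assume \<alpha>: "\<alpha> \<in> alt 4"
    have w: "wedge \<alpha> (star_4 \<eta>) = (\<lambda>us. top_coeff \<eta> * \<alpha> us)"
      by (simp add: fun_eq_iff wedge_degree_0_right star_4_def)
    show "wedge \<alpha> (star_4 \<eta>) = (\<lambda>us. inner 4 [e0, e1, e2, e3] \<alpha> (\<lambda>ws. cnj (\<eta> ws)) * vol us)"
      unfolding w
      by (rule alt_4_eqI[OF sp alt_forms_scale[OF \<alpha>] alt_forms_scale[OF vol_alt]])
        (simp add: inner_eval comp(4)[OF that])
  qed
qed

text \<open>In an orthonormal frame the pairing of a form with itself is the sum of the squared
  moduli of its components, and these determine the form.\<close>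

lemma inner_self:
  assumes "orthonormal e0 e1 e2 e3" "\<alpha> \<in> alt k" "k \<le> 4"
  shows "\<exists>r\<ge>0. inner k [e0, e1, e2, e3] \<alpha> \<alpha> = of_real r"
    and "inner k [e0, e1, e2, e3] \<alpha> \<alpha> = 0 \<Longrightarrow> \<alpha> = (\<lambda>vs. 0)"
proof -
  note sp = orthonormal_spanning[OF assms(1)]
  consider "k = 0" | "k = 1" | "k = 2" | "k = 3" | "k = 4" using assms(3) by linarith
  then have "(\<exists>r\<ge>0. inner k [e0, e1, e2, e3] \<alpha> \<alpha> = of_real r) \<and> (inner k [e0, e1, e2, e3] \<alpha> \<alpha> = 0 \<longrightarrow> \<alpha> = (\<lambda>vs. 0))"
    (is "?A k \<and> (?B k \<longrightarrow> _)")
  proof cases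
    case 1
    have "\<alpha> = (\<lambda>vs. 0)" if "\<alpha> [] = 0"
    proof
      show "\<alpha> vs = 0" for vs using that alt_formsD(1)[OF assms(2)] 1 by (cases vs) auto
    qed
    then show ?thesis using 1 by (auto simp: inner_eval complex_norm_square[symmetric] simp del: of_real_power)
  next
    case 2
    have eq: "inner k [e0, e1, e2, e3] \<alpha> \<alpha> =
        of_real ((cmod (\<alpha> [e0]))\<^sup>2 + (cmod (\<alpha> [e1]))\<^sup>2 + (cmod (\<alpha> [e2]))\<^sup>2 + (cmod (\<alpha> [e3]))\<^sup>2)"
      unfolding 2 by (simp only: inner_eval complex_norm_square of_real_add)
    have "\<alpha> = (\<lambda>vs. 0)" if "?B k"
    proof -
      have "(cmod (\<alpha> [e0]))\<^sup>2 = 0 \<and> (cmod (\<alpha> [e1]))\<^sup>2 = 0 \<and> (cmod (\<alpha> [e2]))\<^sup>2 = 0 \<and> (cmod (\<alpha> [e3]))\<^sup>2 = 0"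
        using that[unfolded eq of_real_eq_0_iff]
          zero_le_power2[of "cmod (\<alpha> [e0])"] zero_le_power2[of "cmod (\<alpha> [e1])"] zero_le_power2[of "cmod (\<alpha> [e2])"] zero_le_power2[of "cmod (\<alpha> [e3])"]
        by (intro conjI; linarith)
      then show ?thesis using assms(2) 2 by (intro alt_1_eqI[OF sp _ alt_forms_zero]) auto
    qed
    moreover have "?A k" unfolding eq by (rule exI, rule conjI[OF _ refl]) simp
    ultimately show ?thesis by blast
  next
    case 3
    have eq: "inner k [e0, e1, e2, e3] \<alpha> \<alpha> =
        of_real ((cmod (\<alpha> [e0, e1]))\<^sup>2 + (cmod (\<alpha> [e0, e2]))\<^sup>2 + (cmod (\<alpha> [e0, e3]))\<^sup>2
          + (cmod (\<alpha> [e1, e2]))\<^sup>2 + (cmod (\<alpha> [e1, e3]))\<^sup>2 + (cmod (\<alpha> [e2, e3]))\<^sup>2)"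
      unfolding 3 by (simp only: inner_eval complex_norm_square of_real_add)
    have "\<alpha> = (\<lambda>vs. 0)" if "?B k"
    proof -
      have "(cmod (\<alpha> [e0, e1]))\<^sup>2 = 0 \<and> (cmod (\<alpha> [e0, e2]))\<^sup>2 = 0 \<and> (cmod (\<alpha> [e0, e3]))\<^sup>2 = 0 \<and> (cmod (\<alpha> [e1, e2]))\<^sup>2 = 0 \<and> (cmod (\<alpha> [e1, e3]))\<^sup>2 = 0 \<and> (cmod (\<alpha> [e2, e3]))\<^sup>2 = 0"
        using that[unfolded eq of_real_eq_0_iff]
          zero_le_power2[of "cmod (\<alpha> [e0, e1])"] zero_le_power2[of "cmod (\<alpha> [e0, e2])"] zero_le_power2[of "cmod (\<alpha> [e0, e3])"] zero_le_power2[of "cmod (\<alpha> [e1, e2])"] zero_le_power2[of "cmod (\<alpha> [e1, e3])"] zero_le_power2[of "cmod (\<alpha> [e2, e3])"]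
        by (intro conjI; linarith)
      then show ?thesis using assms(2) 3 by (intro alt_2_eqI[OF sp _ alt_forms_zero]) auto
    qed
    moreover have "?A k" unfolding eq by (rule exI, rule conjI[OF _ refl]) simp
    ultimately show ?thesis by blast
  next
    case 4
    have eq: "inner k [e0, e1, e2, e3] \<alpha> \<alpha> =
        of_real ((cmod (\<alpha> [e0, e1, e2]))\<^sup>2 + (cmod (\<alpha> [e0, e1, e3]))\<^sup>2 + (cmod (\<alpha> [e0, e2, e3]))\<^sup>2
          + (cmod (\<alpha> [e1, e2, e3]))\<^sup>2)"
      unfolding 4 by (simp only: inner_eval complex_norm_square of_real_add)
    have "\<alpha> = (\<lambda>vs. 0)" if "?B k"
    proof -
      have "(cmod (\<alpha> [e0, e1, e2]))\<^sup>2 = 0 \<and> (cmod (\<alpha> [e0, e1, e3]))\<^sup>2 = 0 \<and> (cmod (\<alpha> [e0, e2, e3]))\<^sup>2 = 0 \<and> (cmod (\<alpha> [e1, e2, e3]))\<^sup>2 = 0"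
        using that[unfolded eq of_real_eq_0_iff]
          zero_le_power2[of "cmod (\<alpha> [e0, e1, e2])"] zero_le_power2[of "cmod (\<alpha> [e0, e1, e3])"] zero_le_power2[of "cmod (\<alpha> [e0, e2, e3])"] zero_le_power2[of "cmod (\<alpha> [e1, e2, e3])"]
        by (intro conjI; linarith)
      then show ?thesis using assms(2) 4 by (intro alt_3_eqI[OF sp _ alt_forms_zero]) auto
    qed
    moreover have "?A k" unfolding eq by (rule exI, rule conjI[OF _ refl]) simp
    ultimately show ?thesis by blast
  next
    case 5
    have eq: "inner k [e0, e1, e2, e3] \<alpha> \<alpha> = of_real ((cmod (\<alpha> [e0, e1, e2, e3]))\<^sup>2)"
      unfolding 5 by (simp only: inner_eval complex_norm_square)
    have "\<alpha> = (\<lambda>vs. 0)" if "?B k"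
      using that[unfolded eq of_real_eq_0_iff] assms(2) 5
      by (intro alt_4_eqI[OF sp _ alt_forms_zero]) auto
    moreover have "?A k" unfolding eq by (rule exI, rule conjI[OF _ refl]) simp
    ultimately show ?thesis by blast
  qed
  then show "\<exists>r\<ge>0. inner k [e0, e1, e2, e3] \<alpha> \<alpha> = of_real r"
    and "inner k [e0, e1, e2, e3] \<alpha> \<alpha> = 0 \<Longrightarrow> \<alpha> = (\<lambda>vs. 0)" by auto
qed

end

lemma wedge_linear_right: "wedge \<alpha> (\<lambda>vs. a * \<beta> vs + b * \<gamma> vs) = (\<lambda>vs. a * wedge \<alpha> \<beta> vs + b * wedge \<alpha> \<gamma> vs)"
  by (simp add: wedge_def fun_eq_iff sum_distrib_left sum.distrib[symmetric] algebra_simps)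

lemma wedge_linear_left: "wedge (\<lambda>vs. a * \<beta> vs + b * \<gamma> vs) \<alpha> = (\<lambda>vs. a * wedge \<beta> \<alpha> vs + b * wedge \<gamma> \<alpha> vs)"
  by (simp add: wedge_def fun_eq_iff sum_distrib_left sum.distrib[symmetric] algebra_simps)

lemma wedge_cnj: "wedge (\<lambda>vs. cnj (\<alpha> vs)) (\<lambda>vs. cnj (\<beta> vs)) vs = cnj (wedge \<alpha> \<beta> vs)"
  by (simp add: wedge_def shuffle_sign_def)

section \<open>The star as one operator over all degrees\<close>

context hermitian4
begin

definition star :: "nat \<Rightarrow> ('a, 'e) cform \<Rightarrow> ('a, 'e) cform"
  where "star k = (if k = 0 then star_0 else if k = 1 then star_1 else if k = 2 then star_2
    else if k = 3 then star_3 else star_4)"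

lemma star_simps: "star 0 = star_0" "star (Suc 0) = star_1" "star 1 = star_1" "star 2 = star_2" "star 3 = star_3" "star 4 = star_4"
  by (simp_all add: star_def)

lemma degree_cases: "k \<le> 4 \<Longrightarrow> k = 0 \<or> k = 1 \<or> k = 2 \<or> k = 3 \<or> k = (4::nat)"
  by linarith

lemma is_star_star: "orthonormal e0 e1 e2 e3 \<Longrightarrow> k \<le> 4 \<Longrightarrow> \<eta> \<in> alt k \<Longrightarrow> is_star k [e0, e1, e2, e3] \<eta> (star k \<eta>)"
  using degree_cases[of k] is_star[of e0 e1 e2 e3 \<eta>] by (auto simp: star_def)

lemma star_alt: "k \<le> 4 \<Longrightarrow> \<eta> \<in> alt k \<Longrightarrow> star k \<eta> \<in> alt (4 - k)"
  using is_star_star adapted_frame unfolding is_star_def by blast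

lemma wedge_commute_top:
  assumes "k \<le> 4" "\<alpha> \<in> alt k" "\<beta> \<in> alt (4 - k)"
  shows "wedge \<beta> \<alpha> = (\<lambda>vs. (-1) ^ k * wedge \<alpha> \<beta> vs)"
  using degree_cases[OF assms(1)]
proof (elim disjE)
  assume "k = 0"
  then show ?thesis using assms by (simp add: fun_eq_iff wedge_degree_0_left wedge_degree_0_right alt_formsD(1))
next
  assume "k = 1"
  then show ?thesis using assms wedge_commute_1_3[of \<alpha> \<beta>] by simp
next
  assume "k = 2"
  then show ?thesis using assms wedge_commute_2_2[of \<alpha> \<beta>] by simp
next
  assume "k = 3"
  then show ?thesis using assms wedge_commute_1_3[of \<beta> \<alpha>] by (simp add: fun_eq_iff)
next
  assume "k = 4"
  then show ?thesis using assms by (simp add: fun_eq_iff wedge_degree_0_left wedge_degree_0_right alt_formsD(1))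
qed

lemma wedge_star_eq_inner:
  assumes "orthonormal e0 e1 e2 e3" "k \<le> 4" "\<alpha> \<in> alt k" "\<beta> \<in> alt k"
  shows "wedge \<alpha> (star k (\<lambda>vs. cnj (\<beta> vs))) = (\<lambda>us. inner k [e0, e1, e2, e3] \<alpha> \<beta> * vol us)"
  using is_star_star[OF assms(1,2) alt_forms_cnj[OF assms(4)]] assms(3) unfolding is_star_def by simp

lemma vol_nonzero: "orthonormal e0 e1 e2 e3 \<Longrightarrow> vol [e0, e1, e2, e3] \<noteq> 0"
  using vol_orthonormal[of e0 e1 e2 e3] by auto

text \<open>The wedge pairing between complementary degrees is nondegenerate. Uniqueness is what
  gives a meaning to the definite description in \<open>hodge_star\<close>.\<close>

lemma is_star_unique:
  assumes E: "orthonormal e0 e1 e2 e3" and "k \<le> 4"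
    and "is_star k [e0, e1, e2, e3] \<eta> \<zeta>" "is_star k [e0, e1, e2, e3] \<eta> \<zeta>'"
  shows "\<zeta> = \<zeta>'"
proof -
  let ?m = "4 - k"
  define \<delta> where "\<delta> = (\<lambda>vs. 1 * \<zeta> vs + (-1) * \<zeta>' vs)"
  have \<delta>: "\<delta> \<in> alt ?m"
    unfolding \<delta>_def by (rule alt_forms_linear) (use assms in \<open>auto simp: is_star_def\<close>)
  have m: "?m \<le> 4" "4 - ?m = k" using assms(2) by auto
  have 0: "wedge \<alpha> \<delta> = (\<lambda>vs. 0)" if "\<alpha> \<in> alt k" for \<alpha>
    unfolding \<delta>_def wedge_linear_right using assms that by (simp add: is_star_def)
  \<comment> \<open>The test form that turns the pairing with \<delta> into the squared norm of
    \<delta>.\<close>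
  define \<alpha> where "\<alpha> = star ?m (\<lambda>vs. cnj (\<delta> vs))"
  have \<alpha>: "\<alpha> \<in> alt k" using star_alt[OF m(1) alt_forms_cnj[OF \<delta>]] unfolding \<alpha>_def m(2) .
  have "wedge \<delta> \<alpha> = (\<lambda>us. inner ?m [e0, e1, e2, e3] \<delta> \<delta> * vol us)"
    unfolding \<alpha>_def by (rule wedge_star_eq_inner[OF E m(1) \<delta> \<delta>])
  moreover have "wedge \<delta> \<alpha> = (\<lambda>us. 0)"
    using wedge_commute_top[OF assms(2) \<alpha> \<delta>] 0[OF \<alpha>] by simp
  ultimately have "inner ?m [e0, e1, e2, e3] \<delta> \<delta> * vol [e0, e1, e2, e3] = 0" by metis
  then have "\<delta> = (\<lambda>vs. 0)" using vol_nonzero[OF E] inner_self(2)[OF E \<delta> m(1)] by simp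
  then show ?thesis by (auto simp: \<delta>_def fun_eq_iff)
qed

lemma top_coeff_star_self:
  assumes "k \<le> 4" "\<alpha> \<in> alt k"
  shows "\<exists>r\<ge>0. top_coeff (wedge \<alpha> (star k (\<lambda>vs. cnj (\<alpha> vs)))) = of_real r"
    and "top_coeff (wedge \<alpha> (star k (\<lambda>vs. cnj (\<alpha> vs)))) = 0 \<Longrightarrow> \<alpha> = (\<lambda>vs. 0)"
proof -
  obtain e0 e2 where e: "orthonormal e0 (J e0) e2 (J e2)" using adapted_frame by blast
  show "\<exists>r\<ge>0. top_coeff (wedge \<alpha> (star k (\<lambda>vs. cnj (\<alpha> vs)))) = of_real r"
    and "top_coeff (wedge \<alpha> (star k (\<lambda>vs. cnj (\<alpha> vs)))) = 0 \<Longrightarrow> \<alpha> = (\<lambda>vs. 0)"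
    unfolding wedge_star_eq_inner[OF e assms(1,2,2)] top_coeff_scale_vol
    using inner_self[OF e assms(2,1)] by auto
qed

lemma top_coeff_star_commute:
  assumes "k \<le> 4" "\<alpha> \<in> alt k" "\<beta> \<in> alt k"
  shows "top_coeff (wedge \<beta> (star k (\<lambda>vs. cnj (\<alpha> vs)))) = cnj (top_coeff (wedge \<alpha> (star k (\<lambda>vs. cnj (\<beta> vs)))))"
proof -
  obtain e0 e2 where e: "orthonormal e0 (J e0) e2 (J e2)" using adapted_frame by blast
  show ?thesis
    unfolding wedge_star_eq_inner[OF e assms(1,2,3)] wedge_star_eq_inner[OF e assms(1,3,2)] top_coeff_scale_vol
    by (simp add: inner_def subset_sum_def mult.commute)
qed

lemma star_star:
  assumes "k \<le> 4" "\<alpha> \<in> alt k"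
  shows "star (4 - k) (star k \<alpha>) = (\<lambda>vs. (-1) ^ k * \<alpha> vs)"
proof -
  obtain e0 e2 where e: "orthonormal e0 (J e0) e2 (J e2)" using adapted_frame by blast
  note sp = orthonormal_spanning[OF e] and comp = star_components[OF e] and vol = vol_adapted[OF e]
  show ?thesis
    using degree_cases[OF assms(1)]
  proof (elim disjE)
    assume k: "k = 0"
    then have "\<alpha> vs = 0" if "vs \<noteq> []" for vs using assms(2) alt_formsD(1)[of \<alpha> V 0 vs] that by auto
    then show ?thesis
      using k top_coeff_scale_vol[of "\<alpha> []"] by (auto simp: star_simps star_4_def star_0_def[abs_def])
  next
    assume k: "k = 1"
    then have a: "\<alpha> \<in> alt 1" using assms(2) by simp
    have "star_3 (star_1 \<alpha>) = (\<lambda>vs. (-1) * \<alpha> vs)"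
      by (rule alt_1_eqI[OF sp star_3_alt[OF star_1_alt[OF a]] alt_forms_scale[OF a]])
        (simp_all add: comp(3)[OF star_1_alt[OF a]] comp(1)[OF a] vol)
    then show ?thesis using k by (simp add: star_simps)
  next
    assume k: "k = 2"
    then have a: "\<alpha> \<in> alt 2" using assms(2) by simp
    have "star_2 (star_2 \<alpha>) = \<alpha>"
      by (rule alt_2_eqI[OF sp star_2_alt[OF star_2_alt[OF a]] a])
        (simp_all add: comp(2)[OF star_2_alt[OF a]] comp(2)[OF a] vol)
    then show ?thesis using k by (simp add: star_simps)
  next
    assume k: "k = 3"
    then have a: "\<alpha> \<in> alt 3" using assms(2) by simp
    have "star_1 (star_3 \<alpha>) = (\<lambda>vs. (-1) * \<alpha> vs)"
      by (rule alt_3_eqI[OF sp star_1_alt[OF star_3_alt[OF a]] alt_forms_scale[OF a]])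
        (simp_all add: comp(1)[OF star_3_alt[OF a]] comp(3)[OF a] vol)
    then show ?thesis using k by (simp add: star_simps)
  next
    assume k: "k = 4"
    then show ?thesis
      using top_coeff_eq[of \<alpha>] assms(2) by (simp add: star_simps star_0_def[abs_def] star_4_def)
  qed
qed

lemma omega_cnj: "cnj (omega vs) = omega vs"
  by (simp add: omega_def)

lemma vol_cnj: "cnj (vol vs) = vol vs"
  using wedge_cnj[of omega omega vs, symmetric] by (simp add: vol_eq omega_cnj)

lemma top_coeff_cnj: "top_coeff (\<lambda>vs. cnj (T vs)) = cnj (top_coeff T)"
  by (simp add: top_coeff_def case_prod_beta)

lemma star_cnj: "star k (\<lambda>vs. cnj (\<alpha> vs)) = (\<lambda>vs. cnj (star k \<alpha> vs))"
proof -
  have J: "form_J (\<lambda>vs. cnj (\<alpha> vs)) = (\<lambda>vs. cnj (form_J \<alpha> vs))" by (auto simp: form_J_def)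
  have w: "wedge (\<lambda>vs. cnj (\<beta> vs)) omega = (\<lambda>vs. cnj (wedge \<beta> omega vs))" for \<beta>
    using wedge_cnj[of \<beta> omega] by (simp add: omega_cnj fun_eq_iff)
  have f: "wedge (flat v) (\<lambda>vs. cnj (\<alpha> vs)) = (\<lambda>vs. cnj (wedge (flat v) \<alpha> vs))" for v
  proof -
    have "(\<lambda>vs. cnj (flat v vs)) = flat v" by (auto simp: flat_def)
    then show ?thesis using wedge_cnj[of "flat v" \<alpha>] by (simp add: fun_eq_iff)
  qed
  show ?thesis
    by (auto simp: star_def fun_eq_iff star_0_def star_1_def star_2_def star_3_def star_4_def
        vol_cnj J w f top_coeff_cnj omega_cnj)
qed

text \<open>Invariance under J is type (1,1), on which \<open>form_J\<close> is the identity. The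
  coefficient of \<omega> is the function h of the main argument.\<close>

lemma star_11:
  assumes "\<eta> \<in> alt 2" "\<And>u v. u \<in> V \<Longrightarrow> v \<in> V \<Longrightarrow> \<eta> [J u, J v] = \<eta> [u, v]"
  shows "star 2 \<eta> = (\<lambda>vs. top_coeff (wedge \<eta> omega) * omega vs - \<eta> vs)"
proof -
  have "form_J \<eta> vs = \<eta> vs" for vs
  proof (cases "length vs = 2 \<and> set vs \<subseteq> V")
    case True
    then show ?thesis using assms(2) by (auto simp: length_eq_lists form_J_eval)
  next
    case False
    then show ?thesis using form_J_outside[OF assms(1)] alt_formsD(1,2)[OF assms(1)] by auto
  qed
  then show ?thesis by (simp add: star_simps star_2_def[abs_def])
qed

lemma form_J_tpart_1:
  assumes "\<alpha> \<in> alt 1"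
  shows "form_J (tpart 0 (Suc 0) \<alpha>) = (\<lambda>vs. - \<i> * tpart 0 (Suc 0) \<alpha> vs)"
    and "form_J (tpart (Suc 0) 0 \<alpha>) = (\<lambda>vs. \<i> * tpart (Suc 0) 0 \<alpha> vs)"
proof -
  have "form_J (tpart 0 (Suc 0) \<alpha>) vs = - \<i> * tpart 0 (Suc 0) \<alpha> vs \<and>
      form_J (tpart (Suc 0) 0 \<alpha>) vs = \<i> * tpart (Suc 0) 0 \<alpha> vs" for vs
  proof (cases "length vs = 1 \<and> set vs \<subseteq> V")
    case True
    then show ?thesis
      by (auto simp: length_Suc_conv form_J_eval tpart_1[OF assms] alt_1[OF assms] field_simps)
  next
    case False
    then show ?thesis
      using form_J_outside[OF tpart_1_alt(1)[OF assms]] form_J_outside[OF tpart_1_alt(2)[OF assms]]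
      by (auto simp: tpart_outside)
  qed
  then show "form_J (tpart 0 (Suc 0) \<alpha>) = (\<lambda>vs. - \<i> * tpart 0 (Suc 0) \<alpha> vs)"
    and "form_J (tpart (Suc 0) 0 \<alpha>) = (\<lambda>vs. \<i> * tpart (Suc 0) 0 \<alpha> vs)" by auto
qed

text \<open>On type (0,1) composition with J is multiplication by -i, so the star becomes wedging
  with i \<omega>. This identifies the integral of conj \<beta> \<and> \<beta> \<and> \<omega> with
  the squared norm of \<beta>, up to a constant.\<close>

lemma star_1_tpart:
  assumes "\<alpha> \<in> alt 1"
  shows "star_1 (tpart 0 (Suc 0) \<alpha>) = (\<lambda>vs. \<i> * wedge (tpart 0 (Suc 0) \<alpha>) omega vs)"
    and "star_1 (tpart (Suc 0) 0 \<alpha>) = (\<lambda>vs. - \<i> * wedge (tpart (Suc 0) 0 \<alpha>) omega vs)"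
  unfolding star_1_def[abs_def] form_J_tpart_1[OF assms]
  using wedge_linear_left[of "- \<i>" "tpart 0 (Suc 0) \<alpha>" 0 "\<lambda>vs. 0" omega]
    wedge_linear_left[of "\<i>" "tpart (Suc 0) 0 \<alpha>" 0 "\<lambda>vs. 0" omega]
  by (simp_all add: fun_eq_iff)

lemma tpart_1_sum:
  assumes "\<alpha> \<in> alt 1"
  shows "tpart (Suc 0) 0 \<alpha> vs + tpart 0 (Suc 0) \<alpha> vs = \<alpha> vs"
proof (cases "length vs = 1 \<and> set vs \<subseteq> V")
  case True
  then show ?thesis by (auto simp: length_Suc_conv tpart_1[OF assms] field_simps)
next
  case False
  then show ?thesis using alt_formsD(1,2)[OF assms, of vs] by (auto simp: tpart_outside)
qed

lemma tpart_3_sum: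
  assumes "\<alpha> \<in> alt 3"
  shows "tpart 2 (Suc 0) \<alpha> vs + tpart (Suc 0) 2 \<alpha> vs = \<alpha> vs"
proof (cases "length vs = 3 \<and> set vs \<subseteq> V")
  case True
  then show ?thesis by (auto simp: length_eq_lists tpart_3[OF assms] field_simps)
next
  case False
  then show ?thesis using alt_formsD(1,2)[OF assms, of vs] by (auto simp: tpart_outside)
qed

lemma tpart_1_idem:
  assumes "\<alpha> \<in> alt 1"
  shows "tpart 0 (Suc 0) (tpart 0 (Suc 0) \<alpha>) = tpart 0 (Suc 0) \<alpha>"
    and "tpart (Suc 0) 0 (tpart (Suc 0) 0 \<alpha>) = tpart (Suc 0) 0 \<alpha>"
proof -
  have "tpart 0 (Suc 0) (tpart 0 (Suc 0) \<alpha>) vs = tpart 0 (Suc 0) \<alpha> vs \<and>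
      tpart (Suc 0) 0 (tpart (Suc 0) 0 \<alpha>) vs = tpart (Suc 0) 0 \<alpha> vs" for vs
    by (cases "length vs = 1 \<and> set vs \<subseteq> V")
      (auto simp: length_Suc_conv tpart_1[OF assms] tpart_1[OF tpart_1_alt(1)[OF assms]]
        tpart_1[OF tpart_1_alt(2)[OF assms]] alt_1[OF assms] tpart_outside field_simps)
  then show "tpart 0 (Suc 0) (tpart 0 (Suc 0) \<alpha>) = tpart 0 (Suc 0) \<alpha>"
    and "tpart (Suc 0) 0 (tpart (Suc 0) 0 \<alpha>) = tpart (Suc 0) 0 \<alpha>" by auto
qed

lemma tpart_2_invariant:
  assumes "\<eta> \<in> alt 2" "\<And>u v. u \<in> V \<Longrightarrow> v \<in> V \<Longrightarrow> \<eta> [J u, J v] = \<eta> [u, v]"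
  shows "tpart (Suc 0) (Suc 0) \<eta> = \<eta>" "tpart 2 0 \<eta> = (\<lambda>vs. 0)" "tpart 0 2 \<eta> = (\<lambda>vs. 0)"
proof -
  have *: "\<eta> [J u, v] = - \<eta> [u, J v]" if "u \<in> V" "v \<in> V" for u v
    using assms(2)[of "J u" v] that by (simp add: alt_2[OF assms(1)])
  have "tpart (Suc 0) (Suc 0) \<eta> vs = \<eta> vs \<and> tpart 2 0 \<eta> vs = 0 \<and> tpart 0 2 \<eta> vs = 0" for vs
  proof (cases "length vs = 2 \<and> set vs \<subseteq> V")
    case True
    then show ?thesis
      by (auto simp: length_eq_lists tpart_2[OF assms(1)] assms(2) * alt_2[OF assms(1)])
  next
    case False
    then show ?thesis using alt_formsD(1,2)[OF assms(1), of vs] by (auto simp: tpart_outside)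
  qed
  then show "tpart (Suc 0) (Suc 0) \<eta> = \<eta>" "tpart 2 0 \<eta> = (\<lambda>vs. 0)" "tpart 0 2 \<eta> = (\<lambda>vs. 0)" by auto
qed

text \<open>The two pure evaluations differ only in the sign of an i-multiple. Their vanishing for
  all u and v gives invariance under J, and invariance applied to J u and v kills that i-multiple in
  turn.\<close>

lemma complexify_pure_2:
  assumes "\<eta> \<in> alt 2"
  shows "(\<forall>u\<in>V. \<forall>v\<in>V. complexify \<eta> [(u, J u), (v, J v)] = 0 \<and> complexify \<eta> [(u, - J u), (v, - J v)] = 0)
    \<longleftrightarrow> (\<forall>u\<in>V. \<forall>v\<in>V. \<eta> [J u, J v] = \<eta> [u, v])"
proof -
  have c: "complexify \<eta> [(u, J u), (v, J v)] = \<eta> [u, v] - \<eta> [J u, J v] + \<i> * (\<eta> [u, J v] + \<eta> [J u, v])"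
    "complexify \<eta> [(u, - J u), (v, - J v)] = \<eta> [u, v] - \<eta> [J u, J v] - \<i> * (\<eta> [u, J v] + \<eta> [J u, v])"
    if "u \<in> V" "v \<in> V" for u v
    using that by (simp_all add: complexify_Cons complexify_Nil alt_2[OF assms] algebra_simps)
  have "\<eta> [u, J v] + \<eta> [J u, v] = 0" if "\<forall>u\<in>V. \<forall>v\<in>V. \<eta> [J u, J v] = \<eta> [u, v]" "u \<in> V" "v \<in> V" for u v
  proof -
    have "\<eta> [J (J u), J v] = \<eta> [J u, v]" using that J_V by blast
    then show ?thesis using that(2,3) by (simp add: alt_2[OF assms]) (metis add.right_inverse)
  qed
  \<comment> \<open>Adding the equations for the two pure types removes the mixed terms; \<eta> is
    complex valued, so real and imaginary parts could not be compared instead.\<close>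
  moreover have "x = y" if "x - y + i = 0" "x - y - i = 0" for x y i :: complex
  proof -
    have "2 * (x - y) = (x - y + i) + (x - y - i)" by (simp add: algebra_simps)
    then show ?thesis using that by simp
  qed
  ultimately show ?thesis
    by (intro iffI ballI) (metis c, simp add: c)
qed

end

section \<open>Charts, tangent vectors and local representations\<close>

context smooth_manifold
begin

abbreviation chart_range :: "('a, 'e) chart \<Rightarrow> 'e set"
  where "chart_range c \<equiv> snd c ` fst c"

lemma open_chart_range: "c \<in> A \<Longrightarrow> open (chart_range c)"
  using chart_open by blast

lemma openin_chart: "c \<in> A \<Longrightarrow> openin X (fst c)"
  using chart_open by blast

lemma chart_subset: "c \<in> A \<Longrightarrow> x \<in> fst c \<Longrightarrow> x \<in> topspace X"
  using openin_chart openin_subset by blast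

lemma chart_inj: "c \<in> A \<Longrightarrow> inj_on (snd c) (fst c)"
  using chart_homeo[of c] openin_subset[OF openin_chart, of c] unfolding homeomorphic_map_def
  by (simp add: topspace_subtopology Int_absorb1)

lemma chart_inv_snd [simp]: "c \<in> A \<Longrightarrow> x \<in> fst c \<Longrightarrow> chart_inv c (snd c x) = x"
  by (simp add: chart_inv_def chart_inj)

lemma snd_chart_inv [simp]: "y \<in> chart_range c \<Longrightarrow> snd c (chart_inv c y) = y"
  by (simp add: chart_inv_def f_inv_into_f)

lemma chart_inv_in: "y \<in> chart_range c \<Longrightarrow> chart_inv c y \<in> fst c"
  by (simp add: chart_inv_def inv_into_into)

lemma topspace_chart: "x \<in> topspace X \<Longrightarrow> \<exists>c\<in>A. x \<in> fst c"
  using cover by blast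

lemma chart_at: "x \<in> topspace X \<Longrightarrow> chart_at x \<in> A \<and> x \<in> fst (chart_at x)"
  unfolding chart_at_def by (rule someI_ex) (use topspace_chart in blast)

lemma open_chart_image:
  assumes "c \<in> A" "openin X U"
  shows "open (snd c ` (fst c \<inter> U))"
proof -
  have "openin (subtopology X (fst c)) (fst c \<inter> U)"
    using assms(2) by (simp add: openin_subtopology_Int2)
  then have "openin (top_of_set (chart_range c)) (snd c ` (fst c \<inter> U))"
    using homeomorphic_imp_open_map[OF chart_homeo[OF assms(1)]] by (simp add: open_map_def)
  then show ?thesis using open_chart_range[OF assms(1)] openin_open_eq by blast
qed

lemma open_overlap: "c \<in> A \<Longrightarrow> c' \<in> A \<Longrightarrow> open (snd c ` (fst c \<inter> fst c'))"
  by (simp add: open_chart_image openin_chart)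

lemma transition_snd: "c \<in> A \<Longrightarrow> x \<in> fst c \<Longrightarrow> transition c c' (snd c x) = snd c' x"
  by (simp add: transition_def)

text \<open>Indexed by the point of the manifold and not by its coordinates, so that the cocycle
  identities hold at one point x.\<close>

definition dtrans :: "('a, 'e) chart \<Rightarrow> ('a, 'e) chart \<Rightarrow> 'a \<Rightarrow> 'e \<Rightarrow> 'e"
  where "dtrans c c' x = frechet_derivative (transition c c') (at (snd c x))"

lemma transition_has_derivative:
  assumes "c \<in> A" "c' \<in> A" "x \<in> fst c" "x \<in> fst c'"
  shows "(transition c c' has_derivative dtrans c c' x) (at (snd c x))"
  unfolding dtrans_def
  by (rule smooth_on_has_derivative[OF transition_smooth[OF assms(1,2)]]) (use assms in blast)

lemma dtrans_linear: "c \<in> A \<Longrightarrow> c' \<in> A \<Longrightarrow> x \<in> fst c \<Longrightarrow> x \<in> fst c' \<Longrightarrow> linear (dtrans c c' x)"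
  using transition_has_derivative has_derivative_linear by blast

lemma dtrans_self:
  assumes "c \<in> A" "x \<in> fst c"
  shows "dtrans c c x w = w"
proof -
  have "(transition c c has_derivative (\<lambda>w. w)) (at (snd c x))"
    by (subst has_derivative_cong_open[OF open_chart_range[OF assms(1)], of _ _ "\<lambda>y. y"])
      (use assms in \<open>auto simp: transition_def\<close>)
  then show ?thesis by (simp add: dtrans_def frechet_derivative_eq)
qed

text \<open>The cocycle identity for Jacobians, by the chain rule. The transition maps compose only
  over the triple overlap, hence the passage to its open image.\<close>

lemma dtrans_compose:
  assumes "c \<in> A" "c' \<in> A" "c'' \<in> A" "x \<in> fst c" "x \<in> fst c'" "x \<in> fst c''"
  shows "dtrans c' c'' x (dtrans c c' x w) = dtrans c c'' x w"
proof -
  let ?S = "snd c ` (fst c \<inter> fst c' \<inter> (fst c''))"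
  have op: "open ?S"
    using open_chart_image[OF assms(1), of "fst c' \<inter> fst c''"] assms openin_chart by (simp add: Int_assoc openin_Int)
  have "(transition c' c'' has_derivative dtrans c' c'' x) (at (transition c c' (snd c x)))"
    using transition_has_derivative[OF assms(2,3,5,6)] assms by (simp add: transition_snd)
  from diff_chain_at[OF transition_has_derivative[OF assms(1,2,4,5)] this]
  have 1: "((\<lambda>y. transition c' c'' (transition c c' y)) has_derivative
      (\<lambda>w. dtrans c' c'' x (dtrans c c' x w))) (at (snd c x))" by (simp add: o_def)
  have "(transition c c'' has_derivative (\<lambda>w. dtrans c' c'' x (dtrans c c' x w))) (at (snd c x))"
    by (subst has_derivative_cong_open[OF op, of _ _ "\<lambda>y. transition c' c'' (transition c c' y)"])
      (use assms 1 in \<open>auto simp: transition_snd\<close>)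
  then show ?thesis using frechet_derivative_eq by (metis dtrans_def)
qed

lemma tangent_eval: "tangent c x w c' = (if c' \<in> A \<and> x \<in> fst c' then dtrans c c' x w else 0)"
  by (simp add: tangent_def dtrans_def)

lemma tangent_space_iff:
  "v \<in> tangent_space x \<longleftrightarrow>
    (\<forall>c\<in>A. \<forall>c'\<in>A. x \<in> fst c \<and> x \<in> fst c' \<longrightarrow> v c' = dtrans c c' x (v c)) \<and>
    (\<forall>c. \<not> (c \<in> A \<and> x \<in> fst c) \<longrightarrow> v c = 0)"
  by (simp add: tangent_space_def dtrans_def)

lemma tangent_in [simp]:
  assumes "c \<in> A" "x \<in> fst c"
  shows "tangent c x w \<in> tangent_space x"
  unfolding tangent_space_iff using assms by (auto simp: tangent_eval dtrans_compose)

lemma tangent_self: "c \<in> A \<Longrightarrow> x \<in> fst c \<Longrightarrow> tangent c x w c = w"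
  by (simp add: tangent_eval dtrans_self)

lemma tangent_of_coords:
  assumes "c \<in> A" "x \<in> fst c" "v \<in> tangent_space x"
  shows "tangent c x (v c) = v"
proof
  fix c'
  have v: "\<forall>c'\<in>A. x \<in> fst c' \<longrightarrow> v c' = dtrans c c' x (v c)" "\<forall>c. \<not> (c \<in> A \<and> x \<in> fst c) \<longrightarrow> v c = 0"
    using assms unfolding tangent_space_iff by blast+
  show "tangent c x (v c) c' = v c'"
  proof (cases "c' \<in> A \<and> x \<in> fst c'")
    case True
    then show ?thesis using v(1)[rule_format, of c'] by (simp add: tangent_eval)
  next
    case False
    then show ?thesis using v(2)[rule_format, OF False] unfolding tangent_eval by (simp only: if_False)
  qed
qed

lemma tangent_linear:
  assumes "c \<in> A" "x \<in> fst c"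
  shows "tangent c x (a *\<^sub>R u + b *\<^sub>R v) = comb a (tangent c x u) b (tangent c x v)"
  using assms dtrans_linear[OF assms(1) _ assms(2)]
  by (auto simp: tangent_eval comb_def fun_eq_iff linear_add linear_cmul)

lemma tangent_change_chart:
  assumes "c \<in> A" "c' \<in> A" "x \<in> fst c" "x \<in> fst c'"
  shows "tangent c x w = tangent c' x (dtrans c c' x w)"
  using tangent_of_coords[OF assms(2,4) tangent_in[OF assms(1,3), of w]] assms by (simp add: tangent_eval)

lemma tangent_bij:
  assumes "c \<in> A" "x \<in> fst c"
  shows "bij_betw (tangent c x) UNIV (tangent_space x)"
proof (rule bij_betwI[of _ _ _ "\<lambda>v. v c"])
qed (use assms in \<open>auto simp: tangent_self tangent_of_coords\<close>)

lemma tangent_space_tvec_space: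
  assumes "x \<in> topspace X"
  shows "tvec_space (tangent_space x)"
proof
  obtain c where c: "c \<in> A" "x \<in> fst c" using topspace_chart[OF assms] by blast
  show "tangent_space x \<noteq> {}" using tangent_in[OF c] by blast
  fix u v a b assume uv: "u \<in> tangent_space x" "v \<in> tangent_space x"
  have "comb a u b v = tangent c x (a *\<^sub>R u c + b *\<^sub>R v c)"
    by (simp add: tangent_linear[OF c] tangent_of_coords[OF c] uv)
  then show "comb a u b v \<in> tangent_space x" using tangent_in[OF c] by simp
qed

lemma alternating_eq: "alternating x k = alt_forms (tangent_space x) k"
  unfolding alternating_def alt_forms_def by simp

text \<open>The coefficients of the form in the chart, that is, the pullback of \<eta> by the
  inverse chart.\<close>

definition loc :: "('a, 'e) chart \<Rightarrow> ('a, 'e) form_field \<Rightarrow> 'e \<Rightarrow> 'e list \<Rightarrow> complex"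
  where "loc c \<eta> y ws = \<eta> (chart_inv c y) (map (tangent c (chart_inv c y)) ws)"

lemma loc_snd: "c \<in> A \<Longrightarrow> x \<in> fst c \<Longrightarrow> loc c \<eta> (snd c x) ws = \<eta> x (map (tangent c x) ws)"
  by (simp add: loc_def)

lemma formsI:
  assumes "\<And>x. x \<notin> topspace X \<Longrightarrow> \<eta> x = 0"
    and "\<And>x. x \<in> topspace X \<Longrightarrow> \<eta> x \<in> alt_forms (tangent_space x) k"
    and "\<And>c ws. c \<in> A \<Longrightarrow> length ws = k \<Longrightarrow> smooth_on (chart_range c) (\<lambda>y. loc c \<eta> y ws)"
  shows "\<eta> \<in> forms k"
  using assms unfolding forms_def alternating_eq loc_def by blast

lemma formsD:
  assumes "\<eta> \<in> forms k"
  shows "x \<notin> topspace X \<Longrightarrow> \<eta> x = 0"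
    and "x \<in> topspace X \<Longrightarrow> \<eta> x \<in> alt_forms (tangent_space x) k"
    and "c \<in> A \<Longrightarrow> length ws = k \<Longrightarrow> smooth_on (chart_range c) (\<lambda>y. loc c \<eta> y ws)"
  using assms unfolding forms_def alternating_eq loc_def by blast+

lemma forms_outside:
  assumes "\<eta> \<in> forms k" "\<not> (x \<in> topspace X \<and> length vs = k \<and> set vs \<subseteq> tangent_space x)"
  shows "\<eta> x vs = 0"
  using formsD(1,2)[OF assms(1), of x] alt_formsD(1,2)[of "\<eta> x" "tangent_space x" k vs] assms(2) by force

lemma loc_multilin:
  assumes "\<eta> \<in> forms k" "c \<in> A" "y \<in> chart_range c"
  shows "multilin k (loc c \<eta> y)"
  unfolding multilin_def
proof (intro allI impI)
  fix ws :: "'e list" and i a u b v assume *: "length ws = k \<and> i < k"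
  let ?x = "chart_inv c y"
  have x: "?x \<in> fst c" "?x \<in> topspace X" using assms chart_inv_in chart_subset by blast+
  have "set (map (tangent c ?x) ws) \<subseteq> tangent_space ?x" using tangent_in[OF assms(2) x(1)] by auto
  then show "loc c \<eta> y (ws[i := a *\<^sub>R u + b *\<^sub>R v]) = a *\<^sub>R loc c \<eta> y (ws[i := u]) + b *\<^sub>R loc c \<eta> y (ws[i := v])"
    using alt_formsD(3)[OF formsD(2)[OF assms(1) x(2)], of "map (tangent c ?x) ws" i "tangent c ?x u" "tangent c ?x v" a b]
      * tangent_in[OF assms(2) x(1)]
    by (simp add: loc_def map_update tangent_linear[OF assms(2) x(1)] scaleR_conv_of_real)
qed

lemma loc_change_chart:
  assumes "c \<in> A" "c' \<in> A" "x \<in> fst c" "x \<in> fst c'"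
  shows "loc c \<eta> (snd c x) ws = loc c' \<eta> (snd c' x) (map (dtrans c c' x) ws)"
  using assms by (simp add: loc_snd tangent_change_chart[OF assms, symmetric] o_def)

lemma forms_linear:
  assumes "\<alpha> \<in> forms k" "\<beta> \<in> forms k"
  shows "(\<lambda>x vs. a * \<alpha> x vs + b * \<beta> x vs) \<in> forms k"
proof (rule formsI)
  show "(\<lambda>vs. a * \<alpha> x vs + b * \<beta> x vs) = 0" if "x \<notin> topspace X" for x
    using formsD(1)[OF assms(1) that] formsD(1)[OF assms(2) that] by (simp add: fun_eq_iff)
  show "(\<lambda>vs. a * \<alpha> x vs + b * \<beta> x vs) \<in> alt_forms (tangent_space x) k" if "x \<in> topspace X" for x
    using formsD(2)[OF assms(1) that] formsD(2)[OF assms(2) that] by (rule alt_forms_linear)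
  show "smooth_on (chart_range c) (\<lambda>y. loc c (\<lambda>x vs. a * \<alpha> x vs + b * \<beta> x vs) y ws)"
    if "c \<in> A" "length ws = k" for c ws
  proof -
    have "smooth_on (chart_range c) (\<lambda>y. a * loc c \<alpha> y ws + b * loc c \<beta> y ws)"
      using that
      by (intro smooth_on_add smooth_on_mult open_chart_range smooth_on_const formsD(3)[OF assms(1)] formsD(3)[OF assms(2)])
    then show ?thesis by (simp add: loc_def)
  qed
qed

lemma forms_zero: "(\<lambda>x vs. 0) \<in> forms k"
  by (rule formsI) (auto simp: fun_eq_iff loc_def alt_forms_zero)

lemma forms_scale: "\<alpha> \<in> forms k \<Longrightarrow> (\<lambda>x vs. a * \<alpha> x vs) \<in> forms k"
  using forms_linear[of \<alpha> k "\<lambda>x vs. 0" a 0] forms_zero by simp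

lemma forms_cnj:
  assumes "\<alpha> \<in> forms k"
  shows "(\<lambda>x vs. cnj (\<alpha> x vs)) \<in> forms k"
proof (rule formsI)
  show "(\<lambda>vs. cnj (\<alpha> x vs)) = 0" if "x \<notin> topspace X" for x
    using formsD(1)[OF assms that] by (simp add: fun_eq_iff)
  show "(\<lambda>vs. cnj (\<alpha> x vs)) \<in> alt_forms (tangent_space x) k" if "x \<in> topspace X" for x
    using formsD(2)[OF assms that] by (rule alt_forms_cnj)
  show "smooth_on (chart_range c) (\<lambda>y. loc c (\<lambda>x vs. cnj (\<alpha> x vs)) y ws)" if "c \<in> A" "length ws = k" for c ws
    using smooth_on_cnj[OF open_chart_range[OF that(1)] formsD(3)[OF assms that]] by (simp add: loc_def)
qed

text \<open>Alternation of the product is a premise because it is established separately for each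
  pair of low degrees; smoothness is uniform in the degrees.\<close>

lemma forms_wedge:
  assumes "\<alpha> \<in> forms k" "\<beta> \<in> forms l"
    and "\<And>x. x \<in> topspace X \<Longrightarrow> wedge (\<alpha> x) (\<beta> x) \<in> alt_forms (tangent_space x) (k + l)"
  shows "(\<lambda>x. wedge (\<alpha> x) (\<beta> x)) \<in> forms (k + l)"
proof (rule formsI)
  show "wedge (\<alpha> x) (\<beta> x) = 0" if "x \<notin> topspace X" for x
    using formsD(1)[OF assms(1) that] by (simp add: fun_eq_iff wedge_def)
  show "wedge (\<alpha> x) (\<beta> x) \<in> alt_forms (tangent_space x) (k + l)" if "x \<in> topspace X" for x
    using assms(3) that .
  show "smooth_on (chart_range c) (\<lambda>y. loc c (\<lambda>x. wedge (\<alpha> x) (\<beta> x)) y ws)" if c: "c \<in> A" and "length ws = k + l" for c ws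
  proof -
    have sm: "smooth_on (chart_range c) (\<lambda>y. loc c \<eta> y vs)" if "\<eta> \<in> forms m" for \<eta> m vs
    proof (cases "length vs = m")
      case False
      then have "loc c \<eta> y vs = 0" for y unfolding loc_def using that by (intro forms_outside) auto
      then show ?thesis by simp
    qed (use formsD(3)[OF that c] in blast)
    have "loc c (\<lambda>x. wedge (\<alpha> x) (\<beta> x)) y ws = (\<Sum>S\<in>Pow {..<length ws}. shuffle_sign (length ws) S *
        loc c \<alpha> y (nths ws S) * loc c \<beta> y (nths ws (- S)))" for y
      by (simp add: loc_def wedge_def nths_map)
    then show ?thesis
      by (simp only:)
        (intro smooth_on_sum smooth_on_mult open_chart_range c smooth_on_const sm[OF assms(1)] sm[OF assms(2)])
  qed
qed

section \<open>The exterior derivative in charts\<close>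

text \<open>The coordinate formula inside \<open>ext_deriv\<close>, freed from the chart that
  \<open>chart_at\<close> picks.\<close>

definition dloc :: "('e \<Rightarrow> 'e list \<Rightarrow> complex) \<Rightarrow> 'e \<Rightarrow> 'e list \<Rightarrow> complex"
  where "dloc F y ws = (\<Sum>i<length ws. (-1) ^ i *
    frechet_derivative (\<lambda>y. F y (take i ws @ drop (Suc i) ws)) (at y) (ws ! i))"

abbreviation fdiff :: "('e \<Rightarrow> 'e list \<Rightarrow> complex) \<Rightarrow> 'e list \<Rightarrow> 'e \<Rightarrow> 'e \<Rightarrow> complex"
  where "fdiff F ws y \<equiv> frechet_derivative (\<lambda>y. F y ws) (at y)"

lemma dloc_simps:
  "dloc F y [] = 0"
  "dloc F y [a] = fdiff F [] y a"
  "dloc F y [a, b] = fdiff F [b] y a - fdiff F [a] y b"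
  "dloc F y [a, b, c] = fdiff F [b, c] y a - fdiff F [a, c] y b + fdiff F [a, b] y c"
  "dloc F y [a, b, c, d] = fdiff F [b, c, d] y a - fdiff F [a, c, d] y b + fdiff F [a, b, d] y c - fdiff F [a, b, c] y d"
  by (simp_all add: dloc_def lessThan_Suc numeral_eq_Suc algebra_simps)

lemma ext_deriv_eq_dloc:
  "ext_deriv \<eta> x vs = (if x \<in> topspace X \<and> set vs \<subseteq> tangent_space x
    then dloc (loc (chart_at x) \<eta>) (snd (chart_at x) x) (map (\<lambda>v. v (chart_at x)) vs) else 0)"
  unfolding ext_deriv_def Let_def dloc_def loc_def
  by (auto simp: take_map drop_map o_def intro!: sum.cong)

lemma loc_differentiable:
  "\<eta> \<in> forms k \<Longrightarrow> c \<in> A \<Longrightarrow> y \<in> chart_range c \<Longrightarrow> length ws = k \<Longrightarrow> (\<lambda>y. loc c \<eta> y ws) differentiable (at y)"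
  using smooth_on_differentiable[OF formsD(3)] by blast

lemma fdiff_loc_linear:
  "\<eta> \<in> forms k \<Longrightarrow> c \<in> A \<Longrightarrow> y \<in> chart_range c \<Longrightarrow> length ws = k \<Longrightarrow> linear (fdiff (loc c \<eta>) ws y)"
  using frechet_linear loc_differentiable by blast

lemma fdiff_loc_multilin:
  assumes "\<eta> \<in> forms k" "c \<in> A" "y \<in> chart_range c" "length ws = k" "i < k"
  shows "fdiff (loc c \<eta>) (ws[i := a *\<^sub>R u + b *\<^sub>R v]) y w =
    a *\<^sub>R fdiff (loc c \<eta>) (ws[i := u]) y w + b *\<^sub>R fdiff (loc c \<eta>) (ws[i := v]) y w"
proof -
  have d: "((\<lambda>y. loc c \<eta> y (ws[i := u])) has_derivative fdiff (loc c \<eta>) (ws[i := u]) y) (at y)" for u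
    by (rule has_derivative_frechet, rule loc_differentiable[OF assms(1-3)]) (simp add: assms)
  have "((\<lambda>y. loc c \<eta> y (ws[i := a *\<^sub>R u + b *\<^sub>R v])) has_derivative
      (\<lambda>w. a *\<^sub>R fdiff (loc c \<eta>) (ws[i := u]) y w + b *\<^sub>R fdiff (loc c \<eta>) (ws[i := v]) y w)) (at y)"
    by (subst has_derivative_cong_open[OF open_chart_range[OF assms(2)] assms(3), of _
          "\<lambda>y. a *\<^sub>R loc c \<eta> y (ws[i := u]) + b *\<^sub>R loc c \<eta> y (ws[i := v])"])
      (use multilinD[OF loc_multilin[OF assms(1,2)] assms(4,5)] in
        \<open>auto intro!: has_derivative_add has_derivative_scaleR_right d\<close>)
  from frechet_derivative_eq[OF this] show ?thesis by simp
qed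

lemma loc_swap:
  assumes "\<eta> \<in> forms k" "c \<in> A" "y \<in> chart_range c" "length ws = k" "i < j" "j < k"
  shows "loc c \<eta> y (ws[i := ws ! j, j := ws ! i]) = - loc c \<eta> y ws"
proof -
  let ?x = "chart_inv c y"
  have x: "?x \<in> fst c" "?x \<in> topspace X" using assms chart_inv_in chart_subset by blast+
  have "set (map (tangent c ?x) ws) \<subseteq> tangent_space ?x" using tangent_in[OF assms(2) x(1)] by auto
  then show ?thesis
    using tvec_space.alt_swap[OF tangent_space_tvec_space[OF x(2)] formsD(2)[OF assms(1) x(2)],
      of "map (tangent c ?x) ws" i j] assms(4-)
    by (simp add: loc_def map_update)
qed

lemma fdiff_loc_swap:
  assumes "\<eta> \<in> forms k" "c \<in> A" "y \<in> chart_range c" "length ws = k" "i < j" "j < k"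
  shows "fdiff (loc c \<eta>) (ws[i := ws ! j, j := ws ! i]) y w = - fdiff (loc c \<eta>) ws y w"
proof -
  have "((\<lambda>y. loc c \<eta> y (ws[i := ws ! j, j := ws ! i])) has_derivative (\<lambda>w. - fdiff (loc c \<eta>) ws y w)) (at y)"
    by (subst has_derivative_cong_open[OF open_chart_range[OF assms(2)] assms(3), of _ "\<lambda>y. - loc c \<eta> y ws"])
      (use loc_swap[OF assms(1,2) _ assms(4-)] in
        \<open>auto intro!: has_derivative_minus has_derivative_frechet loc_differentiable[OF assms(1-4)]\<close>)
  from frechet_derivative_eq[OF this] show ?thesis by simp
qed

lemma loc_swap_2:
  assumes "\<eta> \<in> forms 2" "c \<in> A" "y \<in> chart_range c"
  shows "loc c \<eta> y [v, u] = - loc c \<eta> y [u, v]" "fdiff (loc c \<eta>) [v, u] y w = - fdiff (loc c \<eta>) [u, v] y w"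
  using loc_swap[OF assms, of "[u, v]" 0 1] fdiff_loc_swap[OF assms, of "[u, v]" 0 1] by simp_all

lemma loc_swap_3:
  assumes "\<eta> \<in> forms 3" "c \<in> A" "y \<in> chart_range c"
  shows "loc c \<eta> y [v, u, w] = - loc c \<eta> y [u, v, w]" "loc c \<eta> y [w, v, u] = - loc c \<eta> y [w, u, v]"
    and "fdiff (loc c \<eta>) [v, u, w] y z = - fdiff (loc c \<eta>) [u, v, w] y z"
      "fdiff (loc c \<eta>) [w, v, u] y z = - fdiff (loc c \<eta>) [w, u, v] y z"
  using loc_swap[OF assms, of "[u, v, w]" 0 1] fdiff_loc_swap[OF assms, of "[u, v, w]" 0 1]
    loc_swap[OF assms, of "[w, u, v]" 1 2] fdiff_loc_swap[OF assms, of "[w, u, v]" 1 2]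
  by (simp_all add: numeral_2_eq_2)

text \<open>The second derivatives of the transition map cancel by symmetry.\<close>

lemma fdiff_change_chart:
  assumes \<eta>: "\<eta> \<in> forms k" and c: "c \<in> A" "c' \<in> A" "x \<in> fst c" "x \<in> fst c'" and ws: "length ws = k"
  defines "B \<equiv> \<lambda>u v. frechet_derivative (\<lambda>y. frechet_derivative (transition c c') (at y) u) (at (snd c x)) v"
  shows "fdiff (loc c \<eta>) ws (snd c x) h =
    fdiff (loc c' \<eta>) (map (dtrans c c' x) ws) (snd c' x) (dtrans c c' x h) +
    (\<Sum>j<k. loc c' \<eta> (snd c' x) ((map (dtrans c c' x) ws)[j := B (ws ! j) h]))"
proof -
  let ?T = "transition c c'" and ?S = "snd c ` (fst c \<inter> fst c')" and ?y = "snd c x"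
  let ?us = "map (\<lambda>w y. frechet_derivative ?T (at y) w) ws"
  have y: "?y \<in> ?S" using c by blast
  have op: "open ?S" using open_overlap c by blast
  have Ty: "?T ?y = snd c' x" using transition_snd c by blast
  have maps: "?T z \<in> chart_range c'" if "z \<in> ?S" for z using that c by (auto simp: transition_snd)
  have y': "snd c' x \<in> chart_range c'" using c by blast
  have us: "map (\<lambda>u. u ?y) ?us = map (dtrans c c' x) ws" by (simp add: dtrans_def o_def)
  have der: "((\<lambda>z. loc c' \<eta> (?T z) (map (\<lambda>u. u z) ?us)) has_derivative
    (\<lambda>h. frechet_derivative (\<lambda>z. loc c' \<eta> z (map (\<lambda>u. u ?y) ?us)) (at (?T ?y)) (dtrans c c' x h) +
      (\<Sum>j<length ?us. loc c' \<eta> (?T ?y) ((map (\<lambda>u. u ?y) ?us)[j := frechet_derivative (?us ! j) (at ?y) h])))) (at ?y)"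
  proof (rule has_derivative_multilin[OF op y maps open_chart_range[OF c(2)] transition_has_derivative[OF c]])
    show "multilin (length ?us) (loc c' \<eta> z)" if "z \<in> chart_range c'" for z
      using loc_multilin[OF \<eta> c(2) that] ws by simp
    show "(\<lambda>z. loc c' \<eta> z vs) differentiable (at (?T ?y))" if "length vs = length ?us" for vs
      unfolding Ty using loc_differentiable[OF \<eta> c(2) y'] ws that by simp
    show "u differentiable (at ?y)" if "u \<in> set ?us" for u
      using that smooth_on_differentiable[OF smooth_on_derivative[OF transition_smooth[OF c(1,2)]] y] by auto
  qed
  have eq: "loc c \<eta> z ws = loc c' \<eta> (?T z) (map (\<lambda>u. u z) ?us)" if z: "z \<in> ?S" for z
  proof -
    obtain x' where x': "z = snd c x'" "x' \<in> fst c" "x' \<in> fst c'" using z by blast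
    show ?thesis
      using loc_change_chart[OF c(1,2) x'(2,3)] x' c by (simp add: transition_snd dtrans_def o_def)
  qed
  have "((\<lambda>z. loc c \<eta> z ws) has_derivative
    (\<lambda>h. frechet_derivative (\<lambda>z. loc c' \<eta> z (map (\<lambda>u. u ?y) ?us)) (at (?T ?y)) (dtrans c c' x h) +
      (\<Sum>j<length ?us. loc c' \<eta> (?T ?y) ((map (\<lambda>u. u ?y) ?us)[j := frechet_derivative (?us ! j) (at ?y) h])))) (at ?y)"
    by (subst has_derivative_cong_open[OF op y eq]) (auto intro: der simp del: map_map length_map)
  from frechet_derivative_eq[OF this] show ?thesis
    unfolding us Ty using ws by (simp add: B_def)
qed

text \<open>In the alternating sum every correction term B(u, v) occurs twice with opposite signs: B
  is symmetric as a second derivative, and the local form is alternating. Each degree is expanded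
  explicitly.\<close>

lemma dloc_change_chart:
  assumes \<eta>: "\<eta> \<in> forms k" and k: "k \<le> 3" and c: "c \<in> A" "c' \<in> A" "x \<in> fst c" "x \<in> fst c'"
    and ws: "length ws = Suc k"
  shows "dloc (loc c \<eta>) (snd c x) ws = dloc (loc c' \<eta>) (snd c' x) (map (dtrans c c' x) ws)"
proof -
  define B where "B u v = frechet_derivative (\<lambda>y. frechet_derivative (transition c c') (at y) u) (at (snd c x)) v" for u v
  have B: "B u v = B v u" for u v
    unfolding B_def
    by (rule second_derivative_symmetric[OF open_overlap[OF c(1,2)] transition_smooth[OF c(1,2)]]) (use c in blast)
  have y': "snd c' x \<in> chart_range c'" using c by blast
  note ch = fdiff_change_chart[OF \<eta> c, folded B_def]
  consider "k = 0" | "k = 1" | "k = 2" | "k = 3" using k by linarith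
  then show ?thesis
  proof cases
    case 1
    then obtain a where "ws = [a]" using ws by (auto simp: length_Suc_conv)
    then show ?thesis using 1 ch[of "[]"] by (simp add: dloc_simps)
  next
    case 2
    then obtain a b where "ws = [a, b]" using ws by (auto simp: length_Suc_conv)
    then show ?thesis using 2 ch[of "[a]" b] ch[of "[b]" a] B[of a b] by (simp add: dloc_simps)
  next
    case 3
    then obtain a b d where ws': "ws = [a, b, d]" using ws by (auto simp: length_eq_lists)
    note sw = loc_swap_2(1)[OF \<eta>[unfolded 3] c(2) y']
    show ?thesis
      using ws' ch[of "[a, b]" d] ch[of "[b, d]" a] ch[of "[a, d]" b] 3 B[of a b] B[of a d] B[of b d]
        sw[of "B b a" "dtrans c c' x d"] sw[of "B d a" "dtrans c c' x b"] sw[of "B d b" "dtrans c c' x a"]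
      by (simp add: dloc_simps numeral_2_eq_2)
  next
    case 4
    then obtain a b d e where ws': "ws = [a, b, d, e]" using ws by (auto simp: length_eq_lists)
    note sw = loc_swap_3(1,2)[OF \<eta>[unfolded 4] c(2) y']
    let ?D = "dtrans c c' x"
    have s: "loc c' \<eta> (snd c' x) [u, v, w] = loc c' \<eta> (snd c' x) [w, u, v]" 
      "loc c' \<eta> (snd c' x) [u, w, v] = - loc c' \<eta> (snd c' x) [w, u, v]" for u v w
      using sw(1)[of w u v] sw(2)[of u w v] by simp_all
    show ?thesis
      using ws' ch[of "[b, d, e]" a] ch[of "[a, d, e]" b] ch[of "[a, b, e]" d] ch[of "[a, b, d]" e] 4
        B[of a b] B[of a d] B[of b d] B[of a e] B[of b e] B[of d e]
        s[of "?D d" "?D e" "B b a"] s[of "?D b" "?D e" "B d a"] s[of "?D b" "?D d" "B e a"]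
        s[of "?D a" "?D e" "B d b"] s[of "?D a" "?D d" "B e b"] s[of "?D a" "?D b" "B e d"]
        s(2)[of "?D d" "B b a" "?D e"] s(2)[of "?D b" "B d a" "?D e"] s(2)[of "?D a" "B e b" "?D d"]
      by (simp add: dloc_simps numeral_3_eq_3)
  qed
qed

text \<open>Replaces the arbitrary chart of the definition by any chart around x; all later
  computations with d go through this.\<close>

lemma ext_deriv_in_chart:
  assumes \<eta>: "\<eta> \<in> forms k" and k: "k \<le> 3" and c: "c \<in> A" "x \<in> fst c"
    and vs: "length vs = Suc k" "set vs \<subseteq> tangent_space x"
  shows "ext_deriv \<eta> x vs = dloc (loc c \<eta>) (snd c x) (map (\<lambda>v. v c) vs)"
proof -
  have x: "x \<in> topspace X" using chart_subset c by blast
  note c' = chart_at[OF x]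
  have m: "map (dtrans (chart_at x) c x) (map (\<lambda>v. v (chart_at x)) vs) = map (\<lambda>v. v c) vs"
  proof -
    have "dtrans (chart_at x) c x (v (chart_at x)) = v c" if "v \<in> tangent_space x" for v
      using that c c' unfolding tangent_space_iff by metis
    then show ?thesis using vs(2) by (auto simp: o_def)
  qed
  have "dloc (loc (chart_at x) \<eta>) (snd (chart_at x) x) (map (\<lambda>v. v (chart_at x)) vs) =
      dloc (loc c \<eta>) (snd c x) (map (\<lambda>v. v c) vs)"
    unfolding m[symmetric] by (rule dloc_change_chart[OF \<eta> k]) (use c c' vs in auto)
  then show ?thesis using vs x by (simp add: ext_deriv_eq_dloc)
qed

lemma loc_ext_deriv:
  assumes "\<eta> \<in> forms k" "k \<le> 3" "c \<in> A" "y \<in> chart_range c" "length ws = Suc k"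
  shows "loc c (ext_deriv \<eta>) y ws = dloc (loc c \<eta>) y ws"
proof -
  have x: "chart_inv c y \<in> fst c" using chart_inv_in assms by blast
  have "map (\<lambda>v. v c) (map (tangent c (chart_inv c y)) ws) = ws"
    using tangent_self[OF assms(3) x] by (simp add: o_def)
  then show ?thesis
    using ext_deriv_in_chart[OF assms(1-3) x, of "map (tangent c (chart_inv c y)) ws"] assms(4,5) tangent_in[OF assms(3) x]
    by (auto simp: loc_def[of c "ext_deriv \<eta>"] image_subset_iff)
qed

text \<open>If the number of arguments is not k + 1, each differentiated coefficient is evaluated on
  a list of the wrong length and is identically zero.\<close>

lemma ext_deriv_outside:
  assumes "\<eta> \<in> forms k" "\<not> (x \<in> topspace X \<and> length vs = Suc k \<and> set vs \<subseteq> tangent_space x)"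
  shows "ext_deriv \<eta> x vs = 0"
proof (cases "x \<in> topspace X \<and> set vs \<subseteq> tangent_space x")
  case True
  then have "length vs \<noteq> Suc k" using assms by blast
  then have *: "length (take i ws @ drop (Suc i) ws) \<noteq> k" if "i < length ws" "length ws = length vs" for i and ws :: "'e list"
    using that by auto
  have z: "loc c \<eta> y ws = 0" if "length ws \<noteq> k" for c y ws
    unfolding loc_def using assms(1) that by (intro forms_outside) auto
  have "dloc (loc c \<eta>) y ws = 0" if "length ws = length vs" for c y and ws :: "'e list"
    unfolding dloc_def
  proof (intro sum.neutral ballI)
    fix i assume "i \<in> {..<length ws}"
    then have "length (take i ws @ drop (Suc i) ws) \<noteq> k" using * that by simp
    then have "(\<lambda>y. loc c \<eta> y (take i ws @ drop (Suc i) ws)) = (\<lambda>y. 0)" by (intro ext z)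
    then show "(-1) ^ i * fdiff (loc c \<eta>) (take i ws @ drop (Suc i) ws) y (ws ! i) = 0" by simp
  qed
  then show ?thesis by (simp add: ext_deriv_eq_dloc)
next
  case False
  then show ?thesis by (auto simp: ext_deriv_def)
qed

lemma smooth_on_dloc:
  assumes "\<eta> \<in> forms k" "c \<in> A" "length ws = Suc k"
  shows "smooth_on (chart_range c) (\<lambda>y. dloc (loc c \<eta>) y ws)"
  unfolding dloc_def
  by (intro smooth_on_sum smooth_on_mult open_chart_range assms(2) smooth_on_const smooth_on_derivative
      formsD(3)[OF assms(1)]) (use assms(3) in auto)

lemma ext_deriv_alt:
  assumes \<eta>: "\<eta> \<in> forms k" and k: "k \<le> 3" and x: "x \<in> topspace X"
  shows "ext_deriv \<eta> x \<in> alt_forms (tangent_space x) (Suc k)"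
proof -
  obtain c where c: "c \<in> A" "x \<in> fst c" using topspace_chart[OF x] by blast
  let ?V = "tangent_space x" and ?y = "snd c x"
  have y: "?y \<in> chart_range c" using c by blast
  interpret tvec_space ?V by (rule tangent_space_tvec_space[OF x])
  have d: "ext_deriv \<eta> x vs = dloc (loc c \<eta>) ?y (map (\<lambda>v. v c) vs)" if "length vs = Suc k" "set vs \<subseteq> ?V" for vs
    using ext_deriv_in_chart[OF \<eta> k c that] .
  have out: "ext_deriv \<eta> x vs = 0" if "\<not> (length vs = Suc k \<and> set vs \<subseteq> ?V)" for vs
    using ext_deriv_outside[OF \<eta>] that by blast
  have lin: "fdiff (loc c \<eta>) ws ?y (comb a u b v c) =
      of_real a * fdiff (loc c \<eta>) ws ?y (u c) + of_real b * fdiff (loc c \<eta>) ws ?y (v c)"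
    if "length ws = k" for ws a u b v
    using fdiff_loc_linear[OF \<eta> c(1) y that] by (simp add: comb_def linear_add linear_cmul scaleR_conv_of_real)
  have ml: "fdiff (loc c \<eta>) (comb a u b v c # ws) ?y w =
      of_real a * fdiff (loc c \<eta>) (u c # ws) ?y w + of_real b * fdiff (loc c \<eta>) (v c # ws) ?y w"
    if "Suc (length ws) = k" for ws a u b v w
    using fdiff_loc_multilin[OF \<eta> c(1) y, of "0 # ws" 0 a "u c" b "v c" w] that
    by (auto simp: comb_def scaleR_conv_of_real)
  consider "k = 0" | "k = 1" | "k = 2" | "k = 3" using k by linarith
  then show ?thesis
  proof cases
    case 1
    have "ext_deriv \<eta> x \<in> alt_forms ?V 1"
      by (rule alt_forms_1I) (use 1 out lin in \<open>auto simp: d dloc_simps\<close>)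
    then show ?thesis using 1 by simp
  next
    case 2
    have "ext_deriv \<eta> x \<in> alt_forms ?V 2"
    proof (rule alt_forms_2I)
      show "ext_deriv \<eta> x [comb a u b v, w] = of_real a * ext_deriv \<eta> x [u, w] + of_real b * ext_deriv \<eta> x [v, w]"
        if "u \<in> ?V" "v \<in> ?V" "w \<in> ?V" for a u b v w
        using that 2 by (simp add: d dloc_simps lin ml[of "[]"] algebra_simps)
    qed (use 2 out in \<open>auto simp: d dloc_simps\<close>)
    then show ?thesis using 2 by (simp add: numeral_2_eq_2)
  next
    case 3
    note sw = loc_swap_2(2)[OF \<eta>[unfolded 3] c(1) y]
    have "ext_deriv \<eta> x \<in> alt_forms ?V 3"
    proof (rule alt_forms_3I)
      show "ext_deriv \<eta> x vs = 0" if "\<not> (length vs = 3 \<and> set vs \<subseteq> ?V)" for vs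
        using that 3 by (intro out) simp
      show "ext_deriv \<eta> x [comb a u b v, w, z] = of_real a * ext_deriv \<eta> x [u, w, z] + of_real b * ext_deriv \<eta> x [v, w, z]"
        if "u \<in> ?V" "v \<in> ?V" "w \<in> ?V" "z \<in> ?V" for a u b v w z
        using that 3 by (simp add: d dloc_simps lin ml algebra_simps)
      fix u v w assume V: "u \<in> ?V" "v \<in> ?V" "w \<in> ?V"
      show "ext_deriv \<eta> x [u, v, w] = - ext_deriv \<eta> x [v, u, w]"
        using V 3 sw[of "u c" "v c"] by (simp add: d dloc_simps)
      show "ext_deriv \<eta> x [u, v, w] = - ext_deriv \<eta> x [u, w, v]"
        using V 3 sw[of "v c" "w c"] by (simp add: d dloc_simps)
    qed auto
    then show ?thesis using 3 by simp
  next
    case 4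
    note sw = loc_swap_3(3,4)[OF \<eta>[unfolded 4] c(1) y]
    have "ext_deriv \<eta> x \<in> alt_forms ?V 4"
    proof (rule alt_forms_4I)
      show "ext_deriv \<eta> x vs = 0" if "\<not> (length vs = 4 \<and> set vs \<subseteq> ?V)" for vs
        using that 4 by (intro out) simp
      show "ext_deriv \<eta> x [comb a u b v, w, z, t] = of_real a * ext_deriv \<eta> x [u, w, z, t] + of_real b * ext_deriv \<eta> x [v, w, z, t]"
        if "u \<in> ?V" "v \<in> ?V" "w \<in> ?V" "z \<in> ?V" "t \<in> ?V" for a u b v w z t
        using that 4 by (simp add: d dloc_simps lin ml algebra_simps)
      fix u v w z assume V: "u \<in> ?V" "v \<in> ?V" "w \<in> ?V" "z \<in> ?V"
      show "ext_deriv \<eta> x [u, v, w, z] = - ext_deriv \<eta> x [v, u, w, z]"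
        using V 4 sw(1)[of "u c" "v c"] by (simp add: d dloc_simps)
      show "ext_deriv \<eta> x [u, v, w, z] = - ext_deriv \<eta> x [u, w, v, z]"
        using V 4 sw(1)[of "v c" "w c"] sw(2)[of _ "v c" "w c"] by (simp add: d dloc_simps)
      show "ext_deriv \<eta> x [u, v, w, z] = - ext_deriv \<eta> x [u, v, z, w]"
        using V 4 sw(2)[of _ "w c" "z c"] by (simp add: d dloc_simps)
    qed auto
    then show ?thesis using 4 by simp
  qed
qed

lemma ext_deriv_forms:
  assumes "\<eta> \<in> forms k" "k \<le> 3"
  shows "ext_deriv \<eta> \<in> forms (Suc k)"
proof (rule formsI)
  show "ext_deriv \<eta> x = 0" if "x \<notin> topspace X" for x
    using that by (simp add: ext_deriv_def fun_eq_iff)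
  show "ext_deriv \<eta> x \<in> alt_forms (tangent_space x) (Suc k)" if "x \<in> topspace X" for x
    using ext_deriv_alt assms that by blast
  show "smooth_on (chart_range c) (\<lambda>y. loc c (ext_deriv \<eta>) y ws)" if c: "c \<in> A" and ws: "length ws = Suc k" for c ws
    using smooth_on_dloc[OF assms(1) that]
    by (subst smooth_on_cong[OF open_chart_range[OF c]]) (auto simp: loc_ext_deriv[OF assms c _ ws])
qed

lemma ext_deriv_linear:
  assumes "\<alpha> \<in> forms k" "\<beta> \<in> forms k"
  shows "ext_deriv (\<lambda>x vs. a * \<alpha> x vs + b * \<beta> x vs) = (\<lambda>x vs. a * ext_deriv \<alpha> x vs + b * ext_deriv \<beta> x vs)"
proof (intro ext)
  fix x vs
  show "ext_deriv (\<lambda>x vs. a * \<alpha> x vs + b * \<beta> x vs) x vs = a * ext_deriv \<alpha> x vs + b * ext_deriv \<beta> x vs"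
  proof (cases "x \<in> topspace X \<and> length vs = Suc k \<and> set vs \<subseteq> tangent_space x")
    case True
    let ?c = "chart_at x"
    have c: "?c \<in> A" "x \<in> fst ?c" using chart_at True by blast+
    then have y: "snd ?c x \<in> chart_range ?c" by blast
    have "fdiff (loc ?c (\<lambda>x vs. a * \<alpha> x vs + b * \<beta> x vs)) ws (snd ?c x) w =
        a * fdiff (loc ?c \<alpha>) ws (snd ?c x) w + b * fdiff (loc ?c \<beta>) ws (snd ?c x) w" if "length ws = k" for ws w
    proof -
      have "((\<lambda>y. a * loc ?c \<alpha> y ws + b * loc ?c \<beta> y ws) has_derivative
          (\<lambda>w. a * fdiff (loc ?c \<alpha>) ws (snd ?c x) w + b * fdiff (loc ?c \<beta>) ws (snd ?c x) w)) (at (snd ?c x))"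
        by (intro has_derivative_add has_derivative_mult_right has_derivative_frechet
            loc_differentiable[OF assms(1) c(1) y that] loc_differentiable[OF assms(2) c(1) y that])
      from frechet_derivative_eq[OF this] show ?thesis by (simp add: loc_def)
    qed
    then show ?thesis
      using True by (simp add: ext_deriv_eq_dloc dloc_def sum_distrib_left sum.distrib[symmetric] algebra_simps)
  next
    case False
    then show ?thesis
      using ext_deriv_outside[OF forms_linear[OF assms]] ext_deriv_outside[OF assms(1)] ext_deriv_outside[OF assms(2)]
      by simp
  qed
qed

lemma ext_deriv_cnj:
  assumes "\<alpha> \<in> forms k"
  shows "ext_deriv (\<lambda>x vs. cnj (\<alpha> x vs)) = (\<lambda>x vs. cnj (ext_deriv \<alpha> x vs))"
proof (intro ext)
  fix x vs
  show "ext_deriv (\<lambda>x vs. cnj (\<alpha> x vs)) x vs = cnj (ext_deriv \<alpha> x vs)"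
  proof (cases "x \<in> topspace X \<and> length vs = Suc k \<and> set vs \<subseteq> tangent_space x")
    case True
    let ?c = "chart_at x"
    have c: "?c \<in> A" "x \<in> fst ?c" using chart_at True by blast+
    then have y: "snd ?c x \<in> chart_range ?c" by blast
    have "fdiff (loc ?c (\<lambda>x vs. cnj (\<alpha> x vs))) ws (snd ?c x) w = cnj (fdiff (loc ?c \<alpha>) ws (snd ?c x) w)"
      if "length ws = k" for ws w
    proof -
      have "((\<lambda>y. cnj (loc ?c \<alpha> y ws)) has_derivative (\<lambda>w. cnj (fdiff (loc ?c \<alpha>) ws (snd ?c x) w))) (at (snd ?c x))"
        by (intro bounded_linear.has_derivative[OF bounded_linear_cnj] has_derivative_frechet
            loc_differentiable[OF assms(1) c(1) y that])
      from frechet_derivative_eq[OF this] show ?thesis by (simp add: loc_def)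
    qed
    then show ?thesis using True by (simp add: ext_deriv_eq_dloc dloc_def)
  next
    case False
    then show ?thesis using ext_deriv_outside[OF forms_cnj[OF assms]] ext_deriv_outside[OF assms] by simp
  qed
qed

text \<open>Mixed second derivatives cancel in pairs. The two degrees are those in which it is
  applied: to the function h and to \<eta>.\<close>

lemma ext_deriv_ext_deriv:
  assumes \<eta>: "\<eta> \<in> forms k" and k: "k = 0 \<or> k = 2"
  shows "ext_deriv (ext_deriv \<eta>) = 0"
proof (intro ext)
  fix x vs
  have d: "ext_deriv \<eta> \<in> forms (Suc k)" using ext_deriv_forms[OF \<eta>] k by auto
  show "ext_deriv (ext_deriv \<eta>) x vs = 0 x vs"
  proof (cases "x \<in> topspace X \<and> length vs = Suc (Suc k) \<and> set vs \<subseteq> tangent_space x")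
    case True
    let ?c = "chart_at x"
    let ?F = "loc ?c \<eta>" and ?y = "snd ?c x"
    have c: "?c \<in> A" "x \<in> fst ?c" using chart_at True by blast+
    then have y: "?y \<in> chart_range ?c" by blast
    note op = open_chart_range[OF c(1)]
    have sm: "smooth_on (chart_range ?c) (\<lambda>y. ?F y ws)" if "length ws = k" for ws
      using formsD(3)[OF \<eta> c(1) that] .
    have sym: "frechet_derivative (\<lambda>y. fdiff ?F ws y u) (at ?y) v = frechet_derivative (\<lambda>y. fdiff ?F ws y v) (at ?y) u"
      if "length ws = k" for ws u v
      by (rule second_derivative_symmetric[OF op sm[OF that] y])
    have D: "((\<lambda>y. fdiff ?F ws y u) has_derivative frechet_derivative (\<lambda>y. fdiff ?F ws y u) (at ?y)) (at ?y)"
      if "length ws = k" for ws u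
      by (rule has_derivative_frechet[OF smooth_on_differentiable[OF smooth_on_derivative[OF sm[OF that]] y]])
    have e: "fdiff (loc ?c (ext_deriv \<eta>)) ws ?y = frechet_derivative (\<lambda>y. dloc ?F y ws) (at ?y)"
      if "length ws = Suc k" for ws
      by (rule frechet_derivative_cong_open[OF op y]) (use loc_ext_deriv[OF \<eta> _ c(1) _ that] k in auto)
    have "dloc (loc ?c (ext_deriv \<eta>)) ?y ws = 0" if ws: "length ws = Suc (Suc k)" for ws
      using k
    proof
      assume k: "k = 0"
      then obtain a b where "ws = [a, b]" using ws by (auto simp: length_Suc_conv)
      then show ?thesis using k sym[of "[]" a b] by (simp add: dloc_simps e)
    next
      assume k: "k = 2"
      then obtain p q r s where ws: "ws = [p, q, r, s]" using ws by (auto simp: length_Suc_conv numeral_2_eq_2)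
      have 3: "frechet_derivative (\<lambda>y. dloc ?F y [u, v, w]) (at ?y) h =
          frechet_derivative (\<lambda>y. fdiff ?F [v, w] y u) (at ?y) h - frechet_derivative (\<lambda>y. fdiff ?F [u, w] y v) (at ?y) h
          + frechet_derivative (\<lambda>y. fdiff ?F [u, v] y w) (at ?y) h" for u v w h
        unfolding dloc_simps
        by (subst frechet_derivative_eq[OF has_derivative_add[OF has_derivative_diff[OF D D] D]]) (use k in auto)
      show ?thesis
        using sym[of "[p, q]" r s] sym[of "[p, r]" q s] sym[of "[p, s]" q r] sym[of "[q, r]" p s]
          sym[of "[q, s]" p r] sym[of "[r, s]" p q] k
        by (simp add: ws dloc_simps(5) e 3)
    qed
    then show ?thesis using True by (simp add: ext_deriv_eq_dloc)
  next
    case False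
    then show ?thesis using ext_deriv_outside[OF d] by simp
  qed
qed

lemma loc_has_derivative:
  "\<eta> \<in> forms k \<Longrightarrow> c \<in> A \<Longrightarrow> y \<in> chart_range c \<Longrightarrow> length ws = k \<Longrightarrow>
    ((\<lambda>y. loc c \<eta> y ws) has_derivative fdiff (loc c \<eta>) ws y) (at y)"
  by (rule has_derivative_frechet[OF loc_differentiable])

lemma wedge_alt_0:
  assumes "\<alpha> \<in> alt_forms V 0" "\<beta> \<in> alt_forms V k"
  shows "wedge \<alpha> \<beta> = (\<lambda>vs. \<alpha> [] * \<beta> vs)" "wedge \<alpha> \<beta> \<in> alt_forms V k"
proof -
  have "\<alpha> us = 0" if "us \<noteq> []" for us using alt_formsD(1)[OF assms(1), of us] that by simp
  then show 1: "wedge \<alpha> \<beta> = (\<lambda>vs. \<alpha> [] * \<beta> vs)" by (simp add: fun_eq_iff wedge_degree_0_left)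
  show "wedge \<alpha> \<beta> \<in> alt_forms V k" unfolding 1 by (rule alt_forms_scale[OF assms(2)])
qed

lemma forms_wedge_0:
  assumes "f \<in> forms 0" "\<beta> \<in> forms k"
  shows "(\<lambda>x. wedge (f x) (\<beta> x)) \<in> forms k"
proof -
  have "wedge (f x) (\<beta> x) \<in> alt_forms (tangent_space x) (0 + k)" if "x \<in> topspace X" for x
    using wedge_alt_0(2)[OF formsD(2)[OF assms(1) that] formsD(2)[OF assms(2) that]] by simp
  from forms_wedge[OF assms this] show ?thesis by simp
qed

lemma forms_wedge_1_2:
  assumes "\<alpha> \<in> forms 1" "\<beta> \<in> forms 2"
  shows "(\<lambda>x. wedge (\<alpha> x) (\<beta> x)) \<in> forms 3"
proof -
  have "wedge (\<alpha> x) (\<beta> x) \<in> alt_forms (tangent_space x) (1 + 2)" if "x \<in> topspace X" for x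
    using tvec_space.wedge_1_2_alt[OF tangent_space_tvec_space formsD(2)[OF assms(1)] formsD(2)[OF assms(2)]] that
    by (simp add: numeral_3_eq_3)
  from forms_wedge[OF assms this] show ?thesis by (simp add: numeral_3_eq_3)
qed

lemma forms_wedge_1_3:
  assumes "\<alpha> \<in> forms 1" "\<beta> \<in> forms 3"
  shows "(\<lambda>x. wedge (\<alpha> x) (\<beta> x)) \<in> forms 4"
proof -
  have "wedge (\<alpha> x) (\<beta> x) \<in> alt_forms (tangent_space x) (1 + 3)" if "x \<in> topspace X" for x
    using tvec_space.wedge_1_3_alt[OF tangent_space_tvec_space formsD(2)[OF assms(1)] formsD(2)[OF assms(2)]] that
    by simp
  from forms_wedge[OF assms this] show ?thesis by simp
qed

lemma forms_wedge_2_2: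
  assumes "\<alpha> \<in> forms 2" "\<beta> \<in> forms 2"
  shows "(\<lambda>x. wedge (\<alpha> x) (\<beta> x)) \<in> forms 4"
proof -
  have "wedge (\<alpha> x) (\<beta> x) \<in> alt_forms (tangent_space x) (2 + 2)" if "x \<in> topspace X" for x
    using tvec_space.wedge_2_2_alt[OF tangent_space_tvec_space formsD(2)[OF assms(1)] formsD(2)[OF assms(2)]] that
    by simp
  from forms_wedge[OF assms this] show ?thesis by simp
qed

text \<open>The Leibniz rule for a function times a form. Degree 2 serves h \<and> \<omega>, degree
  3 serves integration by parts against functions.\<close>

lemma ext_deriv_wedge_0:
  assumes f: "f \<in> forms 0" and \<beta>: "\<beta> \<in> forms k" and k: "k = 2 \<or> k = 3" and x: "x \<in> topspace X"
  shows "ext_deriv (\<lambda>x. wedge (f x) (\<beta> x)) x =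
    (\<lambda>vs. wedge (ext_deriv f x) (\<beta> x) vs + wedge (f x) (ext_deriv \<beta> x) vs)"
proof
  fix vs
  let ?V = "tangent_space x"
  have df: "ext_deriv f x \<in> alt_forms ?V 1" using ext_deriv_alt[OF f _ x] by simp
  have bx: "\<beta> x \<in> alt_forms ?V k" using formsD(2)[OF \<beta> x] .
  have db: "ext_deriv \<beta> x \<in> alt_forms ?V (Suc k)" using ext_deriv_alt[OF \<beta> _ x] k by auto
  note w0 = wedge_alt_0(1)[OF formsD(2)[OF f x] db]
  show "ext_deriv (\<lambda>x. wedge (f x) (\<beta> x)) x vs =
    wedge (ext_deriv f x) (\<beta> x) vs + wedge (f x) (ext_deriv \<beta> x) vs"
  proof (cases "length vs = Suc k \<and> set vs \<subseteq> ?V")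
    case True
    obtain c where c: "c \<in> A" "x \<in> fst c" using topspace_chart[OF x] by blast
    let ?y = "snd c x"
    have y: "?y \<in> chart_range c" using c by blast
    have fd: "fdiff (loc c (\<lambda>x. wedge (f x) (\<beta> x))) ws ?y w =
        loc c f ?y [] * fdiff (loc c \<beta>) ws ?y w + fdiff (loc c f) [] ?y w * loc c \<beta> ?y ws"
      if "length ws = k" for ws w
    proof -
      have "loc c (\<lambda>x. wedge (f x) (\<beta> x)) z ws = loc c f z [] * loc c \<beta> z ws" if "z \<in> chart_range c" for z
        using wedge_alt_0(1)[OF formsD(2)[OF f] formsD(2)[OF \<beta>]] chart_subset[OF c(1) chart_inv_in[OF that]]
        by (simp add: loc_def)
      then have "((\<lambda>y. loc c (\<lambda>x. wedge (f x) (\<beta> x)) y ws) has_derivative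
          (\<lambda>w. loc c f ?y [] * fdiff (loc c \<beta>) ws ?y w + fdiff (loc c f) [] ?y w * loc c \<beta> ?y ws)) (at ?y)"
        by (subst has_derivative_cong_open[OF open_chart_range[OF c(1)] y, of _ "\<lambda>y. loc c f y [] * loc c \<beta> y ws"])
          (auto intro!: has_derivative_mult loc_has_derivative[OF f c(1) y] loc_has_derivative[OF \<beta> c(1) y] that)
      from frechet_derivative_eq[OF this] show ?thesis by simp
    qed
    have tv: "map (\<lambda>v. tangent c x (v c)) us = us" if "set us \<subseteq> ?V" for us
      using that tangent_of_coords[OF c] by (induction us) auto
    have lf: "loc c f ?y [] = f x []" by (simp add: loc_snd[OF c])
    have lb: "loc c \<beta> ?y (map (\<lambda>v. v c) us) = \<beta> x us" if "set us \<subseteq> ?V" for us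
      using tv[OF that] by (simp add: loc_snd[OF c] o_def)
    have dfx: "ext_deriv f x [v] = fdiff (loc c f) [] ?y (v c)" if "v \<in> ?V" for v
      using ext_deriv_in_chart[OF f _ c, of "[v]"] that by (simp add: dloc_simps)
    have dx: "ext_deriv (\<lambda>x. wedge (f x) (\<beta> x)) x vs = dloc (loc c (\<lambda>x. wedge (f x) (\<beta> x))) ?y (map (\<lambda>v. v c) vs)"
      using ext_deriv_in_chart[OF forms_wedge_0[OF f \<beta>] _ c] True k by auto
    have dbx: "ext_deriv \<beta> x vs = dloc (loc c \<beta>) ?y (map (\<lambda>v. v c) vs)"
      using ext_deriv_in_chart[OF \<beta> _ c] True k by auto
    show ?thesis
      using k
    proof
      assume k: "k = 2"
      then obtain a b d where vs: "vs = [a, b, d]" "a \<in> ?V" "b \<in> ?V" "d \<in> ?V" using True by (auto simp: length_eq_lists)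
      show ?thesis
        using vs(2-) lb[of "[a, b]"] lb[of "[a, d]"] lb[of "[b, d]"]
        unfolding dx w0 dbx unfolding vs wedge_1_2[OF df bx[unfolded k]] by (simp add: dloc_simps fd k dfx lf algebra_simps)
    next
      assume k: "k = 3"
      then obtain a b d e where vs: "vs = [a, b, d, e]" "a \<in> ?V" "b \<in> ?V" "d \<in> ?V" "e \<in> ?V"
        using True by (auto simp: length_eq_lists)
      show ?thesis
        using vs(2-) lb[of "[a, b, d]"] lb[of "[a, b, e]"] lb[of "[a, d, e]"] lb[of "[b, d, e]"]
        unfolding dx w0 dbx unfolding vs wedge_1_3[OF df bx[unfolded k]] by (simp add: dloc_simps fd k dfx lf algebra_simps)
    qed
  next
    case False
    then show ?thesis
      using ext_deriv_outside[OF forms_wedge_0[OF f \<beta>], of x vs] wedge_outside[OF df bx, of vs]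
        alt_formsD(1,2)[OF db, of vs] by (auto simp: w0)
  qed
qed

lemma ext_deriv_wedge_1_2:
  assumes \<alpha>: "\<alpha> \<in> forms 1" and \<beta>: "\<beta> \<in> forms 2" and x: "x \<in> topspace X"
  shows "ext_deriv (\<lambda>x. wedge (\<alpha> x) (\<beta> x)) x =
    (\<lambda>vs. wedge (ext_deriv \<alpha> x) (\<beta> x) vs - wedge (\<alpha> x) (ext_deriv \<beta> x) vs)"
proof
  fix vs
  let ?V = "tangent_space x"
  have da: "ext_deriv \<alpha> x \<in> alt_forms ?V 2" using ext_deriv_alt[OF \<alpha> _ x] by (simp add: numeral_2_eq_2)
  have db: "ext_deriv \<beta> x \<in> alt_forms ?V 3" using ext_deriv_alt[OF \<beta> _ x] by (simp add: numeral_3_eq_3)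
  have ax: "\<alpha> x \<in> alt_forms ?V 1" and bx: "\<beta> x \<in> alt_forms ?V 2" using formsD(2) \<alpha> \<beta> x by blast+
  show "ext_deriv (\<lambda>x. wedge (\<alpha> x) (\<beta> x)) x vs =
    wedge (ext_deriv \<alpha> x) (\<beta> x) vs - wedge (\<alpha> x) (ext_deriv \<beta> x) vs"
  proof (cases "length vs = 4 \<and> set vs \<subseteq> ?V")
    case True
    obtain c where c: "c \<in> A" "x \<in> fst c" using topspace_chart[OF x] by blast
    let ?y = "snd c x"
    have y: "?y \<in> chart_range c" using c by blast
    let ?D1 = "\<lambda>p w. fdiff (loc c \<alpha>) [p] ?y w" and ?D2 = "\<lambda>p q w. fdiff (loc c \<beta>) [p, q] ?y w"
    have fd: "fdiff (loc c (\<lambda>x. wedge (\<alpha> x) (\<beta> x))) [p, q, r] ?y w =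
        (loc c \<alpha> ?y [p] * ?D2 q r w + ?D1 p w * loc c \<beta> ?y [q, r])
        - (loc c \<alpha> ?y [q] * ?D2 p r w + ?D1 q w * loc c \<beta> ?y [p, r])
        + (loc c \<alpha> ?y [r] * ?D2 p q w + ?D1 r w * loc c \<beta> ?y [p, q])" for p q r w
    proof -
      have eq: "loc c (\<lambda>x. wedge (\<alpha> x) (\<beta> x)) z [p, q, r] =
          loc c \<alpha> z [p] * loc c \<beta> z [q, r] - loc c \<alpha> z [q] * loc c \<beta> z [p, r] + loc c \<alpha> z [r] * loc c \<beta> z [p, q]"
        if "z \<in> chart_range c" for z
        using wedge_1_2[OF formsD(2)[OF \<alpha>] formsD(2)[OF \<beta>]] chart_subset[OF c(1) chart_inv_in[OF that]]
        by (simp add: loc_def)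
      have "((\<lambda>z. loc c \<alpha> z [p] * loc c \<beta> z [q, r] - loc c \<alpha> z [q] * loc c \<beta> z [p, r] + loc c \<alpha> z [r] * loc c \<beta> z [p, q])
        has_derivative (\<lambda>w. (loc c \<alpha> ?y [p] * ?D2 q r w + ?D1 p w * loc c \<beta> ?y [q, r])
        - (loc c \<alpha> ?y [q] * ?D2 p r w + ?D1 q w * loc c \<beta> ?y [p, r])
        + (loc c \<alpha> ?y [r] * ?D2 p q w + ?D1 r w * loc c \<beta> ?y [p, q]))) (at ?y)"
        by (intro has_derivative_add has_derivative_diff has_derivative_mult
            loc_has_derivative[OF \<alpha> c(1) y] loc_has_derivative[OF \<beta> c(1) y]) auto
      then have "((\<lambda>z. loc c (\<lambda>x. wedge (\<alpha> x) (\<beta> x)) z [p, q, r])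
        has_derivative (\<lambda>w. (loc c \<alpha> ?y [p] * ?D2 q r w + ?D1 p w * loc c \<beta> ?y [q, r])
        - (loc c \<alpha> ?y [q] * ?D2 p r w + ?D1 q w * loc c \<beta> ?y [p, r])
        + (loc c \<alpha> ?y [r] * ?D2 p q w + ?D1 r w * loc c \<beta> ?y [p, q]))) (at ?y)"
        by (subst has_derivative_cong_open[OF open_chart_range[OF c(1)] y eq])
      from frechet_derivative_eq[OF this] show ?thesis by simp
    qed
    obtain a b d e where vs: "vs = [a, b, d, e]" "a \<in> ?V" "b \<in> ?V" "d \<in> ?V" "e \<in> ?V"
      using True by (auto simp: length_eq_lists)
    have la: "loc c \<alpha> ?y [v c] = \<alpha> x [v]" if "v \<in> ?V" for v
      using that by (simp add: loc_snd[OF c] tangent_of_coords[OF c])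
    have lb: "loc c \<beta> ?y [u c, v c] = \<beta> x [u, v]" if "u \<in> ?V" "v \<in> ?V" for u v
      using that by (simp add: loc_snd[OF c] tangent_of_coords[OF c])
    have dax: "ext_deriv \<alpha> x [u, v] = ?D1 (v c) (u c) - ?D1 (u c) (v c)" if "u \<in> ?V" "v \<in> ?V" for u v
      using ext_deriv_in_chart[OF \<alpha> _ c, of "[u, v]"] that by (simp add: dloc_simps)
    have dbx: "ext_deriv \<beta> x [u, v, w] = ?D2 (v c) (w c) (u c) - ?D2 (u c) (w c) (v c) + ?D2 (u c) (v c) (w c)"
      if "u \<in> ?V" "v \<in> ?V" "w \<in> ?V" for u v w
      using ext_deriv_in_chart[OF \<beta> _ c, of "[u, v, w]"] that by (simp add: dloc_simps)
    have dx: "ext_deriv (\<lambda>x. wedge (\<alpha> x) (\<beta> x)) x vs = dloc (loc c (\<lambda>x. wedge (\<alpha> x) (\<beta> x))) ?y (map (\<lambda>v. v c) vs)"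
      using ext_deriv_in_chart[OF forms_wedge_1_2[OF \<alpha> \<beta>] _ c] True by auto
    show ?thesis
      unfolding dx unfolding vs(1) wedge_2_2[OF da bx] wedge_1_3[OF ax db]
      using vs(2-) by (simp add: dloc_simps fd la lb dax dbx algebra_simps)
  next
    case False
    then show ?thesis
      using ext_deriv_outside[OF forms_wedge_1_2[OF \<alpha> \<beta>], of x vs] wedge_outside[OF da bx, of vs]
        wedge_outside[OF ax db, of vs] by auto
  qed
qed

end

section \<open>Almost Hermitian manifolds of dimension four\<close>

locale almost_hermitian4 = almost_hermitian X A J g
  for X :: "'a topology" and A :: "('a, real ^ 4) chart set"
    and J :: "'a \<Rightarrow> ('a, real ^ 4) tvec \<Rightarrow> ('a, real ^ 4) tvec"
    and g :: "'a \<Rightarrow> ('a, real ^ 4) tvec \<Rightarrow> ('a, real ^ 4) tvec \<Rightarrow> real"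
begin

lemma hermitian4_at:
  assumes "c \<in> A" "x \<in> fst c"
  shows "hermitian4 (tangent_space x) (J x) (g x) (tangent c x)"
proof -
  have x: "x \<in> topspace X" using chart_subset assms by blast
  interpret tvec_space "tangent_space x" by (rule tangent_space_tvec_space[OF x])
  show ?thesis
    by unfold_locales
      (auto intro: J_tangent[OF x] J_linear[OF x] J_squared[OF x] g_linear[OF x] g_sym[OF x] g_pos[OF x]
        J_isometry[OF x] tangent_linear[OF assms] tangent_bij[OF assms])
qed

lemma hermitian4_ex: "x \<in> topspace X \<Longrightarrow> \<exists>\<kappa>. hermitian4 (tangent_space x) (J x) (g x) \<kappa>"
  using topspace_chart hermitian4_at by blast

text \<open>None of these constants mentions \<kappa>, so all charts around x give the same
  pointwise operators, and \<kappa> may be chosen anew in each proof.\<close>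

abbreviation "omega_at x \<equiv> hermitian4.omega (tangent_space x) (J x) (g x)"
abbreviation "vol_at x \<equiv> hermitian4.vol (tangent_space x) (J x) (g x)"
abbreviation "tpart_at x \<equiv> hermitian4.tpart (tangent_space x) (J x)"
abbreviation "star_at x \<equiv> hermitian4.star (tangent_space x) (J x) (g x)"
abbreviation "top_at x \<equiv> hermitian4.top_coeff (tangent_space x) (J x) (g x)"
abbreviation "form_J_at x \<equiv> hermitian4.form_J (tangent_space x) (J x)"

lemma fundamental_form_at:
  assumes "x \<in> topspace X"
  shows "fundamental_form x = omega_at x"
proof -
  obtain \<kappa> where h: "hermitian4 (tangent_space x) (J x) (g x) \<kappa>" using hermitian4_ex[OF assms] by blast
  show ?thesis by (intro ext) (simp add: fundamental_form_def hermitian4.omega_def[OF h] assms)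
qed

lemma volume_form_at:
  assumes "x \<in> topspace X"
  shows "volume_form x = vol_at x"
proof -
  obtain \<kappa> where h: "hermitian4 (tangent_space x) (J x) (g x) \<kappa>" using hermitian4_ex[OF assms] by blast
  show ?thesis
    by (intro ext) (simp add: volume_form_def hermitian4.vol_def[OF h] fundamental_form_at[OF assms])
qed

lemma pq_part_at:
  assumes "x \<in> topspace X"
  shows "pq_part p q \<eta> x = tpart_at x p q (\<eta> x)"
proof -
  obtain \<kappa> where h: "hermitian4 (tangent_space x) (J x) (g x) \<kappa>" using hermitian4_ex[OF assms] by blast
  show ?thesis
    by (intro ext) (simp add: pq_part_def hermitian4.tpart_def[OF h] type_part_def assms)
qed

lemma pq_part_outside: "x \<notin> topspace X \<Longrightarrow> pq_part p q \<eta> x = 0"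
  by (simp add: pq_part_def fun_eq_iff)

text \<open>An adapted frame witnesses that the choice in \<open>orthonormal_frame\<close> is not
  vacuous. The chosen frame itself may be neither adapted nor positively oriented.\<close>

lemma orthonormal_frame_at:
  assumes "x \<in> topspace X"
  obtains e0 e1 e2 e3 where "orthonormal_frame x = [e0, e1, e2, e3]"
    "hermitian4.orthonormal (tangent_space x) (g x) e0 e1 e2 e3"
proof -
  obtain \<kappa> where "hermitian4 (tangent_space x) (J x) (g x) \<kappa>" using hermitian4_ex[OF assms] by blast
  then interpret h: hermitian4 "tangent_space x" "J x" "g x" \<kappa> .
  let ?P = "\<lambda>es. length es = DIM(real ^ 4) \<and> set es \<subseteq> tangent_space x \<and>
    (\<forall>i<DIM(real ^ 4). \<forall>j<DIM(real ^ 4). g x (es ! i) (es ! j) = (if i = j then 1 else 0))"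
  obtain e0 e2 where e: "h.orthonormal e0 (J x e0) e2 (J x e2)" using h.adapted_frame by blast
  have "?P [e0, J x e0, e2, J x e2]"
    using e h.g_commute[of e0 e2] h.g_commute[of e0 "J x e2"] h.g_commute[of "J x e0" e2]
      h.g_commute[of "J x e0" "J x e2"] by (auto simp: h.orthonormal_def numeral_eq_Suc less_Suc_eq)
  then have P: "?P (orthonormal_frame x)" unfolding orthonormal_frame_def by (rule someI[of ?P])
  then have "length (orthonormal_frame x) = 4" by simp
  then obtain a b c d where abcd: "orthonormal_frame x = [a, b, c, d]" unfolding length_eq_lists by blast
  have V: "a \<in> tangent_space x" "b \<in> tangent_space x" "c \<in> tangent_space x" "d \<in> tangent_space x"
    using P abcd by auto
  have gij: "g x ([a, b, c, d] ! i) ([a, b, c, d] ! j) = (if i = j then 1 else 0)" if "i < 4" "j < 4" for i j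
    using P abcd that by simp
  have "h.orthonormal a b c d"
    using gij[of 0 0] gij[of 1 1] gij[of 2 2] gij[of 3 3] gij[of 0 1] gij[of 0 2] gij[of 0 3]
      gij[of 1 2] gij[of 1 3] gij[of 2 3] V by (simp add: h.orthonormal_def numeral_eq_Suc)
  then show ?thesis using that abcd by blast
qed

text \<open>Existence comes from the explicit formulas and uniqueness from nondegeneracy, so the
  definite description is resolved by \<open>star\<close>.\<close>

lemma hodge_star_at:
  assumes x: "x \<in> topspace X" and \<eta>: "\<eta> x \<in> alt_forms (tangent_space x) k" and k: "k \<le> 4"
  shows "hodge_star \<eta> x = star_at x k (\<eta> x)"
proof
  fix vs
  obtain \<kappa> where "hermitian4 (tangent_space x) (J x) (g x) \<kappa>" using hermitian4_ex[OF x] by blast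
  then interpret h: hermitian4 "tangent_space x" "J x" "g x" \<kappa> .
  obtain e0 e1 e2 e3 where E: "orthonormal_frame x = [e0, e1, e2, e3]" and on: "h.orthonormal e0 e1 e2 e3"
    using orthonormal_frame_at[OF x] by blast
  have inner: "form_inner x m \<alpha> \<beta> = h.inner m [e0, e1, e2, e3] \<alpha> \<beta>" for m \<alpha> \<beta>
    by (simp add: form_inner_def h.inner_def subset_sum_def E numeral_eq_Suc)
  have sa: "h.star k (\<eta> x) \<in> alt_forms (tangent_space x) (4 - k)" using h.star_alt[OF k \<eta>] .
  show "hodge_star \<eta> x vs = h.star k (\<eta> x) vs"
  proof (cases "length vs \<le> 4")
    case True
    \<comment> \<open>\<open>hodge_star\<close> infers the degree of its operand from the number of
      arguments. If the inferred degree m differs from k, all inner products vanish and the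
      described form is zero.\<close>
    define m where "m = 4 - length vs"
    have m: "m \<le> 4" "4 - m = length vs" using True by (auto simp: m_def)
    have "hodge_star \<eta> x vs = (THE \<zeta>. h.is_star m [e0, e1, e2, e3] (\<eta> x) \<zeta>) vs"
      using x True
      by (simp add: hodge_star_def Let_def h.is_star_def alternating_eq inner volume_form_at m_def)
    also have "(THE \<zeta>. h.is_star m [e0, e1, e2, e3] (\<eta> x) \<zeta>) = (if m = k then h.star k (\<eta> x) else (\<lambda>us. 0))"
    proof (rule the_equality)
      show st: "h.is_star m [e0, e1, e2, e3] (\<eta> x) (if m = k then h.star k (\<eta> x) else (\<lambda>us. 0))"
      proof (cases "m = k")
        case False
        have "h.inner m [e0, e1, e2, e3] \<alpha> (\<lambda>ws. cnj (\<eta> x ws)) = 0" for \<alpha>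
          unfolding h.inner_def subset_sum_def
        proof (intro sum.neutral ballI)
          fix I assume "I \<in> {I. I \<subseteq> {..<length [e0, e1, e2, e3]} \<and> card I = m}"
          then have "length (nths [e0, e1, e2, e3] I) \<noteq> k" using False by (subst length_nths_subset) auto
          then show "\<alpha> (nths [e0, e1, e2, e3] I) * cnj (cnj (\<eta> x (nths [e0, e1, e2, e3] I))) = 0"
            using alt_formsD(1)[OF \<eta>] by simp
        qed
        then show ?thesis using False by (simp add: h.is_star_def alt_forms_zero wedge_zero_left fun_eq_iff)
      qed (use h.is_star_star[OF on k \<eta>] in simp)
      show "\<zeta> = (if m = k then h.star k (\<eta> x) else (\<lambda>us. 0))" if "h.is_star m [e0, e1, e2, e3] (\<eta> x) \<zeta>" for \<zeta>
        using h.is_star_unique[OF on m(1) that st] .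
    qed
    finally show ?thesis using alt_formsD(1)[OF sa, of vs] k m by (auto simp: m_def)
  next
    case False
    then show ?thesis using alt_formsD(1)[OF sa, of vs] by (simp add: hodge_star_def)
  qed
qed

end

section \<open>Smoothness of the pointwise operators\<close>

definition basis4 :: "(real ^ 4) list"
  where "basis4 = [axis 1 1, axis 2 1, axis 3 1, axis 4 1]"

lemma basis4_expansion:
  "w = 1 *\<^sub>R (w $ 1 *\<^sub>R axis 1 1 + w $ 2 *\<^sub>R axis 2 1) + 1 *\<^sub>R (w $ 3 *\<^sub>R axis 3 1 + w $ 4 *\<^sub>R axis 4 1)"
  for w :: "real ^ 4"
  by (simp add: vec_eq_iff forall_4 axis_def)

context almost_hermitian4
begin

definition J_loc :: "('a, real ^ 4) chart \<Rightarrow> real ^ 4 \<Rightarrow> real ^ 4 \<Rightarrow> real ^ 4"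
  where "J_loc c y w = J (chart_inv c y) (tangent c (chart_inv c y) w) c"

lemma tangent_J_loc:
  assumes "c \<in> A" "y \<in> chart_range c"
  shows "tangent c (chart_inv c y) (J_loc c y w) = J (chart_inv c y) (tangent c (chart_inv c y) w)"
proof -
  have x: "chart_inv c y \<in> fst c" using chart_inv_in assms by blast
  show ?thesis unfolding J_loc_def
    by (rule tangent_of_coords[OF assms(1) x J_tangent[OF chart_subset[OF assms(1) x] tangent_in[OF assms(1) x]]])
qed

lemma J_loc_smooth: "c \<in> A \<Longrightarrow> smooth_on (chart_range c) (\<lambda>y. J_loc c y w)"
  unfolding J_loc_def by (rule J_smooth)

text \<open>Each triple (a, b, w) encodes the argument a w + b J w. Both the type projections and
  \<open>form_J\<close> are finite sums of such evaluations.\<close>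

lemma smooth_on_J_args:
  assumes \<eta>: "\<eta> \<in> forms k" and c: "c \<in> A" and len: "length bws = k"
  shows "smooth_on (chart_range c) (\<lambda>y. \<eta> (chart_inv c y) (map (\<lambda>(a, b, w).
    comb a (tangent c (chart_inv c y) w) b (J (chart_inv c y) (tangent c (chart_inv c y) w))) bws))"
proof -
  let ?us = "map (\<lambda>(a, b, w) y. a *\<^sub>R w + b *\<^sub>R J_loc c y w) bws"
  note op = open_chart_range[OF c]
  have sm: "smooth_on (chart_range c) (\<lambda>y. loc c \<eta> y (map (\<lambda>u. u y) ?us))"
  proof (rule smooth_on_multilin[OF op])
    show "multilin (length ?us) (loc c \<eta> y)" if "y \<in> chart_range c" for y
      using loc_multilin[OF \<eta> c that] len by simp
    show "smooth_on (chart_range c) (\<lambda>y. loc c \<eta> y ws)" if "length ws = length ?us" for ws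
      using formsD(3)[OF \<eta> c] that len by simp
    show "smooth_on (chart_range c) u" if "u \<in> set ?us" for u
      using that by (auto intro!: smooth_on_add smooth_on_scaleR smooth_on_const op J_loc_smooth[OF c])
  qed
  have eq: "\<eta> (chart_inv c y) (map (\<lambda>(a, b, w).
      comb a (tangent c (chart_inv c y) w) b (J (chart_inv c y) (tangent c (chart_inv c y) w))) bws) =
    loc c \<eta> y (map (\<lambda>u. u y) ?us)" if "y \<in> chart_range c" for y
    unfolding loc_def map_map using tangent_linear[OF c chart_inv_in[OF that]] tangent_J_loc[OF c that]
    by (intro arg_cong[where f = "\<eta> (chart_inv c y)"]) auto
  show ?thesis by (rule smooth_on_congI[OF op sm eq])
qed

lemma hermitian4_loc:
  assumes "c \<in> A" "y \<in> chart_range c"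
  shows "hermitian4 (tangent_space (chart_inv c y)) (J (chart_inv c y)) (g (chart_inv c y)) (tangent c (chart_inv c y))"
    "tangent c (chart_inv c y) w \<in> tangent_space (chart_inv c y)" "chart_inv c y \<in> topspace X"
  using hermitian4_at[OF assms(1) chart_inv_in[OF assms(2)]] tangent_in[OF assms(1) chart_inv_in[OF assms(2)]]
    chart_subset[OF assms(1) chart_inv_in[OF assms(2)]] by blast+

lemma pq_part_formsI:
  assumes \<eta>: "\<eta> \<in> forms k" and k: "p + q = k"
    and alt: "\<And>x. x \<in> topspace X \<Longrightarrow> tpart_at x p q (\<eta> x) \<in> alt_forms (tangent_space x) k"
  shows "pq_part p q \<eta> \<in> forms k"
proof (rule formsI)
  show "pq_part p q \<eta> x = 0" if "x \<notin> topspace X" for x using pq_part_outside[OF that] .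
  show "pq_part p q \<eta> x \<in> alt_forms (tangent_space x) k" if "x \<in> topspace X" for x
    using alt[OF that] by (simp add: pq_part_at[OF that])
  show "smooth_on (chart_range c) (\<lambda>y. loc c (pq_part p q \<eta>) y ws)" if c: "c \<in> A" and ws: "length ws = k" for c ws
  proof -
    note op = open_chart_range[OF c]
    \<comment> \<open>Expanding \<open>complexify\<close> over T puts into slot j either half the
      vector or plus or minus half its image under J, the sign depending on S.\<close>
    let ?b = "\<lambda>S T j. if j \<in> T then (0, if j \<in> S then - 1 / 2 else 1 / 2, ws ! j) else (1 / 2, 0, ws ! j)"
    let ?F = "\<lambda>S T y. \<eta> (chart_inv c y) (map (\<lambda>(a, b, w).
      comb a (tangent c (chart_inv c y) w) b (J (chart_inv c y) (tangent c (chart_inv c y) w))) (map (?b S T) [0..<k]))"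
    have "smooth_on (chart_range c) (\<lambda>y. \<Sum>S | S \<subseteq> {..<k} \<and> card S = p. \<Sum>T\<in>Pow {..<k}. \<i> ^ card T * ?F S T y)"
      by (intro smooth_on_sum smooth_on_mult smooth_on_const op smooth_on_J_args[OF \<eta> c]) simp
    then show ?thesis
    proof (rule smooth_on_congI[OF op])
      fix y assume y: "y \<in> chart_range c"
      let ?vs = "map (tangent c (chart_inv c y)) ws"
      let ?zs = "\<lambda>S. map (\<lambda>j. (comb (1 / 2) (?vs ! j) 0 0, comb (if j \<in> S then - 1 / 2 else 1 / 2) (J (chart_inv c y) (?vs ! j)) 0 0)) [0..<k]"
      have "map (\<lambda>j. if j \<in> T then snd (?zs S ! j) else fst (?zs S ! j)) [0..<k] = map (\<lambda>(a, b, w).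
        comb a (tangent c (chart_inv c y) w) b (J (chart_inv c y) (tangent c (chart_inv c y) w))) (map (?b S T) [0..<k])" for S T
        using ws by (auto simp: comb_def)
      then have "complexify (\<eta> (chart_inv c y)) (?zs S) = (\<Sum>T\<in>Pow {..<k}. \<i> ^ card T * ?F S T y)" for S
        unfolding complexify_def by (simp only: length_map length_upt diff_zero)
      moreover have "set ?vs \<subseteq> tangent_space (chart_inv c y)" using hermitian4_loc(2)[OF c y] by auto
      then have "loc c (pq_part p q \<eta>) y ws = (\<Sum>S | S \<subseteq> {..<k} \<and> card S = p. complexify (\<eta> (chart_inv c y)) (?zs S))"
        using ws hermitian4_loc(3)[OF c y] by (simp only: loc_def pq_part_def k length_map simp_thms if_True)
      ultimately show "loc c (pq_part p q \<eta>) y ws = (\<Sum>S | S \<subseteq> {..<k} \<and> card S = p. \<Sum>T\<in>Pow {..<k}. \<i> ^ card T * ?F S T y)"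
        by (simp only:)
    qed
  qed
qed

lemma pq_part_forms_1:
  assumes \<eta>: "\<eta> \<in> forms 1"
  shows "pq_part (Suc 0) 0 \<eta> \<in> forms 1" "pq_part 0 (Suc 0) \<eta> \<in> forms 1"
  by (rule pq_part_formsI[OF \<eta>], simp, use hermitian4_ex hermitian4.tpart_1_alt formsD(2)[OF \<eta>] in blast)+

lemma pq_part_forms_2:
  assumes \<eta>: "\<eta> \<in> forms 2"
  shows "pq_part 2 0 \<eta> \<in> forms 2" "pq_part (Suc 0) (Suc 0) \<eta> \<in> forms 2" "pq_part 0 2 \<eta> \<in> forms 2"
  by (rule pq_part_formsI[OF \<eta>], simp, use hermitian4_ex hermitian4.tpart_2_alt[unfolded One_nat_def] formsD(2)[OF \<eta>] in blast)+

lemma pq_part_forms_3: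
  assumes \<eta>: "\<eta> \<in> forms 3"
  shows "pq_part 2 (Suc 0) \<eta> \<in> forms 3" "pq_part (Suc 0) 2 \<eta> \<in> forms 3"
  by (rule pq_part_formsI[OF \<eta>], simp, use hermitian4_ex hermitian4.tpart_3_alt formsD(2)[OF \<eta>] in blast)+

lemma g_loc_smooth:
  assumes "c \<in> A"
  shows "smooth_on (chart_range c) (\<lambda>y. complex_of_real (g (chart_inv c y) (tangent c (chart_inv c y) u) (tangent c (chart_inv c y) w)))"
  by (rule smooth_on_of_real[OF open_chart_range[OF assms] g_smooth[OF assms]])

lemma fundamental_form_forms: "fundamental_form \<in> forms 2"
proof (rule formsI)
  show "fundamental_form x = 0" if "x \<notin> topspace X" for x using that by (simp add: fundamental_form_def fun_eq_iff)
  show "fundamental_form x \<in> alt_forms (tangent_space x) 2" if "x \<in> topspace X" for x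
    using hermitian4_ex[OF that] hermitian4.omega_alt by (auto simp: fundamental_form_at[OF that])
  show "smooth_on (chart_range c) (\<lambda>y. loc c fundamental_form y ws)" if c: "c \<in> A" and "length ws = 2" for c ws
  proof -
    obtain u w where ws: "ws = [u, w]" using \<open>length ws = 2\<close> by (auto simp: length_eq_lists)
    note op = open_chart_range[OF c]
    \<comment> \<open>The metric with its second argument kept constant is a multilinear map of one
      argument, into which the smooth field J u can be substituted.\<close>
    let ?G = "\<lambda>y us. complex_of_real (g (chart_inv c y) (tangent c (chart_inv c y) (us ! 0)) (tangent c (chart_inv c y) w))"
    have "smooth_on (chart_range c) (\<lambda>y. ?G y (map (\<lambda>u. u y) [\<lambda>y. J_loc c y u]))"
    proof (rule smooth_on_multilin[OF op])
      show "multilin (length [\<lambda>y. J_loc c y u]) (?G y)" if y: "y \<in> chart_range c" for y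
      proof -
        interpret h: hermitian4 "tangent_space (chart_inv c y)" "J (chart_inv c y)" "g (chart_inv c y)" "tangent c (chart_inv c y)"
          by (rule hermitian4_loc(1)[OF c y])
        show ?thesis
          unfolding multilin_def by (auto simp: length_Suc_conv h.\<kappa>_linear h.g_comb scaleR_conv_of_real[where 'a = complex])
      qed
    qed (use g_loc_smooth[OF c] J_loc_smooth[OF c] in auto)
    moreover have "loc c fundamental_form y ws = ?G y (map (\<lambda>u. u y) [\<lambda>y. J_loc c y u])" if y: "y \<in> chart_range c" for y
      using hermitian4_loc(2,3)[OF c y] by (simp add: loc_def ws fundamental_form_def tangent_J_loc[OF c y])
    ultimately show ?thesis by (rule smooth_on_congI[OF op])
  qed
qed

lemma volume_form_forms: "volume_form \<in> forms 4"
proof -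
  have "(\<lambda>x vs. (1/2) * wedge (fundamental_form x) (fundamental_form x) vs) \<in> forms 4"
    by (intro forms_scale forms_wedge_2_2 fundamental_form_forms)
  moreover have "volume_form = (\<lambda>x vs. (1/2) * wedge (fundamental_form x) (fundamental_form x) vs)"
  proof
    fix x
    show "volume_form x = (\<lambda>vs. (1/2) * wedge (fundamental_form x) (fundamental_form x) vs)"
    proof (cases "x \<in> topspace X")
      case True
      then obtain \<kappa> where h: "hermitian4 (tangent_space x) (J x) (g x) \<kappa>" using hermitian4_ex by blast
      show ?thesis using hermitian4.vol_eq[OF h] True by (simp add: volume_form_at fundamental_form_at)
    next
      case False
      then have f0: "fundamental_form x = (\<lambda>vs. 0)" by (simp add: fundamental_form_def fun_eq_iff)
      have "wedge_power (fundamental_form x) 2 vs = 0" for vs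
        unfolding f0 numeral_2_eq_2 by (simp add: wedge_zero_left)
      then have "volume_form x vs = 0" for vs by (simp add: volume_form_def)
      then show ?thesis by (intro ext) (simp add: f0 wedge_zero_left)
    qed
  qed
  ultimately show ?thesis by simp
qed

lemma basis4_spanning:
  assumes "c \<in> A" "x \<in> fst c"
  shows "tvec_space.spanning (tangent_space x) (tangent c x (axis 1 1)) (tangent c x (axis 2 1))
    (tangent c x (axis 3 1)) (tangent c x (axis 4 1))"
proof -
  interpret tvec_space "tangent_space x" by (rule tangent_space_tvec_space[OF chart_subset[OF assms]])
  have "\<exists>p q r s. v = comb 1 (comb p (tangent c x (axis 1 1)) q (tangent c x (axis 2 1))) 1
      (comb r (tangent c x (axis 3 1)) s (tangent c x (axis 4 1)))" if "v \<in> tangent_space x" for v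
  proof -
    have "tangent c x (v c) = comb 1 (comb (v c $ 1) (tangent c x (axis 1 1)) (v c $ 2) (tangent c x (axis 2 1))) 1
      (comb (v c $ 3) (tangent c x (axis 3 1)) (v c $ 4) (tangent c x (axis 4 1)))"
      by (subst basis4_expansion) (simp only: tangent_linear[OF assms])
    then show ?thesis using tangent_of_coords[OF assms that] by metis
  qed
  then show ?thesis using assms by (simp add: spanning_def)
qed

lemma loc_volume_nonzero:
  assumes "c \<in> A" "y \<in> chart_range c"
  shows "loc c volume_form y basis4 \<noteq> 0"
proof
  assume 0: "loc c volume_form y basis4 = 0"
  let ?x = "chart_inv c y"
  interpret h: hermitian4 "tangent_space ?x" "J ?x" "g ?x" "tangent c ?x" by (rule hermitian4_loc(1)[OF assms])
  have "h.vol = (\<lambda>vs. 0)"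
    using 0 by (intro h.alt_4_eqI[OF basis4_spanning[OF assms(1) chart_inv_in[OF assms(2)]] h.vol_alt alt_forms_zero])
      (simp add: loc_def basis4_def volume_form_at[OF hermitian4_loc(3)[OF assms]])
  moreover obtain e0 e2 where "h.orthonormal e0 (J ?x e0) e2 (J ?x e2)" using h.adapted_frame by blast
  ultimately show False using h.vol_adapted[of e0 e2] by simp
qed

text \<open>The top coefficient as a quotient of two coordinate coefficients. It depends smoothly on
  the point although the adapted frame in the definition is chosen pointwise and without any
  continuity.\<close>

lemma top_at_loc:
  assumes "c \<in> A" "y \<in> chart_range c" "T (chart_inv c y) \<in> alt_forms (tangent_space (chart_inv c y)) 4"
  shows "top_at (chart_inv c y) (T (chart_inv c y)) = loc c T y basis4 / loc c volume_form y basis4"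
proof -
  let ?x = "chart_inv c y"
  interpret h: hermitian4 "tangent_space ?x" "J ?x" "g ?x" "tangent c ?x" by (rule hermitian4_loc(1)[OF assms(1,2)])
  have "loc c T y basis4 = h.top_coeff (T ?x) * loc c volume_form y basis4"
    using h.top_coeff_eval[OF assms(3)] by (simp add: loc_def volume_form_at[OF hermitian4_loc(3)[OF assms(1,2)]])
  then show ?thesis using loc_volume_nonzero[OF assms(1,2)] by simp
qed

lemma top_at_smooth:
  assumes c: "c \<in> A" and alt: "\<And>y. y \<in> chart_range c \<Longrightarrow> T (chart_inv c y) \<in> alt_forms (tangent_space (chart_inv c y)) 4"
    and sm: "smooth_on (chart_range c) (\<lambda>y. loc c T y basis4)"
  shows "smooth_on (chart_range c) (\<lambda>y. top_at (chart_inv c y) (T (chart_inv c y)))"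
proof -
  have "smooth_on (chart_range c) (\<lambda>y. loc c T y basis4 / loc c volume_form y basis4)"
    by (rule smooth_on_divide[OF open_chart_range[OF c] sm formsD(3)[OF volume_form_forms c]])
      (simp_all add: basis4_def loc_volume_nonzero[OF c, unfolded basis4_def])
  then show ?thesis
    by (rule smooth_on_congI[OF open_chart_range[OF c]]) (rule top_at_loc[where T = T, OF c _ alt])
qed

definition top_form :: "('a, real ^ 4) form_field \<Rightarrow> ('a, real ^ 4) form_field"
  where "top_form T x vs = (if x \<in> topspace X \<and> vs = [] then top_at x (T x) else 0)"

lemma top_form_forms:
  assumes "T \<in> forms 4"
  shows "top_form T \<in> forms 0"
proof (rule formsI)
  show "top_form T x = 0" if "x \<notin> topspace X" for x using that by (simp add: top_form_def fun_eq_iff)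
  show "top_form T x \<in> alt_forms (tangent_space x) 0" if "x \<in> topspace X" for x
    using alt_forms_0I[of "top_at x (T x)"] that by (simp add: top_form_def[abs_def])
  show "smooth_on (chart_range c) (\<lambda>y. loc c (top_form T) y ws)" if c: "c \<in> A" and "length ws = 0" for c ws
  proof -
    have "smooth_on (chart_range c) (\<lambda>y. top_at (chart_inv c y) (T (chart_inv c y)))"
    proof (rule top_at_smooth[where T = T, OF c])
      show "T (chart_inv c y) \<in> alt_forms (tangent_space (chart_inv c y)) 4" if "y \<in> chart_range c" for y
        by (rule formsD(2)[OF assms hermitian4_loc(3)[OF c that]])
      show "smooth_on (chart_range c) (\<lambda>y. loc c T y basis4)"
        by (rule formsD(3)[OF assms c]) (simp add: basis4_def)
    qed
    moreover have "loc c (top_form T) y ws = top_at (chart_inv c y) (T (chart_inv c y))" if "y \<in> chart_range c" for y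
      using hermitian4_loc(3)[OF c that] \<open>length ws = 0\<close> by (simp add: loc_def top_form_def)
    ultimately show ?thesis by (rule smooth_on_congI[OF open_chart_range[OF c]])
  qed
qed

definition form_J_field :: "('a, real ^ 4) form_field \<Rightarrow> ('a, real ^ 4) form_field"
  where "form_J_field \<eta> x = (if x \<in> topspace X then form_J_at x (\<eta> x) else 0)"

lemma form_J_field_forms:
  assumes \<eta>: "\<eta> \<in> forms k" and k: "k = 1 \<or> k = 2"
  shows "form_J_field \<eta> \<in> forms k"
proof (rule formsI)
  show "form_J_field \<eta> x = 0" if "x \<notin> topspace X" for x using that by (simp add: form_J_field_def)
  show "form_J_field \<eta> x \<in> alt_forms (tangent_space x) k" if "x \<in> topspace X" for x
    using hermitian4_ex[OF that] hermitian4.form_J_1_alt hermitian4.form_J_2_alt formsD(2)[OF \<eta> that] k that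
    by (auto simp: form_J_field_def)
  show "smooth_on (chart_range c) (\<lambda>y. loc c (form_J_field \<eta>) y ws)" if c: "c \<in> A" and ws: "length ws = k" for c ws
  proof -
    have "loc c (form_J_field \<eta>) y ws = \<eta> (chart_inv c y) (map (\<lambda>(a, b, w). comb a (tangent c (chart_inv c y) w) b
        (J (chart_inv c y) (tangent c (chart_inv c y) w))) (map (\<lambda>w. (0, 1, w)) ws))" if y: "y \<in> chart_range c" for y
    proof -
      have "set (map (tangent c (chart_inv c y)) ws) \<subseteq> tangent_space (chart_inv c y)"
        using hermitian4_loc(2)[OF c y] by auto
      then show ?thesis
        using hermitian4_loc(3)[OF c y]
        by (simp add: loc_def form_J_field_def hermitian4.form_J_def[OF hermitian4_loc(1)[OF c y]] o_def comb_def)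
    qed
    then show ?thesis
      by (intro smooth_on_congI[OF open_chart_range[OF c] smooth_on_J_args[OF \<eta> c, of "map (\<lambda>w. (0, 1, w)) ws"]])
        (use ws in auto)
  qed
qed

text \<open>Except in degree 3, the formulas for the star are built from wedge products,
  \<open>form_J_field\<close> and \<open>top_form\<close>, all of which preserve smoothness.\<close>

lemma hodge_star_forms:
  assumes \<eta>: "\<eta> \<in> forms k" and k: "k \<le> 4"
  shows "hodge_star \<eta> \<in> forms (4 - k)"
proof -
  have out: "hodge_star \<eta> x = (\<lambda>vs. 0)" if "x \<notin> topspace X" for x
    using that by (simp add: hodge_star_def fun_eq_iff)
  have at: "hodge_star \<eta> x = star_at x k (\<eta> x)" if "x \<in> topspace X" for x
    using hodge_star_at[where \<eta> = \<eta>, OF that formsD(2)[OF \<eta> that] k] .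
  have eqI: "hodge_star \<eta> \<in> forms (4 - k)"
    if "\<beta> \<in> forms (4 - k)" "\<And>x. x \<in> topspace X \<Longrightarrow> star_at x k (\<eta> x) = \<beta> x" for \<beta>
  proof -
    have "hodge_star \<eta> x = \<beta> x" for x
      using out[of x] at[of x] that(2)[of x] formsD(1)[OF that(1), of x] by (cases "x \<in> topspace X") (auto simp: fun_eq_iff)
    then have "hodge_star \<eta> = \<beta>" by blast
    then show ?thesis using that(1) by simp
  qed
  consider "k = 0" | "k = 1" | "k = 2" | "k = 3" | "k = 4" using k by linarith
  then show ?thesis
  proof cases
    case 1
    show ?thesis
    proof (rule eqI)
      show "(\<lambda>x. wedge (\<eta> x) (volume_form x)) \<in> forms (4 - k)"
        using forms_wedge_0[OF \<eta>[unfolded 1] volume_form_forms] 1 by simp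
      show "star_at x k (\<eta> x) = wedge (\<eta> x) (volume_form x)" if x: "x \<in> topspace X" for x
      proof -
        obtain \<kappa> where h: "hermitian4 (tangent_space x) (J x) (g x) \<kappa>" using hermitian4_ex[OF x] by blast
        show ?thesis
          using wedge_alt_0(1)[OF formsD(2)[OF \<eta>[unfolded 1] x] formsD(2)[OF volume_form_forms x]]
          by (simp add: 1 hermitian4.star_simps[OF h] hermitian4.star_0_def[OF h, abs_def] volume_form_at[OF x])
      qed
    qed
  next
    case 2
    show ?thesis
    proof (rule eqI)
      show "(\<lambda>x vs. (-1) * wedge (form_J_field \<eta> x) (fundamental_form x) vs) \<in> forms (4 - k)"
        using forms_scale[OF forms_wedge_1_2[OF form_J_field_forms[OF \<eta>[unfolded 2]] fundamental_form_forms], of "-1"] 2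
        by simp
      show "star_at x k (\<eta> x) = (\<lambda>vs. (-1) * wedge (form_J_field \<eta> x) (fundamental_form x) vs)" if x: "x \<in> topspace X" for x
      proof -
        obtain \<kappa> where h: "hermitian4 (tangent_space x) (J x) (g x) \<kappa>" using hermitian4_ex[OF x] by blast
        show ?thesis
          by (simp add: 2 hermitian4.star_simps[OF h] hermitian4.star_1_def[OF h, abs_def] form_J_field_def x fundamental_form_at)
      qed
    qed
  next
    case 3
    let ?T = "\<lambda>x. wedge (\<eta> x) (fundamental_form x)"
    have T: "?T \<in> forms 4" using forms_wedge_2_2[OF \<eta>[unfolded 3] fundamental_form_forms] .
    show ?thesis
    proof (rule eqI)
      show "(\<lambda>x vs. (-1) * form_J_field \<eta> x vs + 1 * wedge (top_form ?T x) (fundamental_form x) vs) \<in> forms (4 - k)"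
        using forms_linear[OF form_J_field_forms[OF \<eta>[unfolded 3]] forms_wedge_0[OF top_form_forms[OF T] fundamental_form_forms], of "-1" 1] 3
        by simp
      show "star_at x k (\<eta> x) = (\<lambda>vs. (-1) * form_J_field \<eta> x vs + 1 * wedge (top_form ?T x) (fundamental_form x) vs)"
        if x: "x \<in> topspace X" for x
      proof -
        obtain \<kappa> where h: "hermitian4 (tangent_space x) (J x) (g x) \<kappa>" using hermitian4_ex[OF x] by blast
        have "wedge (top_form ?T x) (fundamental_form x) = (\<lambda>vs. top_form ?T x [] * fundamental_form x vs)"
          by (rule wedge_alt_0(1)[OF formsD(2)[OF top_form_forms[OF T] x] formsD(2)[OF fundamental_form_forms x]])
        then show ?thesis
          by (simp add: 3 hermitian4.star_simps[OF h] hermitian4.star_2_def[OF h, abs_def] form_J_field_def x fundamental_form_at top_form_def)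
      qed
    qed
  next
    case 4
    show ?thesis
    proof (rule formsI)
      show "hodge_star \<eta> x = 0" if "x \<notin> topspace X" for x using out[OF that] by (simp add: fun_eq_iff)
      show "hodge_star \<eta> x \<in> alt_forms (tangent_space x) (4 - k)" if x: "x \<in> topspace X" for x
        using hermitian4_ex[OF x] hermitian4.star_alt[OF _ k formsD(2)[OF \<eta> x]] by (auto simp: at[OF x])
      show "smooth_on (chart_range c) (\<lambda>y. loc c (hodge_star \<eta>) y ws)" if c: "c \<in> A" and ws: "length ws = 4 - k" for c ws
      proof -
        obtain w where w: "ws = [w]" using ws 4 by (auto simp: length_Suc_conv)
        note op = open_chart_range[OF c]
        \<comment> \<open>The coefficient of a star of degree 3 is the top coefficient of flat v
          \<and> \<eta> with v a coordinate field. This field lives only over the chart, so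
          smoothness is checked chart by chart.\<close>
        let ?t = "\<lambda>x. tangent c x w"
        let ?T = "\<lambda>x. wedge (hermitian4.flat (tangent_space x) (g x) (?t x)) (\<eta> x)"
        have fl: "hermitian4.flat (tangent_space (chart_inv c y)) (g (chart_inv c y)) (?t (chart_inv c y))
            \<in> alt_forms (tangent_space (chart_inv c y)) 1" if y: "y \<in> chart_range c" for y
          using hermitian4.flat_alt[OF hermitian4_loc(1)[OF c y] hermitian4_loc(2)[OF c y]] .
        have et: "\<eta> (chart_inv c y) \<in> alt_forms (tangent_space (chart_inv c y)) 3" if y: "y \<in> chart_range c" for y
          using formsD(2)[OF \<eta> hermitian4_loc(3)[OF c y]] 4 by simp
        have sm: "smooth_on (chart_range c) (\<lambda>y. top_at (chart_inv c y) (?T (chart_inv c y)))"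
        proof (rule top_at_smooth[OF c])
          show "?T (chart_inv c y) \<in> alt_forms (tangent_space (chart_inv c y)) 4" if y: "y \<in> chart_range c" for y
            by (rule tvec_space.wedge_1_3_alt[OF tangent_space_tvec_space[OF hermitian4_loc(3)[OF c y]] fl[OF y] et[OF y]])
          let ?G = "\<lambda>y b. complex_of_real (g (chart_inv c y) (?t (chart_inv c y)) (tangent c (chart_inv c y) b))"
          have e1: "loc c ?T y [p, q, r, s] = ?G y p * loc c \<eta> y [q, r, s] - ?G y q * loc c \<eta> y [p, r, s]
              + ?G y r * loc c \<eta> y [p, q, s] - ?G y s * loc c \<eta> y [p, q, r]" if y: "y \<in> chart_range c" for y p q r s
            using wedge_1_3[OF fl[OF y] et[OF y]]
            by (simp add: loc_def hermitian4.flat_eval[OF hermitian4_loc(1)[OF c y]] hermitian4_loc(2)[OF c y])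
          have e2: "smooth_on (chart_range c) (\<lambda>y. ?G y p * loc c \<eta> y [q, r, s] - ?G y q * loc c \<eta> y [p, r, s]
              + ?G y r * loc c \<eta> y [p, q, s] - ?G y s * loc c \<eta> y [p, q, r])" for p q r s
            by (intro smooth_on_add smooth_on_diff smooth_on_mult op g_loc_smooth[OF c] formsD(3)[OF \<eta> c]) (simp_all add: 4)
          show "smooth_on (chart_range c) (\<lambda>y. loc c ?T y basis4)"
            unfolding basis4_def by (rule smooth_on_congI[OF op e2 e1])
        qed
        have "loc c (hodge_star \<eta>) y ws = - top_at (chart_inv c y) (?T (chart_inv c y))" if y: "y \<in> chart_range c" for y
          using hermitian4_loc(2)[OF c y]
          by (simp add: loc_def at[OF hermitian4_loc(3)[OF c y]] 4 w hermitian4.star_simps[OF hermitian4_loc(1)[OF c y]]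
              hermitian4.star_3_def[OF hermitian4_loc(1)[OF c y]])
        then show ?thesis by (rule smooth_on_congI[OF op smooth_on_minus[OF op sm]])
      qed
    qed
  next
    case 5
    show ?thesis
    proof (rule eqI)
      show "top_form \<eta> \<in> forms (4 - k)" using top_form_forms \<eta> 5 by simp
      show "star_at x k (\<eta> x) = top_form \<eta> x" if x: "x \<in> topspace X" for x
      proof -
        obtain \<kappa> where h: "hermitian4 (tangent_space x) (J x) (g x) \<kappa>" using hermitian4_ex[OF x] by blast
        show ?thesis by (auto simp: 5 hermitian4.star_simps[OF h] hermitian4.star_4_def[OF h] top_form_def x fun_eq_iff)
      qed
    qed
  qed
qed

end

section \<open>Smooth bump functions\<close>

text \<open>The polynomial factor makes the family closed under differentiation: with s = 1 / t, the
  derivative has the polynomial s^2 (p - p'). Smoothness then follows by induction over all p at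
  once.\<close>

definition flat_exp :: "real poly \<Rightarrow> real \<Rightarrow> real"
  where "flat_exp p t = (if t > 0 then poly p (1 / t) * exp (- (1 / t)) else 0)"

lemma poly_exp_tendsto_0: "((\<lambda>s::real. poly p s * exp (- s)) \<longlongrightarrow> 0) at_top"
proof -
  have "((\<lambda>s::real. \<Sum>i\<le>degree p. coeff p i * (s ^ i / exp s)) \<longlongrightarrow> (\<Sum>i\<le>degree p. coeff p i * 0)) at_top"
    by (intro tendsto_sum tendsto_mult tendsto_const tendsto_power_div_exp_0)
  moreover have "(\<Sum>i\<le>degree p. coeff p i * (s ^ i / exp s)) = poly p s * exp (- s)" for s :: real
    by (auto simp: poly_altdef sum_distrib_right exp_minus divide_inverse mult.assoc intro!: sum.cong)
  ultimately show ?thesis by simp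
qed

lemma flat_exp_has_derivative:
  "(flat_exp p has_real_derivative flat_exp ([:0, 0, 1:] * (p - pderiv p)) t) (at t)"
proof -
  consider "t > 0" | "t < 0" | "t = 0" by linarith
  then show ?thesis
  proof cases
    case 1
    have "((\<lambda>t. poly p (1 / t) * exp (- (1 / t))) has_real_derivative
        flat_exp ([:0, 0, 1:] * (p - pderiv p)) t) (at t)"
      using 1 by (auto intro!: derivative_eq_intros poly_DERIV[THEN DERIV_chain2]
          simp: flat_exp_def field_simps power2_eq_square)
    then show ?thesis
      by (rule has_field_derivative_transform_within_open[of _ _ _ "{0<..}"]) (use 1 in \<open>auto simp: flat_exp_def\<close>)
  next
    case 2
    have "((\<lambda>t. 0) has_real_derivative flat_exp ([:0, 0, 1:] * (p - pderiv p)) t) (at t)"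
      using 2 by (simp add: flat_exp_def)
    then show ?thesis
      by (rule has_field_derivative_transform_within_open[of _ _ _ "{..<0}"]) (use 2 in \<open>auto simp: flat_exp_def\<close>)
  next
    case 3
    \<comment> \<open>With s = 1 / h the difference quotient is s p(s) exp(-s), which explains
      \<open>pCons 0 p\<close>.\<close>
    have "((\<lambda>h. flat_exp p h / h) \<longlongrightarrow> 0) (at_right 0)"
    proof -
      have "((\<lambda>s::real. poly (pCons 0 p) s * exp (- s)) \<longlongrightarrow> 0) at_top" by (rule poly_exp_tendsto_0)
      then have "((\<lambda>h::real. poly (pCons 0 p) (inverse h) * exp (- inverse h)) \<longlongrightarrow> 0) (at_right 0)"
        by (rule filterlim_compose[OF _ filterlim_inverse_at_top_right])
      then show ?thesis
        by (rule Lim_transform_eventually) (auto simp: eventually_at_filter flat_exp_def field_simps)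
    qed
    moreover have "((\<lambda>h. flat_exp p h / h) \<longlongrightarrow> 0) (at_left 0)"
      by (rule Lim_transform_eventually[OF tendsto_const]) (auto simp: eventually_at_filter flat_exp_def)
    ultimately have "((\<lambda>h. flat_exp p h / h) \<longlongrightarrow> 0) (at 0)"
      by (simp add: filterlim_split_at)
    then show ?thesis using 3 by (simp add: DERIV_def flat_exp_def)
  qed
qed

lemma flat_exp_smooth: "smooth_on S (flat_exp p)"
proof -
  have "differentiable_upto m (flat_exp p) UNIV" for m
  proof (induction m arbitrary: p)
    case 0
    have "isCont (flat_exp p) t" for t using flat_exp_has_derivative DERIV_isCont by blast
    then show ?case by (simp add: continuous_on_eq_continuous_at)
  next
    case (Suc m)
    let ?q = "[:0, 0, 1:] * (p - pderiv p)"
    have D: "(flat_exp p has_derivative (\<lambda>w. flat_exp ?q t * w)) (at t)" for t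
      using flat_exp_has_derivative has_field_derivative_def by blast
    have "differentiable_upto m (\<lambda>t. flat_exp ?q t * w) UNIV" for w
      by (intro differentiable_upto_bilinear[OF bounded_bilinear_mult] Suc.IH differentiable_upto_const) simp
    moreover have "frechet_derivative (flat_exp p) (at t) w = flat_exp ?q t * w" for t w
      using frechet_derivative_eq[OF D] by simp
    moreover have "flat_exp p differentiable at t" for t using D unfolding differentiable_def by blast
    ultimately show ?case by simp
  qed
  then show ?thesis using smooth_on_subset[of UNIV] by (auto simp: smooth_on_def)
qed

text \<open>The squared distance is used because it is smooth at the centre as well; the bump is
  positive exactly on the open ball.\<close>

definition ball_bump :: "'e::euclidean_space \<Rightarrow> real \<Rightarrow> 'e \<Rightarrow> real"
  where "ball_bump y0 r y = flat_exp 1 (r\<^sup>2 - (y - y0) \<bullet> (y - y0))"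

lemma ball_bump_smooth: "open S \<Longrightarrow> smooth_on S (ball_bump y0 r)"
  unfolding ball_bump_def[abs_def]
  by (rule smooth_on_compose[where R = UNIV and f = "flat_exp 1"])
    (auto intro!: smooth_on_diff smooth_on_inner smooth_on_ident smooth_on_const flat_exp_smooth)

lemma ball_bump_nonneg: "ball_bump y0 r y \<ge> 0"
  by (simp add: ball_bump_def flat_exp_def)

lemma ball_bump_pos_iff: "r > 0 \<Longrightarrow> ball_bump y0 r y > 0 \<longleftrightarrow> y \<in> ball y0 r"
proof -
  assume r: "r > 0"
  have "r\<^sup>2 - (y - y0) \<bullet> (y - y0) > 0 \<longleftrightarrow> norm (y - y0) < r"
    using r power2_less_imp_less[of "norm (y - y0)" r] power_strict_mono[of "norm (y - y0)" r 2]
    by (auto simp: power2_norm_eq_inner)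
  then show ?thesis by (simp add: ball_bump_def flat_exp_def dist_norm norm_minus_commute)
qed

section \<open>Integrals of compactly supported functions\<close>

lemma continuous_compact_support_integrable:
  fixes f :: "'e::euclidean_space \<Rightarrow> 'b::euclidean_space"
  assumes "continuous_on UNIV f" "compact K" "\<And>y. y \<notin> K \<Longrightarrow> f y = 0"
  shows "integrable lborel f" "f absolutely_integrable_on UNIV" "f integrable_on UNIV"
proof -
  have "integrable lborel (\<lambda>y. indicator K y *\<^sub>R f y)"
    by (rule borel_integrable_compact[OF assms(2) continuous_on_subset[OF assms(1)]]) simp
  moreover have "(\<lambda>y. indicator K y *\<^sub>R f y) = f" using assms(3) by (auto simp: indicator_def fun_eq_iff)
  ultimately show i: "integrable lborel f" by simp
  then show "f integrable_on UNIV" by (rule integrable_on_lborel)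
  show "f absolutely_integrable_on UNIV"
    using i by (simp add: set_integrable_def integrable_completion)
qed

text \<open>R and the complement of K form an open cover on whose members the extension is
  continuous.\<close>

lemma continuous_on_zero_extension:
  fixes f :: "'e::metric_space \<Rightarrow> 'b::real_normed_vector"
  assumes "open R" "compact K" "K \<subseteq> R" "continuous_on R f" "\<And>y. y \<in> R - K \<Longrightarrow> f y = 0"
  shows "continuous_on UNIV (\<lambda>y. if y \<in> R then f y else 0)"
proof -
  have op: "open (- K)" using compact_imp_closed[OF assms(2)] by blast
  have "continuous_on (R \<union> - K) (\<lambda>y. if y \<in> R then f y else 0)"
  proof (rule continuous_on_open_Un[OF assms(1) op])
    show "continuous_on R (\<lambda>y. if y \<in> R then f y else 0)" using assms(4) by (simp cong: continuous_on_cong)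
    have "continuous_on (- K) (\<lambda>y. 0::'b)" by simp
    then show "continuous_on (- K) (\<lambda>y. if y \<in> R then f y else 0)"
      by (rule continuous_on_eq) (use assms(5) in auto)
  qed
  moreover have "R \<union> - K = UNIV" using assms(3) by blast
  ultimately show ?thesis by simp
qed

text \<open>Translation invariance makes the integral of every difference quotient zero; dominated
  convergence passes to the derivative. This replaces iterated integration over coordinate
  lines.\<close>

lemma integral_directional_derivative_zero:
  fixes h :: "'e::euclidean_space \<Rightarrow> complex"
  assumes D: "\<And>y. (h has_derivative h' y) (at y)" and cont: "continuous_on UNIV (\<lambda>y. h' y w)"
    and K: "compact K" "\<And>y. y \<notin> K \<Longrightarrow> h y = 0"
  shows "integral UNIV (\<lambda>y. h' y w) = 0"
proof -
  have contH: "continuous_on UNIV h"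
    using D has_derivative_continuous continuous_at_imp_continuous_on by blast
  have D0: "h' y w = 0" if "y \<notin> K" for y
  proof -
    have "open (- K)" using compact_imp_closed[OF K(1)] by blast
    then have "(h has_derivative (\<lambda>_. 0)) (at y)"
      by (subst has_derivative_cong_open[of "- K" y h "\<lambda>_. 0"]) (use that K(2) in auto)
    then show ?thesis using has_derivative_unique[OF D[of y]] by metis
  qed
  obtain M where M: "\<And>y. norm (h' y w) \<le> M" "M \<ge> 0"
  proof -
    have "bounded ((\<lambda>y. h' y w) ` K)"
      by (rule compact_imp_bounded[OF compact_continuous_image[OF continuous_on_subset[OF cont] K(1)]]) simp
    then obtain B where "\<And>y. y \<in> K \<Longrightarrow> norm (h' y w) \<le> B" by (auto simp: bounded_iff)
    then have "norm (h' y w) \<le> max B 0" for y using D0[of y] by (cases "y \<in> K") force+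
    then show ?thesis using that[of "max B 0"] by simp
  qed
  obtain r where r: "K \<subseteq> ball 0 r" using compact_imp_bounded[OF K(1)] bounded_subset_ballD by blast
  \<comment> \<open>Large enough to contain the support of h and of all its translates by w / (n +
    1), so it carries the dominating function.\<close>
  let ?B = "cball (0::'e) (r + norm w)"
  define q where "q n y = of_nat (Suc n) * (h (y + (1 / real (Suc n)) *\<^sub>R w) - h y)" for n y
  have line: "((\<lambda>t. h (y + t *\<^sub>R w)) has_vector_derivative h' (y + t *\<^sub>R w) w) (at t within S)" for y t S
  proof -
    have "((\<lambda>t. h (y + t *\<^sub>R w)) has_derivative (\<lambda>s. h' (y + t *\<^sub>R w) (0 + s *\<^sub>R w))) (at t within S)"
      by (rule has_derivative_compose[of "\<lambda>t. y + t *\<^sub>R w", OF _ D]) (auto intro!: derivative_eq_intros)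
    then show ?thesis
      using linear_cmul[OF has_derivative_linear[OF D]] by (simp add: has_vector_derivative_def)
  qed
  have int0: "integral\<^sup>L lborel (q n) = 0" for n
  proof -
    let ?v = "(1 / real (Suc n)) *\<^sub>R w"
    have "integrable lborel h" using continuous_compact_support_integrable[OF contH K] by blast
    moreover have "distr lborel borel ((+) ?v) = lborel" by (rule lborel_distr_plus)
    ultimately have "integrable lborel (\<lambda>y. h (?v + y))" "integral\<^sup>L lborel (\<lambda>y. h (?v + y)) = integral\<^sup>L lborel h"
      using integrable_distr[of "(+) ?v" lborel borel h] integral_distr[of "(+) ?v" lborel borel h]
        borel_measurable_continuous_onI[OF contH] by (auto simp: measurable_lborel2)
    then show ?thesis unfolding q_def using \<open>integrable lborel h\<close> by (simp add: add.commute)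
  qed
  have lim: "(\<lambda>n. q n y) \<longlonglongrightarrow> h' y w" for y
  proof -
    have "((\<lambda>t. h (y + t *\<^sub>R w)) has_vector_derivative h' y w) (at 0)" using line[of y 0 UNIV] by simp
    then have lim1: "((\<lambda>t. norm ((h (y + t *\<^sub>R w) - h y - t *\<^sub>R h' y w) /\<^sub>R \<bar>t\<bar>)) \<longlongrightarrow> 0) (at 0)"
      using tendsto_norm_zero by (fastforce simp: has_vector_derivative_def has_derivative_def)
    have eq1: "norm ((h (y + t *\<^sub>R w) - h y - t *\<^sub>R h' y w) /\<^sub>R \<bar>t\<bar>) =
        norm ((h (y + t *\<^sub>R w) - h y) /\<^sub>R t - h' y w)" if "t \<noteq> 0" for t
    proof -
      have "(h (y + t *\<^sub>R w) - h y) /\<^sub>R t - h' y w = (h (y + t *\<^sub>R w) - h y - t *\<^sub>R h' y w) /\<^sub>R t"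
        using that by (simp add: scaleR_diff_right)
      then show ?thesis by simp
    qed
    have "((\<lambda>t. norm ((h (y + t *\<^sub>R w) - h y) /\<^sub>R t - h' y w)) \<longlongrightarrow> 0) (at 0)"
      by (rule Lim_transform_eventually[OF lim1]) (use eq1 in \<open>auto simp: eventually_at_filter\<close>)
    then have "((\<lambda>t. (h (y + t *\<^sub>R w) - h y) /\<^sub>R t) \<longlongrightarrow> h' y w) (at 0)"
      using tendsto_norm_zero_iff LIM_zero_iff by blast
    moreover have "filterlim (\<lambda>n. 1 / real (Suc n)) (at 0) sequentially"
      by real_asymp
    ultimately have "(\<lambda>n. (h (y + (1 / real (Suc n)) *\<^sub>R w) - h y) /\<^sub>R (1 / real (Suc n))) \<longlonglongrightarrow> h' y w"
      by (rule filterlim_compose)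
    then show ?thesis by (simp add: q_def scaleR_conv_of_real divide_inverse)
  qed
  have bound: "norm (q n y) \<le> M * indicator ?B y" for n y
  proof (cases "y \<in> ?B")
    case True
    \<comment> \<open>The mean value inequality along the segment from y in direction w bounds each
      difference quotient by the supremum M of the directional derivative.\<close>
    have "norm (h (y + (1 / real (Suc n)) *\<^sub>R w) - h (y + 0 *\<^sub>R w)) \<le> M * norm (1 / real (Suc n) - 0)"
    proof (rule differentiable_bound[of UNIV "\<lambda>t. h (y + t *\<^sub>R w)" "\<lambda>t s. s *\<^sub>R h' (y + t *\<^sub>R w) w"])
      show "((\<lambda>t. h (y + t *\<^sub>R w)) has_derivative (\<lambda>s. s *\<^sub>R h' (y + t *\<^sub>R w) w)) (at t within UNIV)" for t
        using line[of y t UNIV] by (simp add: has_vector_derivative_def)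
      show "onorm (\<lambda>s. s *\<^sub>R h' (y + t *\<^sub>R w) w) \<le> M" for t
        by (rule onorm_le) (simp add: mult.commute[of M] mult_left_mono[OF M(1) abs_ge_zero])
    qed auto
    moreover have "norm (q n y) = real (Suc n) * norm (h (y + (1 / real (Suc n)) *\<^sub>R w) - h y)"
      by (simp only: q_def norm_mult norm_of_nat)
    ultimately show ?thesis using True by (simp add: field_simps)
  next
    case False
    then have "norm y > r + norm w" by simp
    moreover have "norm ((1 / real (Suc n)) *\<^sub>R w) \<le> norm w" by (simp add: field_simps)
    ultimately have "norm (y + (1 / real (Suc n)) *\<^sub>R w) > r" "norm y > r"
      using norm_diff_ineq[of y "(1 / real (Suc n)) *\<^sub>R w"] norm_ge_zero[of w] by linarith+
    then have "y \<notin> K" "y + (1 / real (Suc n)) *\<^sub>R w \<notin> K" using r by auto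
    then show ?thesis using False K(2) by (simp add: q_def)
  qed
  have "(\<lambda>n. integral\<^sup>L lborel (q n)) \<longlonglongrightarrow> integral\<^sup>L lborel (\<lambda>y. h' y w)"
  proof (rule integral_dominated_convergence[where w = "\<lambda>y. M * indicator ?B y"])
    show "(\<lambda>y. h' y w) \<in> borel_measurable lborel" using borel_measurable_continuous_onI[OF cont] by simp
    have "continuous_on UNIV (q n)" for n
      unfolding q_def by (intro continuous_intros continuous_on_compose2[OF contH]) auto
    then show "q n \<in> borel_measurable lborel" for n using borel_measurable_continuous_onI by auto
    have "integrable lborel (indicat_real ?B)"
      by (rule integrable_real_indicator) (use emeasure_compact_finite[OF compact_cball[of "0::'e" "r + norm w"]] in auto)
    then show "integrable lborel (\<lambda>y. M * indicator ?B y)" by simp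
  qed (use lim bound in auto)
  then have "integral\<^sup>L lborel (\<lambda>y. h' y w) = 0" by (simp add: int0 LIMSEQ_const_iff)
  moreover have "integrable lborel (\<lambda>y. h' y w)"
    using continuous_compact_support_integrable(1)[OF cont K(1)] D0 by blast
  ultimately show ?thesis by (simp add: integral_lborel)
qed

text \<open>The substitution formula is applied to values in real ^ 2; L and P carry complex values
  there and back.\<close>

lemma integral_change_of_variables:
  fixes f :: "real ^ 4 \<Rightarrow> complex" and T :: "real ^ 4 \<Rightarrow> real ^ 4"
  assumes "open S" "\<And>y. y \<in> S \<Longrightarrow> (T has_derivative T' y) (at y)" "inj_on T S"
    and "f absolutely_integrable_on (T ` S)"
  shows "integral S (\<lambda>y. \<bar>det (matrix (T' y))\<bar> *\<^sub>R f (T y)) = integral (T ` S) f"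
proof -
  define L :: "complex \<Rightarrow> real ^ 2" where "L z = (\<chi> i. if i = 1 then Re z else Im z)" for z
  have bl: "bounded_linear L"
    by (rule linear_conv_bounded_linear[THEN iffD1]) (auto simp: L_def linear_iff vec_eq_iff)
  define P :: "real ^ 2 \<Rightarrow> complex" where "P v = Complex (v $ 1) (v $ 2)" for v
  have blP: "bounded_linear P"
    by (rule linear_conv_bounded_linear[THEN iffD1]) (auto simp: P_def linear_iff complex_eq_iff)
  have PL: "P (L z) = z" for z by (simp add: P_def L_def)
  have "(\<lambda>z. L (f z)) absolutely_integrable_on T ` S"
    using absolutely_integrable_linear[OF assms(4) bl] by (simp add: o_def)
  moreover have "S \<in> sets lebesgue" using assms(1) by (simp add: borel_open)
  ultimately have *: "(\<lambda>y. \<bar>det (matrix (T' y))\<bar> *\<^sub>R L (f (T y))) absolutely_integrable_on S"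
    "integral S (\<lambda>y. \<bar>det (matrix (T' y))\<bar> *\<^sub>R L (f (T y))) = integral (T ` S) (\<lambda>z. L (f z))"
    using has_absolute_integral_change_of_variables[of S T T' "\<lambda>z. L (f z)" "integral (T ` S) (\<lambda>z. L (f z))"]
      assms(2,3) by (auto intro: has_derivative_at_withinI)
  have 1: "integral S (P \<circ> (\<lambda>y. \<bar>det (matrix (T' y))\<bar> *\<^sub>R L (f (T y)))) = P (integral S (\<lambda>y. \<bar>det (matrix (T' y))\<bar> *\<^sub>R L (f (T y))))"
    using integral_linear[OF set_lebesgue_integral_eq_integral(1)[OF *(1)] blP] .
  have 2: "integral (T ` S) (L \<circ> f) = L (integral (T ` S) f)"
    using integral_linear[OF set_lebesgue_integral_eq_integral(1)[OF assms(4)] bl] .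
  show ?thesis
    using 1 2 *(2) PL linear_cmul[OF bounded_linear.linear[OF blP]] by (simp add: o_def)
qed

section \<open>Integration of top forms\<close>

text \<open>Makes the determinant a function of a list of four vectors, so that it can be compared
  with 4-forms.\<close>

definition rows4 :: "(real ^ 4) list \<Rightarrow> real ^ 4 ^ 4"
  where "rows4 ws = (\<chi> i. if i = 1 then ws ! 0 else if i = 2 then ws ! 1 else if i = 3 then ws ! 2 else ws ! 3)"

lemma det_rows4_linear:
  "det (rows4 [a *\<^sub>R u + b *\<^sub>R v, w, x, y]) = a * det (rows4 [u, w, x, y]) + b * det (rows4 [v, w, x, y])"
proof -
  let ?c = "\<lambda>i::4. if i = 2 then w else if i = 3 then x else y"
  have r: "rows4 [z, w, x, y] = (\<chi> i. if i = 1 then z else ?c i)" for z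
    by (auto simp: rows4_def vec_eq_iff numeral_2_eq_2 numeral_3_eq_3)
  show ?thesis
    unfolding r scalar_mult_eq_scaleR[symmetric] using det_row_add[of 1 "\<lambda>_. a *s u" "\<lambda>_. b *s v" ?c] det_row_mul[of 1 a "\<lambda>_. u" ?c] det_row_mul[of 1 b "\<lambda>_. v" ?c]
    by simp
qed

lemma det_rows4_swap:
  "det (rows4 [u, v, w, x]) = - det (rows4 [v, u, w, x])"
  "det (rows4 [u, v, w, x]) = - det (rows4 [u, w, v, x])"
  "det (rows4 [u, v, w, x]) = - det (rows4 [u, v, x, w])"
proof -
  have *: "det (\<chi> i. M $ (Transposition.transpose a b) i) = - det M" if "a \<noteq> b" for M :: "real ^ 4 ^ 4" and a b
    using det_permute_rows[of "Transposition.transpose a b" M] permutes_swap_id[of a UNIV b] that by (simp add: sign_swap_id)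
  have 4: "(4::4) \<noteq> 1" "(4::4) \<noteq> 2" "(4::4) \<noteq> 3" "(1::4) \<noteq> 2" "(1::4) \<noteq> 3" "(2::4) \<noteq> 3" by simp_all
  have "(\<chi> i. rows4 [v, u, w, x] $ (Transposition.transpose 1 2) i) = rows4 [u, v, w, x]"
    "(\<chi> i. rows4 [u, w, v, x] $ (Transposition.transpose 2 3) i) = rows4 [u, v, w, x]"
    "(\<chi> i. rows4 [u, v, x, w] $ (Transposition.transpose 3 4) i) = rows4 [u, v, w, x]"
    using 4 by (auto simp: vec_eq_iff forall_4 rows4_def Transposition.transpose_def numeral_2_eq_2 numeral_3_eq_3)
  then show "det (rows4 [u, v, w, x]) = - det (rows4 [v, u, w, x])"
    "det (rows4 [u, v, w, x]) = - det (rows4 [u, w, v, x])"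
    "det (rows4 [u, v, w, x]) = - det (rows4 [u, v, x, w])"
    using *[OF 4(4), of "rows4 [v, u, w, x]"] *[OF 4(6), of "rows4 [u, w, v, x]"] *[OF 4(3)[symmetric], of "rows4 [u, v, x, w]"]
    by simp_all
qed

lemma rows4_basis: "linear D \<Longrightarrow> det (rows4 (map D basis4)) = det (matrix D)"
proof -
  have "rows4 (map D basis4) = Finite_Cartesian_Product.transpose (matrix D)"
    by (simp add: rows4_def basis4_def vec_eq_iff forall_4 matrix_def numeral_2_eq_2 numeral_3_eq_3 Finite_Cartesian_Product.transpose_def)
  then show ?thesis by simp
qed

context almost_hermitian4
begin

text \<open>T and the determinant \<delta> of the coordinates in c' are both top forms, hence
  proportional. The factor is read off on the coordinate basis of c', and evaluation on that of c
  produces the Jacobian.\<close>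

lemma dtrans_volume:
  assumes c: "c \<in> A" "c' \<in> A" "x \<in> fst c" "x \<in> fst c'" and T: "T \<in> forms 4"
  shows "loc c T (snd c x) basis4 = of_real (det (matrix (dtrans c c' x))) * loc c' T (snd c' x) basis4"
proof -
  have x: "x \<in> topspace X" using chart_subset[OF c(1,3)] .
  interpret tvec_space "tangent_space x" by (rule tangent_space_tvec_space[OF x])
  define \<delta> :: "('a, real ^ 4) cform" where
    "\<delta> vs = (if length vs = 4 \<and> set vs \<subseteq> tangent_space x then of_real (det (rows4 (map (\<lambda>v. v c') vs))) else 0)" for vs
  have \<delta>: "\<delta> \<in> alt_forms (tangent_space x) 4"
  proof (rule alt_forms_4I)
    fix a b u v w z y
    assume V: "u \<in> tangent_space x" "v \<in> tangent_space x" "w \<in> tangent_space x" "z \<in> tangent_space x"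
      "y \<in> tangent_space x" "comb a u b v \<in> tangent_space x"
    have "comb a u b v c' = a *\<^sub>R u c' + b *\<^sub>R v c'" by (simp add: comb_def)
    then show "\<delta> [comb a u b v, w, z, y] = of_real a * \<delta> [u, w, z, y] + of_real b * \<delta> [v, w, z, y]"
      using V by (simp add: \<delta>_def det_rows4_linear)
  next
    fix u v w z
    assume V: "u \<in> tangent_space x" "v \<in> tangent_space x" "w \<in> tangent_space x" "z \<in> tangent_space x"
    show "\<delta> [u, v, w, z] = - \<delta> [v, u, w, z]" using V det_rows4_swap(1)[of "u c'" "v c'" "w c'" "z c'"] by (simp add: \<delta>_def)
    show "\<delta> [u, v, w, z] = - \<delta> [u, w, v, z]" using V det_rows4_swap(2)[of "u c'" "v c'" "w c'" "z c'"] by (simp add: \<delta>_def)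
    show "\<delta> [u, v, w, z] = - \<delta> [u, v, z, w]" using V det_rows4_swap(3)[of "u c'" "v c'" "w c'" "z c'"] by (simp add: \<delta>_def)
  qed (auto simp: \<delta>_def)
  let ?k = "loc c' T (snd c' x) basis4"
  have \<delta>_tangent: "\<delta> (map (tangent c'' x) basis4) = of_real (det (rows4 (map (dtrans c'' c' x) basis4)))"
    if "c'' \<in> A" "x \<in> fst c''" for c''
    using that c by (simp add: \<delta>_def basis4_def tangent_eval)
  have "dtrans c' c' x = id" using dtrans_self[OF c(2,4)] by auto
  then have one: "\<delta> (map (tangent c' x) basis4) = 1"
    using \<delta>_tangent[OF c(2,4)] rows4_basis[OF linear_id] by (simp add: matrix_id_mat_1)
  have "T x = (\<lambda>vs. ?k * \<delta> vs)"
    by (rule alt_4_eqI[OF basis4_spanning[OF c(2,4)] formsD(2)[OF T x] alt_forms_scale[OF \<delta>]])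
      (use one loc_snd[OF c(2,4)] in \<open>simp add: basis4_def\<close>)
  then have "loc c T (snd c x) basis4 = ?k * \<delta> (map (tangent c x) basis4)" by (simp add: loc_snd[OF c(1,3)])
  then show ?thesis
    using \<delta>_tangent[OF c(1,3)] rows4_basis[OF dtrans_linear[OF c]] by simp
qed

text \<open>The orientation of a chart relative to the volume form, as a complex number \<open>\<plusminus>1\<close>.\<close>

definition vsign :: "('a, real ^ 4) chart \<Rightarrow> real ^ 4 \<Rightarrow> complex"
  where "vsign c y = of_real (cmod (loc c volume_form y basis4)) / loc c volume_form y basis4"

text \<open>The sign corrects for the orientation of the chart, so the density changes by the
  absolute value of the Jacobian and no oriented atlas is needed.\<close>

definition density :: "('a, real ^ 4) chart \<Rightarrow> ('a, real ^ 4) form_field \<Rightarrow> real ^ 4 \<Rightarrow> complex"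
  where "density c T y = (if y \<in> chart_range c then vsign c y * loc c T y basis4 else 0)"

text \<open>A compact set inside the chart range, and not merely vanishing off the chart domain, so
  that the density extends continuously by zero.\<close>

definition supported :: "('a, real ^ 4) chart \<Rightarrow> ('a, real ^ 4) form_field \<Rightarrow> bool"
  where "supported c T \<longleftrightarrow> (\<exists>K. compact K \<and> K \<subseteq> chart_range c \<and>
    (\<forall>x. \<not> (x \<in> fst c \<and> snd c x \<in> K) \<longrightarrow> T x = 0))"

definition chart_integral :: "('a, real ^ 4) chart \<Rightarrow> ('a, real ^ 4) form_field \<Rightarrow> complex"
  where "chart_integral c T = integral UNIV (density c T)"

text \<open>The volume coefficient is real and nonzero, so its sign is continuous with values 1 and
  -1. Local constancy lets the sign pass through derivatives in Stokes' theorem.\<close>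

lemma vsign_locally_constant:
  assumes c: "c \<in> A" and y: "y \<in> chart_range c"
  obtains U where "open U" "y \<in> U" "U \<subseteq> chart_range c" "\<And>z. z \<in> U \<Longrightarrow> vsign c z = vsign c y"
proof -
  have op: "open (chart_range c)" using open_chart_range[OF c] .
  have val: "vsign c z = 1 \<or> vsign c z = -1" if "z \<in> chart_range c" for z
  proof -
    let ?v = "loc c volume_form z basis4"
    interpret h: hermitian4 "tangent_space (chart_inv c z)" "J (chart_inv c z)" "g (chart_inv c z)" "tangent c (chart_inv c z)"
      by (rule hermitian4_loc(1)[OF c that])
    have "cnj ?v = ?v" by (simp add: loc_def volume_form_at[OF hermitian4_loc(3)[OF c that]] h.vol_cnj)
    then obtain r where "?v = of_real r" by (metis Reals_cases Reals_cnj_iff)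
    then show ?thesis using loc_volume_nonzero[OF c that] by (auto simp: vsign_def abs_if)
  qed
  have "continuous_on (chart_range c) (\<lambda>y. loc c volume_form y basis4)"
    by (rule smooth_on_continuous[OF formsD(3)[OF volume_form_forms c]]) (simp add: basis4_def)
  then have cont: "continuous_on (chart_range c) (vsign c)"
    unfolding vsign_def[abs_def] by (intro continuous_intros) (use loc_volume_nonzero[OF c] in auto)
  \<comment> \<open>The two possible values have distance 2, so a ball of radius 1 around one of
    them excludes the other.\<close>
  let ?U = "chart_range c \<inter> vsign c -` ball (vsign c y) 1"
  have "open ?U" by (rule continuous_open_preimage[OF cont op open_ball])
  moreover have "y \<in> ?U" "?U \<subseteq> chart_range c" using y by auto
  moreover have "vsign c z = vsign c y" if "z \<in> ?U" for z
    using that val[of z] val[OF y] by (auto simp: dist_norm)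
  ultimately show ?thesis using that by blast
qed

lemma supported_zero: "supported c T \<Longrightarrow> x \<notin> fst c \<Longrightarrow> T x = 0"
  unfolding supported_def by blast

lemma density_support:
  assumes "c \<in> A" "supported c T"
  obtains K where "compact K" "K \<subseteq> chart_range c" "\<And>y. y \<notin> K \<Longrightarrow> density c T y = 0"
    "\<And>y ws. y \<in> chart_range c - K \<Longrightarrow> loc c T y ws = 0"
proof -
  obtain K where K: "compact K" "K \<subseteq> chart_range c" "\<And>x. \<not> (x \<in> fst c \<and> snd c x \<in> K) \<Longrightarrow> T x = 0"
    using assms(2) unfolding supported_def by blast
  have 1: "loc c T y ws = 0" if "y \<in> chart_range c - K" for y ws
    using that K(3)[of "chart_inv c y"] by (simp add: loc_def)
  then have "density c T y = 0" if "y \<notin> K" for y using that by (simp add: density_def)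
  then show ?thesis using that K 1 by blast
qed

lemma density_integrable:
  assumes c: "c \<in> A" and T: "T \<in> forms 4" "supported c T"
  shows "continuous_on UNIV (density c T)" "density c T absolutely_integrable_on UNIV" "density c T integrable_on UNIV"
proof -
  obtain K where K: "compact K" "K \<subseteq> chart_range c" "\<And>y. y \<notin> K \<Longrightarrow> density c T y = 0"
    using density_support[OF c T(2)] by metis
  have "continuous_on (chart_range c) (\<lambda>y. loc c T' y basis4)" if "T' \<in> forms 4" for T'
    by (rule smooth_on_continuous[OF formsD(3)[OF that c]]) (simp add: basis4_def)
  note co = this[OF T(1)] this[OF volume_form_forms]
  have "continuous_on (chart_range c) (\<lambda>y. vsign c y * loc c T y basis4)"
    unfolding vsign_def[abs_def] by (intro continuous_intros co) (use loc_volume_nonzero[OF c] in auto)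
  moreover have "vsign c y * loc c T y basis4 = 0" if "y \<in> chart_range c - K" for y
    using K(3)[of y] that by (simp add: density_def)
  ultimately show cont: "continuous_on UNIV (density c T)"
    using continuous_on_zero_extension[OF open_chart_range[OF c] K(1,2), of "\<lambda>y. vsign c y * loc c T y basis4"]
    by (simp add: density_def[abs_def])
  show "density c T absolutely_integrable_on UNIV" "density c T integrable_on UNIV"
    using continuous_compact_support_integrable[OF cont K(1,3)] by blast+
qed

text \<open>The coefficient of T picks up the Jacobian determinant and the sign factor picks up the
  sign of that determinant; the product is the absolute value.\<close>

lemma density_change_chart:
  assumes c: "c \<in> A" "c' \<in> A" "x \<in> fst c" "x \<in> fst c'" and T: "T \<in> forms 4"
  shows "density c T (snd c x) = \<bar>det (matrix (dtrans c c' x))\<bar> *\<^sub>R density c' T (snd c' x)"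
proof -
  let ?d = "det (matrix (dtrans c c' x))"
  have "?d \<noteq> 0"
    using dtrans_volume[OF c volume_form_forms] loc_volume_nonzero[OF c(1) imageI[OF c(3)]] by auto
  then show ?thesis
    using dtrans_volume[OF c T] dtrans_volume[OF c volume_form_forms] c
    by (simp add: density_def vsign_def norm_mult field_simps scaleR_conv_of_real[where 'a = complex])
qed

text \<open>T vanishes off both chart domains, so both integrals reduce to the overlap, where the
  transition map is an injective change of variables.\<close>

lemma chart_integral_change:
  assumes c: "c \<in> A" "c' \<in> A" and T: "T \<in> forms 4" "supported c T" "supported c' T"
  shows "chart_integral c T = chart_integral c' T"
proof -
  let ?S = "snd c ` (fst c \<inter> fst c')" and ?S' = "snd c' ` (fst c \<inter> fst c')"
  have zero: "density a T y = 0" if "a \<in> {c, c'}" "y \<notin> snd a ` (fst c \<inter> fst c')" for a y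
  proof (cases "y \<in> chart_range a")
    case True
    then have "chart_inv a y \<notin> fst c \<inter> fst c'" using that(2) by (metis image_eqI snd_chart_inv)
    then have "T (chart_inv a y) = 0" using supported_zero[OF T(2)] supported_zero[OF T(3)] by blast
    then show ?thesis by (simp add: density_def loc_def)
  qed (simp add: density_def)
  have int: "integral UNIV (density a T) = integral (snd a ` (fst c \<inter> fst c')) (density a T)" if "a \<in> {c, c'}" for a
  proof -
    have "density a T = (\<lambda>y. if y \<in> snd a ` (fst c \<inter> fst c') then density a T y else 0)"
      using zero[OF that] by auto
    then show ?thesis using integral_restrict_UNIV[of "snd a ` (fst c \<inter> fst c')" "density a T"] by simp
  qed
  have op: "open ?S" "open ?S'" using open_overlap[OF c] open_overlap[OF c(2,1)] by (simp_all add: Int_commute)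
  have tr: "transition c c' ` ?S = ?S'"
    unfolding image_image by (rule image_cong[OF refl]) (use transition_snd[OF c(1)] in blast)
  have "integral ?S (\<lambda>y. \<bar>det (matrix (dtrans c c' (chart_inv c y)))\<bar> *\<^sub>R density c' T (transition c c' y)) =
      integral (transition c c' ` ?S) (density c' T)"
  proof (rule integral_change_of_variables[OF op(1), where T = "transition c c'" and T' = "\<lambda>y. dtrans c c' (chart_inv c y)"
        and f = "density c' T"])
    show "(transition c c' has_derivative dtrans c c' (chart_inv c y)) (at y)" if y: "y \<in> ?S" for y
    proof -
      obtain x where x: "x \<in> fst c" "x \<in> fst c'" "y = snd c x" using y by blast
      show ?thesis using transition_has_derivative[OF c x(1,2)] by (simp only: x(3) chart_inv_snd[OF c(1) x(1)])
    qed
    show "inj_on (transition c c') ?S"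
      using transition_snd[OF c(1)] chart_inj[OF c(2)] by (auto simp: inj_on_def)
    show "density c' T absolutely_integrable_on transition c c' ` ?S"
      unfolding tr using set_integrable_subset[OF density_integrable(2)[OF c(2) T(1,3)]] op(2) by (simp add: borel_open)
  qed
  moreover have "integral ?S (density c T) =
      integral ?S (\<lambda>y. \<bar>det (matrix (dtrans c c' (chart_inv c y)))\<bar> *\<^sub>R density c' T (transition c c' y))"
  proof (rule integral_cong)
    fix y assume "y \<in> ?S"
    then obtain x where x: "x \<in> fst c" "x \<in> fst c'" "y = snd c x" by blast
    show "density c T y = \<bar>det (matrix (dtrans c c' (chart_inv c y)))\<bar> *\<^sub>R density c' T (transition c c' y)"
      using density_change_chart[OF c x(1,2) T(1)] x(1) by (simp add: x(3) chart_inv_snd[OF c(1)] transition_snd[OF c(1)])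
  qed
  ultimately show ?thesis unfolding chart_integral_def using int[of c] int[of c'] tr by simp
qed

end

section \<open>Partitions of unity\<close>

context smooth_manifold
begin

definition real_form :: "('a \<Rightarrow> real) \<Rightarrow> ('a, 'e) form_field"
  where "real_form f x vs = (if x \<in> topspace X \<and> vs = [] then of_real (f x) else 0)"

lemma real_form_forms:
  assumes "\<And>c. c \<in> A \<Longrightarrow> smooth_on (chart_range c) (\<lambda>y. f (chart_inv c y))"
  shows "real_form f \<in> forms 0"
proof (rule formsI)
  show "real_form f x = 0" if "x \<notin> topspace X" for x using that by (simp add: real_form_def fun_eq_iff)
  show "real_form f x \<in> alt_forms (tangent_space x) 0" if "x \<in> topspace X" for x
    using alt_forms_0I[of "of_real (f x)"] that by (simp add: real_form_def[abs_def])
  show "smooth_on (chart_range c) (\<lambda>y. loc c (real_form f) y ws)" if c: "c \<in> A" and "length ws = 0" for c ws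
  proof (rule smooth_on_congI[OF open_chart_range[OF c] smooth_on_of_real[OF open_chart_range[OF c] assms[OF c]]])
    show "loc c (real_form f) y ws = of_real (f (chart_inv c y))" if "y \<in> chart_range c" for y
      using chart_subset[OF c chart_inv_in[OF that]] \<open>length ws = 0\<close> by (simp add: loc_def real_form_def)
  qed
qed

lemma wedge_form_0:
  assumes "f \<in> forms 0" "\<beta> \<in> forms k"
  shows "wedge (f x) (\<beta> x) vs = f x [] * \<beta> x vs"
proof (cases "x \<in> topspace X")
  case True
  then show ?thesis using wedge_alt_0(1)[OF formsD(2)[OF assms(1)] formsD(2)[OF assms(2)]] by simp
next
  case False
  then have "f x = (\<lambda>vs. 0)" using formsD(1)[OF assms(1)] by (simp add: fun_eq_iff)
  then show ?thesis by (simp add: wedge_zero_left)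
qed

text \<open>The preimage of a compact set is compact, and the Hausdorff property makes it closed in
  all of X and not just in the chart domain. Extensions by zero rest on this.\<close>

lemma chart_preimage:
  assumes "c \<in> A"
  shows "open U \<Longrightarrow> U \<subseteq> chart_range c \<Longrightarrow> openin X {x \<in> fst c. snd c x \<in> U}"
    and "compact K \<Longrightarrow> K \<subseteq> chart_range c \<Longrightarrow> closedin X {x \<in> fst c. snd c x \<in> K}"
proof -
  let ?Y = "subtopology X (fst c)" and ?Z = "top_of_set (chart_range c)"
  have hom: "homeomorphic_map ?Y ?Z (snd c)" using chart_homeo[OF assms] .
  have top: "topspace ?Y = fst c" using openin_subset[OF openin_chart[OF assms]] by auto
  have img: "snd c ` {x \<in> fst c. snd c x \<in> U} = U" if "U \<subseteq> chart_range c" for U using that by auto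
  show "openin X {x \<in> fst c. snd c x \<in> U}" if "open U" "U \<subseteq> chart_range c"
  proof -
    have "openin ?Z U" using that by (auto simp: openin_open)
    then have "openin ?Y {x \<in> fst c. snd c x \<in> U}"
      using homeomorphic_map_openness[OF hom, of "{x \<in> fst c. snd c x \<in> U}"] img[OF that(2)] top by auto
    then show ?thesis by (rule openin_trans_full[OF _ openin_chart[OF assms]])
  qed
  show "closedin X {x \<in> fst c. snd c x \<in> K}" if "compact K" "K \<subseteq> chart_range c"
  proof -
    have "compactin ?Z K" using that by (simp add: compactin_subtopology)
    then have "compactin ?Y {x \<in> fst c. snd c x \<in> K}"
      using homeomorphic_map_compactness[OF hom, of "{x \<in> fst c. snd c x \<in> K}"] img[OF that(2)] top by auto
    then show ?thesis using compactin_imp_closedin[OF Hausdorff] by (simp add: compactin_subtopology)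
  qed
qed

definition bump_at :: "('a, 'e) chart \<Rightarrow> 'e \<Rightarrow> real \<Rightarrow> 'a \<Rightarrow> real"
  where "bump_at c y0 r x = (if x \<in> fst c then ball_bump y0 r (snd c x) else 0)"

text \<open>Near a point of the domain of c the bump is a composition with a transition map; near
  any other point it vanishes, because the preimage of the closed ball is closed.\<close>

lemma bump_at_smooth:
  assumes c: "c \<in> A" "c' \<in> A" and r: "r > 0" "cball y0 r \<subseteq> chart_range c"
  shows "smooth_on (chart_range c') (\<lambda>y. bump_at c y0 r (chart_inv c' y))"
proof (rule smooth_on_locally[OF open_chart_range[OF c(2)]])
  fix y assume y: "y \<in> chart_range c'"
  let ?f = "\<lambda>y. bump_at c y0 r (chart_inv c' y)"
  show "\<exists>T. open T \<and> y \<in> T \<and> smooth_on T ?f"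
  proof (cases "chart_inv c' y \<in> fst c")
    case True
    let ?T = "snd c' ` (fst c' \<inter> fst c)"
    have op: "open ?T" using open_overlap[OF c(2,1)] .
    have "smooth_on ?T (\<lambda>z. ball_bump y0 r (transition c' c z))"
      by (rule smooth_on_compose[OF op open_UNIV transition_smooth[OF c(2,1)]]) (simp_all add: ball_bump_smooth)
    then have "smooth_on ?T ?f"
    proof (rule smooth_on_congI[OF op])
      fix z assume "z \<in> ?T"
      then obtain x where "x \<in> fst c'" "x \<in> fst c" "z = snd c' x" by blast
      then show "?f z = ball_bump y0 r (transition c' c z)"
        using transition_snd[OF c(2), of x c] c(2) by (simp add: bump_at_def)
    qed
    moreover have "y \<in> ?T" using True chart_inv_in[OF y] snd_chart_inv[OF y] by (metis IntI image_eqI)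
    ultimately show ?thesis using op by blast
  next
    case False
    let ?U = "topspace X - {x \<in> fst c. snd c x \<in> cball y0 r}"
    let ?T = "snd c' ` (fst c' \<inter> ?U)"
    have "openin X ?U" using chart_preimage(2)[OF c(1) compact_cball r(2)] by blast
    then have op: "open ?T" by (rule open_chart_image[OF c(2)])
    have "smooth_on ?T ?f"
    proof (rule smooth_on_congI[OF op smooth_on_const])
      fix z assume "z \<in> ?T"
      then obtain x where "x \<in> fst c'" "x \<in> ?U" "z = snd c' x" by blast
      moreover have "ball_bump y0 r w = 0" if "w \<notin> cball y0 r" for w
        using ball_bump_pos_iff[OF r(1), of y0 w] ball_bump_nonneg[of y0 r w] that by auto
      ultimately show "?f z = 0" using c(2) by (auto simp: bump_at_def)
    qed
    moreover have "chart_inv c' y \<in> fst c' \<inter> ?U" using False chart_inv_in[OF y] chart_subset[OF c(2) chart_inv_in[OF y]] by blast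
    then have "y \<in> ?T" using snd_chart_inv[OF y] by (metis image_eqI)
    ultimately show ?thesis using op by blast
  qed
qed

text \<open>The indices are triples of a chart, a centre and a radius. By compactness finitely many
  balls cover X, so the sum of their bumps is positive everywhere and can be divided out.\<close>

lemma partition_of_unity:
  assumes "compact_space X"
  obtains P :: "(('a, 'e) chart \<times> 'e \<times> real) set" and \<phi> where "finite P"
    and "\<And>p. p \<in> P \<Longrightarrow> fst p \<in> A" and "\<And>p x. p \<in> P \<Longrightarrow> 0 \<le> \<phi> p x"
    and "\<And>p c. p \<in> P \<Longrightarrow> c \<in> A \<Longrightarrow> smooth_on (chart_range c) (\<lambda>y. \<phi> p (chart_inv c y))"
    and "\<And>x. x \<in> topspace X \<Longrightarrow> (\<Sum>p\<in>P. \<phi> p x) = (1::real)"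
    and "\<And>p. p \<in> P \<Longrightarrow> \<exists>K. compact K \<and> K \<subseteq> chart_range (fst p) \<and>
      (\<forall>x. \<not> (x \<in> fst (fst p) \<and> snd (fst p) x \<in> K) \<longrightarrow> \<phi> p x = 0)"
proof -
  \<comment> \<open>The closed ball has to lie in the chart range, since it serves as the compact
    support of the function in coordinates.\<close>
  define Q where "Q = {(c, y0, r). c \<in> A \<and> r > 0 \<and> cball y0 r \<subseteq> chart_range c}"
  define N :: "('a, 'e) chart \<times> 'e \<times> real \<Rightarrow> 'a set"
    where "N = (\<lambda>(c, y0, r). {x \<in> fst c. snd c x \<in> ball y0 r})"
  define b :: "('a, 'e) chart \<times> 'e \<times> real \<Rightarrow> 'a \<Rightarrow> real" where "b = (\<lambda>(c, y0, r) x. bump_at c y0 r x)"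
  have "\<forall>U\<in>N ` Q. openin X U"
    using chart_preimage(1)[OF _ open_ball] ball_subset_cball unfolding Q_def N_def by fastforce
  moreover have "topspace X \<subseteq> \<Union> (N ` Q)"
  proof
    fix x assume "x \<in> topspace X"
    then obtain c where c: "c \<in> A" "x \<in> fst c" using topspace_chart by blast
    obtain r where r: "r > 0" "cball (snd c x) r \<subseteq> chart_range c"
      using open_chart_range[OF c(1)] c(2) open_contains_cball by blast
    then have "(c, snd c x, r) \<in> Q" "x \<in> N (c, snd c x, r)" using c by (auto simp: Q_def N_def)
    then show "x \<in> \<Union> (N ` Q)" by blast
  qed
  moreover have "compactin X (topspace X)" using assms by (simp add: compact_space_def)
  ultimately obtain F where "finite F" "F \<subseteq> N ` Q" "topspace X \<subseteq> \<Union> F"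
    unfolding compactin_def by meson
  then obtain P where P: "finite P" "P \<subseteq> Q" "topspace X \<subseteq> \<Union> (N ` P)" using finite_subset_image by metis
  have b0: "0 \<le> b p x" for p x by (simp add: b_def bump_at_def ball_bump_nonneg case_prod_beta)
  have pos: "(\<Sum>p\<in>P. b p x) > 0" if "x \<in> topspace X" for x
  proof -
    obtain p where p: "p \<in> P" "x \<in> N p" using P(3) \<open>x \<in> topspace X\<close> by blast
    obtain c y0 r where pc: "p = (c, y0, r)" by (cases p) blast
    then have "r > 0" "x \<in> fst c" "snd c x \<in> ball y0 r" using p P(2) by (auto simp: N_def Q_def)
    then have "b p x > 0" using ball_bump_pos_iff[of r y0 "snd c x"] by (simp add: pc b_def bump_at_def)
    then show ?thesis using sum_pos2[OF P(1) p(1), of "\<lambda>p. b p x"] b0 by simp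
  qed
  have sm: "smooth_on (chart_range c) (\<lambda>y. b p (chart_inv c y))" if "p \<in> P" "c \<in> A" for p c
  proof -
    obtain c' y0 r where pc: "p = (c', y0, r)" by (cases p) blast
    then have "c' \<in> A" "r > 0" "cball y0 r \<subseteq> chart_range c'" using that(1) P(2) by (auto simp: Q_def)
    then show ?thesis using bump_at_smooth[of c' c r y0] that(2) by (simp add: pc b_def)
  qed
  define \<phi> where "\<phi> p x = b p x / (\<Sum>p\<in>P. b p x)" for p x
  show ?thesis
  proof (rule that[of P \<phi>])
    show "finite P" by fact
    show "fst p \<in> A" if "p \<in> P" for p using that P(2) by (auto simp: Q_def)
    show "0 \<le> \<phi> p x" for p x by (simp add: \<phi>_def b0 sum_nonneg)
    show "smooth_on (chart_range c) (\<lambda>y. \<phi> p (chart_inv c y))" if "p \<in> P" and c: "c \<in> A" for p c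
      unfolding \<phi>_def
    proof (intro smooth_on_divide smooth_on_sum sm that open_chart_range)
      show "(\<Sum>p\<in>P. b p (chart_inv c y)) \<noteq> 0" if "y \<in> chart_range c" for y
        using pos[OF chart_subset[OF c chart_inv_in[OF that]]] by simp
    qed
    show "(\<Sum>p\<in>P. \<phi> p x) = 1" if "x \<in> topspace X" for x
      using pos[OF that] by (simp add: \<phi>_def sum_divide_distrib[symmetric])
    show "\<exists>K. compact K \<and> K \<subseteq> chart_range (fst p) \<and> (\<forall>x. \<not> (x \<in> fst (fst p) \<and> snd (fst p) x \<in> K) \<longrightarrow> \<phi> p x = 0)"
      if pP: "p \<in> P" for p
    proof -
      obtain c y0 r where p: "p = (c, y0, r)" "r > 0" "cball y0 r \<subseteq> chart_range c" using pP P(2) by (cases p) (auto simp: Q_def)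
      have "b p x = 0" if "\<not> (x \<in> fst c \<and> snd c x \<in> cball y0 r)" for x
        using that ball_bump_pos_iff[OF p(2), of y0 "snd c x"] ball_bump_nonneg[of y0 r "snd c x"]
        by (auto simp: b_def p(1) bump_at_def)
      then show ?thesis using p by (intro exI[of _ "cball y0 r"]) (auto simp: \<phi>_def)
    qed
  qed
qed

end

section \<open>Stokes' theorem on closed almost Hermitian 4-manifolds\<close>

text \<open>The functionals and operators in question are linear only on forms of a given degree or
  support. The induction therefore keeps the partial sums inside D.\<close>

lemma linear_on_sum:
  fixes L :: "('a, 'e::real_vector) form_field \<Rightarrow> complex"
  assumes lin: "\<And>S T a b. S \<in> D \<Longrightarrow> T \<in> D \<Longrightarrow> (\<lambda>x vs. a * S x vs + b * T x vs) \<in> D \<and>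
      L (\<lambda>x vs. a * S x vs + b * T x vs) = a * L S + b * L T"
    and "(\<lambda>x vs. 0) \<in> D" "finite Q" "\<And>q. q \<in> Q \<Longrightarrow> T q \<in> D"
  shows "(\<lambda>x vs. \<Sum>q\<in>Q. T q x vs) \<in> D \<and> L (\<lambda>x vs. \<Sum>q\<in>Q. T q x vs) = (\<Sum>q\<in>Q. L (T q))"
  using assms(3,4)
proof (induction rule: finite_induct)
  case empty
  show ?case using lin[OF assms(2,2), of 0 0] assms(2) by simp
next
  case (insert q Q)
  then show ?case using lin[of "T q" "\<lambda>x vs. \<Sum>q\<in>Q. T q x vs" 1 1] by simp
qed

context almost_hermitian4
begin

lemma supported_linear:
  assumes "supported c S" "supported c T"
  shows "supported c (\<lambda>x vs. a * S x vs + b * T x vs)"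
proof -
  obtain K L where "compact K" "K \<subseteq> chart_range c" "\<forall>x. \<not> (x \<in> fst c \<and> snd c x \<in> K) \<longrightarrow> S x = 0"
    "compact L" "L \<subseteq> chart_range c" "\<forall>x. \<not> (x \<in> fst c \<and> snd c x \<in> L) \<longrightarrow> T x = 0"
    using assms unfolding supported_def by blast
  then show ?thesis unfolding supported_def by (intro exI[of _ "K \<union> L"]) (auto simp: fun_eq_iff compact_Un)
qed

lemma supported_wedge_0:
  assumes "f \<in> forms 0" "T \<in> forms k"
  shows "supported c f \<Longrightarrow> supported c (\<lambda>x. wedge (f x) (T x))"
    and "supported c T \<Longrightarrow> supported c (\<lambda>x. wedge (f x) (T x))"
proof -
  have "f x = 0 \<or> T x = 0 \<Longrightarrow> wedge (f x) (T x) = 0" for x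
    using wedge_form_0[OF assms] by (auto simp: fun_eq_iff)
  then show "supported c f \<Longrightarrow> supported c (\<lambda>x. wedge (f x) (T x))" "supported c T \<Longrightarrow> supported c (\<lambda>x. wedge (f x) (T x))"
    unfolding supported_def by meson+
qed

text \<open>d is local: off the closed preimage of K the form vanishes on a neighbourhood, hence so
  do all derivatives of its coefficients.\<close>

lemma supported_ext_deriv:
  assumes \<eta>: "\<eta> \<in> forms k" and c: "c \<in> A" "supported c \<eta>"
  shows "supported c (ext_deriv \<eta>)"
proof -
  obtain K where K: "compact K" "K \<subseteq> chart_range c" "\<And>x. \<not> (x \<in> fst c \<and> snd c x \<in> K) \<Longrightarrow> \<eta> x = 0"
    using c(2) unfolding supported_def by blast
  let ?U = "topspace X - {x \<in> fst c. snd c x \<in> K}"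
  have "ext_deriv \<eta> x vs = 0" if x: "\<not> (x \<in> fst c \<and> snd c x \<in> K)" for x vs
  proof (cases "x \<in> topspace X")
    case True
    let ?c = "chart_at x"
    let ?T = "snd ?c ` (fst ?c \<inter> ?U)"
    have "openin X ?U" using chart_preimage(2)[OF c(1) K(1,2)] by blast
    then have op: "open ?T" using open_chart_image chart_at[OF True] by blast
    have T: "snd ?c x \<in> ?T" using x True chart_at[OF True] by blast
    have "fdiff (loc ?c \<eta>) ws (snd ?c x) v = 0" for ws v
    proof -
      have "loc ?c \<eta> z ws = 0" if "z \<in> ?T" for z
      proof -
        obtain u where u: "u \<in> fst ?c" "u \<in> ?U" "z = snd ?c u" using \<open>z \<in> ?T\<close> by blast
        then have "\<eta> u = 0" using K(3)[of u] by blast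
        then show ?thesis using chart_at[OF True] u by (simp add: loc_snd)
      qed
      then have "((\<lambda>z. loc ?c \<eta> z ws) has_derivative (\<lambda>_. 0)) (at (snd ?c x))"
        by (subst has_derivative_cong_open[OF op T, of _ "\<lambda>_. 0"]) auto
      then show ?thesis using frechet_derivative_eq by metis
    qed
    then show ?thesis unfolding ext_deriv_eq_dloc dloc_def by simp
  qed (simp add: ext_deriv_eq_dloc)
  then show ?thesis using K(1,2) unfolding supported_def by (intro exI[of _ K]) (auto simp: fun_eq_iff)
qed

lemma chart_integral_linear:
  assumes c: "c \<in> A" and "S \<in> forms 4" "supported c S" "T \<in> forms 4" "supported c T"
  shows "chart_integral c (\<lambda>x vs. a * S x vs + b * T x vs) = a * chart_integral c S + b * chart_integral c T"
proof -
  have "density c (\<lambda>x vs. a * S x vs + b * T x vs) = (\<lambda>y. a * density c S y + b * density c T y)"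
    by (auto simp: density_def loc_def fun_eq_iff algebra_simps)
  moreover have "((\<lambda>y. a * density c S y + b * density c T y) has_integral
      (a * integral UNIV (density c S) + b * integral UNIV (density c T))) UNIV"
    by (intro has_integral_add has_integral_mult_right integrable_integral density_integrable(3) assms)
  ultimately show ?thesis by (simp add: chart_integral_def integral_unique)
qed

text \<open>In the chart dW is a signed sum of four directional derivatives of compactly supported
  functions, each with integral zero.\<close>

lemma chart_integral_ext_deriv:
  assumes c: "c \<in> A" and W: "W \<in> forms 3" "supported c W"
  shows "chart_integral c (ext_deriv W) = 0"
proof -
  obtain K where K: "compact K" "K \<subseteq> chart_range c" "\<And>y ws. y \<in> chart_range c - K \<Longrightarrow> loc c W y ws = 0"
    using density_support[OF c W(2)] by metis
  have op: "open (chart_range c)" "open (- K)" using open_chart_range[OF c] compact_imp_closed[OF K(1)] by auto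
  \<comment> \<open>The signed coefficients extended by zero to all of real ^ 4; \<open>h'\<close>
    is their derivative, since the sign is locally constant.\<close>
  define h where "h ws y = (if y \<in> chart_range c then vsign c y * loc c W y ws else 0)" for ws y
  define h' where "h' ws y v = (if y \<in> chart_range c then vsign c y * fdiff (loc c W) ws y v else 0)" for ws y v
  have h0: "h ws y = 0" if "y \<notin> K" for ws y using that K(3) by (simp add: h_def)
  have D: "(h ws has_derivative h' ws y) (at y)" if ws: "length ws = 3" for ws y
  proof (cases "y \<in> chart_range c")
    case True
    obtain U where U: "open U" "y \<in> U" "U \<subseteq> chart_range c" "\<And>z. z \<in> U \<Longrightarrow> vsign c z = vsign c y"
      using vsign_locally_constant[OF c True] by metis
    have "((\<lambda>z. vsign c y * loc c W z ws) has_derivative (\<lambda>v. vsign c y * fdiff (loc c W) ws y v)) (at y)"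
      by (intro has_derivative_mult_right loc_has_derivative[OF W(1) c True ws])
    then show ?thesis unfolding h'_def using True
      by (subst has_derivative_cong_open[OF U(1,2), of _ "\<lambda>z. vsign c y * loc c W z ws"]) (use U(3,4) in \<open>auto simp: h_def\<close>)
  next
    case False
    then have "y \<in> - K" using K(2) by blast
    then have "(h ws has_derivative (\<lambda>_. 0)) (at y)"
      by (subst has_derivative_cong_open[OF op(2), of _ _ "\<lambda>_. 0"]) (auto simp: h0)
    then show ?thesis using False by (simp add: h'_def[abs_def])
  qed
  have fd0: "fdiff (loc c W) ws y v = 0" if "y \<in> chart_range c - K" "length ws = 3" for ws y v
  proof -
    have "open (chart_range c - K)" using op by (simp add: Diff_eq open_Int)
    then have "((\<lambda>y. loc c W y ws) has_derivative (\<lambda>_. 0)) (at y)"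
      by (subst has_derivative_cong_open[OF _ that(1), of _ "\<lambda>_. 0"]) (auto simp: K(3))
    then show ?thesis using frechet_derivative_eq by metis
  qed
  have cont: "continuous_on UNIV (\<lambda>y. h' ws y v)" if ws: "length ws = 3" for ws v
    unfolding h'_def
  proof (rule continuous_on_zero_extension[OF op(1) K(1,2)])
    have "continuous_on (chart_range c) (\<lambda>y. loc c volume_form y basis4)"
      by (rule smooth_on_continuous[OF formsD(3)[OF volume_form_forms c]]) (simp add: basis4_def)
    moreover have "continuous_on (chart_range c) (\<lambda>y. fdiff (loc c W) ws y v)"
      by (rule smooth_on_continuous[OF smooth_on_derivative[OF formsD(3)[OF W(1) c ws]]])
    ultimately show "continuous_on (chart_range c) (\<lambda>y. vsign c y * fdiff (loc c W) ws y v)"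
      unfolding vsign_def by (intro continuous_intros) (use loc_volume_nonzero[OF c] in auto)
  qed (use fd0 ws in auto)
  have h'0: "h' ws y v = 0" if "y \<notin> K" "length ws = 3" for ws y v
    using that fd0 by (simp add: h'_def)
  have I0: "((\<lambda>y. h' ws y v) has_integral 0) UNIV" if "length ws = 3" for ws v
  proof -
    have "(\<lambda>y. h' ws y v) integrable_on UNIV"
      using continuous_compact_support_integrable(3)[OF cont[OF that] K(1)] h'0 that by blast
    moreover have "integral UNIV (\<lambda>y. h' ws y v) = 0"
      by (rule integral_directional_derivative_zero[OF D[OF that] cont[OF that] K(1) h0])
    ultimately show ?thesis using integrable_integral by fastforce
  qed
  have "density c (ext_deriv W) = (\<lambda>y. h' [axis 2 1, axis 3 1, axis 4 1] y (axis 1 1) - h' [axis 1 1, axis 3 1, axis 4 1] y (axis 2 1)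
      + h' [axis 1 1, axis 2 1, axis 4 1] y (axis 3 1) - h' [axis 1 1, axis 2 1, axis 3 1] y (axis 4 1))"
  proof
    fix y
    show "density c (ext_deriv W) y = h' [axis 2 1, axis 3 1, axis 4 1] y (axis 1 1) - h' [axis 1 1, axis 3 1, axis 4 1] y (axis 2 1)
      + h' [axis 1 1, axis 2 1, axis 4 1] y (axis 3 1) - h' [axis 1 1, axis 2 1, axis 3 1] y (axis 4 1)"
    proof (cases "y \<in> chart_range c")
      case True
      have "loc c (ext_deriv W) y basis4 = dloc (loc c W) y basis4"
        by (rule loc_ext_deriv[OF W(1) _ c True]) (simp_all add: basis4_def)
      then have "density c (ext_deriv W) y = vsign c y * dloc (loc c W) y basis4" using True by (simp add: density_def)
      then show ?thesis using True by (simp add: h'_def basis4_def dloc_simps algebra_simps)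
    qed (simp add: density_def h'_def)
  qed
  moreover have "(\<dots> has_integral (0 - 0 + 0 - 0)) UNIV"
    by (intro has_integral_add has_integral_diff I0) simp_all
  ultimately show ?thesis by (simp add: chart_integral_def integral_unique)
qed

text \<open>The density is the top coefficient times the absolute value of the volume coefficient,
  so positivity of the former passes to the density.\<close>

lemma density_nonneg:
  assumes c: "c \<in> A" and T: "T \<in> forms 4"
    and pos: "\<And>x. x \<in> topspace X \<Longrightarrow> \<exists>r\<ge>0. top_at x (T x) = of_real r"
  shows "Im (density c T y) = 0" "Re (density c T y) \<ge> 0"
    and "y \<in> chart_range c \<Longrightarrow> density c T y = 0 \<Longrightarrow> T (chart_inv c y) = 0"
proof -
  let ?x = "chart_inv c y" and ?v = "loc c volume_form y basis4"
  have eq: "density c T y = top_at ?x (T ?x) * of_real (cmod ?v)" if y: "y \<in> chart_range c"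
    using top_at_loc[where T = T, OF c y formsD(2)[OF T hermitian4_loc(3)[OF c y]]] loc_volume_nonzero[OF c y] y
    by (simp add: density_def vsign_def)
  have "\<exists>r\<ge>0. density c T y = of_real r"
  proof (cases "y \<in> chart_range c")
    case True
    then obtain r where "r \<ge> 0" "top_at ?x (T ?x) = of_real r" using pos[OF hermitian4_loc(3)[OF c True]] by blast
    then show ?thesis using eq[OF True] by (intro exI[of _ "r * cmod ?v"]) simp
  qed (auto simp: density_def)
  then show "Im (density c T y) = 0" "Re (density c T y) \<ge> 0" by auto
  assume y: "y \<in> chart_range c" and "density c T y = 0"
  then have "top_at ?x (T ?x) = 0" using eq loc_volume_nonzero[OF c y] by simp
  then show "T ?x = 0"
    using hermitian4.top_coeff_eval[OF hermitian4_loc(1)[OF c y] formsD(2)[OF T hermitian4_loc(3)[OF c y]]]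
    by (simp add: fun_eq_iff)
qed

text \<open>A continuous nonnegative function with integral zero vanishes; this is the definiteness
  behind all energy arguments.\<close>

lemma chart_integral_nonneg:
  assumes c: "c \<in> A" and T: "T \<in> forms 4" "supported c T"
    and pos: "\<And>x. x \<in> topspace X \<Longrightarrow> \<exists>r\<ge>0. top_at x (T x) = of_real r"
  shows "Im (chart_integral c T) = 0" "Re (chart_integral c T) \<ge> 0"
    and "Re (chart_integral c T) = 0 \<Longrightarrow> T = (\<lambda>x vs. 0)"
proof -
  let ?f = "\<lambda>y. Re (density c T y)"
  note int = density_integrable[OF c T]
  have nn: "Im (density c T y) = 0" "Re (density c T y) \<ge> 0"
    "y \<in> chart_range c \<Longrightarrow> density c T y = 0 \<Longrightarrow> T (chart_inv c y) = 0" for y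
    using density_nonneg[where T = T, OF c T(1) pos] by blast+
  have Re: "Re (chart_integral c T) = integral UNIV ?f" and "Im (chart_integral c T) = integral UNIV (\<lambda>y. Im (density c T y))"
    using integral_linear[OF int(3) bounded_linear_Re] integral_linear[OF int(3) bounded_linear_Im]
    by (simp_all add: chart_integral_def o_def)
  then show "Im (chart_integral c T) = 0" by (simp add: nn(1))
  have int': "?f integrable_on UNIV" using integrable_linear[OF int(3) bounded_linear_Re] by (simp add: o_def)
  then show "Re (chart_integral c T) \<ge> 0" unfolding Re by (rule integral_nonneg) (simp add: nn(2))
  assume "Re (chart_integral c T) = 0"
  then have 0: "integral UNIV ?f = 0" using Re by simp
  have cont: "continuous_on UNIV ?f" by (intro continuous_intros int(1))
  have "?f y = 0" for y
  proof -
    \<comment> \<open>Any box around y will do: its integral is squeezed between 0 and the total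
      integral, and vanishing there forces the value at y to be 0.\<close>
    let ?B = "cbox (y - (\<chi> i. 1)) (y + (\<chi> i. 1))"
    have i: "?f integrable_on ?B" by (rule integrable_continuous[OF continuous_on_subset[OF cont]]) simp
    have "integral ?B ?f \<le> integral UNIV ?f"
      by (rule integral_subset_le[OF _ i int']) (simp_all add: nn(2))
    moreover have "integral ?B ?f \<ge> 0" by (rule integral_nonneg[OF i]) (simp add: nn(2))
    ultimately have "(?f has_integral 0) ?B" using 0 i by (metis integrable_integral order_antisym)
    moreover have "y \<in> box (y - (\<chi> i. 1)) (y + (\<chi> i. 1))" by (simp add: mem_box_cart)
    ultimately show ?thesis
      using has_integral_0_cbox_imp_0[of "y - (\<chi> i. 1)" "y + (\<chi> i. 1)" ?f y] continuous_on_subset[OF cont] nn(2) box_subset_cbox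
      by blast
  qed
  then have d0: "density c T y = 0" for y using nn(1) by (simp add: complex_eq_iff)
  have "T x = 0" for x
  proof (cases "x \<in> fst c")
    case True
    then show ?thesis using nn(3)[OF imageI[OF True] d0] c by simp
  qed (use supported_zero[OF T(2)] in blast)
  then show "T = (\<lambda>x vs. 0)" by (simp add: fun_eq_iff)
qed

lemma integral_exists:
  assumes "compact_space X"
  shows "\<exists>I. (\<forall>S\<in>forms 4. \<forall>T\<in>forms 4. \<forall>a b. I (\<lambda>x vs. a * S x vs + b * T x vs) = a * I S + b * I T) \<and>
    (\<forall>u\<in>forms 3. I (ext_deriv u) = 0) \<and>
    (\<forall>T\<in>forms 4. (\<forall>x\<in>topspace X. \<exists>r\<ge>0. top_at x (T x) = of_real r) \<longrightarrow>
      Im (I T) = 0 \<and> Re (I T) \<ge> 0 \<and> (Re (I T) = 0 \<longrightarrow> T = (\<lambda>x vs. 0)))"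
proof -
  obtain P :: "(('a, real ^ 4) chart \<times> (real ^ 4) \<times> real) set" and \<phi> where P: "finite P" "\<And>p. p \<in> P \<Longrightarrow> fst p \<in> A" and \<phi>0: "\<And>p x. p \<in> P \<Longrightarrow> 0 \<le> \<phi> p x"
    and \<phi>s: "\<And>p c. p \<in> P \<Longrightarrow> c \<in> A \<Longrightarrow> smooth_on (chart_range c) (\<lambda>y. \<phi> p (chart_inv c y))"
    and \<phi>1: "\<And>x. x \<in> topspace X \<Longrightarrow> (\<Sum>p\<in>P. \<phi> p x) = (1::real)"
    and \<phi>K: "\<And>p. p \<in> P \<Longrightarrow> \<exists>K. compact K \<and> K \<subseteq> chart_range (fst p) \<and>
      (\<forall>x. \<not> (x \<in> fst (fst p) \<and> snd (fst p) x \<in> K) \<longrightarrow> \<phi> p x = 0)"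
  proof (rule partition_of_unity[OF assms], goal_cases)
    case (1 P \<phi>)
    show ?case by (rule 1(1)[of P \<phi>]) (fact 1)+
  qed
  define F where "F p = real_form (\<phi> p)" for p
  define m where "m p T = (\<lambda>x. wedge (F p x) (T x))" for p T
  define I where "I T = (\<Sum>p\<in>P. chart_integral (fst p) (m p T))" for T
  have F: "F p \<in> forms 0" if "p \<in> P" for p unfolding F_def by (rule real_form_forms[OF \<phi>s[OF that]])
  have Fs: "supported (fst p) (F p)" if p: "p \<in> P" for p
  proof -
    obtain K where K: "compact K" "K \<subseteq> chart_range (fst p)" "\<And>x. \<not> (x \<in> fst (fst p) \<and> snd (fst p) x \<in> K) \<Longrightarrow> \<phi> p x = 0"
      using \<phi>K[OF p] by blast
    have "F p x = 0" if "\<not> (x \<in> fst (fst p) \<and> snd (fst p) x \<in> K)" for x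
      using K(3)[OF that] by (simp add: F_def real_form_def fun_eq_iff)
    then show ?thesis unfolding supported_def using K(1,2) by blast
  qed
  have m_eq: "m p T x vs = F p x [] * T x vs" if "p \<in> P" "T \<in> forms k" for p T k x vs
    unfolding m_def by (rule wedge_form_0[OF F[OF that(1)] that(2)])
  have m_forms: "m p T \<in> forms k" if "p \<in> P" "T \<in> forms k" for p T k
    unfolding m_def by (rule forms_wedge_0[OF F[OF that(1)] that(2)])
  have m_supp: "supported (fst p) (m p T)" "supported c T \<Longrightarrow> supported c (m p T)" if "p \<in> P" "T \<in> forms k" for p T k c
    unfolding m_def using supported_wedge_0[OF F[OF that(1)] that(2)] Fs[OF that(1)] by blast+
  have F1: "(\<Sum>p\<in>P. F p x []) = 1" if "x \<in> topspace X" for x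
    using \<phi>1[OF that] that of_real_sum[of "\<lambda>p. \<phi> p x" P, where 'a = complex] by (simp add: F_def real_form_def)
  have m_sum: "T = (\<lambda>x vs. \<Sum>p\<in>P. m p T x vs)" if "T \<in> forms k" for T k
  proof (intro ext)
    fix x vs
    have "(\<Sum>p\<in>P. m p T x vs) = (\<Sum>p\<in>P. F p x []) * T x vs" by (simp add: m_eq[OF _ that] sum_distrib_right)
    then show "T x vs = (\<Sum>p\<in>P. m p T x vs)"
      using F1[of x] formsD(1)[OF that, of x] by (cases "x \<in> topspace X") auto
  qed
  have m_lin: "m p (\<lambda>x vs. a * S x vs + b * T x vs) = (\<lambda>x vs. a * m p S x vs + b * m p T x vs)" for p S T a b
    unfolding m_def by (simp add: wedge_linear_right)
  have I_lin: "I (\<lambda>x vs. a * S x vs + b * T x vs) = a * I S + b * I T" if "S \<in> forms 4" "T \<in> forms 4" for S T a b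
    unfolding I_def sum_distrib_left sum.distrib[symmetric] m_lin
    by (rule sum.cong[OF refl])
      (rule chart_integral_linear[OF P(2) m_forms[OF _ that(1)] m_supp(1)[OF _ that(1)] m_forms[OF _ that(2)] m_supp(1)[OF _ that(2)]])
  have Stokes: "I (ext_deriv u) = 0" if u: "u \<in> forms 3" for u
  proof -
    \<comment> \<open>The form is cut into pieces before differentiating, so derivatives of the
      partition functions never have to be tracked.\<close>
    define W where "W q = ext_deriv (m q u)" for q
    have Wf: "W q \<in> forms 4" "supported (fst q) (W q)" if q: "q \<in> P" for q
      using ext_deriv_forms[OF m_forms[OF q u]] supported_ext_deriv[OF m_forms[OF q u] P(2)[OF q] m_supp(1)[OF q u]]
      by (simp_all add: W_def)
    have "ext_deriv u x vs = (\<Sum>q\<in>P. W q x vs)" for x vs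
    proof -
      have "ext_deriv (\<lambda>x vs. \<Sum>q\<in>P. m q u x vs) x vs = (\<Sum>q\<in>P. ext_deriv (m q u) x vs)"
        using linear_on_sum[of "forms 3" "\<lambda>\<eta>. ext_deriv \<eta> x vs" P "\<lambda>q. m q u"] forms_linear ext_deriv_linear forms_zero P(1) m_forms[OF _ u]
        by (simp add: fun_eq_iff)
      then show ?thesis unfolding W_def m_sum[OF u, symmetric] .
    qed
    then have dW: "ext_deriv u = (\<lambda>x vs. \<Sum>q\<in>P. W q x vs)" by blast
    have "I (ext_deriv u) = (\<Sum>q\<in>P. I (W q))"
      unfolding dW using linear_on_sum[of "forms 4" I P W] forms_linear I_lin forms_zero P(1) Wf(1) by simp
    also have "\<dots> = (\<Sum>q\<in>P. chart_integral (fst q) (W q))"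
    proof (rule sum.cong[OF refl])
      fix q assume q: "q \<in> P"
      \<comment> \<open>\<open>W q\<close> is supported in the chart of q, so every piece of its
        integral can be computed in that one chart, where the pieces recombine to
        \<open>W q\<close>.\<close>
      have "I (W q) = (\<Sum>p\<in>P. chart_integral (fst q) (m p (W q)))"
        unfolding I_def by (rule sum.cong[OF refl])
          (rule chart_integral_change[OF P(2) P(2)[OF q] m_forms[OF _ Wf(1)[OF q]] m_supp(1)[OF _ Wf(1)[OF q]] m_supp(2)[OF _ Wf[OF q]]])
      also have "\<dots> = chart_integral (fst q) (\<lambda>x vs. \<Sum>p\<in>P. m p (W q) x vs)"
      proof -
        let ?D = "{T \<in> forms 4. supported (fst q) T}"
        have lin: "(\<lambda>x vs. a * S x vs + b * T x vs) \<in> ?D \<and>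
            chart_integral (fst q) (\<lambda>x vs. a * S x vs + b * T x vs) = a * chart_integral (fst q) S + b * chart_integral (fst q) T"
          if "S \<in> ?D" "T \<in> ?D" for S T a b
          using that forms_linear supported_linear chart_integral_linear[OF P(2)[OF q]] by blast
        have z: "(\<lambda>x vs. 0) \<in> ?D" using forms_zero by (auto simp: supported_def fun_eq_iff intro: exI[of _ "{}"])
        have D: "m p (W q) \<in> ?D" if "p \<in> P" for p using m_forms[OF that Wf(1)[OF q]] m_supp(2)[OF that Wf[OF q]] by blast
        have "(\<lambda>x vs. \<Sum>p\<in>P. m p (W q) x vs) \<in> ?D \<and>
            chart_integral (fst q) (\<lambda>x vs. \<Sum>p\<in>P. m p (W q) x vs) = (\<Sum>p\<in>P. chart_integral (fst q) (m p (W q)))"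
        proof (rule linear_on_sum[where D = ?D and L = "chart_integral (fst q)" and T = "\<lambda>p. m p (W q)", OF _ z P(1)], goal_cases)
          case (1 S T a b)
          then show ?case by (rule lin)
        next
          case (2 p)
          then show ?case by (rule D)
        qed
        then show ?thesis by (simp only:)
      qed
      finally show "I (W q) = chart_integral (fst q) (W q)" using m_sum[OF Wf(1)[OF q]] by simp
    qed
    also have "\<dots> = 0"
      using chart_integral_ext_deriv[OF P(2) m_forms[OF _ u] m_supp(1)[OF _ u]] by (simp add: W_def)
    finally show ?thesis .
  qed
  have nonneg: "Im (I T) = 0 \<and> Re (I T) \<ge> 0 \<and> (Re (I T) = 0 \<longrightarrow> T = (\<lambda>x vs. 0))"
    if T: "T \<in> forms 4" and pos: "\<forall>x\<in>topspace X. \<exists>r\<ge>0. top_at x (T x) = of_real r" for T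
  proof -
    have pos': "\<exists>r\<ge>0. top_at x (m p T x) = of_real r" if p: "p \<in> P" and x: "x \<in> topspace X" for p x
    proof -
      obtain \<kappa> where h: "hermitian4 (tangent_space x) (J x) (g x) \<kappa>" using hermitian4_ex[OF x] by blast
      obtain r where r: "r \<ge> 0" "top_at x (T x) = of_real r" using pos x by blast
      \<comment> \<open>The vanishing second summand only brings the expression into the shape of
        \<open>top_coeff_linear\<close>.\<close>
      have "m p T x = (\<lambda>vs. of_real (\<phi> p x) * T x vs + 0 * T x vs)"
        using m_eq[OF p T] x by (simp add: fun_eq_iff F_def real_form_def)
      then have "top_at x (m p T x) = of_real (\<phi> p x * r)"
        using hermitian4.top_coeff_linear[OF h, of "of_real (\<phi> p x)" "T x" 0 "T x"] r(2) by simp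
      then show ?thesis using \<phi>0[OF p] r(1) by (intro exI[of _ "\<phi> p x * r"]) simp
    qed
    have nn: "Im (chart_integral (fst p) (m p T)) = 0" "Re (chart_integral (fst p) (m p T)) \<ge> 0"
      "Re (chart_integral (fst p) (m p T)) = 0 \<Longrightarrow> m p T = (\<lambda>x vs. 0)" if p: "p \<in> P" for p
      using chart_integral_nonneg[OF P(2)[OF p] m_forms[OF p T] m_supp(1)[OF p T] pos'[OF p]] by blast+
    have "Im (I T) = 0" "Re (I T) \<ge> 0" using nn(1,2) by (auto simp: I_def intro!: sum_nonneg)
    moreover have "T = (\<lambda>x vs. 0)" if "Re (I T) = 0"
    proof -
      have "Re (chart_integral (fst p) (m p T)) = 0" if "p \<in> P" for p
        using sum_nonneg_eq_0_iff[OF P(1), of "\<lambda>p. Re (chart_integral (fst p) (m p T))"] nn(2) \<open>Re (I T) = 0\<close> that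
        by (simp add: I_def)
      then have "m p T = (\<lambda>x vs. 0)" if "p \<in> P" for p using nn(3) that by blast
      then show ?thesis using m_sum[OF T] by simp
    qed
    ultimately show ?thesis by blast
  qed
  show ?thesis using I_lin Stokes nonneg by (intro exI[of _ I]) blast
qed

end

section \<open>The operators on forms of each degree\<close>

context hermitian4
begin

lemma star_linear:
  assumes "k \<le> 4"
  shows "star k (\<lambda>vs. a * \<alpha> vs + b * \<beta> vs) = (\<lambda>vs. a * star k \<alpha> vs + b * star k \<beta> vs)"
proof -
  have J: "form_J (\<lambda>vs. a * \<alpha> vs + b * \<beta> vs) = (\<lambda>vs. a * form_J \<alpha> vs + b * form_J \<beta> vs)" by (auto simp: form_J_def)
  show ?thesis
    using degree_cases[OF assms]
    by (auto simp: star_simps fun_eq_iff star_0_def star_1_def star_2_def star_3_def star_4_def J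
        wedge_linear_left wedge_linear_right top_coeff_linear algebra_simps)
qed

end

context smooth_manifold
begin

abbreviation cnj_form :: "('a, 'e) form_field \<Rightarrow> ('a, 'e) form_field"
  where "cnj_form \<alpha> \<equiv> (\<lambda>x vs. cnj (\<alpha> x vs))"

abbreviation wedge_form :: "('a, 'e) form_field \<Rightarrow> ('a, 'e) form_field \<Rightarrow> ('a, 'e) form_field"
  where "wedge_form \<alpha> \<beta> \<equiv> (\<lambda>x. wedge (\<alpha> x) (\<beta> x))"

lemma zero_form: "(0 :: ('a, 'e) form_field) = (\<lambda>x vs. 0)"
  by (simp add: fun_eq_iff)

lemma forms_0 [simp]: "0 \<in> forms k"
  unfolding zero_form by (rule forms_zero)

lemma forms_add: "\<alpha> \<in> forms k \<Longrightarrow> \<beta> \<in> forms k \<Longrightarrow> \<alpha> + \<beta> \<in> forms k"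
  using forms_linear[of \<alpha> k \<beta> 1 1] by (simp add: plus_fun_def)

lemma forms_uminus: "\<alpha> \<in> forms k \<Longrightarrow> - \<alpha> \<in> forms k"
  using forms_scale[of \<alpha> k "-1"] by (simp add: fun_Compl_def)

lemma ext_deriv_0 [simp]: "ext_deriv 0 = 0"
  using ext_deriv_linear[OF forms_0[of 0] forms_0[of 0], of 0 0] by (simp add: zero_form)

end

context almost_hermitian4
begin

lemma wedge_form_commute:
  assumes "k \<le> 4" "\<alpha> \<in> forms k" "\<beta> \<in> forms (4 - k)"
  shows "wedge_form \<beta> \<alpha> = (\<lambda>x vs. (-1) ^ k * wedge (\<alpha> x) (\<beta> x) vs)"
proof
  fix x
  show "wedge (\<beta> x) (\<alpha> x) = (\<lambda>vs. (-1) ^ k * wedge (\<alpha> x) (\<beta> x) vs)"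
  proof (cases "x \<in> topspace X")
    case True
    obtain \<kappa> where h: "hermitian4 (tangent_space x) (J x) (g x) \<kappa>" using hermitian4_ex[OF True] by blast
    show ?thesis
      using hermitian4.wedge_commute_top[OF h assms(1) formsD(2)[OF assms(2) True] formsD(2)[OF assms(3) True]] .
  next
    case False
    have "\<alpha> x vs = 0" for vs using formsD(1)[OF assms(2) False] by simp
    then show ?thesis by (simp add: wedge_def)
  qed
qed

lemma wedge_form_4:
  assumes "k \<le> 4" "\<alpha> \<in> forms k" "\<beta> \<in> forms (4 - k)"
  shows "wedge_form \<alpha> \<beta> \<in> forms 4"
proof -
  consider "k = 0" | "k = 1" | "k = 2" | "4 - k = 1" | "4 - k = 0" using assms(1) by linarith
  then show ?thesis
  proof cases
    case 1
    then show ?thesis using forms_wedge_0[of \<alpha> \<beta> 4] assms by simp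
  next
    case 2
    then show ?thesis using forms_wedge_1_3[of \<alpha> \<beta>] assms by simp
  next
    case 3
    then show ?thesis using forms_wedge_2_2[of \<alpha> \<beta>] assms by simp
  next
    case 4
    then have "k = 3" by simp
    then have "wedge_form \<beta> \<alpha> \<in> forms 4" using forms_wedge_1_3[of \<beta> \<alpha>] assms by simp
    moreover have "wedge_form \<alpha> \<beta> = (\<lambda>x vs. (-1) ^ (4 - k) * wedge (\<beta> x) (\<alpha> x) vs)"
      by (rule wedge_form_commute) (use assms \<open>k = 3\<close> in simp_all)
    ultimately show ?thesis by (simp add: forms_scale)
  next
    case 5
    then have "k = 4" using assms(1) by simp
    then have "wedge_form \<beta> \<alpha> \<in> forms 4" using forms_wedge_0[of \<beta> \<alpha> 4] assms by simp
    moreover have "wedge_form \<alpha> \<beta> = (\<lambda>x vs. (-1) ^ (4 - k) * wedge (\<beta> x) (\<alpha> x) vs)"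
      by (rule wedge_form_commute) (use assms \<open>k = 4\<close> in simp_all)
    ultimately show ?thesis by (simp add: forms_scale)
  qed
qed

lemma hodge_star_form_at:
  "\<eta> \<in> forms k \<Longrightarrow> k \<le> 4 \<Longrightarrow> x \<in> topspace X \<Longrightarrow> hodge_star \<eta> x = star_at x k (\<eta> x)"
  by (rule hodge_star_at[where \<eta> = \<eta>, OF _ formsD(2)])

lemma hodge_star_linear:
  assumes "\<alpha> \<in> forms k" "\<beta> \<in> forms k" "k \<le> 4"
  shows "hodge_star (\<lambda>x vs. a * \<alpha> x vs + b * \<beta> x vs) = (\<lambda>x vs. a * hodge_star \<alpha> x vs + b * hodge_star \<beta> x vs)"
proof
  fix x
  show "hodge_star (\<lambda>x vs. a * \<alpha> x vs + b * \<beta> x vs) x = (\<lambda>vs. a * hodge_star \<alpha> x vs + b * hodge_star \<beta> x vs)"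
  proof (cases "x \<in> topspace X")
    case True
    note fl = forms_linear[OF assms(1,2), of a b]
    obtain \<kappa> where h: "hermitian4 (tangent_space x) (J x) (g x) \<kappa>" using hermitian4_ex[OF True] by blast
    show ?thesis
      using hodge_star_form_at[OF fl assms(3) True] hodge_star_form_at[OF assms(1,3) True]
        hodge_star_form_at[OF assms(2,3) True] hermitian4.star_linear[OF h assms(3)]
      by simp
  qed (simp add: hodge_star_def fun_eq_iff)
qed

lemma hodge_star_0 [simp]: "hodge_star 0 = 0"
  using hodge_star_linear[OF forms_0[of 0] forms_0[of 0], of 0 0] by (simp add: zero_form)

lemma hodge_star_uminus: "\<alpha> \<in> forms k \<Longrightarrow> k \<le> 4 \<Longrightarrow> hodge_star (- \<alpha>) = - hodge_star \<alpha>"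
  using hodge_star_linear[of \<alpha> k \<alpha> "-1" 0] by (simp add: fun_Compl_def)

lemma hodge_star_hodge_star:
  assumes "\<alpha> \<in> forms k" "k \<le> 4"
  shows "hodge_star (hodge_star \<alpha>) = (\<lambda>x vs. (-1) ^ k * \<alpha> x vs)"
proof
  fix x
  show "hodge_star (hodge_star \<alpha>) x = (\<lambda>vs. (-1) ^ k * \<alpha> x vs)"
  proof (cases "x \<in> topspace X")
    case True
    obtain \<kappa> where h: "hermitian4 (tangent_space x) (J x) (g x) \<kappa>" using hermitian4_ex[OF True] by blast
    show ?thesis
      using hodge_star_form_at[OF hodge_star_forms[OF assms] _ True]
        hodge_star_form_at[OF assms True]
        hermitian4.star_star[OF h assms(2) formsD(2)[OF assms(1) True]]
      by simp
  next
    case False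
    then show ?thesis using formsD(1)[OF assms(1) False] by (simp add: hodge_star_def fun_eq_iff)
  qed
qed

lemma hodge_star_cnj:
  assumes "\<alpha> \<in> forms k" "k \<le> 4"
  shows "hodge_star (cnj_form \<alpha>) = cnj_form (hodge_star \<alpha>)"
proof
  fix x
  show "hodge_star (cnj_form \<alpha>) x = (\<lambda>vs. cnj (hodge_star \<alpha> x vs))"
  proof (cases "x \<in> topspace X")
    case True
    obtain \<kappa> where h: "hermitian4 (tangent_space x) (J x) (g x) \<kappa>" using hermitian4_ex[OF True] by blast
    show ?thesis
      using hodge_star_form_at[OF forms_cnj[OF assms(1)] assms(2) True]
        hodge_star_form_at[OF assms True] hermitian4.star_cnj[OF h]
      by simp
  qed (simp add: hodge_star_def fun_eq_iff)
qed

lemma pq_part_degree: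
  assumes "\<eta> \<in> forms k" "p + q \<noteq> k"
  shows "pq_part p q \<eta> = 0"
proof -
  have "complexify (\<eta> x) zs = 0" if "length zs \<noteq> k" for x zs
    using that forms_outside[OF assms(1)] by (simp add: complexify_def)
  then show ?thesis using assms(2) by (simp add: pq_part_def fun_eq_iff)
qed

lemma pq_part_0 [simp]: "pq_part p q 0 = 0"
  by (simp add: pq_part_def complexify_def fun_eq_iff)

lemma pq_part_eqI:
  assumes "\<beta> \<in> forms k" "\<And>x \<kappa>. x \<in> topspace X \<Longrightarrow> hermitian4 (tangent_space x) (J x) (g x) \<kappa> \<Longrightarrow> tpart_at x p q (\<alpha> x) = \<beta> x"
  shows "pq_part p q \<alpha> = \<beta>"
proof
  fix x
  show "pq_part p q \<alpha> x = \<beta> x"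
    using assms(2)[of x] hermitian4_ex[of x] pq_part_at[of x p q \<alpha>] pq_part_outside[of x p q \<alpha>] formsD(1)[OF assms(1), of x]
    by (cases "x \<in> topspace X") (auto simp: fun_eq_iff)
qed

lemma pq_part_cases_0: "f \<in> forms 0 \<Longrightarrow> pq_part 0 0 f = f"
  by (rule pq_part_eqI) (auto dest: hermitian4.tpart_0_0 formsD(2))

lemma pq_part_cases_3:
  assumes "u \<in> forms 3"
  shows "pq_part 3 0 u = 0" "pq_part 0 3 u = 0"
proof -
  note t = hermitian4.tpart_3_zero[OF _ formsD(2)[OF assms]]
  show "pq_part 3 0 u = 0" "pq_part 0 3 u = 0"
    by (rule pq_part_eqI[OF forms_0], simp add: t zero_fun_def)+
qed

lemma pq_part_cases_4:
  assumes "T \<in> forms 4"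
  shows "pq_part 2 2 T = T" "pq_part 3 (Suc 0) T = 0" "pq_part (Suc 0) 3 T = 0"
proof -
  note t = hermitian4.tpart_4_cases[OF _ formsD(2)[OF assms]]
  show "pq_part 2 2 T = T" by (rule pq_part_eqI[OF assms], simp add: t)
  show "pq_part 3 (Suc 0) T = 0" "pq_part (Suc 0) 3 T = 0"
    by (rule pq_part_eqI[OF forms_0], simp add: t zero_fun_def)+
qed

text \<open>For a form of pure degree k the sum over bidegrees collapses to p + q = k, since the
  projections of any other total degree are zero.\<close>

lemma del_sums:
  assumes "\<eta> \<in> forms k"
  shows "del \<eta> = (\<lambda>x vs. \<Sum>p\<le>k. pq_part (Suc p) (k - p) (ext_deriv (pq_part p (k - p) \<eta>)) x vs)"
    and "delbar \<eta> = (\<lambda>x vs. \<Sum>p\<le>k. pq_part p (Suc (k - p)) (ext_deriv (pq_part p (k - p) \<eta>)) x vs)"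
proof -
  \<comment> \<open>h and h' abstract which of the two indices is raised, so del and delbar are
    handled together.\<close>
  have *: "(\<Sum>(p, q) | p + q + 1 = length vs. pq_part (h p) (h' q) (ext_deriv (pq_part p q \<eta>)) x vs) =
    (\<Sum>p\<le>k. pq_part (h p) (h' (k - p)) (ext_deriv (pq_part p (k - p) \<eta>)) x vs)"
    if h: "\<And>p q. h p + h' q = Suc (p + q)" for h h' and x vs
  proof (cases "length vs = Suc k")
    case True
    then have "{(p, q). p + q + 1 = length vs} = (\<lambda>p. (p, k - p)) ` {..k}" by (auto simp: image_iff)
    moreover have "inj_on (\<lambda>p. (p, k - p)) {..k}" by (auto simp: inj_on_def)
    ultimately show ?thesis by (simp add: sum.reindex)
  next
    case False
    have "pq_part (h p) (h' q) (ext_deriv (pq_part p q \<eta>)) x vs = 0" if "p + q + 1 = length vs" for p q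
      using pq_part_degree[OF assms, of p q] that False by simp
    moreover have "pq_part (h p) (h' (k - p)) (ext_deriv (pq_part p (k - p) \<eta>)) x vs = 0" if "p \<le> k" for p
      using h[of p "k - p"] that False by (simp add: pq_part_def)
    ultimately show ?thesis by (simp add: sum.neutral)
  qed
  show "del \<eta> = (\<lambda>x vs. \<Sum>p\<le>k. pq_part (Suc p) (k - p) (ext_deriv (pq_part p (k - p) \<eta>)) x vs)"
    using *[of Suc "\<lambda>q. q"] by (simp add: del_def fun_eq_iff)
  show "delbar \<eta> = (\<lambda>x vs. \<Sum>p\<le>k. pq_part p (Suc (k - p)) (ext_deriv (pq_part p (k - p) \<eta>)) x vs)"
    using *[of "\<lambda>p. p" Suc] by (simp add: delbar_def fun_eq_iff)
qed

text \<open>Types that do not exist in complex dimension two drop out. On 3-forms the projection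
  after d disappears, as the target is entirely of type (2,2); this makes del equal to d on type
  (1,2).\<close>

lemma del_formulas:
  shows "f \<in> forms 0 \<Longrightarrow> del f = pq_part (Suc 0) 0 (ext_deriv f)"
    and "f \<in> forms 0 \<Longrightarrow> delbar f = pq_part 0 (Suc 0) (ext_deriv f)"
    and "\<theta> \<in> forms 1 \<Longrightarrow> del \<theta> = pq_part (Suc 0) (Suc 0) (ext_deriv (pq_part 0 (Suc 0) \<theta>)) + pq_part 2 0 (ext_deriv (pq_part (Suc 0) 0 \<theta>))"
    and "\<theta> \<in> forms 1 \<Longrightarrow> delbar \<theta> = pq_part 0 2 (ext_deriv (pq_part 0 (Suc 0) \<theta>)) + pq_part (Suc 0) (Suc 0) (ext_deriv (pq_part (Suc 0) 0 \<theta>))"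
    and "\<eta> \<in> forms 2 \<Longrightarrow> del \<eta> = pq_part (Suc 0) 2 (ext_deriv (pq_part 0 2 \<eta>)) + pq_part 2 (Suc 0) (ext_deriv (pq_part (Suc 0) (Suc 0) \<eta>))"
    and "\<eta> \<in> forms 2 \<Longrightarrow> delbar \<eta> = pq_part (Suc 0) 2 (ext_deriv (pq_part (Suc 0) (Suc 0) \<eta>)) + pq_part 2 (Suc 0) (ext_deriv (pq_part 2 0 \<eta>))"
    and "u \<in> forms 3 \<Longrightarrow> del u = ext_deriv (pq_part (Suc 0) 2 u)"
    and "u \<in> forms 3 \<Longrightarrow> delbar u = ext_deriv (pq_part 2 (Suc 0) u)"
proof -
  have s1: "{..Suc 0} = {0, Suc 0}" and s2: "{..2} = {0, Suc 0, 2}" and s3: "{..3} = {0, Suc 0, 2, 3::nat}" by auto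
  have n: "Suc (Suc 0) = 2" "Suc 2 = 3" "2 - Suc 0 = Suc 0" "3 - Suc 0 = 2" "3 - 2 = Suc (0::nat)" by simp_all
  show "del f = pq_part (Suc 0) 0 (ext_deriv f)" "delbar f = pq_part 0 (Suc 0) (ext_deriv f)" if "f \<in> forms 0"
    using del_sums[OF that] pq_part_cases_0[OF that] by simp_all
  show "del \<theta> = pq_part (Suc 0) (Suc 0) (ext_deriv (pq_part 0 (Suc 0) \<theta>)) + pq_part 2 0 (ext_deriv (pq_part (Suc 0) 0 \<theta>))"
    "delbar \<theta> = pq_part 0 2 (ext_deriv (pq_part 0 (Suc 0) \<theta>)) + pq_part (Suc 0) (Suc 0) (ext_deriv (pq_part (Suc 0) 0 \<theta>))"
    if "\<theta> \<in> forms 1"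
    using del_sums[OF that] by (simp_all add: s1 n plus_fun_def)
  show "del \<eta> = pq_part (Suc 0) 2 (ext_deriv (pq_part 0 2 \<eta>)) + pq_part 2 (Suc 0) (ext_deriv (pq_part (Suc 0) (Suc 0) \<eta>))"
    "delbar \<eta> = pq_part (Suc 0) 2 (ext_deriv (pq_part (Suc 0) (Suc 0) \<eta>)) + pq_part 2 (Suc 0) (ext_deriv (pq_part 2 0 \<eta>))"
    if \<eta>: "\<eta> \<in> forms 2"
  proof -
    have "pq_part 3 0 (ext_deriv (pq_part 2 0 \<eta>)) = 0" "pq_part 0 3 (ext_deriv (pq_part 0 2 \<eta>)) = 0"
      using pq_part_cases_3 ext_deriv_forms[of _ 2] pq_part_forms_2[OF \<eta>] by (simp_all add: n)
    then show "del \<eta> = pq_part (Suc 0) 2 (ext_deriv (pq_part 0 2 \<eta>)) + pq_part 2 (Suc 0) (ext_deriv (pq_part (Suc 0) (Suc 0) \<eta>))"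
      "delbar \<eta> = pq_part (Suc 0) 2 (ext_deriv (pq_part (Suc 0) (Suc 0) \<eta>)) + pq_part 2 (Suc 0) (ext_deriv (pq_part 2 0 \<eta>))"
      using del_sums[OF \<eta>] by (simp_all add: s2 n plus_fun_def)
  qed
  show "del u = ext_deriv (pq_part (Suc 0) 2 u)" "delbar u = ext_deriv (pq_part 2 (Suc 0) u)" if u: "u \<in> forms 3"
  proof -
    have "ext_deriv (pq_part 2 (Suc 0) u) \<in> forms 4" "ext_deriv (pq_part (Suc 0) 2 u) \<in> forms 4"
      using ext_deriv_forms[of _ 3] pq_part_forms_3[OF u] by simp_all
    then show "del u = ext_deriv (pq_part (Suc 0) 2 u)" "delbar u = ext_deriv (pq_part 2 (Suc 0) u)"
      using del_sums[OF u] pq_part_cases_4 pq_part_cases_3[OF u] by (simp_all add: s3 n)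
  qed
qed

lemma ext_deriv_forms_num:
  "\<beta> \<in> forms 0 \<Longrightarrow> ext_deriv \<beta> \<in> forms 1" "\<beta> \<in> forms 1 \<Longrightarrow> ext_deriv \<beta> \<in> forms 2"
  "\<beta> \<in> forms 2 \<Longrightarrow> ext_deriv \<beta> \<in> forms 3" "\<beta> \<in> forms 3 \<Longrightarrow> ext_deriv \<beta> \<in> forms 4"
  using ext_deriv_forms[of \<beta> 0] ext_deriv_forms[of \<beta> 1] ext_deriv_forms[of \<beta> 2] ext_deriv_forms[of \<beta> 3]
  by (simp_all add: numeral_2_eq_2 numeral_3_eq_3 numeral_eq_Suc)

lemma del_forms:
  assumes "\<eta> \<in> forms k" "k \<le> 3"
  shows "del \<eta> \<in> forms (Suc k)" "delbar \<eta> \<in> forms (Suc k)"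
proof -
  note d = ext_deriv_forms_num
  have 0: "del f \<in> forms 1 \<and> delbar f \<in> forms 1" if "f \<in> forms 0" for f
    using d(1)[OF that] that pq_part_forms_1 by (simp add: del_formulas)
  have 1: "del \<theta> \<in> forms 2 \<and> delbar \<theta> \<in> forms 2" if \<theta>: "\<theta> \<in> forms 1" for \<theta>
    unfolding del_formulas(3,4)[OF \<theta>] by (intro conjI forms_add pq_part_forms_2 d(2) pq_part_forms_1 \<theta>)
  have 2: "del \<eta> \<in> forms 3 \<and> delbar \<eta> \<in> forms 3" if \<eta>: "\<eta> \<in> forms 2" for \<eta>
    unfolding del_formulas(5,6)[OF \<eta>] by (intro conjI forms_add pq_part_forms_3 d(3) pq_part_forms_2 \<eta>)
  have 3: "del u \<in> forms 4 \<and> delbar u \<in> forms 4" if u: "u \<in> forms 3" for u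
    unfolding del_formulas(7,8)[OF u] by (intro conjI d(4) pq_part_forms_3 u)
  consider "k = 0" | "k = 1" | "k = 2" | "k = 3" using assms(2) by linarith
  then have "del \<eta> \<in> forms (Suc k) \<and> delbar \<eta> \<in> forms (Suc k)"
  proof cases
    assume k: "k = 0"
    show ?thesis using 0[of \<eta>] assms(1) by (simp add: k)
  next
    assume k: "k = 1"
    show ?thesis using 1[of \<eta>] assms(1) by (simp add: k numeral_2_eq_2)
  next
    assume k: "k = 2"
    show ?thesis using 2[of \<eta>] assms(1) by (simp add: k)
  next
    assume k: "k = 3"
    show ?thesis using 3[of \<eta>] assms(1) by (simp add: k)
  qed
  then show "del \<eta> \<in> forms (Suc k)" "delbar \<eta> \<in> forms (Suc k)" by blast+
qed

lemma pq_part_cnj: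
  shows "\<alpha> \<in> forms 1 \<Longrightarrow> pq_part (Suc 0) 0 (cnj_form \<alpha>) = cnj_form (pq_part 0 (Suc 0) \<alpha>)"
    and "\<alpha> \<in> forms 1 \<Longrightarrow> pq_part 0 (Suc 0) (cnj_form \<alpha>) = cnj_form (pq_part (Suc 0) 0 \<alpha>)"
    and "\<beta> \<in> forms 2 \<Longrightarrow> pq_part 2 0 (cnj_form \<beta>) = cnj_form (pq_part 0 2 \<beta>)"
    and "\<beta> \<in> forms 2 \<Longrightarrow> pq_part (Suc 0) (Suc 0) (cnj_form \<beta>) = cnj_form (pq_part (Suc 0) (Suc 0) \<beta>)"
    and "\<beta> \<in> forms 2 \<Longrightarrow> pq_part 0 2 (cnj_form \<beta>) = cnj_form (pq_part 2 0 \<beta>)"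
    and "\<gamma> \<in> forms 3 \<Longrightarrow> pq_part 2 (Suc 0) (cnj_form \<gamma>) = cnj_form (pq_part (Suc 0) 2 \<gamma>)"
    and "\<gamma> \<in> forms 3 \<Longrightarrow> pq_part (Suc 0) 2 (cnj_form \<gamma>) = cnj_form (pq_part 2 (Suc 0) \<gamma>)"
proof -
  show "pq_part (Suc 0) 0 (cnj_form \<alpha>) = cnj_form (pq_part 0 (Suc 0) \<alpha>)"
    "pq_part 0 (Suc 0) (cnj_form \<alpha>) = cnj_form (pq_part (Suc 0) 0 \<alpha>)" if a: "\<alpha> \<in> forms 1"
    by (rule pq_part_eqI[OF forms_cnj[OF pq_part_forms_1(2)[OF a]]], simp add: pq_part_at hermitian4.tpart_cnj(1)[OF _ formsD(2)[OF a]])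
      (rule pq_part_eqI[OF forms_cnj[OF pq_part_forms_1(1)[OF a]]], simp add: pq_part_at hermitian4.tpart_cnj(2)[OF _ formsD(2)[OF a]])
  show "pq_part 2 0 (cnj_form \<beta>) = cnj_form (pq_part 0 2 \<beta>)"
    "pq_part (Suc 0) (Suc 0) (cnj_form \<beta>) = cnj_form (pq_part (Suc 0) (Suc 0) \<beta>)"
    "pq_part 0 2 (cnj_form \<beta>) = cnj_form (pq_part 2 0 \<beta>)" if b: "\<beta> \<in> forms 2"
    by (rule pq_part_eqI[OF forms_cnj[OF pq_part_forms_2(3)[OF b]]], simp add: pq_part_at hermitian4.tpart_cnj(3)[OF _ formsD(2)[OF b]])
      (rule pq_part_eqI[OF forms_cnj[OF pq_part_forms_2(2)[OF b]]], simp add: pq_part_at hermitian4.tpart_cnj(4)[OF _ formsD(2)[OF b]],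
       rule pq_part_eqI[OF forms_cnj[OF pq_part_forms_2(1)[OF b]]], simp add: pq_part_at hermitian4.tpart_cnj(5)[OF _ formsD(2)[OF b]])
  show "pq_part 2 (Suc 0) (cnj_form \<gamma>) = cnj_form (pq_part (Suc 0) 2 \<gamma>)"
    "pq_part (Suc 0) 2 (cnj_form \<gamma>) = cnj_form (pq_part 2 (Suc 0) \<gamma>)" if c: "\<gamma> \<in> forms 3"
    by (rule pq_part_eqI[OF forms_cnj[OF pq_part_forms_3(2)[OF c]]], simp add: pq_part_at hermitian4.tpart_cnj(6)[OF _ formsD(2)[OF c]])
      (rule pq_part_eqI[OF forms_cnj[OF pq_part_forms_3(1)[OF c]]], simp add: pq_part_at hermitian4.tpart_cnj(7)[OF _ formsD(2)[OF c]])
qed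

lemma del_cnj:
  assumes "\<eta> \<in> forms k" "k \<le> 3"
  shows "del (cnj_form \<eta>) = cnj_form (delbar \<eta>)"
proof -
  note d = ext_deriv_forms_num
  consider "k = 0" | "k = 1" | "k = 2" | "k = 3" using assms(2) by linarith
  then show ?thesis
  proof cases
    assume "k = 0"
    then have f: "\<eta> \<in> forms 0" using assms(1) by simp
    show ?thesis
      unfolding del_formulas(1)[OF forms_cnj[OF f]] del_formulas(2)[OF f] ext_deriv_cnj[OF f] pq_part_cnj(1)[OF d(1)[OF f]] ..
  next
    assume "k = 1"
    then have \<eta>: "\<eta> \<in> forms 1" using assms(1) by simp
    note p = pq_part_forms_1[OF \<eta>]
    show ?thesis
      unfolding del_formulas(3)[OF forms_cnj[OF \<eta>]] del_formulas(4)[OF \<eta>] pq_part_cnj(1,2)[OF \<eta>]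
        ext_deriv_cnj[OF p(1)] ext_deriv_cnj[OF p(2)] pq_part_cnj(4)[OF d(2)[OF p(1)]] pq_part_cnj(3)[OF d(2)[OF p(2)]]
      by (simp add: fun_eq_iff)
  next
    assume "k = 2"
    then have \<eta>: "\<eta> \<in> forms 2" using assms(1) by simp
    note p = pq_part_forms_2[OF \<eta>]
    show ?thesis
      unfolding del_formulas(5)[OF forms_cnj[OF \<eta>]] del_formulas(6)[OF \<eta>] pq_part_cnj(4,5)[OF \<eta>]
        ext_deriv_cnj[OF p(1)] ext_deriv_cnj[OF p(2)] pq_part_cnj(7)[OF d(3)[OF p(1)]] pq_part_cnj(6)[OF d(3)[OF p(2)]]
      by (simp add: fun_eq_iff)
  next
    assume "k = 3"
    then have \<eta>: "\<eta> \<in> forms 3" using assms(1) by simp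
    show ?thesis
      unfolding del_formulas(7)[OF forms_cnj[OF \<eta>]] del_formulas(8)[OF \<eta>] pq_part_cnj(7)[OF \<eta>]
        ext_deriv_cnj[OF pq_part_forms_3(1)[OF \<eta>]] ..
  qed
qed

lemma delbar_cnj:
  assumes "\<eta> \<in> forms k" "k \<le> 3"
  shows "delbar (cnj_form \<eta>) = cnj_form (del \<eta>)"
  using del_cnj[OF forms_cnj[OF assms(1)] assms(2)] by (simp add: fun_eq_iff)

lemma del_0 [simp]: "del 0 = 0" "delbar 0 = 0"
  using del_formulas(1,2)[OF forms_0] by simp_all

end

locale compact_almost_kaehler4 = almost_hermitian4 X A J g
  for X :: "'a topology" and A :: "('a, real ^ 4) chart set"
    and J :: "'a \<Rightarrow> ('a, real ^ 4) tvec \<Rightarrow> ('a, real ^ 4) tvec"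
    and g :: "'a \<Rightarrow> ('a, real ^ 4) tvec \<Rightarrow> ('a, real ^ 4) tvec \<Rightarrow> real" +
  assumes compact: "compact_space X" and omega_closed: "ext_deriv fundamental_form = 0"
begin

text \<open>A choice among the functionals provided by \<open>integral_exists\<close>; from here on
  only its three properties are used.\<close>

definition integral4 :: "('a, real ^ 4) form_field \<Rightarrow> complex"
  where "integral4 = (SOME I. (\<forall>S\<in>forms 4. \<forall>T\<in>forms 4. \<forall>a b. I (\<lambda>x vs. a * S x vs + b * T x vs) = a * I S + b * I T) \<and>
    (\<forall>u\<in>forms 3. I (ext_deriv u) = 0) \<and>
    (\<forall>T\<in>forms 4. (\<forall>x\<in>topspace X. \<exists>r\<ge>0. top_at x (T x) = of_real r) \<longrightarrow>
      Im (I T) = 0 \<and> Re (I T) \<ge> 0 \<and> (Re (I T) = 0 \<longrightarrow> T = (\<lambda>x vs. 0))))"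

lemma integral4_props:
  "(\<forall>S\<in>forms 4. \<forall>T\<in>forms 4. \<forall>a b. integral4 (\<lambda>x vs. a * S x vs + b * T x vs) = a * integral4 S + b * integral4 T) \<and>
    (\<forall>u\<in>forms 3. integral4 (ext_deriv u) = 0) \<and>
    (\<forall>T\<in>forms 4. (\<forall>x\<in>topspace X. \<exists>r\<ge>0. top_at x (T x) = of_real r) \<longrightarrow>
      Im (integral4 T) = 0 \<and> Re (integral4 T) \<ge> 0 \<and> (Re (integral4 T) = 0 \<longrightarrow> T = (\<lambda>x vs. 0)))"
  unfolding integral4_def by (rule someI_ex[OF integral_exists[OF compact]])

lemma integral4_linear:
  "S \<in> forms 4 \<Longrightarrow> T \<in> forms 4 \<Longrightarrow> integral4 (\<lambda>x vs. a * S x vs + b * T x vs) = a * integral4 S + b * integral4 T"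
  using integral4_props by blast

lemma integral4_scale: "T \<in> forms 4 \<Longrightarrow> integral4 (\<lambda>x vs. a * T x vs) = a * integral4 T"
  using integral4_linear[of T T a 0] by simp

lemma integral4_add: "S \<in> forms 4 \<Longrightarrow> T \<in> forms 4 \<Longrightarrow> integral4 (\<lambda>x vs. S x vs + T x vs) = integral4 S + integral4 T"
  using integral4_linear[of S T 1 1] by simp

lemma Stokes: "u \<in> forms 3 \<Longrightarrow> integral4 (ext_deriv u) = 0"
  using integral4_props by blast

lemma integral4_nonneg:
  assumes "T \<in> forms 4" "\<And>x. x \<in> topspace X \<Longrightarrow> \<exists>r\<ge>0. top_at x (T x) = of_real r"
  shows "Re (integral4 T) \<ge> 0" "Re (integral4 T) = 0 \<Longrightarrow> T = (\<lambda>x vs. 0)"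
  using integral4_props assms by blast+

lemma integral4_0 [simp]: "integral4 (\<lambda>x vs. 0) = 0"
  using integral4_scale[OF forms_zero, of 0] by simp

section \<open>Integration by parts\<close>

lemma field_ext:
  assumes "\<And>x \<kappa>. x \<in> topspace X \<Longrightarrow> hermitian4 (tangent_space x) (J x) (g x) \<kappa> \<Longrightarrow> F x = G x"
    and "\<And>x vs. x \<notin> topspace X \<Longrightarrow> F x vs = G x vs"
  shows "F = G"
proof
  fix x
  show "F x = G x" using assms hermitian4_ex[of x] by (cases "x \<in> topspace X") (blast, auto)
qed

lemma ext_deriv_wedge_form_0:
  assumes "f \<in> forms 0" "\<beta> \<in> forms k" "k = 2 \<or> k = 3"
  shows "ext_deriv (wedge_form f \<beta>) = (\<lambda>x vs. wedge (ext_deriv f x) (\<beta> x) vs + wedge (f x) (ext_deriv \<beta> x) vs)"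
proof (rule field_ext)
  show "ext_deriv (wedge_form f \<beta>) x = (\<lambda>vs. wedge (ext_deriv f x) (\<beta> x) vs + wedge (f x) (ext_deriv \<beta> x) vs)"
    if "x \<in> topspace X" for x using ext_deriv_wedge_0[OF assms that] .
qed (simp add: ext_deriv_eq_dloc wedge_def)

lemma ext_deriv_wedge_form_1_2:
  assumes "\<alpha> \<in> forms 1" "\<beta> \<in> forms 2"
  shows "ext_deriv (wedge_form \<alpha> \<beta>) = (\<lambda>x vs. wedge (ext_deriv \<alpha> x) (\<beta> x) vs - wedge (\<alpha> x) (ext_deriv \<beta> x) vs)"
proof (rule field_ext)
  show "ext_deriv (wedge_form \<alpha> \<beta>) x = (\<lambda>vs. wedge (ext_deriv \<alpha> x) (\<beta> x) vs - wedge (\<alpha> x) (ext_deriv \<beta> x) vs)"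
    if "x \<in> topspace X" for x using ext_deriv_wedge_1_2[OF assms that] .
qed (simp add: ext_deriv_eq_dloc wedge_def)

lemma wedge_pq_part_1_3:
  assumes "\<alpha> \<in> forms 1" "u \<in> forms 3"
  shows "wedge_form (pq_part (Suc 0) 0 \<alpha>) u = wedge_form \<alpha> (pq_part (Suc 0) 2 u)"
    and "wedge_form (pq_part 0 (Suc 0) \<alpha>) u = wedge_form \<alpha> (pq_part 2 (Suc 0) u)"
  by (rule field_ext, simp add: pq_part_at hermitian4.wedge_tpart_1_3[OF _ formsD(2)[OF assms(1)] formsD(2)[OF assms(2)]],
      simp add: pq_part_outside wedge_def)+

lemma wedge_pq_part_2_2:
  assumes "\<alpha> \<in> forms 2" "\<beta> \<in> forms 2"
  shows "wedge_form (pq_part 2 0 \<alpha>) \<beta> = wedge_form \<alpha> (pq_part 0 2 \<beta>)"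
    and "wedge_form (pq_part (Suc 0) (Suc 0) \<alpha>) \<beta> = wedge_form \<alpha> (pq_part (Suc 0) (Suc 0) \<beta>)"
    and "wedge_form (pq_part 0 2 \<alpha>) \<beta> = wedge_form \<alpha> (pq_part 2 0 \<beta>)"
  by (rule field_ext, simp add: pq_part_at hermitian4.wedge_tpart_2_2[unfolded One_nat_def, OF _ formsD(2)[OF assms(1)] formsD(2)[OF assms(2)]],
      simp add: pq_part_outside wedge_def)+

text \<open>The degrees \<open>2\<close> and \<open>3\<close> of the integration by parts rule follow from degrees \<open>1\<close> and \<open>0\<close> because
  the wedge product is graded commutative.\<close>

definition parts_op :: "(('a, real ^ 4) form_field \<Rightarrow> ('a, real ^ 4) form_field) \<Rightarrow> bool"
  where "parts_op D \<longleftrightarrow> (\<forall>k\<le>3. \<forall>\<alpha>\<in>forms k. D \<alpha> \<in> forms (Suc k)) \<and>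
    (\<forall>f\<in>forms 0. \<forall>u\<in>forms 3. integral4 (wedge_form (D f) u) = - integral4 (wedge_form f (D u))) \<and>
    (\<forall>\<alpha>\<in>forms 1. \<forall>\<beta>\<in>forms 2. integral4 (wedge_form (D \<alpha>) \<beta>) = integral4 (wedge_form \<alpha> (D \<beta>)))"

lemma parts_op_forms: "parts_op D \<Longrightarrow> \<alpha> \<in> forms k \<Longrightarrow> k \<le> 3 \<Longrightarrow> m = Suc k \<Longrightarrow> D \<alpha> \<in> forms m"
  unfolding parts_op_def by blast

lemma integration_by_parts:
  assumes D: "parts_op D" and "k \<le> 3" "\<alpha> \<in> forms k" "\<beta> \<in> forms (3 - k)"
  shows "integral4 (wedge_form (D \<alpha>) \<beta>) = (-1) ^ Suc k * integral4 (wedge_form \<alpha> (D \<beta>))"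
proof -
  have p0: "integral4 (wedge_form (D f) u) = - integral4 (wedge_form f (D u))" if "f \<in> forms 0" "u \<in> forms 3" for f u
    using D that unfolding parts_op_def by blast
  have p1: "integral4 (wedge_form (D \<alpha>) \<beta>) = integral4 (wedge_form \<alpha> (D \<beta>))" if "\<alpha> \<in> forms 1" "\<beta> \<in> forms 2" for \<alpha> \<beta>
    using D that unfolding parts_op_def by blast
  have comm: "integral4 (wedge_form \<delta> \<gamma>) = (-1) ^ l * integral4 (wedge_form \<gamma> \<delta>)"
    if "\<gamma> \<in> forms l" "\<delta> \<in> forms (4 - l)" "l \<le> 4" for l \<gamma> \<delta>
    using wedge_form_commute[OF that(3,1,2)] integral4_scale[OF wedge_form_4[OF that(3,1,2)]] by simp
  consider "k = 0" | "k = 1" | "k = 2" | "k = 3" using assms(2) by linarith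
  then show ?thesis
  proof cases
    case 1
    then show ?thesis using p0[of \<alpha> \<beta>] assms(3,4) by simp
  next
    case 2
    then show ?thesis using p1[of \<alpha> \<beta>] assms(3,4) by simp
  next
    case 3
    have a: "\<alpha> \<in> forms 2" "\<beta> \<in> forms 1" using 3 assms(3,4) by simp_all
    have Da: "D \<alpha> \<in> forms 3" "D \<beta> \<in> forms 2"
      by (rule parts_op_forms[OF D a(1)], simp, simp) (rule parts_op_forms[OF D a(2)], simp, simp)
    show ?thesis using comm[of \<beta> 1 "D \<alpha>"] comm[of \<alpha> 2 "D \<beta>"] p1[OF a(2,1)] a Da 3 by simp
  next
    case 4
    have a: "\<alpha> \<in> forms 3" "\<beta> \<in> forms 0" using 4 assms(3,4) by simp_all
    have Da: "D \<alpha> \<in> forms 4" "D \<beta> \<in> forms 1"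
      by (rule parts_op_forms[OF D a(1)], simp, simp) (rule parts_op_forms[OF D a(2)], simp, simp)
    show ?thesis using comm[of \<beta> 0 "D \<alpha>"] comm[of \<alpha> 3 "D \<beta>"] p0[OF a(2,1)] a Da 4 by simp
  qed
qed

text \<open>Stokes' theorem for f u and for \<alpha> \<and> \<beta>; the different signs come from
  moving d past a factor of degree 0 or 1.\<close>

lemma parts_ext_deriv:
  shows "f \<in> forms 0 \<Longrightarrow> u \<in> forms 3 \<Longrightarrow> integral4 (wedge_form (ext_deriv f) u) = - integral4 (wedge_form f (ext_deriv u))"
    and "\<alpha> \<in> forms 1 \<Longrightarrow> \<beta> \<in> forms 2 \<Longrightarrow> integral4 (wedge_form (ext_deriv \<alpha>) \<beta>) = integral4 (wedge_form \<alpha> (ext_deriv \<beta>))"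
proof -
  assume f: "f \<in> forms 0" and u: "u \<in> forms 3"
  have d: "ext_deriv f \<in> forms 1" "ext_deriv u \<in> forms 4" using ext_deriv_forms[OF f] ext_deriv_forms[OF u] by simp_all
  have "integral4 (\<lambda>x vs. wedge (ext_deriv f x) (u x) vs + wedge (f x) (ext_deriv u x) vs) = 0"
    using Stokes[OF forms_wedge_0[OF f u]] ext_deriv_wedge_form_0[OF f u] by simp
  then show "integral4 (wedge_form (ext_deriv f) u) = - integral4 (wedge_form f (ext_deriv u))"
    using integral4_add[OF forms_wedge_1_3[OF d(1) u] forms_wedge_0[OF f d(2)]] by (simp add: eq_neg_iff_add_eq_0)
next
  assume a: "\<alpha> \<in> forms 1" and b: "\<beta> \<in> forms 2"
  have d: "ext_deriv \<alpha> \<in> forms 2" "ext_deriv \<beta> \<in> forms 3" using ext_deriv_forms[OF a] ext_deriv_forms[OF b]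
    by (simp_all add: numeral_2_eq_2 numeral_3_eq_3)
  have "integral4 (\<lambda>x vs. wedge (ext_deriv \<alpha> x) (\<beta> x) vs - wedge (\<alpha> x) (ext_deriv \<beta> x) vs) = 0"
    using Stokes[OF forms_wedge_1_2[OF a b]] ext_deriv_wedge_form_1_2[OF a b] by simp
  then show "integral4 (wedge_form (ext_deriv \<alpha>) \<beta>) = integral4 (wedge_form \<alpha> (ext_deriv \<beta>))"
    using integral4_linear[OF forms_wedge_2_2[OF d(1) b] forms_wedge_1_3[OF a d(2)], of 1 "-1"] by simp
qed

lemma parts_op_ext_deriv: "parts_op ext_deriv"
  unfolding parts_op_def using parts_ext_deriv ext_deriv_forms by blast

lemma wedge_form_add_left: "wedge_form (\<alpha> + \<beta>) \<gamma> = (\<lambda>x vs. wedge (\<alpha> x) (\<gamma> x) vs + wedge (\<beta> x) (\<gamma> x) vs)"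
proof (intro ext)
  fix x vs
  show "wedge ((\<alpha> + \<beta>) x) (\<gamma> x) vs = wedge (\<alpha> x) (\<gamma> x) vs + wedge (\<beta> x) (\<gamma> x) vs"
    using fun_cong[OF wedge_linear_left[of 1 "\<alpha> x" 1 "\<beta> x" "\<gamma> x"], of vs] by (simp add: plus_fun_def)
qed

lemma wedge_form_add_right: "wedge_form \<gamma> (\<alpha> + \<beta>) = (\<lambda>x vs. wedge (\<gamma> x) (\<alpha> x) vs + wedge (\<gamma> x) (\<beta> x) vs)"
proof (intro ext)
  fix x vs
  show "wedge (\<gamma> x) ((\<alpha> + \<beta>) x) vs = wedge (\<gamma> x) (\<alpha> x) vs + wedge (\<gamma> x) (\<beta> x) vs"
    using fun_cong[OF wedge_linear_right[of "\<gamma> x" 1 "\<alpha> x" 1 "\<beta> x"], of vs] by (simp add: plus_fun_def)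
qed

lemma wedge_form_scale_right: "wedge_form \<alpha> (\<lambda>x vs. a * \<beta> x vs) = (\<lambda>x vs. a * wedge (\<alpha> x) (\<beta> x) vs)"
  by (intro ext) (simp add: wedge_def sum_distrib_left mult_ac)

text \<open>The type projection outside d is moved to the other factor, d is integrated by parts,
  and the projection inside d is moved across as well. The resulting summands are exactly those of
  del or delbar on the other factor.\<close>

lemma parts_op_del: "parts_op del" "parts_op delbar"
proof -
  note d = ext_deriv_forms_num
  have 0: "integral4 (wedge_form (del f) u) = - integral4 (wedge_form f (del u))"
    "integral4 (wedge_form (delbar f) u) = - integral4 (wedge_form f (delbar u))" if f: "f \<in> forms 0" and u: "u \<in> forms 3" for f u
    unfolding del_formulas(1,2)[OF f] del_formulas(7,8)[OF u] wedge_pq_part_1_3[OF d(1)[OF f] u]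
    by (rule parts_ext_deriv(1)[OF f pq_part_forms_3(2)[OF u]], rule parts_ext_deriv(1)[OF f pq_part_forms_3(1)[OF u]])
  have 1: "integral4 (wedge_form (del \<theta>) \<eta>) = integral4 (wedge_form \<theta> (del \<eta>)) \<and>
    integral4 (wedge_form (delbar \<theta>) \<eta>) = integral4 (wedge_form \<theta> (delbar \<eta>))"
    if \<theta>: "\<theta> \<in> forms 1" and \<eta>: "\<eta> \<in> forms 2" for \<theta> \<eta>
  proof -
    note p = pq_part_forms_1[OF \<theta>] and q = pq_part_forms_2[OF \<eta>]
    note dp = d(2)[OF p(1)] d(2)[OF p(2)] and dq = d(3)[OF q(1)] d(3)[OF q(2)] d(3)[OF q(3)]
    have i: "integral4 (wedge_form (A + B) \<eta>) = integral4 (wedge_form A \<eta>) + integral4 (wedge_form B \<eta>)"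
      if "A \<in> forms 2" "B \<in> forms 2" for A B
      unfolding wedge_form_add_left by (rule integral4_add[OF forms_wedge_2_2[OF that(1) \<eta>] forms_wedge_2_2[OF that(2) \<eta>]])
    have j: "integral4 (wedge_form \<theta> (A + B)) = integral4 (wedge_form \<theta> A) + integral4 (wedge_form \<theta> B)"
      if "A \<in> forms 3" "B \<in> forms 3" for A B
      unfolding wedge_form_add_right by (rule integral4_add[OF forms_wedge_1_3[OF \<theta> that(1)] forms_wedge_1_3[OF \<theta> that(2)]])
    have "integral4 (wedge_form (del \<theta>) \<eta>) = integral4 (wedge_form \<theta> (del \<eta>))"
      unfolding del_formulas(3)[OF \<theta>] del_formulas(5)[OF \<eta>] i[OF pq_part_forms_2(2)[OF dp(2)] pq_part_forms_2(1)[OF dp(1)]]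
        j[OF pq_part_forms_3(2)[OF dq(3)] pq_part_forms_3(1)[OF dq(2)]]
        wedge_pq_part_2_2[OF dp(1) \<eta>] wedge_pq_part_2_2[OF dp(2) \<eta>]
        parts_ext_deriv(2)[OF p(1) q(3)] parts_ext_deriv(2)[OF p(2) q(2)]
        wedge_pq_part_1_3(1)[OF \<theta> dq(3)] wedge_pq_part_1_3(2)[OF \<theta> dq(2)] by simp
    moreover have "integral4 (wedge_form (delbar \<theta>) \<eta>) = integral4 (wedge_form \<theta> (delbar \<eta>))"
      unfolding del_formulas(4)[OF \<theta>] del_formulas(6)[OF \<eta>] i[OF pq_part_forms_2(3)[OF dp(2)] pq_part_forms_2(2)[OF dp(1)]]
        j[OF pq_part_forms_3(2)[OF dq(2)] pq_part_forms_3(1)[OF dq(1)]]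
        wedge_pq_part_2_2[OF dp(1) \<eta>] wedge_pq_part_2_2[OF dp(2) \<eta>]
        parts_ext_deriv(2)[OF p(1) q(2)] parts_ext_deriv(2)[OF p(2) q(1)]
        wedge_pq_part_1_3(1)[OF \<theta> dq(2)] wedge_pq_part_1_3(2)[OF \<theta> dq(1)] by simp
    ultimately show ?thesis by blast
  qed
  show "parts_op del" "parts_op delbar" unfolding parts_op_def using 0 1 del_forms by blast+
qed

section \<open>Adjoints and energy\<close>

text \<open>D and D' are conjugate to each other: d is paired with itself and del with delbar. The
  Hermitian product conjugates its second argument, so the formal adjoint of D is built from
  D'.\<close>

definition adjoint_pair :: "(('a, real ^ 4) form_field \<Rightarrow> ('a, real ^ 4) form_field) \<Rightarrow>
    (('a, real ^ 4) form_field \<Rightarrow> ('a, real ^ 4) form_field) \<Rightarrow> bool"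
  where "adjoint_pair D D' \<longleftrightarrow> parts_op D \<and> parts_op D' \<and> (\<forall>k\<le>3. \<forall>\<alpha>\<in>forms k. D (cnj_form \<alpha>) = cnj_form (D' \<alpha>))"

lemma adjoint_pairs: "adjoint_pair ext_deriv ext_deriv" "adjoint_pair del delbar" "adjoint_pair delbar del"
  unfolding adjoint_pair_def using parts_op_ext_deriv parts_op_del ext_deriv_cnj del_cnj delbar_cnj by blast+

lemma adjoint_pairD:
  assumes "adjoint_pair D D'"
  shows "parts_op D" "parts_op D'" "k \<le> 3 \<Longrightarrow> \<alpha> \<in> forms k \<Longrightarrow> D (cnj_form \<alpha>) = cnj_form (D' \<alpha>)"
  using assms by (simp_all add: adjoint_pair_def)

lemma adjoint_pair_sym:
  assumes "adjoint_pair D D'"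
  shows "adjoint_pair D' D"
proof -
  have "D' (cnj_form \<alpha>) = cnj_form (D \<alpha>)" if "k \<le> 3" "\<alpha> \<in> forms k" for k \<alpha>
  proof -
    have "D (cnj_form (cnj_form \<alpha>)) = cnj_form (D' (cnj_form \<alpha>))"
      by (rule adjoint_pairD(3)[OF assms that(1) forms_cnj[OF that(2)]])
    then show ?thesis by (simp add: fun_eq_iff)
  qed
  then show ?thesis using adjoint_pairD(1,2)[OF assms] by (simp add: adjoint_pair_def)
qed

text \<open>Not the adjoint of D itself but of its conjugate partner, which is why
  \<open>del_adj\<close> is \<open>adj delbar\<close>.\<close>

definition adj :: "(('a, real ^ 4) form_field \<Rightarrow> ('a, real ^ 4) form_field) \<Rightarrow> ('a, real ^ 4) form_field \<Rightarrow> ('a, real ^ 4) form_field"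
  where "adj D \<beta> = - hodge_star (D (hodge_star \<beta>))"

lemma adj_simps: "ext_deriv_adj = adj ext_deriv" "del_adj = adj delbar" "delbar_adj = adj del"
  by (simp_all add: fun_eq_iff adj_def ext_deriv_adj_def del_adj_def delbar_adj_def)

text \<open>The global L2 product; the conjugate sits under the star because the star is complex
  linear.\<close>

definition inner_form :: "('a, real ^ 4) form_field \<Rightarrow> ('a, real ^ 4) form_field \<Rightarrow> complex"
  where "inner_form \<alpha> \<beta> = integral4 (wedge_form \<alpha> (hodge_star (cnj_form \<beta>)))"

lemma star_D_star_forms:
  assumes "parts_op D" "\<beta> \<in> forms m" "m = Suc k" "k \<le> 3"
  shows "hodge_star \<beta> \<in> forms (3 - k)" "D (hodge_star \<beta>) \<in> forms (4 - k)"
proof -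
  show s: "hodge_star \<beta> \<in> forms (3 - k)" using hodge_star_forms[OF assms(2)] assms(3,4) by simp
  show "D (hodge_star \<beta>) \<in> forms (4 - k)" by (rule parts_op_forms[OF assms(1) s]) (use assms(4) in simp_all)
qed

lemma adj_forms:
  assumes "parts_op D" "\<beta> \<in> forms m" "m = Suc k" "k \<le> 3"
  shows "adj D \<beta> \<in> forms k"
  using forms_uminus[OF hodge_star_forms[OF star_D_star_forms(2)[OF assms]]] assms(4) by (simp add: adj_def)

text \<open>The sign combines the minus in \<open>adj\<close> with star star = (-1) ^ (4 - k) in
  degree 4 - k. It also turns the vanishing of an adjoint into an equation for the star of
  \<beta>.\<close>

lemma hodge_star_adj:
  assumes "parts_op D" "\<beta> \<in> forms m" "m = Suc k" "k \<le> 3"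
  shows "hodge_star (adj D \<beta>) = (\<lambda>x vs. (-1) ^ Suc k * D (hodge_star \<beta>) x vs)"
proof -
  note f = star_D_star_forms(2)[OF assms]
  have "hodge_star (adj D \<beta>) = - hodge_star (hodge_star (D (hodge_star \<beta>)))"
    unfolding adj_def by (rule hodge_star_uminus[OF hodge_star_forms[OF f]]) simp_all
  moreover have "k = 0 \<or> k = 1 \<or> k = 2 \<or> k = 3" using assms(4) by linarith
  then have "(-1 :: complex) ^ Suc k = - ((-1) ^ (4 - k))" by auto
  ultimately show ?thesis using hodge_star_hodge_star[OF f] by (simp add: fun_eq_iff)
qed

lemma adj_eq_0:
  assumes "parts_op D" "\<beta> \<in> forms m" "m = Suc k" "k \<le> 3" "adj D \<beta> = 0"
  shows "D (hodge_star \<beta>) = 0"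
  using hodge_star_adj[OF assms(1-4)] assms(5) by (simp add: fun_eq_iff)

lemma cnj_adj:
  assumes "adjoint_pair D D'" "\<beta> \<in> forms m" "m = Suc k" "k \<le> 3"
  shows "cnj_form (adj D' \<beta>) = adj D (cnj_form \<beta>)"
proof -
  note p = adjoint_pairD(2)[OF assms(1)]
  note f = star_D_star_forms[OF p assms(2-4)]
  have e1: "hodge_star (cnj_form \<beta>) = cnj_form (hodge_star \<beta>)"
    by (rule hodge_star_cnj[OF assms(2)]) (use assms(3,4) in simp)
  have e2: "D (cnj_form (hodge_star \<beta>)) = cnj_form (D' (hodge_star \<beta>))" by (rule adjoint_pairD(3)[OF assms(1) _ f(1)]) simp
  have e3: "hodge_star (cnj_form (D' (hodge_star \<beta>))) = cnj_form (hodge_star (D' (hodge_star \<beta>)))"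
    by (rule hodge_star_cnj[OF f(2)]) simp
  show ?thesis unfolding adj_def e1 e2 e3 by (simp add: fun_eq_iff)
qed

text \<open>Integration by parts and the star of the adjoint both contribute the sign (-1) ^ (k +
  1), so the signs cancel.\<close>

lemma inner_form_adj_right:
  assumes D: "adjoint_pair D D'" and a: "\<alpha> \<in> forms k" and b: "\<beta> \<in> forms m" "m = Suc k" "k \<le> 3"
  shows "inner_form (D \<alpha>) \<beta> = inner_form \<alpha> (adj D' \<beta>)"
proof -
  note p = adjoint_pairD(1)[OF D]
  note f = star_D_star_forms[OF p forms_cnj[OF b(1)] b(2,3)]
  have "inner_form \<alpha> (adj D' \<beta>) = integral4 (wedge_form \<alpha> (hodge_star (adj D (cnj_form \<beta>))))"
    unfolding inner_form_def cnj_adj[OF D b] ..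
  also have "\<dots> = integral4 (\<lambda>x vs. (-1) ^ Suc k * wedge (\<alpha> x) (D (hodge_star (cnj_form \<beta>)) x) vs)"
    unfolding hodge_star_adj[OF p forms_cnj[OF b(1)] b(2,3)] wedge_form_scale_right ..
  also have "\<dots> = (-1) ^ Suc k * integral4 (wedge_form \<alpha> (D (hodge_star (cnj_form \<beta>))))"
    by (rule integral4_scale[OF wedge_form_4[OF _ a f(2)]]) (use b(3) in simp)
  also have "\<dots> = inner_form (D \<alpha>) \<beta>"
    unfolding inner_form_def using integration_by_parts[OF p b(3) a f(1)] by simp
  finally show ?thesis ..
qed

text \<open>Hermitian symmetry in a form without an outer conjugation of the integral: the star is
  real, and the two integrands agree pointwise. It carries adjointness from one argument to the
  other.\<close>

lemma inner_form_cnj: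
  assumes a: "\<alpha> \<in> forms k" and b: "\<beta> \<in> forms k" and k: "k \<le> 4"
  shows "inner_form \<beta> \<alpha> = inner_form (cnj_form \<alpha>) (cnj_form \<beta>)"
proof -
  have "wedge_form \<beta> (hodge_star (cnj_form \<alpha>)) = wedge_form (cnj_form \<alpha>) (hodge_star \<beta>)"
  proof (rule field_ext)
    fix x \<kappa> assume x: "x \<in> topspace X" and h: "hermitian4 (tangent_space x) (J x) (g x) \<kappa>"
    let ?P = "wedge (\<beta> x) (hodge_star (cnj_form \<alpha>) x)" and ?Q = "wedge (cnj_form \<alpha> x) (hodge_star \<beta> x)"
    have P: "?P \<in> alt_forms (tangent_space x) 4"
      using formsD(2)[OF wedge_form_4[OF k b hodge_star_forms[OF forms_cnj[OF a] k]] x] .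
    have Q: "?Q \<in> alt_forms (tangent_space x) 4"
      using formsD(2)[OF wedge_form_4[OF k forms_cnj[OF a] hodge_star_forms[OF b k]] x] .
    have "top_at x ?P = cnj (top_at x (wedge (\<alpha> x) (star_at x k (\<lambda>vs. cnj (\<beta> x vs)))))"
      using hermitian4.top_coeff_star_commute[OF h k formsD(2)[OF a x] formsD(2)[OF b x]]
      by (simp add: hodge_star_form_at[OF forms_cnj[OF a] k x])
    also have "\<dots> = top_at x (\<lambda>vs. cnj (wedge (\<alpha> x) (star_at x k (\<lambda>vs. cnj (\<beta> x vs))) vs))"
      using hermitian4.top_coeff_cnj[OF h] by simp
    also have "(\<lambda>vs. cnj (wedge (\<alpha> x) (star_at x k (\<lambda>vs. cnj (\<beta> x vs))) vs)) = ?Q"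
    proof -
      have e: "star_at x k (\<lambda>vs. cnj (\<beta> x vs)) = (\<lambda>vs. cnj (hodge_star \<beta> x vs))"
        using hermitian4.star_cnj[OF h, of k "\<beta> x"] by (simp add: hodge_star_form_at[OF b k x])
      show ?thesis unfolding e using wedge_cnj[of "\<alpha> x" "\<lambda>vs. cnj (hodge_star \<beta> x vs)"] by (simp add: fun_eq_iff)
    qed
    finally have "top_at x ?P = top_at x ?Q" .
    then show "?P = ?Q" using hermitian4.top_coeff_eq[OF h P] hermitian4.top_coeff_eq[OF h Q] by simp
  next
    fix x vs assume x: "x \<notin> topspace X"
    then show "wedge (\<beta> x) (hodge_star (cnj_form \<alpha>) x) vs = wedge (cnj_form \<alpha> x) (hodge_star \<beta> x) vs"
      using formsD(1)[OF a x] formsD(1)[OF b x] by (simp add: wedge_def)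
  qed
  then show ?thesis by (simp add: inner_form_def)
qed

lemma inner_form_adj_left:
  assumes D: "adjoint_pair D D'" and a: "\<alpha> \<in> forms k" and b: "\<beta> \<in> forms m" "m = Suc k" "k \<le> 3"
  shows "inner_form (adj D' \<beta>) \<alpha> = inner_form \<beta> (D \<alpha>)"
proof -
  note p = adjoint_pairD(1,2)[OF D] and c = adjoint_pairD(3)[OF adjoint_pair_sym[OF D] b(3) a]
  have "inner_form (adj D' \<beta>) \<alpha> = inner_form (cnj_form \<alpha>) (cnj_form (adj D' \<beta>))"
    by (rule inner_form_cnj[OF a adj_forms[OF p(2) b]]) (use b(3) in simp)
  also have "\<dots> = inner_form (D' (cnj_form \<alpha>)) (cnj_form \<beta>)"
    unfolding cnj_adj[OF D b] by (rule inner_form_adj_right[OF adjoint_pair_sym[OF D] forms_cnj[OF a] forms_cnj[OF b(1)] b(2,3), symmetric])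
  also have "\<dots> = inner_form \<beta> (D \<alpha>)"
    unfolding c by (rule inner_form_cnj[OF parts_op_forms[OF p(1) a b(3,2)] b(1), symmetric]) (use b(2,3) in simp)
  finally show ?thesis .
qed

lemma inner_form_self:
  assumes a: "\<alpha> \<in> forms k" and k: "k \<le> 4"
  shows "Re (inner_form \<alpha> \<alpha>) \<ge> 0" "Re (inner_form \<alpha> \<alpha>) = 0 \<Longrightarrow> \<alpha> = 0"
proof -
  let ?T = "wedge_form \<alpha> (hodge_star (cnj_form \<alpha>))"
  have T: "?T \<in> forms 4" by (rule wedge_form_4[OF k a hodge_star_forms[OF forms_cnj[OF a] k]])
  have eq: "?T x = wedge (\<alpha> x) (star_at x k (\<lambda>vs. cnj (\<alpha> x vs)))" if "x \<in> topspace X" for x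
    using hodge_star_form_at[OF forms_cnj[OF a] k that] by simp
  have pos: "\<exists>r\<ge>0. top_at x (?T x) = of_real r" if x: "x \<in> topspace X" for x
    unfolding eq[OF x] using hermitian4_ex[OF x] hermitian4.top_coeff_star_self(1)[OF _ k formsD(2)[OF a x]] by blast
  show "Re (inner_form \<alpha> \<alpha>) \<ge> 0"
    unfolding inner_form_def by (rule integral4_nonneg(1)[where T = ?T, OF T pos])
  assume "Re (inner_form \<alpha> \<alpha>) = 0"
  then have T0: "?T = (\<lambda>x vs. 0)"
    unfolding inner_form_def by (rule integral4_nonneg(2)[where T = ?T, OF T pos, rotated])
  show "\<alpha> = 0"
  proof (rule field_ext)
    fix x \<kappa> assume x: "x \<in> topspace X" and h: "hermitian4 (tangent_space x) (J x) (g x) \<kappa>"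
    have "top_at x (?T x) = 0"
      unfolding fun_cong[OF T0, of x] using hermitian4.top_coeff_linear[OF h, of 0 _ 0] by simp
    then show "\<alpha> x = 0 x"
      using hermitian4.top_coeff_star_self(2)[OF h k formsD(2)[OF a x]] by (simp add: eq[OF x] zero_fun_def)
  qed (use formsD(1)[OF a] in simp)
qed

lemma inner_form_add:
  assumes "\<alpha> \<in> forms k" "\<beta> \<in> forms k" "\<gamma> \<in> forms k" "k \<le> 4"
  shows "inner_form (\<alpha> + \<beta>) \<gamma> = inner_form \<alpha> \<gamma> + inner_form \<beta> \<gamma>"
  unfolding inner_form_def wedge_form_add_left
  using integral4_add[OF wedge_form_4[OF assms(4,1) hodge_star_forms[OF forms_cnj[OF assms(3)] assms(4)]]
      wedge_form_4[OF assms(4,2) hodge_star_forms[OF forms_cnj[OF assms(3)] assms(4)]]] .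

lemma inner_form_0 [simp]: "inner_form 0 \<beta> = 0"
  by (simp add: inner_form_def wedge_def)

end

section \<open>Harmonic forms of type (1, 1)\<close>

context almost_hermitian4
begin

lemma pq_part_linear:
  "pq_part p q (\<lambda>x vs. a * \<alpha> x vs + b * \<beta> x vs) = (\<lambda>x vs. a * pq_part p q \<alpha> x vs + b * pq_part p q \<beta> x vs)"
  by (simp add: pq_part_def complexify_def fun_eq_iff sum_distrib_left sum.distrib[symmetric] algebra_simps)

lemma pq_part_1_idem:
  assumes "\<alpha> \<in> forms 1"
  shows "pq_part 0 (Suc 0) (pq_part 0 (Suc 0) \<alpha>) = pq_part 0 (Suc 0) \<alpha>"
proof (rule pq_part_eqI[OF pq_part_forms_1(2)[OF assms]])
  fix x \<kappa> assume "x \<in> topspace X" "hermitian4 (tangent_space x) (J x) (g x) \<kappa>"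
  then show "tpart_at x 0 (Suc 0) (pq_part 0 (Suc 0) \<alpha> x) = pq_part 0 (Suc 0) \<alpha> x"
    using hermitian4.tpart_1_idem(1)[of "tangent_space x" "J x" "g x" \<kappa>, OF _ formsD(2)[OF assms]] by (simp add: pq_part_at)
qed

lemma forms_wedge_omega: "\<alpha> \<in> forms 1 \<Longrightarrow> wedge_form \<alpha> fundamental_form \<in> forms 3"
  by (rule forms_wedge_1_2[OF _ fundamental_form_forms])

lemma pq_part_wedge_omega:
  assumes "\<alpha> \<in> forms 1"
  shows "pq_part (Suc 0) 2 (wedge_form \<alpha> fundamental_form) = wedge_form (pq_part 0 (Suc 0) \<alpha>) fundamental_form"
    and "pq_part 2 (Suc 0) (wedge_form \<alpha> fundamental_form) = wedge_form (pq_part (Suc 0) 0 \<alpha>) fundamental_form"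
proof -
  note f = pq_part_forms_1[OF assms, THEN forms_wedge_omega] and t = hermitian4.tpart_wedge_omega[OF _ formsD(2)[OF assms]]
  show "pq_part (Suc 0) 2 (wedge_form \<alpha> fundamental_form) = wedge_form (pq_part 0 (Suc 0) \<alpha>) fundamental_form"
    by (rule pq_part_eqI[OF f(2)]) (simp add: pq_part_at fundamental_form_at t)
  show "pq_part 2 (Suc 0) (wedge_form \<alpha> fundamental_form) = wedge_form (pq_part (Suc 0) 0 \<alpha>) fundamental_form"
    by (rule pq_part_eqI[OF f(1)]) (simp add: pq_part_at fundamental_form_at t)
qed

lemma pq_part_sums:
  shows "\<alpha> \<in> forms 1 \<Longrightarrow> pq_part (Suc 0) 0 \<alpha> + pq_part 0 (Suc 0) \<alpha> = \<alpha>"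
    and "u \<in> forms 3 \<Longrightarrow> pq_part 2 (Suc 0) u + pq_part (Suc 0) 2 u = u"
proof -
  assume a: "\<alpha> \<in> forms 1"
  have "pq_part (Suc 0) 0 \<alpha> x vs + pq_part 0 (Suc 0) \<alpha> x vs = \<alpha> x vs" for x vs
    using hermitian4_ex[of x] hermitian4.tpart_1_sum[OF _ formsD(2)[OF a]] formsD(1)[OF a, of x]
    by (cases "x \<in> topspace X") (auto simp: pq_part_at pq_part_outside)
  then show "pq_part (Suc 0) 0 \<alpha> + pq_part 0 (Suc 0) \<alpha> = \<alpha>" by (simp add: fun_eq_iff)
next
  assume u: "u \<in> forms 3"
  have "pq_part 2 (Suc 0) u x vs + pq_part (Suc 0) 2 u x vs = u x vs" for x vs
    using hermitian4_ex[of x] hermitian4.tpart_3_sum[OF _ formsD(2)[OF u]] formsD(1)[OF u, of x]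
    by (cases "x \<in> topspace X") (auto simp: pq_part_at pq_part_outside)
  then show "pq_part 2 (Suc 0) u + pq_part (Suc 0) 2 u = u" by (simp add: fun_eq_iff)
qed

lemma hodge_star_pq_part_1:
  assumes "\<alpha> \<in> forms 1"
  shows "hodge_star (pq_part 0 (Suc 0) \<alpha>) = (\<lambda>x vs. \<i> * wedge (pq_part 0 (Suc 0) \<alpha> x) (fundamental_form x) vs)"
proof
  fix x
  show "hodge_star (pq_part 0 (Suc 0) \<alpha>) x = (\<lambda>vs. \<i> * wedge (pq_part 0 (Suc 0) \<alpha> x) (fundamental_form x) vs)"
  proof (cases "x \<in> topspace X")
    case True
    obtain \<kappa> where h: "hermitian4 (tangent_space x) (J x) (g x) \<kappa>" using hermitian4_ex[OF True] by blast
    show ?thesis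
      using hermitian4.star_1_tpart(1)[OF h formsD(2)[OF assms True]] hodge_star_form_at[OF pq_part_forms_1(2)[OF assms] _ True]
      by (simp add: hermitian4.star_simps[OF h] pq_part_at[OF True] fundamental_form_at[OF True])
  next
    case False
    then show ?thesis by (simp add: hodge_star_def pq_part_outside fun_eq_iff wedge_def)
  qed
qed

text \<open>Type (1,1) as invariance under J, a condition that is visibly preserved by the
  star.\<close>

definition invariant_form :: "('a, real ^ 4) form_field \<Rightarrow> bool"
  where "invariant_form \<eta> \<longleftrightarrow> \<eta> \<in> forms 2 \<and>
    (\<forall>x\<in>topspace X. \<forall>u\<in>tangent_space x. \<forall>v\<in>tangent_space x. \<eta> x [J x u, J x v] = \<eta> x [u, v])"

lemma pq_forms_1_1_invariant:
  assumes "\<eta> \<in> pq_forms 1 1"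
  shows "invariant_form \<eta>"
proof -
  have \<eta>: "\<eta> \<in> forms 2" using assms by (simp add: pq_forms_def numeral_2_eq_2)
  have "\<eta> x [J x u, J x v] = \<eta> x [u, v]" if x: "x \<in> topspace X" and uv: "u \<in> tangent_space x" "v \<in> tangent_space x" for x u v
  proof -
    obtain \<kappa> where h: "hermitian4 (tangent_space x) (J x) (g x) \<kappa>" using hermitian4_ex[OF x] by blast
    have z: "complexify (\<eta> x) (map (\<lambda>j. (vs ! j, if j \<in> S then - J x (vs ! j) else J x (vs ! j))) [0..<1 + 1]) = 0"
      if "length vs = 1 + 1" "set vs \<subseteq> tangent_space x" "S \<subseteq> {..<1 + 1}" "card S \<noteq> 1" for vs S
      using assms x that by (simp only: pq_forms_def mem_Collect_eq) blast
    have "complexify (\<eta> x) [(u, J x u), (v, J x v)] = 0 \<and> complexify (\<eta> x) [(u, - J x u), (v, - J x v)] = 0"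
      if "u \<in> tangent_space x" "v \<in> tangent_space x" for u v
      \<comment> \<open>The empty and the full set of positions are the only ones whose cardinality
        is not 1; they test two vectors of type (0,1) and two of type (1,0).\<close>
      using z[of "[u, v]" "{}"] z[of "[u, v]" "{..<2}"] that by (simp add: numeral_2_eq_2)
    then show ?thesis using hermitian4.complexify_pure_2[OF h formsD(2)[OF \<eta> x]] uv by blast
  qed
  then show ?thesis using \<eta> by (simp add: invariant_form_def)
qed

text \<open>The (2,0) and (0,2) parts are zero, so only the terms of \<open>del_formulas\<close>
  coming from the (1,1) part remain.\<close>

lemma invariant_form_del:
  assumes "invariant_form \<eta>"
  shows "del \<eta> = pq_part 2 (Suc 0) (ext_deriv \<eta>)" "delbar \<eta> = pq_part (Suc 0) 2 (ext_deriv \<eta>)"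
proof -
  have \<eta>: "\<eta> \<in> forms 2"
    and inv: "\<And>x u v. x \<in> topspace X \<Longrightarrow> u \<in> tangent_space x \<Longrightarrow> v \<in> tangent_space x \<Longrightarrow> \<eta> x [J x u, J x v] = \<eta> x [u, v]"
    using assms by (simp_all add: invariant_form_def)
  have t: "tpart_at x (Suc 0) (Suc 0) (\<eta> x) = \<eta> x" "tpart_at x 2 0 (\<eta> x) = (\<lambda>vs. 0)" "tpart_at x 0 2 (\<eta> x) = (\<lambda>vs. 0)"
    if x: "x \<in> topspace X" for x
  proof -
    obtain \<kappa> where h: "hermitian4 (tangent_space x) (J x) (g x) \<kappa>" using hermitian4_ex[OF x] by blast
    show "tpart_at x (Suc 0) (Suc 0) (\<eta> x) = \<eta> x" "tpart_at x 2 0 (\<eta> x) = (\<lambda>vs. 0)" "tpart_at x 0 2 (\<eta> x) = (\<lambda>vs. 0)"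
      by (rule hermitian4.tpart_2_invariant[OF h formsD(2)[OF \<eta> x]], erule (1) inv[OF x])+
  qed
  have p: "pq_part (Suc 0) (Suc 0) \<eta> = \<eta>" by (rule pq_part_eqI[OF \<eta>]) (simp add: t)
  have "pq_part 2 0 \<eta> = 0" "pq_part 0 2 \<eta> = 0"
    by (rule pq_part_eqI[OF forms_0], simp add: t zero_fun_def)+
  then show "del \<eta> = pq_part 2 (Suc 0) (ext_deriv \<eta>)" "delbar \<eta> = pq_part (Suc 0) 2 (ext_deriv \<eta>)"
    using del_formulas(5,6)[OF \<eta>] p by simp_all
qed

lemma invariant_form_star:
  assumes "invariant_form \<eta>"
  defines "h \<equiv> top_form (wedge_form \<eta> fundamental_form)"
  shows "h \<in> forms 0" "hodge_star \<eta> = (\<lambda>x vs. 1 * wedge (h x) (fundamental_form x) vs + (-1) * \<eta> x vs)"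
    "invariant_form (hodge_star \<eta>)"
proof -
  have \<eta>: "\<eta> \<in> forms 2"
    and inv: "\<And>x u v. x \<in> topspace X \<Longrightarrow> u \<in> tangent_space x \<Longrightarrow> v \<in> tangent_space x \<Longrightarrow> \<eta> x [J x u, J x v] = \<eta> x [u, v]"
    using assms by (simp_all add: invariant_form_def)
  show h: "h \<in> forms 0" unfolding h_def by (rule top_form_forms[OF forms_wedge_2_2[OF \<eta> fundamental_form_forms]])
  have w: "wedge (h x) (fundamental_form x) vs = h x [] * fundamental_form x vs" for x vs
    by (rule wedge_form_0[OF h fundamental_form_forms])
  have at: "hodge_star \<eta> x = (\<lambda>vs. h x [] * fundamental_form x vs - \<eta> x vs)" if x: "x \<in> topspace X" for x
  proof -
    obtain \<kappa> where hx: "hermitian4 (tangent_space x) (J x) (g x) \<kappa>" using hermitian4_ex[OF x] by blast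
    have "star_at x 2 (\<eta> x) = (\<lambda>vs. top_at x (wedge (\<eta> x) (omega_at x)) * omega_at x vs - \<eta> x vs)"
      by (rule hermitian4.star_11[OF hx formsD(2)[OF \<eta> x]], erule (1) inv[OF x])
    then show ?thesis
      using hodge_star_form_at[OF \<eta> _ x] by (simp add: h_def top_form_def x fundamental_form_at[OF x])
  qed
  show "hodge_star \<eta> = (\<lambda>x vs. 1 * wedge (h x) (fundamental_form x) vs + (-1) * \<eta> x vs)"
  proof
    fix x
    show "hodge_star \<eta> x = (\<lambda>vs. 1 * wedge (h x) (fundamental_form x) vs + (-1) * \<eta> x vs)"
      using at[of x] formsD(1)[OF \<eta>, of x] formsD(1)[OF h, of x]
      by (cases "x \<in> topspace X") (auto simp: w hodge_star_def fun_eq_iff)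
  qed
  have "hodge_star \<eta> \<in> forms 2" using hodge_star_forms[OF \<eta>] by simp
  moreover have "hodge_star \<eta> x [J x u, J x v] = hodge_star \<eta> x [u, v]"
    if "x \<in> topspace X" "u \<in> tangent_space x" "v \<in> tangent_space x" for x u v
    using that inv J_tangent J_isometry by (simp add: at fundamental_form_def)
  ultimately show "invariant_form (hodge_star \<eta>)" by (simp add: invariant_form_def)
qed

end

context compact_almost_kaehler4
begin

lemma wedge_0 [simp]: "wedge \<alpha> 0 = 0" "wedge 0 \<alpha> = 0"
  by (simp_all add: wedge_def fun_eq_iff)

text \<open>The almost Kaehler condition enters here: the Leibniz term containing d\<omega>
  vanishes.\<close>

lemma ext_deriv_wedge_omega:
  "h \<in> forms 0 \<Longrightarrow> ext_deriv (wedge_form h fundamental_form) = wedge_form (ext_deriv h) fundamental_form"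
  "\<theta> \<in> forms 1 \<Longrightarrow> ext_deriv (wedge_form \<theta> fundamental_form) = wedge_form (ext_deriv \<theta>) fundamental_form"
  by (simp_all add: ext_deriv_wedge_form_0[OF _ fundamental_form_forms] ext_deriv_wedge_form_1_2[OF _ fundamental_form_forms]
      omega_closed)

text \<open>Pairing \<open>d(delbar h \<and> \<omega>) = 0\<close> with the conjugate of \<open>h\<close> and integrating by parts gives the norm of \<open>delbar h\<close>, as
  \<open>\<beta> \<and> \<omega> = - \<i> * \<beta>\<close> for \<open>\<beta>\<close> of type \<open>(0, 1)\<close>.\<close>

lemma delbar_zero:
  assumes h: "h \<in> forms 0" and d: "ext_deriv (wedge_form (pq_part 0 (Suc 0) (ext_deriv h)) fundamental_form) = 0"
  shows "pq_part 0 (Suc 0) (ext_deriv h) = 0"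
proof -
  have dh: "ext_deriv h \<in> forms 1" using ext_deriv_forms_num(1)[OF h] .
  define \<beta> where "\<beta> = pq_part 0 (Suc 0) (ext_deriv h)"
  define \<gamma> where "\<gamma> = wedge_form \<beta> fundamental_form"
  have \<beta>: "\<beta> \<in> forms 1" unfolding \<beta>_def by (rule pq_part_forms_1(2)[OF dh])
  have \<gamma>: "\<gamma> \<in> forms 3" unfolding \<gamma>_def by (rule forms_wedge_omega[OF \<beta>])
  have "pq_part (Suc 0) 2 \<gamma> = \<gamma>"
    unfolding \<gamma>_def pq_part_wedge_omega(1)[OF \<beta>] unfolding \<beta>_def pq_part_1_idem[OF dh] ..
  then have "wedge_form (cnj_form (ext_deriv h)) \<gamma> = wedge_form (cnj_form \<beta>) \<gamma>"
    using wedge_pq_part_1_3(1)[OF forms_cnj[OF dh] \<gamma>] pq_part_cnj(1)[OF dh] by (simp add: \<beta>_def)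
  moreover have "integral4 (wedge_form (cnj_form (ext_deriv h)) \<gamma>) = - integral4 (wedge_form (cnj_form h) (ext_deriv \<gamma>))"
    using parts_ext_deriv(1)[OF forms_cnj[OF h] \<gamma>] by (simp add: ext_deriv_cnj[OF h])
  moreover have "ext_deriv \<gamma> = 0" using d by (simp add: \<gamma>_def \<beta>_def)
  ultimately have 0: "integral4 (wedge_form (cnj_form \<beta>) \<gamma>) = 0" by (simp add: wedge_def)
  have "hodge_star \<beta> = (\<lambda>x vs. \<i> * \<gamma> x vs)"
    unfolding \<beta>_def hodge_star_pq_part_1[OF dh] \<gamma>_def ..
  then have "inner_form (cnj_form \<beta>) (cnj_form \<beta>) = integral4 (\<lambda>x vs. \<i> * wedge (cnj_form \<beta> x) (\<gamma> x) vs)"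
    using wedge_form_scale_right[of "cnj_form \<beta>" \<i> \<gamma>] by (simp add: inner_form_def)
  also have "\<dots> = 0" using integral4_scale[OF forms_wedge_1_3[OF forms_cnj[OF \<beta>] \<gamma>], of \<i>] 0 by simp
  finally have "cnj_form \<beta> = 0" using inner_form_self(2)[OF forms_cnj[OF \<beta>]] by simp
  then show ?thesis by (simp add: \<beta>_def fun_eq_iff)
qed

text \<open>\<omega> is real, so conjugation turns the hypothesis into that of
  \<open>delbar_zero\<close> for the conjugate of h.\<close>

lemma del_zero:
  assumes h: "h \<in> forms 0" and d: "ext_deriv (wedge_form (pq_part (Suc 0) 0 (ext_deriv h)) fundamental_form) = 0"
  shows "pq_part (Suc 0) 0 (ext_deriv h) = 0"
proof -
  have dh: "ext_deriv h \<in> forms 1" using ext_deriv_forms_num(1)[OF h] .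
  have p: "pq_part 0 (Suc 0) (ext_deriv (cnj_form h)) = cnj_form (pq_part (Suc 0) 0 (ext_deriv h))"
    unfolding ext_deriv_cnj[OF h] by (rule pq_part_cnj(2)[OF dh])
  have "cnj (fundamental_form x vs) = fundamental_form x vs" for x vs by (simp add: fundamental_form_def)
  then have w: "wedge_form (cnj_form (pq_part (Suc 0) 0 (ext_deriv h))) fundamental_form =
      cnj_form (wedge_form (pq_part (Suc 0) 0 (ext_deriv h)) fundamental_form)"
    using wedge_cnj[of _ "fundamental_form _"] by (simp add: fun_eq_iff)
  have "ext_deriv (wedge_form (pq_part 0 (Suc 0) (ext_deriv (cnj_form h))) fundamental_form) = 0"
    unfolding p w using d ext_deriv_cnj[OF forms_wedge_omega[OF pq_part_forms_1(1)[OF dh]]] by (simp add: fun_eq_iff)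
  from delbar_zero[OF forms_cnj[OF h] this] show ?thesis unfolding p by (simp add: fun_eq_iff)
qed

text \<open>Once one type component of dh vanishes, dh equals the other component, and d(dh \<and>
  \<omega>) = ddh \<and> \<omega> = 0 supplies the hypothesis that kills it. No identity for the
  squares of del and delbar is involved.\<close>

lemma ext_deriv_zero:
  assumes h: "h \<in> forms 0"
    and "ext_deriv (wedge_form (pq_part 0 (Suc 0) (ext_deriv h)) fundamental_form) = 0 \<or>
      ext_deriv (wedge_form (pq_part (Suc 0) 0 (ext_deriv h)) fundamental_form) = 0"
  shows "ext_deriv h = 0"
proof -
  have dh: "ext_deriv h \<in> forms 1" using ext_deriv_forms_num(1)[OF h] .
  have dd: "ext_deriv (wedge_form (ext_deriv h) fundamental_form) = 0"
    using ext_deriv_wedge_omega(2)[OF dh] ext_deriv_ext_deriv[OF h] by (simp add: wedge_def fun_eq_iff)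
  have s: "pq_part (Suc 0) 0 (ext_deriv h) + pq_part 0 (Suc 0) (ext_deriv h) = ext_deriv h" by (rule pq_part_sums(1)[OF dh])
  from assms(2) show ?thesis
  proof
    assume "ext_deriv (wedge_form (pq_part 0 (Suc 0) (ext_deriv h)) fundamental_form) = 0"
    then have "pq_part 0 (Suc 0) (ext_deriv h) = 0" by (rule delbar_zero[OF h])
    then have e: "pq_part (Suc 0) 0 (ext_deriv h) = ext_deriv h" using s by simp
    have "pq_part (Suc 0) 0 (ext_deriv h) = 0" by (rule del_zero[OF h]) (simp only: e dd)
    then show ?thesis using e by simp
  next
    assume "ext_deriv (wedge_form (pq_part (Suc 0) 0 (ext_deriv h)) fundamental_form) = 0"
    then have "pq_part (Suc 0) 0 (ext_deriv h) = 0" by (rule del_zero[OF h])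
    then have e: "pq_part 0 (Suc 0) (ext_deriv h) = ext_deriv h" using s by simp
    have "pq_part 0 (Suc 0) (ext_deriv h) = 0" by (rule delbar_zero[OF h]) (simp only: e dd)
    then show ?thesis using e by simp
  qed
qed

section \<open>From the Laplacians to closed and coclosed forms\<close>

definition closed_coclosed :: "('a, real ^ 4) form_field \<Rightarrow> bool"
  where "closed_coclosed \<eta> \<longleftrightarrow> ext_deriv \<eta> = 0 \<and> ext_deriv (hodge_star \<eta>) = 0"

lemma closed_coclosed_laplacians:
  assumes \<eta>: "invariant_form \<eta>" and cc: "closed_coclosed \<eta>"
  shows "laplacian_d \<eta> = 0" "laplacian_del \<eta> = 0" "laplacian_delbar \<eta> = 0" "laplacian_BC \<eta> = 0" "laplacian_A \<eta> = 0"
proof -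
  have "del \<eta> = 0" "delbar \<eta> = 0" "del (hodge_star \<eta>) = 0" "delbar (hodge_star \<eta>) = 0"
    using invariant_form_del[OF \<eta>] invariant_form_del[OF invariant_form_star(3)[OF \<eta>]] cc
    by (simp_all add: closed_coclosed_def)
  then have z: "del \<eta> = 0" "delbar \<eta> = 0" "adj del \<eta> = 0" "adj delbar \<eta> = 0" "adj ext_deriv \<eta> = 0" "ext_deriv \<eta> = 0"
    "adj del 0 = 0" "adj delbar 0 = 0" "adj ext_deriv 0 = 0"
    using cc by (simp_all add: adj_def closed_coclosed_def)
  show "laplacian_d \<eta> = 0" "laplacian_del \<eta> = 0" "laplacian_delbar \<eta> = 0" "laplacian_BC \<eta> = 0" "laplacian_A \<eta> = 0"
    by (simp_all add: laplacian_d_def laplacian_del_def laplacian_delbar_def laplacian_BC_def laplacian_A_def adj_simps z)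
qed

text \<open>The type components of d(star \<eta>) = dh \<and> \<omega> - d \<eta>. They express what
  remains to be shown through h alone.\<close>

lemma invariant_form_relations:
  assumes \<eta>: "invariant_form \<eta>"
  obtains h where "h \<in> forms 0"
    "del (hodge_star \<eta>) = wedge_form (pq_part (Suc 0) 0 (ext_deriv h)) fundamental_form - del \<eta>"
    "delbar (hodge_star \<eta>) = wedge_form (pq_part 0 (Suc 0) (ext_deriv h)) fundamental_form - delbar \<eta>"
    "ext_deriv \<eta> = del \<eta> + delbar \<eta>" "ext_deriv (hodge_star \<eta>) = del (hodge_star \<eta>) + delbar (hodge_star \<eta>)"
proof
  define h where "h = top_form (wedge_form \<eta> fundamental_form)"
  have \<eta>2: "\<eta> \<in> forms 2" "hodge_star \<eta> \<in> forms 2"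
    using \<eta> invariant_form_star(3)[OF \<eta>] by (simp_all add: invariant_form_def)
  show h: "h \<in> forms 0" unfolding h_def by (rule invariant_form_star(1)[OF \<eta>])
  have dh: "ext_deriv h \<in> forms 1" using ext_deriv_forms_num(1)[OF h] .
  have d: "ext_deriv (hodge_star \<eta>) = (\<lambda>x vs. 1 * wedge (ext_deriv h x) (fundamental_form x) vs + (-1) * ext_deriv \<eta> x vs)"
    unfolding invariant_form_star(2)[OF \<eta>, folded h_def] ext_deriv_linear[OF forms_wedge_0[OF h fundamental_form_forms] \<eta>2(1)]
      ext_deriv_wedge_omega(1)[OF h] ..
  show "del (hodge_star \<eta>) = wedge_form (pq_part (Suc 0) 0 (ext_deriv h)) fundamental_form - del \<eta>"
    "delbar (hodge_star \<eta>) = wedge_form (pq_part 0 (Suc 0) (ext_deriv h)) fundamental_form - delbar \<eta>"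
    unfolding invariant_form_del[OF \<eta>] invariant_form_del[OF invariant_form_star(3)[OF \<eta>]] d pq_part_linear pq_part_wedge_omega[OF dh]
    by (simp_all add: fun_eq_iff)
  show "ext_deriv \<eta> = del \<eta> + delbar \<eta>" "ext_deriv (hodge_star \<eta>) = del (hodge_star \<eta>) + delbar (hodge_star \<eta>)"
    unfolding invariant_form_del[OF \<eta>] invariant_form_del[OF invariant_form_star(3)[OF \<eta>]]
    using pq_part_sums(2)[OF ext_deriv_forms_num(3)[OF \<eta>2(1)]] pq_part_sums(2)[OF ext_deriv_forms_num(3)[OF \<eta>2(2)]] by simp_all
qed

text \<open>The common part of the energy identities of \<open>\<Delta>\<^sub>B\<^sub>C\<close> and \<open>\<Delta>\<^sub>A\<close>: each summand of these operators, paired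
  with \<open>\<eta>\<close>, is the squared norm of one of its factors applied to \<open>\<eta>\<close>.\<close>

lemma inner_form_factors:
  assumes \<eta>: "\<eta> \<in> forms 2" and D: "adjoint_pair D D'" and E: "adjoint_pair E E'"
  shows "D (E (adj E' (adj D' \<eta>))) \<in> forms 2 \<and> 0 \<le> Re (inner_form (D (E (adj E' (adj D' \<eta>)))) \<eta>) \<and> (Re (inner_form (D (E (adj E' (adj D' \<eta>)))) \<eta>) = 0 \<longrightarrow> adj E' (adj D' \<eta>) = 0)"
    and "adj D' (adj E' (E (D \<eta>))) \<in> forms 2 \<and> 0 \<le> Re (inner_form (adj D' (adj E' (E (D \<eta>)))) \<eta>) \<and> (Re (inner_form (adj D' (adj E' (E (D \<eta>)))) \<eta>) = 0 \<longrightarrow> E (D \<eta>) = 0)"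
    and "adj D' (E (adj E' (D \<eta>))) \<in> forms 2 \<and> 0 \<le> Re (inner_form (adj D' (E (adj E' (D \<eta>)))) \<eta>) \<and> (Re (inner_form (adj D' (E (adj E' (D \<eta>)))) \<eta>) = 0 \<longrightarrow> adj E' (D \<eta>) = 0)"
    and "D (adj E' (E (adj D' \<eta>))) \<in> forms 2 \<and> 0 \<le> Re (inner_form (D (adj E' (E (adj D' \<eta>)))) \<eta>) \<and> (Re (inner_form (D (adj E' (E (adj D' \<eta>)))) \<eta>) = 0 \<longrightarrow> E (adj D' \<eta>) = 0)"
    and "adj D' (D \<eta>) \<in> forms 2 \<and> 0 \<le> Re (inner_form (adj D' (D \<eta>)) \<eta>) \<and> (Re (inner_form (adj D' (D \<eta>)) \<eta>) = 0 \<longrightarrow> D \<eta> = 0)"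
    and "D (adj D' \<eta>) \<in> forms 2 \<and> 0 \<le> Re (inner_form (D (adj D' \<eta>)) \<eta>) \<and> (Re (inner_form (D (adj D' \<eta>)) \<eta>) = 0 \<longrightarrow> adj D' \<eta> = 0)"
proof -
  note Dp = adjoint_pairD(1,2)[OF D] and Ep = adjoint_pairD(1,2)[OF E]
  have up: "P \<alpha> \<in> forms m" if "parts_op P" "\<alpha> \<in> forms k" "k \<le> 3" "m = Suc k" for P \<alpha> k m
    using parts_op_forms[OF that] .
  have down: "adj P \<alpha> \<in> forms k" if "parts_op P" "\<alpha> \<in> forms m" "k \<le> 3" "m = Suc k" for P \<alpha> k m
    using adj_forms[OF that(1,2,4,3)] .
  have D\<eta>: "D \<eta> \<in> forms 3" by (rule up[OF Dp(1) \<eta>]) simp_all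
  have a\<eta>: "adj D' \<eta> \<in> forms 1" by (rule down[OF Dp(2) \<eta>]) simp_all
  have ED: "E (D \<eta>) \<in> forms 4" by (rule up[OF Ep(1) D\<eta>]) simp_all
  have aD: "adj E' (D \<eta>) \<in> forms 2" by (rule down[OF Ep(2) D\<eta>]) simp_all
  have Ea: "E (adj D' \<eta>) \<in> forms 2" by (rule up[OF Ep(1) a\<eta>]) simp_all
  have aa: "adj E' (adj D' \<eta>) \<in> forms 0" by (rule down[OF Ep(2) a\<eta>]) simp_all
  have 1: "E (adj E' (adj D' \<eta>)) \<in> forms 1" by (rule up[OF Ep(1) aa]) simp_all
  have 2: "adj E' (E (D \<eta>)) \<in> forms 3" by (rule down[OF Ep(2) ED]) simp_all
  have 3: "E (adj E' (D \<eta>)) \<in> forms 3" by (rule up[OF Ep(1) aD]) simp_all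
  have 4: "adj E' (E (adj D' \<eta>)) \<in> forms 1" by (rule down[OF Ep(2) Ea]) simp_all
  have upD: "D \<alpha> \<in> forms 2 \<and> inner_form (D \<alpha>) \<eta> = inner_form \<alpha> (adj D' \<eta>)" if "\<alpha> \<in> forms 1" for \<alpha>
    by (rule conjI, rule up[OF Dp(1) that], simp, simp, rule inner_form_adj_right[OF D that \<eta>], simp, simp)
  have dnD: "adj D' \<beta> \<in> forms 2 \<and> inner_form (adj D' \<beta>) \<eta> = inner_form \<beta> (D \<eta>)" if "\<beta> \<in> forms 3" for \<beta>
    by (rule conjI, rule down[OF Dp(2) that], simp, simp, rule inner_form_adj_left[OF D \<eta> that], simp, simp)
  show "D (E (adj E' (adj D' \<eta>))) \<in> forms 2 \<and> 0 \<le> Re (inner_form (D (E (adj E' (adj D' \<eta>)))) \<eta>) \<and> (Re (inner_form (D (E (adj E' (adj D' \<eta>)))) \<eta>) = 0 \<longrightarrow> adj E' (adj D' \<eta>) = 0)"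
    using upD[OF 1] inner_form_adj_right[OF E aa a\<eta>] inner_form_self[OF aa] by simp
  show "adj D' (adj E' (E (D \<eta>))) \<in> forms 2 \<and> 0 \<le> Re (inner_form (adj D' (adj E' (E (D \<eta>)))) \<eta>) \<and> (Re (inner_form (adj D' (adj E' (E (D \<eta>)))) \<eta>) = 0 \<longrightarrow> E (D \<eta>) = 0)"
    using dnD[OF 2] inner_form_adj_left[OF E D\<eta> ED] inner_form_self[OF ED] by simp
  show "adj D' (E (adj E' (D \<eta>))) \<in> forms 2 \<and> 0 \<le> Re (inner_form (adj D' (E (adj E' (D \<eta>)))) \<eta>) \<and> (Re (inner_form (adj D' (E (adj E' (D \<eta>)))) \<eta>) = 0 \<longrightarrow> adj E' (D \<eta>) = 0)"
    using dnD[OF 3] inner_form_adj_right[OF E aD D\<eta>] inner_form_self[OF aD] by simp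
  show "D (adj E' (E (adj D' \<eta>))) \<in> forms 2 \<and> 0 \<le> Re (inner_form (D (adj E' (E (adj D' \<eta>)))) \<eta>) \<and> (Re (inner_form (D (adj E' (E (adj D' \<eta>)))) \<eta>) = 0 \<longrightarrow> E (adj D' \<eta>) = 0)"
    using upD[OF 4] inner_form_adj_left[OF E a\<eta> Ea] inner_form_self[OF Ea] by simp
  show "adj D' (D \<eta>) \<in> forms 2 \<and> 0 \<le> Re (inner_form (adj D' (D \<eta>)) \<eta>) \<and> (Re (inner_form (adj D' (D \<eta>)) \<eta>) = 0 \<longrightarrow> D \<eta> = 0)"
    using dnD[OF D\<eta>] inner_form_self[OF D\<eta>] by simp
  show "D (adj D' \<eta>) \<in> forms 2 \<and> 0 \<le> Re (inner_form (D (adj D' \<eta>)) \<eta>) \<and> (Re (inner_form (D (adj D' \<eta>)) \<eta>) = 0 \<longrightarrow> adj D' \<eta> = 0)"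
    using upD[OF a\<eta>] inner_form_self[OF a\<eta>] by simp
qed

text \<open>Covers three Laplacians at once: D may be d, del or delbar, with D' its conjugate
  partner. Both terms of the energy are squared norms, so each is zero.\<close>

lemma first_order_energy:
  assumes D: "adjoint_pair D D'" and \<eta>: "\<eta> \<in> forms 2" and L: "D (adj D' \<eta>) + adj D' (D \<eta>) = 0"
  shows "D \<eta> = 0" "adj D' \<eta> = 0"
proof -
  note F = inner_form_factors(5,6)[OF \<eta> D D]
  have "inner_form (D (adj D' \<eta>)) \<eta> + inner_form (adj D' (D \<eta>)) \<eta> = 0"
    using inner_form_add[of "D (adj D' \<eta>)" 2 "adj D' (D \<eta>)" \<eta>] F \<eta> L by simp
  then have "Re (inner_form (D (adj D' \<eta>)) \<eta>) + Re (inner_form (adj D' (D \<eta>)) \<eta>) = 0"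
    by (metis plus_complex.sel(1) zero_complex.sel(1))
  then have "Re (inner_form (D (adj D' \<eta>)) \<eta>) = 0 \<and> Re (inner_form (adj D' (D \<eta>)) \<eta>) = 0" using F by linarith
  then show "D \<eta> = 0" "adj D' \<eta> = 0" using F by blast+
qed

lemma Re_sum_zero_6:
  assumes "Re a \<ge> 0" "Re b \<ge> 0" "Re c \<ge> 0" "Re d \<ge> 0" "Re e \<ge> 0" "Re f \<ge> 0" "a + b + c + d + e + f = 0"
  shows "Re a = 0" "Re b = 0" "Re c = 0" "Re d = 0" "Re e = 0" "Re f = 0"
proof -
  have "Re a + Re b + Re c + Re d + Re e + Re f = 0" using arg_cong[OF assms(7), of Re] by simp
  then show "Re a = 0" "Re b = 0" "Re c = 0" "Re d = 0" "Re e = 0" "Re f = 0" using assms(1-6) by linarith+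
qed

lemma inner_form_add_6:
  assumes "\<alpha>1 \<in> forms k" "\<alpha>2 \<in> forms k" "\<alpha>3 \<in> forms k" "\<alpha>4 \<in> forms k" "\<alpha>5 \<in> forms k" "\<alpha>6 \<in> forms k" "\<gamma> \<in> forms k" "k \<le> 4"
  shows "inner_form (\<alpha>1 + \<alpha>2 + \<alpha>3 + \<alpha>4 + \<alpha>5 + \<alpha>6) \<gamma> = inner_form \<alpha>1 \<gamma> + inner_form \<alpha>2 \<gamma> + inner_form \<alpha>3 \<gamma>
    + inner_form \<alpha>4 \<gamma> + inner_form \<alpha>5 \<gamma> + inner_form \<alpha>6 \<gamma>"
  using assms inner_form_add[OF _ _ assms(7,8)] by (simp add: forms_add)

text \<open>All six energies vanish. The first-order ones give the first two equations; the third
  comes from the first fourth-order summand and is what will constrain h.\<close>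

lemma laplacian_BC_zero:
  assumes \<eta>: "\<eta> \<in> forms 2" and L: "laplacian_BC \<eta> = 0"
  shows "del \<eta> = 0" "delbar \<eta> = 0" "adj del (adj delbar \<eta>) = 0"
proof -
  note I = inner_form_factors[OF \<eta> adjoint_pairs(2,3)] and I' = inner_form_factors[OF \<eta> adjoint_pairs(3,2)]
  \<comment> \<open>The factorisations in the order of the summands of the Laplacian: unprimed ones
    have del as the operator next to \<eta> or its adjoint, primed ones have delbar in that
    role.\<close>
  note F = I(1) I'(2) I(3) I'(3) I(5) I'(5)
  note f = F[THEN conjunct1] and n = F[THEN conjunct2, THEN conjunct1]
  have "inner_form (laplacian_BC \<eta>) \<eta> = 0" by (simp add: L)
  then have "inner_form (del (delbar (adj del (adj delbar \<eta>)))) \<eta> + inner_form (adj del (adj delbar (del (delbar \<eta>)))) \<eta> + inner_form (adj delbar (delbar (adj del (del \<eta>)))) \<eta> + inner_form (adj del (del (adj delbar (delbar \<eta>)))) \<eta> + inner_form (adj delbar (del \<eta>)) \<eta> + inner_form (adj del (delbar \<eta>)) \<eta> = 0"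
    unfolding laplacian_BC_def adj_simps inner_form_add_6[OF f \<eta>, simplified] .
  from Re_sum_zero_6[OF n this] show "del \<eta> = 0" "delbar \<eta> = 0" "adj del (adj delbar \<eta>) = 0" using F by blast+
qed

text \<open>Here the first-order energies control only the adjoints; the equation del delbar \<eta>
  = 0 from the second summand constrains h.\<close>

lemma laplacian_A_zero:
  assumes \<eta>: "\<eta> \<in> forms 2" and L: "laplacian_A \<eta> = 0"
  shows "adj del \<eta> = 0" "adj delbar \<eta> = 0" "del (delbar \<eta>) = 0"
proof -
  note I = inner_form_factors[OF \<eta> adjoint_pairs(2,3)] and I' = inner_form_factors[OF \<eta> adjoint_pairs(3,2)]
  note F = I(1) I'(2) I(4) I'(4) I(6) I'(6)
  note f = F[THEN conjunct1] and n = F[THEN conjunct2, THEN conjunct1]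
  have "inner_form (laplacian_A \<eta>) \<eta> = 0" by (simp add: L)
  then have "inner_form (del (delbar (adj del (adj delbar \<eta>)))) \<eta> + inner_form (adj del (adj delbar (del (delbar \<eta>)))) \<eta> + inner_form (del (adj del (delbar (adj delbar \<eta>)))) \<eta> + inner_form (delbar (adj delbar (del (adj del \<eta>)))) \<eta> + inner_form (del (adj delbar \<eta>)) \<eta> + inner_form (delbar (adj del \<eta>)) \<eta> = 0"
    unfolding laplacian_A_def adj_simps inner_form_add_6[OF f \<eta>, simplified] .
  from Re_sum_zero_6[OF n this] show "adj del \<eta> = 0" "adj delbar \<eta> = 0" "del (delbar \<eta>) = 0" using F by blast+
qed

lemma closed_coclosed_of_laplacians:
  assumes \<eta>: "invariant_form \<eta>"
    and "laplacian_d \<eta> = 0 \<or> laplacian_del \<eta> = 0 \<or> laplacian_delbar \<eta> = 0 \<or> laplacian_BC \<eta> = 0 \<or> laplacian_A \<eta> = 0"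
  shows "closed_coclosed \<eta>"
proof -
  let ?\<zeta> = "hodge_star \<eta>"
  obtain h where h: "h \<in> forms 0"
    and del: "del ?\<zeta> = wedge_form (pq_part (Suc 0) 0 (ext_deriv h)) fundamental_form - del \<eta>"
    and delbar: "delbar ?\<zeta> = wedge_form (pq_part 0 (Suc 0) (ext_deriv h)) fundamental_form - delbar \<eta>"
    and d: "ext_deriv \<eta> = del \<eta> + delbar \<eta>" "ext_deriv ?\<zeta> = del ?\<zeta> + delbar ?\<zeta>"
    using invariant_form_relations[OF \<eta>] by blast
  define v where "v = wedge_form (pq_part (Suc 0) 0 (ext_deriv h)) fundamental_form"
  define w where "w = wedge_form (pq_part 0 (Suc 0) (ext_deriv h)) fundamental_form"
  note rel = del[folded v_def] delbar[folded w_def]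
  have \<eta>2: "\<eta> \<in> forms 2" using \<eta> by (simp add: invariant_form_def)
  have dh: "ext_deriv h \<in> forms 1" using ext_deriv_forms_num(1)[OF h] .
  have w3: "w \<in> forms 3" unfolding w_def by (rule forms_wedge_omega[OF pq_part_forms_1(2)[OF dh]])
  \<comment> \<open>w has type (1,2), and on such 3-forms del is all of d.\<close>
  have dw: "del w = ext_deriv w"
    unfolding del_formulas(7)[OF w3] unfolding w_def pq_part_wedge_omega(1)[OF pq_part_forms_1(2)[OF dh]] pq_part_1_idem[OF dh] ..
  have vw: "v = 0 \<and> w = 0" if "ext_deriv v = 0 \<or> ext_deriv w = 0"
  proof -
    have e: "ext_deriv h = 0" using ext_deriv_zero[OF h] that unfolding v_def w_def by blast
    show ?thesis unfolding v_def w_def e pq_part_0 by (simp add: fun_eq_iff)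
  qed
  have dd: "ext_deriv (ext_deriv \<eta>) = 0" by (rule ext_deriv_ext_deriv[OF \<eta>2]) simp
  have star0: "D ?\<zeta> = 0" if "parts_op D" "adj D \<eta> = 0" for D
    by (rule adj_eq_0[OF that(1) \<eta>2 _ _ that(2), of 1]) simp_all
  from assms(2) consider "laplacian_d \<eta> = 0" | "laplacian_del \<eta> = 0" | "laplacian_delbar \<eta> = 0"
    | "laplacian_BC \<eta> = 0" | "laplacian_A \<eta> = 0" by blast
  then show ?thesis
  proof cases
    case 1
    then show ?thesis
      using first_order_energy[OF adjoint_pairs(1) \<eta>2] star0[OF parts_op_ext_deriv]
      by (simp add: laplacian_d_def adj_simps closed_coclosed_def)
  next
    case 2
    then have z: "del \<eta> = 0" "adj delbar \<eta> = 0"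
      using first_order_energy[OF adjoint_pairs(2) \<eta>2] by (simp_all add: laplacian_del_def adj_simps)
    have "delbar ?\<zeta> = 0" by (rule star0[OF parts_op_del(2) z(2)])
    \<comment> \<open>As delbar of the star vanishes, the relation for it reads delbar \<eta> = w.
      Thus w is exact, and dd = 0 gives the equation for h.\<close>
    moreover from this have "ext_deriv \<eta> = w" using rel d z(1) by simp
    then have "v = 0 \<and> w = 0" using vw dd by simp
    ultimately show ?thesis using rel d z(1) by (simp add: closed_coclosed_def)
  next
    case 3
    then have z: "delbar \<eta> = 0" "adj del \<eta> = 0"
      using first_order_energy[OF adjoint_pairs(3) \<eta>2] by (simp_all add: laplacian_delbar_def adj_simps)
    have "del ?\<zeta> = 0" by (rule star0[OF parts_op_del(1) z(2)])
    moreover from this have "ext_deriv \<eta> = v" using rel d z(1) by simp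
    then have "v = 0 \<and> w = 0" using vw dd by simp
    ultimately show ?thesis using rel d z(1) by (simp add: closed_coclosed_def)
  next
    case 4
    note z = laplacian_BC_zero[OF \<eta>2 4]
    have a: "adj delbar \<eta> \<in> forms 1" by (rule adj_forms[OF parts_op_del(2) \<eta>2]) simp_all
    \<comment> \<open>The fourth-order equation, read through the star, says that del delbar star
      \<eta> = 0; since delbar \<eta> = 0, the inner form delbar star \<eta> is w.\<close>
    have "del (hodge_star (adj delbar \<eta>)) = 0" by (rule adj_eq_0[OF parts_op_del(1) a _ _ z(3), of 0]) simp_all
    moreover have "hodge_star (adj delbar \<eta>) = delbar ?\<zeta>"
      using hodge_star_adj[OF parts_op_del(2) \<eta>2, of 1] by simp
    ultimately have "ext_deriv w = 0" using rel z(2) dw by simp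
    then show ?thesis using vw rel d z by (simp add: closed_coclosed_def)
  next
    case 5
    note z = laplacian_A_zero[OF \<eta>2 5]
    have s: "del ?\<zeta> = 0" "delbar ?\<zeta> = 0" by (rule star0[OF parts_op_del(1) z(1)], rule star0[OF parts_op_del(2) z(2)])
    then have "delbar \<eta> = w" "del \<eta> = v" using rel by simp_all
    \<comment> \<open>del delbar \<eta> = 0 now reads del w = 0, hence dw = 0.\<close>
    moreover from this have "v = 0 \<and> w = 0" using vw z(3) dw by simp
    ultimately show ?thesis using d s by (simp add: closed_coclosed_def)
  qed
qed

lemma harmonic_1_1:
  defines "K \<equiv> {\<eta> \<in> pq_forms 1 1. closed_coclosed \<eta>}"
  shows "harmonic_d 1 1 = K" "harmonic_del 1 1 = K" "harmonic_delbar 1 1 = K" "harmonic_BC 1 1 = K" "harmonic_A 1 1 = K"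
  using pq_forms_1_1_invariant closed_coclosed_laplacians closed_coclosed_of_laplacians
  unfolding harmonic_d_def harmonic_del_def harmonic_delbar_def harmonic_BC_def harmonic_A_def K_def by blast+

end

theorem corollary1p2:
  fixes X :: "'a topology" and A :: "('a, real ^ 4) chart set"
    and J :: "'a \<Rightarrow> ('a, real ^ 4) tvec \<Rightarrow> ('a, real ^ 4) tvec"
    and g :: "'a \<Rightarrow> ('a, real ^ 4) tvec \<Rightarrow> ('a, real ^ 4) tvec \<Rightarrow> real"
  assumes "almost_kaehler X A J g"
    and "compact_space X"
    and "connected_space X"
  shows "almost_hermitian.harmonic_d X A J g 1 1 = almost_hermitian.harmonic_del X A J g 1 1 \<and>
    almost_hermitian.harmonic_del X A J g 1 1 = almost_hermitian.harmonic_delbar X A J g 1 1 \<and>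
    almost_hermitian.harmonic_delbar X A J g 1 1 = almost_hermitian.harmonic_BC X A J g 1 1 \<and>
    almost_hermitian.harmonic_BC X A J g 1 1 = almost_hermitian.harmonic_A X A J g 1 1"
proof -
  interpret almost_kaehler X A J g by (rule assms(1))
  interpret compact_almost_kaehler4 X A J g by unfold_locales (rule assms(2), rule closed)
  show ?thesis unfolding harmonic_1_1 by simp
qed

end
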